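(* Let $w\in C^2([-2,2])$, $\eta>0$, $\mu>0$, $\gamma>0$, $f_r,f_p\in L^2(-1,1)$ and $0<\beta\le\alpha\le2\beta$. Let $$\begin{aligned}F_1(v_r,v_p)=\;&\alpha\,\sharp(S_{v_r})+\beta\,\sharp(S_{\dot v_r}\setminus S_{v_r})+\int_{-1}^1\big(\eta|\ddot v_r|^2-f_rv_r\big)\,dx\\&+\mu\int_{-1}^1|v_r-v_p|^2\,dx+\int_{-1}^1\big(\gamma|v_p''|^2-f_pv_p\big)\,dx\end{aligned}$$ and let $\mathbf{K}$ be the convex set of pairs $(v_r,v_p)\in\mathbf{H}^2(-2,2)\times H^2(-2,2)$ with $v_r\ge v_p$ on $[-1,1]$ and $v_r=v_p=w$ on $(-2,-1)\cup(1,2)$. Every minimizing pair $(u_r,u_p)$ of $F_1$ over $\mathbf{K}$ satisfies the quasi-variational inequalities: $(u_r,u_p)\in\mathbf{K}$ and $$\int_{(-1,1)\setminus(S_{u_r}\cup S_{\dot u_r})}\big(\eta u_r''''+\mu(u_r-u_p)-f_r/2\big)\,(u_r-v)\le0\qquad\forall v:\ (v,u_p)\in\mathbf{K},$$ $$\int_{(-1,1)\setminus(S_{u_r}\cup S_{\dot u_r})}\big(\gamma u_p''''+\mu(u_p-u_r)-f_p/2\big)\,(u_p-z)\le0\qquad\forall z:\ (u_r,z)\in\mathbf{K},$$ together with the following conditions. Bilateral conditions away from contact: (a) $\ddot u_r^+=\ddot u_r^-=0$ and $\dddot u_r^+=\dddot u_r^-=0$ on $(S_{u_r}\setminus\{\pm1\})\cap\{u_r^+>u_p\}\cap\{u_r^->u_p\}$;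 (b) $\ddot u_r^+=\ddot u_r^-=[\dddot u_r]=0$ on $\big(S_{\dot u_r}\setminus(S_{u_r}\cup\{\pm1\})\big)\cap\{u_r^+>u_p\}\cap\{u_r^->u_p\}$; (c) $\ddot u_r\in H^2\big((-1,1)\setminus\{u_r^+=u_p\text{ or }u_r^-=u_p\}\big)$ and $\eta(\ddot u_r)''+\mu(u_r-u_p)=f_r/2$ in $\mathcal{D}'\big((-1,1)\setminus\{u_r^+=u_p\text{ or }u_r^-=u_p\}\big)$; (d) $\ddot u_r^+(-1)=\dddot u_r^+(-1)=0$ if $-1\notin S_{\dot u_r}\setminus S_{u_r}$ and $u_r^+(-1)>u_p(-1)$; $\ddot u_r^-(1)=\dddot u_r^-(1)=0$ if $1\notin S_{\dot u_r}\setminus S_{u_r}$ and $u_r^-(1)>u_p(1)$; (e) $\ddot u_r^+(-1)=0$ if $-1\in S_{\dot u_r}\setminus S_{u_r}$ and $u_r^+(-1)>u_p(-1)$; $\ddot u_r^-(1)=0$ if $1\in S_{\dot u_r}\setminus S_{u_r}$ and $u_r^-(1)>u_p(1)$. Unilateral conditions at contact: (f) $\ddot u_r^+\ge0$ on $\big((S_{u_r}\cup S_{\dot u_r})\setminus\{1\}\big)\cap\{u_r^+=u_p\}$; (g) $\ddot u_r^-\ge0$ on $\big((S_{u_r}\cup S_{\dot u_r})\setminus\{-1\}\big)\cap\{u_r^-=u_p\}$.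
   Context: $H^2$ is the usual Sobolev space. $\mathbf{H}^2(-2,2)$ is the set of functions $v:(-2,2)\to\mathbb{R}$ that are piecewise $H^2$, i.e. made of finitely many $H^2$ pieces: there is a finite partition $-2=s_0<\dots<s_n=2$ with $v\in H^2(s_{i-1},s_i)$ for each $i$. $\dot v$ is the absolutely continuous part of the distributional derivative $v'$, $\ddot v$ is the absolutely continuous part of $(\dot v)'$, and $\dddot v$ is the absolutely continuous part of $(\ddot v)'$; $S_v$ and $S_{\dot v}$ are the sets of discontinuity points of $v$ and $\dot v$ in $(-2,2)$ (possibly including the points $\pm1$); $\sharp$ is the counting measure. Superscripts $+$ and $-$ denote right and left limits, and $[z]=z^+-z^-$. The constraint "$v_r\ge v_p$ on $[-1,1]$" means: $v_r(x)\ge v_p(x)$ for $x\in[-1,1]\setminus S_{v_r}$; $v_r^+(x)\ge v_p(x)$ for $x\in S_{v_r}\cup\{-1\}$; $v_r^-(x)\ge v_p(x)$ for $x\in S_{v_r}\cup\{1\}$. In the inequalities, $u_r''''$ and $u_p''''$ are fourth distributional derivatives on the open set $(-1,1)\setminus(S_{u_r}\cup S_{\dot u_r})$; the expressions in brackets are measures on that set and the integrals are with respect to these measures, with either one-sided value of $v$ allowed at its jump points. *)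

theory Defs
  imports "HOL-Analysis.Analysis"
begin

text \<open>
  Functions \<open>real \<Rightarrow> real\<close> stand for their Lebesgue classes on the open set under consideration:
  every notion below is invariant under changes on a null set and outside that open set.
\<close>

definition test_function :: "real set \<Rightarrow> (real \<Rightarrow> real) \<Rightarrow> bool" where
  "test_function \<Omega> \<phi> \<longleftrightarrow>
     (\<forall>k x. (deriv ^^ k) \<phi> differentiable at x) \<and>
     compact (closure {x. \<phi> x \<noteq> 0}) \<and> closure {x. \<phi> x \<noteq> 0} \<subseteq> \<Omega>"

definition loc_integrable :: "real set \<Rightarrow> (real \<Rightarrow> real) \<Rightarrow> bool" where
  "loc_integrable \<Omega> f \<longleftrightarrow> (\<forall>C. compact C \<and> C \<subseteq> \<Omega> \<longrightarrow> f absolutely_integrable_on C)"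

definition L2 :: "real set \<Rightarrow> (real \<Rightarrow> real) \<Rightarrow> bool" where
  "L2 \<Omega> f \<longleftrightarrow> f \<in> borel_measurable (lebesgue_on \<Omega>) \<and> integrable (lebesgue_on \<Omega>) (\<lambda>x. (f x)\<^sup>2)"

text \<open>The \<open>k\<close>-th distributional derivative of \<open>f\<close> on \<open>\<Omega>\<close>, evaluated at the test function \<open>\<phi>\<close>.\<close>

definition dist_deriv :: "real set \<Rightarrow> nat \<Rightarrow> (real \<Rightarrow> real) \<Rightarrow> (real \<Rightarrow> real) \<Rightarrow> real" where
  "dist_deriv \<Omega> k f \<phi> = (-1) ^ k * (LINT x:\<Omega>|lebesgue. f x * (deriv ^^ k) \<phi> x)"

definition has_weak_deriv :: "real set \<Rightarrow> nat \<Rightarrow> (real \<Rightarrow> real) \<Rightarrow> (real \<Rightarrow> real) \<Rightarrow> bool" where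
  "has_weak_deriv \<Omega> k f g \<longleftrightarrow> loc_integrable \<Omega> f \<and> loc_integrable \<Omega> g \<and>
     (\<forall>\<phi>. test_function \<Omega> \<phi> \<longrightarrow> dist_deriv \<Omega> k f \<phi> = dist_deriv \<Omega> 0 g \<phi>)"

definition weak_deriv :: "real set \<Rightarrow> nat \<Rightarrow> (real \<Rightarrow> real) \<Rightarrow> real \<Rightarrow> real" where
  "weak_deriv \<Omega> k f = (SOME g. has_weak_deriv \<Omega> k f g)"

definition sobolev :: "nat \<Rightarrow> real set \<Rightarrow> (real \<Rightarrow> real) \<Rightarrow> bool" where
  "sobolev k \<Omega> f \<longleftrightarrow> L2 \<Omega> f \<and> (\<forall>j\<in>{1..k}. \<exists>g. L2 \<Omega> g \<and> has_weak_deriv \<Omega> j f g)"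

definition piecewise_H2 :: "(real \<Rightarrow> real) \<Rightarrow> bool" where
  "piecewise_H2 v \<longleftrightarrow> (\<exists>(n::nat) (s :: nat \<Rightarrow> real). s 0 = -2 \<and> s n = 2 \<and>
     (\<forall>i<n. s i < s (Suc i) \<and> sobolev 2 {s i<..<s (Suc i)} v))"

definition radon_on :: "real set \<Rightarrow> real measure \<Rightarrow> bool" where
  "radon_on \<Omega> m \<longleftrightarrow> sets m = sets borel \<and> (\<forall>C. compact C \<and> C \<subseteq> \<Omega> \<longrightarrow> emeasure m C < \<infinity>)"

text \<open>
  A signed Radon measure on \<open>\<Omega>\<close> is given by its Jordan decomposition \<open>m1 - m2\<close>;
  neither part need be finite near the boundary of \<open>\<Omega>\<close>.
\<close>

definition signed_radon :: "real set \<Rightarrow> real measure \<Rightarrow> real measure \<Rightarrow> bool" where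
  "signed_radon \<Omega> m1 m2 \<longleftrightarrow> radon_on \<Omega> m1 \<and> radon_on \<Omega> m2 \<and>
     (\<exists>P\<in>sets borel. emeasure m1 (\<Omega> - P) = 0 \<and> emeasure m2 (\<Omega> \<inter> P) = 0)"

definition signed_set_integrable ::
    "real set \<Rightarrow> real measure \<Rightarrow> real measure \<Rightarrow> (real \<Rightarrow> real) \<Rightarrow> bool" where
  "signed_set_integrable \<Omega> m1 m2 f \<longleftrightarrow> set_integrable m1 \<Omega> f \<and> set_integrable m2 \<Omega> f"

definition signed_set_integral ::
    "real set \<Rightarrow> real measure \<Rightarrow> real measure \<Rightarrow> (real \<Rightarrow> real) \<Rightarrow> real" where
  "signed_set_integral \<Omega> m1 m2 f = (LINT x:\<Omega>|m1. f x) - (LINT x:\<Omega>|m2. f x)"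

definition distribution_is_measure ::
    "real set \<Rightarrow> ((real \<Rightarrow> real) \<Rightarrow> real) \<Rightarrow> real measure \<Rightarrow> real measure \<Rightarrow> bool" where
  "distribution_is_measure \<Omega> T m1 m2 \<longleftrightarrow> signed_radon \<Omega> m1 m2 \<and>
     (\<forall>\<phi>. test_function \<Omega> \<phi> \<longrightarrow> T \<phi> = signed_set_integral \<Omega> m1 m2 \<phi>)"

text \<open>
  \<open>g\<close> is the density of the absolutely continuous part in the Lebesgue decomposition
  \<open>f' = g dx + (m1 - m2)\<close> of the distributional derivative of \<open>f\<close> on \<open>\<Omega>\<close>; in particular that
  derivative is required to be a measure.
\<close>

definition has_ac_deriv :: "real set \<Rightarrow> (real \<Rightarrow> real) \<Rightarrow> (real \<Rightarrow> real) \<Rightarrow> bool" where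
  "has_ac_deriv \<Omega> f g \<longleftrightarrow> loc_integrable \<Omega> f \<and> loc_integrable \<Omega> g \<and>
     (\<exists>m1 m2 N. N \<in> sets borel \<and> emeasure lborel N = 0 \<and>
        emeasure m1 (\<Omega> - N) = 0 \<and> emeasure m2 (\<Omega> - N) = 0 \<and>
        distribution_is_measure \<Omega> (\<lambda>\<phi>. dist_deriv \<Omega> 1 f \<phi> - dist_deriv \<Omega> 0 g \<phi>) m1 m2)"

definition ac_deriv :: "real set \<Rightarrow> (real \<Rightarrow> real) \<Rightarrow> real \<Rightarrow> real" where
  "ac_deriv \<Omega> f = (SOME g. has_ac_deriv \<Omega> f g)"

definition dot :: "(real \<Rightarrow> real) \<Rightarrow> real \<Rightarrow> real" where
  "dot v = ac_deriv {-2<..<2} v"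

definition ddot :: "(real \<Rightarrow> real) \<Rightarrow> real \<Rightarrow> real" where
  "ddot v = ac_deriv {-2<..<2} (dot v)"

text \<open>
  Taken on \<open>(-1,1)\<close> only: where \<open>v\<close> coincides with a merely twice continuously differentiable
  function, the derivative of \<open>ddot v\<close> need not be a measure.
\<close>

definition dddot :: "(real \<Rightarrow> real) \<Rightarrow> real \<Rightarrow> real" where
  "dddot v = ac_deriv {-1<..<1} (ddot v)"

text \<open>
  Limits of a Lebesgue class: \<open>l\<close> is the limit at \<open>x\<close> from within \<open>A\<close> of some representative
  of \<open>f\<close>.
\<close>

definition ess_lim :: "(real \<Rightarrow> real) \<Rightarrow> real \<Rightarrow> real set \<Rightarrow> real \<Rightarrow> bool" where
  "ess_lim f x A l \<longleftrightarrow> (\<exists>N. negligible N \<and> (f \<longlongrightarrow> l) (at x within (A - N)))"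

definition has_rlim :: "(real \<Rightarrow> real) \<Rightarrow> real \<Rightarrow> real \<Rightarrow> bool" where
  "has_rlim f x l \<longleftrightarrow> ess_lim f x {x<..} l"

definition has_llim :: "(real \<Rightarrow> real) \<Rightarrow> real \<Rightarrow> real \<Rightarrow> bool" where
  "has_llim f x l \<longleftrightarrow> ess_lim f x {..<x} l"

definition rlim :: "(real \<Rightarrow> real) \<Rightarrow> real \<Rightarrow> real" where
  "rlim f x = (THE l. has_rlim f x l)"

definition llim :: "(real \<Rightarrow> real) \<Rightarrow> real \<Rightarrow> real" where
  "llim f x = (THE l. has_llim f x l)"

text \<open>The value at \<open>x\<close> of the representative of \<open>f\<close> that is continuous at \<open>x\<close>.\<close>

definition val :: "(real \<Rightarrow> real) \<Rightarrow> real \<Rightarrow> real" where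
  "val f x = (THE l. ess_lim f x UNIV l)"

definition disc :: "(real \<Rightarrow> real) \<Rightarrow> real set" where
  "disc f = {x\<in>{-2<..<2}. \<nexists>l. ess_lim f x UNIV l}"

definition C2_on :: "real \<Rightarrow> real \<Rightarrow> (real \<Rightarrow> real) \<Rightarrow> bool" where
  "C2_on a b w \<longleftrightarrow> (\<exists>w1 w2. continuous_on {a..b} w2 \<and>
     (\<forall>x\<in>{a..b}. (w has_real_derivative w1 x) (at x within {a..b}) \<and>
                 (w1 has_real_derivative w2 x) (at x within {a..b})))"

definition above :: "(real \<Rightarrow> real) \<Rightarrow> (real \<Rightarrow> real) \<Rightarrow> bool" where
  "above vr vp \<longleftrightarrow>
     (\<forall>x\<in>{-1..1} - disc vr. val vr x \<ge> val vp x) \<and>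
     (\<forall>x\<in>disc vr \<union> {-1}. rlim vr x \<ge> val vp x) \<and>
     (\<forall>x\<in>disc vr \<union> {1}. llim vr x \<ge> val vp x)"

definition KK :: "(real \<Rightarrow> real) \<Rightarrow> ((real \<Rightarrow> real) \<times> (real \<Rightarrow> real)) set" where
  "KK w = {(vr, vp). piecewise_H2 vr \<and> sobolev 2 {-2<..<2} vp \<and> above vr vp \<and>
     (AE x in lebesgue. x \<in> {-2<..<-1} \<union> {1<..<2} \<longrightarrow> vr x = w x \<and> vp x = w x)}"

definition F1 :: "real \<Rightarrow> real \<Rightarrow> real \<Rightarrow> real \<Rightarrow> real \<Rightarrow> (real \<Rightarrow> real) \<Rightarrow> (real \<Rightarrow> real) \<Rightarrow>
    (real \<Rightarrow> real) \<times> (real \<Rightarrow> real) \<Rightarrow> real" where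
  "F1 \<alpha> \<beta> \<eta> \<mu> \<gamma> fr fp = (\<lambda>(vr, vp).
     \<alpha> * real (card (disc vr)) + \<beta> * real (card (disc (dot vr) - disc vr))
     + (LINT x:{-1<..<1}|lebesgue. \<eta> * \<bar>ddot vr x\<bar>\<^sup>2 - fr x * vr x)
     + \<mu> * (LINT x:{-1<..<1}|lebesgue. \<bar>vr x - vp x\<bar>\<^sup>2)
     + (LINT x:{-1<..<1}|lebesgue. \<gamma> * \<bar>weak_deriv {-2<..<2} 2 vp x\<bar>\<^sup>2 - fp x * vp x))"

end

(*
  Classes of piecewise H^2 functions are parametrised by the jumps c of v, the jumps d of v' and the
  density r of v'', so that v = J c + I (J d + I r) with J the jump function and I the primitive.
  In these terms the constraint of K is just v_r >= v_p almost everywhere, and varying (u_r, u_p)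
  within the given jump sets, where the jump cost cannot increase, gives a linear inequality.

  Let G = eta r - I I h with h = f_r/2 - mu (u_r - u_p).  Three-node splines, at Lebesgue points of G,
  show that G is convex on all of (-1,1), also across the jumps, and affine between contact points;
  moving u_r and u_p together shows that G + G_p is affine.  Hence r has a continuous representative R
  whose derivative is g + I h up to the factor eta, with g increasing, and the Stieltjes measure of g
  is eta u_r'''' - h and minus the corresponding measure for u_p.  It does not charge the
  non-contact set, whence both inequalities.  That g stays bounded near -1 and 1 follows from the
  Rolle property of u_r - u_p between contact points accumulating there.  The conditions at
  jumps and creases come from splines concentrating there: hats and half hats for R, steps for R'.
*)

theory Submission
  imports Defs
begin

section \<open>Smooth cut-off functions\<close>

text \<open>One-sided variations make the fourth-order measure positive, but finite only on compact
  subsets of (-1,1). Its mass could blow up at the ends, where u_r and u_p are glued to w, and then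
  the pairing with u_r - v would not exist; \<open>third_derivative\<close> removes this danger.
  Monotonicity bounds g from above near -1 and from below near 1, so the two opposite bounds are
  missing. Because G + G_p is affine, the second derivative of u_r - u_p equals (1/\<eta> +
  1/\<gamma>) G plus a Lipschitz function. The gap u_r - u_p has a minimum at each contact point, so
  its slope vanishes at two such points and, by Rolle, at a third one between them. Its second
  derivative then takes both signs, in either order, and this bounds the slope of G from the missing
  side.

  Derivatives are chosen by \<open>SOME\<close> and limits ignore null sets, so the parametrisation
  by c, d and r is tied to the stated notions through uniqueness of absolutely continuous parts.
  Constants of integration never appear separately: a jump at a node at or left of -2 is a constant
  on (-2,2).\<close>

definition smooth :: "nat \<Rightarrow> (real \<Rightarrow> real) \<Rightarrow> bool" where
  "smooth k f \<longleftrightarrow> (\<forall>j\<le>k. \<forall>x. (deriv ^^ j) f differentiable at x)"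

lemma smooth_0: "smooth 0 f \<longleftrightarrow> (\<forall>x. f differentiable at x)"
  by (simp add: smooth_def)

text \<open>Differentiability up to a finite order is used because this recursion on the order turns
  every closure property below into an induction that passes from the functions to their
  derivatives.\<close>

lemma smooth_Suc: "smooth (Suc k) f \<longleftrightarrow> (\<forall>x. f differentiable at x) \<and> smooth k (deriv f)"
proof
  assume L: "smooth (Suc k) f"
  have "(deriv ^^ j) (deriv f) differentiable at x" if "j \<le> k" for j x
    using L that by (auto simp: smooth_def dest!: spec[of _ "Suc j"] simp: funpow_Suc_right simp del: funpow.simps)
  moreover have "f differentiable at x" for x using L by (auto simp: smooth_def dest: spec[of _ 0])
  ultimately show "(\<forall>x. f differentiable at x) \<and> smooth k (deriv f)" by (simp add: smooth_def)
next
  assume R: "(\<forall>x. f differentiable at x) \<and> smooth k (deriv f)"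
  show "smooth (Suc k) f" unfolding smooth_def
  proof (intro allI impI)
    fix j x assume "j \<le> Suc k"
    then show "(deriv ^^ j) f differentiable at x"
      using R by (cases j) (auto simp: smooth_def funpow_Suc_right simp del: funpow.simps(2))
  qed
qed

lemma smooth_differentiable: "smooth k f \<Longrightarrow> f differentiable at x"
  using smooth_def[of k f] by (metis funpow_0 le0)

lemma smooth_mono: "smooth k f \<Longrightarrow> j \<le> k \<Longrightarrow> smooth j f"
  by (auto simp: smooth_def)

lemma deriv_DERIV: "f differentiable at x \<Longrightarrow> (f has_real_derivative deriv f x) (at x)" for f :: "real \<Rightarrow> real"
  by (simp add: DERIV_deriv_iff_real_differentiable)

lemma smooth_add: "smooth k f \<Longrightarrow> smooth k g \<Longrightarrow> smooth k (\<lambda>x. f x + g x)"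
proof (induction k arbitrary: f g)
  case (Suc k)
  have "deriv (\<lambda>x. f x + g x) = (\<lambda>x. deriv f x + deriv g x)"
    using Suc.prems by (intro ext DERIV_imp_deriv DERIV_add deriv_DERIV) (auto simp: smooth_Suc)
  then show ?case using Suc by (simp add: smooth_Suc)
qed (simp add: smooth_0)

lemma smooth_mult: "smooth k f \<Longrightarrow> smooth k g \<Longrightarrow> smooth k (\<lambda>x. f x * g x)"
proof (induction k arbitrary: f g)
  case (Suc k)
  have "deriv (\<lambda>x. f x * g x) = (\<lambda>x. deriv f x * g x + deriv g x * f x)"
    using Suc.prems by (intro ext DERIV_imp_deriv DERIV_mult deriv_DERIV) (auto simp: smooth_Suc)
  moreover have "smooth k f" "smooth k g" using Suc.prems smooth_mono le_SucI by blast+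
  ultimately show ?case using Suc by (simp add: smooth_Suc smooth_add)
qed (simp add: smooth_0)

lemma smooth_const: "smooth k (\<lambda>x. c)"
proof (induction k arbitrary: c)
  case (Suc k)
  have "deriv (\<lambda>x::real. c) = (\<lambda>x. 0)" by (intro ext DERIV_imp_deriv) simp
  then show ?case using Suc by (simp add: smooth_Suc)
qed (simp add: smooth_0)

lemma smooth_cmult: "smooth k f \<Longrightarrow> smooth k (\<lambda>x. c * f x)"
  by (intro smooth_mult smooth_const)

lemma smooth_affine: "smooth k f \<Longrightarrow> smooth k (\<lambda>x. f (a * x + b))"
proof (induction k arbitrary: f)
  case 0
  show ?case using 0 unfolding smooth_0
    by (intro allI differentiable_chain_at[of "\<lambda>x. a * x + b" _ f, unfolded o_def]) auto
next
  case (Suc k)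
  have D: "((\<lambda>x. f (a * x + b)) has_real_derivative deriv f (a * x + b) * a) (at x)" for x
  proof -
    have "((\<lambda>x. a * x + b) has_real_derivative a) (at x)" by (auto intro!: derivative_eq_intros)
    moreover have "(f has_real_derivative deriv f (a * x + b)) (at (a * x + b))"
      using Suc.prems by (intro deriv_DERIV) (auto simp: smooth_Suc)
    ultimately show ?thesis by (rule DERIV_chain2[rotated])
  qed
  then have "deriv (\<lambda>x. f (a * x + b)) = (\<lambda>x. deriv f (a * x + b) * a)"
    by (intro ext DERIV_imp_deriv)
  moreover have "(\<lambda>x. f (a * x + b)) differentiable at x" for x
    using D real_differentiable_def by blast
  ultimately show ?case using Suc smooth_mult smooth_const by (auto simp: smooth_Suc)
qed

section \<open>The function exp(-1/x), flat at the origin\<close>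

definition expinv :: "real \<Rightarrow> real" where
  "expinv x = (if x > 0 then exp (- 1 / x) else 0)"

lemma tendsto_poly_exp: "((\<lambda>y::real. poly p y * exp (- y)) \<longlongrightarrow> 0) at_top"
proof -
  have "((\<lambda>y::real. \<Sum>i\<le>degree p. coeff p i * (y ^ i / exp y)) \<longlongrightarrow> (\<Sum>i\<le>degree p. coeff p i * 0)) at_top"
    by (intro tendsto_intros tendsto_power_div_exp_0)
  then show ?thesis
    by (simp add: poly_altdef sum_distrib_right exp_minus divide_inverse mult.assoc)
qed

text \<open>The functions p(1/x) exp(-1/x) are closed under differentiation: with y = 1/x the chain
  rule yields the factor y^2, the exponential contributes p and the polynomial -p'. At 0 the
  difference quotient is again such a function with one more factor y, and exponential decay beats
  every power of y.\<close>

lemma expinv_poly_deriv: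
  fixes p :: "real poly"
  defines "f \<equiv> (\<lambda>q x. if x > 0 then poly q (1/x) * exp (- 1/x) else 0 :: real)"
  shows "(f p has_real_derivative f ([:0,0,1:] * (p - pderiv p)) x) (at x)"
proof -
  consider "x > 0" | "x < 0" | "x = 0" by linarith
  then show ?thesis
  proof cases
    case 1
    have "((\<lambda>x. poly p (1/x) * exp (-1/x)) has_real_derivative
       (poly (pderiv p) (1/x) * (-1/x^2) * exp (-1/x) + poly p (1/x) * (exp (-1/x) * (1/x^2)))) (at x)"
      using 1 by (auto intro!: derivative_eq_intros DERIV_chain'[OF _ poly_DERIV] simp: power2_eq_square divide_simps)
    moreover have "f ([:0,0,1:] * (p - pderiv p)) x = 
       (poly (pderiv p) (1/x) * (-1/x^2) * exp (-1/x) + poly p (1/x) * (exp (-1/x) * (1/x^2)))"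
      using 1 by (simp add: f_def power2_eq_square field_simps)
    ultimately have "((\<lambda>x. poly p (1/x) * exp (-1/x)) has_real_derivative f ([:0,0,1:] * (p - pderiv p)) x) (at x)"
      by simp
    then show ?thesis
      by (rule has_field_derivative_transform_within_open[of _ _ _ "{0<..}"]) (use 1 in \<open>auto simp: f_def\<close>)
  next
    case 2
    have "((\<lambda>x. 0) has_real_derivative f ([:0,0,1:] * (p - pderiv p)) x) (at x)"
      using 2 by (simp add: f_def)
    then show ?thesis
      by (rule has_field_derivative_transform_within_open[of _ _ _ "{..<0}"]) (use 2 in \<open>auto simp: f_def\<close>)
  next
    case 3
    have "((\<lambda>y. f p y / y) \<longlongrightarrow> 0) (at_right 0)"
    proof -
      have "((\<lambda>y::real. poly ([:0,1:] * p) (inverse y) * exp (- inverse y)) \<longlongrightarrow> 0) (at_right 0)"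
        by (rule filterlim_compose[OF tendsto_poly_exp filterlim_inverse_at_top_right])
      then show ?thesis
        by (rule Lim_transform_eventually)
           (auto simp: eventually_at_filter f_def field_simps intro!: always_eventually)
    qed
    moreover have "((\<lambda>y. f p y / y) \<longlongrightarrow> 0) (at_left 0)"
      by (rule Lim_transform_eventually[OF tendsto_const])
         (auto simp: eventually_at_filter f_def intro!: always_eventually)
    ultimately have "((\<lambda>y. f p y / y) \<longlongrightarrow> 0) (at 0)"
      by (simp add: filterlim_at_split)
    then show ?thesis using 3 by (simp add: has_field_derivative_iff f_def)
  qed
qed

lemma smooth_expinv: "smooth k expinv"
proof -
  have "smooth k (\<lambda>x. if x > 0 then poly p (1/x) * exp (- 1/x) else 0)" for p :: "real poly"
  proof (induction k arbitrary: p)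
    case 0
    then show ?case unfolding smooth_0 using expinv_poly_deriv real_differentiable_def by blast
  next
    case (Suc k)
    have "deriv (\<lambda>x. if x > 0 then poly p (1/x) * exp (- 1/x) else 0) =
       (\<lambda>x. if x > 0 then poly ([:0,0,1:] * (p - pderiv p)) (1/x) * exp (- 1/x) else 0)"
      by (intro ext DERIV_imp_deriv expinv_poly_deriv)
    moreover have "(\<lambda>x. if x > 0 then poly p (1/x) * exp (- 1/x) else 0) differentiable at x" for x
      using expinv_poly_deriv[of p x] real_differentiable_def by blast
    ultimately show ?case unfolding smooth_Suc using Suc[of "[:0,0,1:] * (p - pderiv p)"] by (simp only:) blast
  qed
  from this[of "[:1:]"] show ?thesis unfolding expinv_def[abs_def] by (simp cong: if_cong)
qed

section \<open>Test functions and their supports\<close>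

lemma test_function_iff_smooth:
  "test_function \<Omega> \<phi> \<longleftrightarrow> (\<forall>k. smooth k \<phi>) \<and>
     compact (closure {x. \<phi> x \<noteq> 0}) \<and> closure {x. \<phi> x \<noteq> 0} \<subseteq> \<Omega>"
  unfolding test_function_def smooth_def by blast

lemma test_function_supportI:
  assumes "\<And>k. smooth k \<phi>" "\<And>x. x \<notin> {a..b} \<Longrightarrow> \<phi> x = 0" "{a..b} \<subseteq> \<Omega>"
  shows "test_function \<Omega> \<phi>"
proof -
  have "{x. \<phi> x \<noteq> 0} \<subseteq> {a..b}" using assms(2) by blast
  then have "closure {x. \<phi> x \<noteq> 0} \<subseteq> {a..b}" by (simp add: closure_minimal)
  then show ?thesis using assms bounded_subset[OF bounded_closed_interval]
    by (auto simp: test_function_iff_smooth compact_eq_bounded_closed)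
qed

text \<open>Off its closed support the function vanishes on an open set, so differentiation cannot
  enlarge the support.\<close>

lemma test_function_deriv: 
  assumes "test_function \<Omega> \<phi>" shows "test_function \<Omega> (deriv \<phi>)"
proof -
  have z: "deriv \<phi> x = 0" if "x \<notin> closure {x. \<phi> x \<noteq> 0}" for x
  proof -
    let ?U = "- closure {x. \<phi> x \<noteq> 0}"
    have "0 = \<phi> y" if "y \<in> ?U" for y using that closure_subset[of "{x. \<phi> x \<noteq> 0}"] by auto
    moreover have "open ?U" "x \<in> ?U" using that by (auto simp: open_Compl)
    moreover have "((\<lambda>_. 0) has_real_derivative 0) (at x)" by simp
    ultimately have "(\<phi> has_real_derivative 0) (at x)"
      using has_field_derivative_transform_within_open by blast
    then show ?thesis by (rule DERIV_imp_deriv)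
  qed
  then have "{x. deriv \<phi> x \<noteq> 0} \<subseteq> closure {x. \<phi> x \<noteq> 0}" by blast
  then have sub: "closure {x. deriv \<phi> x \<noteq> 0} \<subseteq> closure {x. \<phi> x \<noteq> 0}" by (simp add: closure_minimal)
  have K: "compact (closure {x. \<phi> x \<noteq> 0})" "closure {x. \<phi> x \<noteq> 0} \<subseteq> \<Omega>" "\<And>k. smooth k \<phi>"
    using assms by (auto simp: test_function_iff_smooth)
  have "compact (closure {x. \<phi> x \<noteq> 0} \<inter> closure {x. deriv \<phi> x \<noteq> 0})"
    using K(1) closed_closure by (rule compact_Int_closed)
  then have "compact (closure {x. deriv \<phi> x \<noteq> 0})" using sub by (simp add: Int_absorb1)
  moreover have "smooth k (deriv \<phi>)" for k using K(3)[of "Suc k"] by (simp add: smooth_Suc)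
  ultimately show ?thesis using sub K(2) unfolding test_function_iff_smooth by (meson order_trans)
qed

lemma test_function_DERIV: "test_function \<Omega> \<phi> \<Longrightarrow> (\<phi> has_real_derivative deriv \<phi> x) (at x)"
  using smooth_differentiable[of 0 \<phi>] by (auto simp: test_function_iff_smooth intro!: deriv_DERIV)

lemma test_function_continuous: "test_function \<Omega> \<phi> \<Longrightarrow> continuous_on A \<phi>"
  by (meson DERIV_isCont continuous_at_imp_continuous_on test_function_DERIV)

lemma test_function_zero: "test_function \<Omega> \<phi> \<Longrightarrow> x \<notin> \<Omega> \<Longrightarrow> \<phi> x = 0"
  unfolding test_function_def using closure_subset[of "{x. \<phi> x \<noteq> 0}"] by blast

lemma test_function_bounded:
  assumes "test_function \<Omega> \<phi>" obtains B where "\<And>x. \<bar>\<phi> x\<bar> \<le> B"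
proof -
  let ?K = "closure {x. \<phi> x \<noteq> 0}"
  have "compact (\<phi> ` ?K)"
    using assms test_function_continuous[OF assms] by (intro compact_continuous_image) (auto simp: test_function_def)
  then obtain B where B: "\<And>y. y \<in> \<phi> ` ?K \<Longrightarrow> \<bar>y\<bar> \<le> B"
    by (metis bounded_iff compact_imp_bounded real_norm_def)
  have "\<bar>\<phi> x\<bar> \<le> max 0 B" for x
    using B[of "\<phi> x"] closure_subset[of "{x. \<phi> x \<noteq> 0}"] by (cases "\<phi> x = 0") (auto simp: max_def intro: order_trans)
  then show ?thesis using that by blast
qed

text \<open>A nonempty compact support has a least and a greatest point, both strictly inside the
  open interval. The zero function is split off because it has no such points.\<close>

lemma test_function_interval:
  assumes "test_function {a<..<b} \<phi>"
  obtains a' b' where "a < a'" "a' \<le> b'" "b' < b" "\<And>x. x \<notin> {a'..b'} \<Longrightarrow> \<phi> x = 0" | "\<phi> = (\<lambda>x. 0)"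
proof -
  let ?K = "closure {x. \<phi> x \<noteq> 0}"
  show ?thesis
  proof (cases "?K = {}")
    case True
    then have "\<phi> = (\<lambda>x. 0)" by auto
    then show ?thesis using that by blast
  next
    case False
    have K: "compact ?K" "?K \<subseteq> {a<..<b}" using assms by (auto simp: test_function_def)
    obtain u where u: "u \<in> ?K" "\<And>y. y \<in> ?K \<Longrightarrow> u \<le> y" using compact_attains_inf[OF K(1) False] by auto
    obtain v where v: "v \<in> ?K" "\<And>y. y \<in> ?K \<Longrightarrow> y \<le> v" using compact_attains_sup[OF K(1) False] by auto
    have "\<phi> x = 0" if "x \<notin> {u..v}" for x
      using that u(2)[of x] v(2)[of x] closure_subset[of "{x. \<phi> x \<noteq> 0}"] by fastforce
    then show ?thesis using that(1)[of u v] u v K(2) by (metis greaterThanLessThan_iff subsetD)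
  qed
qed

section \<open>Bumps approximating indicators of intervals\<close>

text \<open>Scaling the argument by n keeps the support in [a,b] while the values inside tend to 1,
  so that dominated convergence recovers integrals over open intervals without any
  mollification.\<close>

definition bump :: "nat \<Rightarrow> real \<Rightarrow> real \<Rightarrow> real \<Rightarrow> real" where
  "bump n a b x = expinv (real n * (x - a)) * expinv (real n * (b - x))"

lemma expinv_bounds: "0 \<le> expinv x" "expinv x \<le> 1"
  by (auto simp: expinv_def)

lemma bump_bounds: "0 \<le> bump n a b x" "bump n a b x \<le> 1"
  by (auto simp: bump_def expinv_bounds intro!: mult_le_one mult_nonneg_nonneg)

lemma bump_zero: "x \<notin> {a<..<b} \<Longrightarrow> bump n a b x = 0"
  by (auto simp: bump_def expinv_def not_less mult_le_0_iff zero_less_mult_iff)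

lemma bump_pos: "n > 0 \<Longrightarrow> x \<in> {a<..<b} \<Longrightarrow> bump n a b x > 0"
  by (auto simp: bump_def expinv_def)

lemma smooth_bump: "smooth k (bump n a b)"
proof -
  have "smooth k (\<lambda>x. expinv (real n * x + (- real n * a)) * expinv (- real n * x + real n * b))"
    by (intro smooth_mult smooth_affine[of k expinv] smooth_expinv)
  then show ?thesis by (simp add: bump_def[abs_def] algebra_simps)
qed

lemma test_function_bump: "{a..b} \<subseteq> \<Omega> \<Longrightarrow> test_function \<Omega> (bump n a b)"
  by (rule test_function_supportI[of _ a b]) (auto simp: smooth_bump bump_zero)

lemma expinv_tendsto: "(\<lambda>n. expinv (real n * x)) \<longlonglongrightarrow> (if x > 0 then 1 else 0)"
proof (cases "x > 0")
  case True
  have "(\<lambda>n. exp (- (1 / x) * (1 / real n))) \<longlonglongrightarrow> exp (- (1 / x) * 0)"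
    by (intro tendsto_intros lim_1_over_n)
  then have "(\<lambda>n. expinv (real n * x)) \<longlonglongrightarrow> exp (- (1 / x) * 0)"
    by (rule Lim_transform_eventually)
       (use True in \<open>auto simp: expinv_def eventually_sequentially field_simps intro!: exI[of _ 1]\<close>)
  then show ?thesis using True by simp
next
  case False
  then show ?thesis by (auto simp: expinv_def zero_less_mult_iff)
qed

lemma bump_tendsto: "(\<lambda>n. bump n a b x) \<longlonglongrightarrow> indicator {a<..<b} x"
proof -
  have "(\<lambda>n. bump n a b x) \<longlonglongrightarrow> (if x - a > 0 then 1 else 0) * (if b - x > 0 then 1 else 0)"
    unfolding bump_def by (intro tendsto_mult expinv_tendsto)
  then show ?thesis by (cases "a < x"; cases "x < b") auto
qed

section \<open>Integrals of Lebesgue classes\<close>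

lemma absolutely_integrable_cong_AE:
  fixes f g :: "real \<Rightarrow> real"
  assumes "AE x in lebesgue. x \<in> A \<longrightarrow> f x = g x"
  shows "f absolutely_integrable_on A \<longleftrightarrow> g absolutely_integrable_on A"
proof -
  have "g absolutely_integrable_on A"
    if "f absolutely_integrable_on A" "AE x in lebesgue. x \<in> A \<longrightarrow> f x = g x" for f g :: "real \<Rightarrow> real"
  proof -
    have ae: "AE x in lebesgue. indicator A x *\<^sub>R f x = indicator A x *\<^sub>R g x"
      using that(2) by eventually_elim (auto simp: indicator_def)
    have m: "(\<lambda>x. indicator A x *\<^sub>R f x) \<in> borel_measurable lebesgue"
      using that(1) by (auto simp: set_integrable_def)
    then have "(\<lambda>x. indicator A x *\<^sub>R g x) \<in> borel_measurable lebesgue"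
      by (rule borel_measurable_AE[OF _ ae])
    then show ?thesis using that(1) integrable_cong_AE[OF m _ ae] by (simp add: set_integrable_def)
  qed
  from this[of f g] this[of g f] show ?thesis using assms by (auto simp: eq_commute)
qed

text \<open>Integrability is not assumed: it transfers along equality almost everywhere, and in its
  absence both integrals take the default value 0.\<close>

lemma LINT_cong_AE:
  fixes f g :: "real \<Rightarrow> real"
  assumes "AE x in lebesgue. x \<in> A \<longrightarrow> f x = g x"
  shows "(LINT x:A|lebesgue. f x) = (LINT x:A|lebesgue. g x)"
proof (cases "f absolutely_integrable_on A")
  case True
  then have "g absolutely_integrable_on A" using absolutely_integrable_cong_AE[OF assms] by blast
  with True show ?thesis unfolding set_lebesgue_integral_def set_integrable_def
    by (intro integral_cong_AE) (use assms in \<open>auto elim: eventually_mono\<close>)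
next
  case False
  then have "\<not> g absolutely_integrable_on A" using absolutely_integrable_cong_AE[OF assms] by blast
  with False show ?thesis unfolding set_lebesgue_integral_def set_integrable_def
    by (simp add: not_integrable_integral_eq)
qed

lemma absolutely_integrable_mult_bounded:
  fixes f g :: "real \<Rightarrow> real"
  assumes "f absolutely_integrable_on A" "A \<in> sets lebesgue" "g \<in> borel_measurable borel"
    "\<And>x. x \<in> A \<Longrightarrow> \<bar>g x\<bar> \<le> B"
  shows "(\<lambda>x. f x * g x) absolutely_integrable_on A"
proof -
  have "g \<in> borel_measurable (lebesgue_on A)"
    by (simp add: assms(3) measurable_completion measurable_restrict_space1)
  moreover have "bounded (g ` A)" using assms(4) by (auto simp: bounded_iff)
  ultimately have "(\<lambda>x. g x * f x) absolutely_integrable_on A"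
    using absolutely_integrable_bounded_measurable_product_real assms by blast
  then show ?thesis by (simp add: mult.commute)
qed

lemma absolutely_integrable_bounded:
  fixes g :: "real \<Rightarrow> real"
  assumes "A \<in> sets lebesgue" "bounded A" "g \<in> borel_measurable borel" "\<And>x. x \<in> A \<Longrightarrow> \<bar>g x\<bar> \<le> B"
  shows "g absolutely_integrable_on A"
proof -
  have "(\<lambda>x. 1::real) absolutely_integrable_on A"
    using assms by (intro absolutely_integrable_on_const) (simp add: bounded_set_imp_lmeasurable)
  from absolutely_integrable_mult_bounded[OF this assms(1,3,4)] show ?thesis by simp
qed

text \<open>Lebesgue differentiation: at almost every x the averages over [x, x + h] tend to f x,
  and all of these averages vanish.\<close>

lemma integrals_zero_imp_AE_zero:
  fixes f :: "real \<Rightarrow> real"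
  assumes f: "f absolutely_integrable_on {c..d}"
    and z: "\<And>p q. c < p \<Longrightarrow> p < q \<Longrightarrow> q < d \<Longrightarrow> (LINT x:{p<..<q}|lebesgue. f x) = 0"
  shows "AE x in lebesgue. x \<in> {c<..<d} \<longrightarrow> f x = 0"
proof -
  let ?g = "\<lambda>x. if x \<in> {c..d} then f x else 0"
  have g: "?g absolutely_integrable_on UNIV" using f absolutely_integrable_restrict_UNIV by blast
  have int: "?g integrable_on cbox a b" for a b
    by (rule set_lebesgue_integral_eq_integral(1), rule set_integrable_subset[OF g]) auto
  obtain N where N: "negligible N" and lim: "\<And>x e. x \<notin> N \<Longrightarrow> 0 < e \<Longrightarrow>
      \<exists>\<delta>>0. \<forall>h. 0 < h \<and> h < \<delta> \<longrightarrow> norm (integral (cbox x (x + h *\<^sub>R One)) ?g /\<^sub>R h ^ DIM(real) - ?g x) < e"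
  proof (rule integrable_ccontinuous_explicit[OF int], goal_cases)
    case (1 N) then show ?thesis using that[of N] by simp
  qed
  have "f x = 0" if x: "x \<in> {c<..<d}" "x \<notin> N" for x
  proof (rule ccontr)
    assume "f x \<noteq> 0"
    then have "\<exists>\<delta>>0. \<forall>h. 0 < h \<and> h < \<delta> \<longrightarrow> norm (integral (cbox x (x + h *\<^sub>R One)) ?g /\<^sub>R h ^ DIM(real) - ?g x) < \<bar>f x\<bar>"
      using x(2) by (intro lim) auto
    then obtain \<delta> where \<delta>: "\<delta> > 0"
      "\<And>h. 0 < h \<Longrightarrow> h < \<delta> \<Longrightarrow> norm (integral (cbox x (x + h *\<^sub>R One)) ?g /\<^sub>R h ^ DIM(real) - ?g x) < \<bar>f x\<bar>"
      by blast
    define h where "h = min (\<delta>/2) ((d - x)/2)"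
    have h: "0 < h" "h < \<delta>" "x + h < d" using \<delta> x by (auto simp: h_def min_def field_simps)
    have box: "cbox x (x + h *\<^sub>R One) = {x..x + h}" by simp
    have "integral {x..x + h} ?g = integral {x..x+h} f"
      using h x by (intro integral_cong) auto
    also have "\<dots> = integral {x<..<x+h} f"
      by (simp add: integral_open_interval_real)
    also have "\<dots> = (LINT y:{x<..<x+h}|lebesgue. f y)"
      using h x by (intro set_lebesgue_integral_eq_integral(2)[symmetric] set_integrable_subset[OF f]) auto
    also have "\<dots> = 0" using z h x by auto
    finally have "integral {x..x + h} ?g = 0" .
    then show False using \<delta>(2)[OF h(1,2)] x(1) unfolding box by simp
  qed
  then show ?thesis using N
    by (intro AE_I'[of N]) (auto simp: negligible_iff_null_sets)
qed

text \<open>Intervals with rational end points suffice, and they leave only countably many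
  exceptional sets to unite.\<close>

lemma AE_open_interval_exhaust:
  assumes "\<And>c d. a < c \<Longrightarrow> c < d \<Longrightarrow> d < b \<Longrightarrow> AE x in M. x \<in> {c<..<d} \<longrightarrow> P x"
  shows "AE x in M. x \<in> {a<..<b::real} \<longrightarrow> P x"
proof -
  have "AE x in M. \<forall>c\<in>\<rat>. \<forall>d\<in>\<rat>. a < c \<longrightarrow> c < d \<longrightarrow> d < b \<longrightarrow> x \<in> {c<..<d} \<longrightarrow> P x"
    using assms by (intro AE_ball_countable[THEN iffD2] countable_rat ballI AE_impI) blast
  then show ?thesis
  proof eventually_elim
    case (elim x)
    show ?case
    proof
      assume "x \<in> {a<..<b}"
      then obtain c d where "c \<in> \<rat>" "a < c" "c < x" "d \<in> \<rat>" "x < d" "d < b"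
        using Rats_dense_in_real by (metis greaterThanLessThan_iff)
      then show "P x" using elim by force
    qed
  qed
qed

lemma loc_integrable_Icc:
  "loc_integrable {a<..<b} f \<Longrightarrow> a < c \<Longrightarrow> d < b \<Longrightarrow> f absolutely_integrable_on {c..d}"
  unfolding loc_integrable_def by (drule spec[of _ "{c..d}"]) (simp add: subset_eq)

lemma loc_integrable_mult_test:
  assumes "loc_integrable {a<..<b} f" "test_function {a<..<b} \<phi>"
  shows "(\<lambda>x. f x * \<phi> x) absolutely_integrable_on {a<..<b}"
proof (cases rule: test_function_interval[OF assms(2)])
  case (1 a' b')
  obtain B where B: "\<And>x. \<bar>\<phi> x\<bar> \<le> B" using test_function_bounded[OF assms(2)] by blast
  have "(\<lambda>x. f x * \<phi> x) absolutely_integrable_on {a'..b'}"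
  proof (rule absolutely_integrable_mult_bounded)
    show "f absolutely_integrable_on {a'..b'}" using loc_integrable_Icc assms(1) 1 by blast
    show "\<phi> \<in> borel_measurable borel"
      by (rule borel_measurable_continuous_onI) (rule test_function_continuous[OF assms(2)])
  qed (use B in auto)
  then have "(\<lambda>x. if x \<in> {a'..b'} then f x * \<phi> x else 0) absolutely_integrable_on UNIV"
    by (simp only: absolutely_integrable_restrict_UNIV)
  moreover have "(\<lambda>x. if x \<in> {a'..b'} then f x * \<phi> x else 0) = (\<lambda>x. f x * \<phi> x)"
    using 1(4) by fastforce
  ultimately have "(\<lambda>x. f x * \<phi> x) absolutely_integrable_on UNIV" by (simp only:)
  then show ?thesis by (rule set_integrable_subset) auto
qed (auto simp: set_integrable_def)

lemma LINT_bump_tendsto: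
  assumes f: "loc_integrable {a<..<b} f" and "a < p" "q < b"
  shows "(\<lambda>n. LINT x:{a<..<b}|lebesgue. f x * bump n p q x) \<longlonglongrightarrow> (LINT x:{p<..<q}|lebesgue. f x)"
  unfolding set_lebesgue_integral_def
proof (rule integral_dominated_convergence)
  have f': "f absolutely_integrable_on {p..q}" using loc_integrable_Icc assms by blast
  then have fo: "f absolutely_integrable_on {p<..<q}" by (rule set_integrable_subset) auto
  then show m: "(\<lambda>x. indicat_real {p<..<q} x *\<^sub>R f x) \<in> borel_measurable lebesgue"
    by (auto simp: set_integrable_def)
  have eq: "(\<lambda>x. indicat_real {a<..<b} x *\<^sub>R (f x * bump n p q x)) = (\<lambda>x. (indicat_real {p<..<q} x *\<^sub>R f x) * bump n p q x)" for n
    using assms by (auto simp: fun_eq_iff indicator_def bump_zero)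
  have "bump n p q \<in> borel_measurable lebesgue" for n
    using test_function_bump[of p q UNIV n] test_function_continuous
    by (auto intro!: measurable_completion borel_measurable_continuous_onI)
  with m show "(\<lambda>x. indicat_real {a<..<b} x *\<^sub>R (f x * bump n p q x)) \<in> borel_measurable lebesgue" for n
    unfolding eq by simp
  show "integrable lebesgue (\<lambda>x. \<bar>indicat_real {p<..<q} x *\<^sub>R f x\<bar>)"
    using fo unfolding set_integrable_def by (rule integrable_abs)
  show "AE x in lebesgue. (\<lambda>n. indicat_real {a<..<b} x *\<^sub>R (f x * bump n p q x)) \<longlonglongrightarrow> indicat_real {p<..<q} x *\<^sub>R f x"
  proof (intro AE_I2)
    fix x
    have "(\<lambda>n. (indicat_real {p<..<q} x *\<^sub>R f x) * bump n p q x) \<longlonglongrightarrow> (indicat_real {p<..<q} x *\<^sub>R f x) * indicator {p<..<q} x"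
      by (intro tendsto_intros bump_tendsto)
    moreover have "indicat_real {a<..<b} x *\<^sub>R (f x * bump n p q x) = (indicat_real {p<..<q} x *\<^sub>R f x) * bump n p q x" for n
      using fun_cong[OF eq[of n], of x] .
    moreover have "(indicat_real {p<..<q} x *\<^sub>R f x) * indicator {p<..<q} x = indicat_real {p<..<q} x *\<^sub>R f x"
      by (simp add: indicator_def)
    ultimately show "(\<lambda>n. indicat_real {a<..<b} x *\<^sub>R (f x * bump n p q x)) \<longlonglongrightarrow> indicat_real {p<..<q} x *\<^sub>R f x"
      by (simp only:)
  qed
  show "AE x in lebesgue. norm (indicat_real {a<..<b} x *\<^sub>R (f x * bump n p q x)) \<le> \<bar>indicat_real {p<..<q} x *\<^sub>R f x\<bar>" for n
    unfolding fun_cong[OF eq[of n]] real_norm_def abs_mult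
    by (intro AE_I2 mult_left_le) (auto simp: bump_bounds)
qed

section \<open>The fundamental lemma and uniqueness of weak derivatives\<close>

text \<open>Bumps make the integrals over all open subintervals vanish, and these integrals
  determine f almost everywhere.\<close>

lemma fundamental_lemma:
  assumes f: "loc_integrable {a<..<b} f"
    and z: "\<And>\<phi>. test_function {a<..<b} \<phi> \<Longrightarrow> (LINT x:{a<..<b}|lebesgue. f x * \<phi> x) = 0"
  shows "AE x in lebesgue. x \<in> {a<..<b} \<longrightarrow> f x = 0"
proof (rule AE_open_interval_exhaust)
  fix c d assume cd: "a < c" "c < d" "d < b"
  show "AE x in lebesgue. x \<in> {c<..<d} \<longrightarrow> f x = 0"
  proof (rule integrals_zero_imp_AE_zero)
    show "f absolutely_integrable_on {c..d}" using loc_integrable_Icc f cd by blast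
    fix p q assume pq: "c < p" "p < q" "q < d"
    have "(\<lambda>n. 0) \<longlonglongrightarrow> (LINT x:{p<..<q}|lebesgue. f x)"
      using LINT_bump_tendsto[OF f, of p q] z[OF test_function_bump] pq cd by (simp add: subset_eq)
    then show "(LINT x:{p<..<q}|lebesgue. f x) = 0" by (simp add: LIMSEQ_const_iff)
  qed
qed

lemma has_weak_deriv_unique:
  assumes "has_weak_deriv {a<..<b} k f g" "has_weak_deriv {a<..<b} k f h"
  shows "AE x in lebesgue. x \<in> {a<..<b} \<longrightarrow> g x = h x"
proof -
  have l: "loc_integrable {a<..<b} g" "loc_integrable {a<..<b} h" using assms by (auto simp: has_weak_deriv_def)
  then have "AE x in lebesgue. x \<in> {a<..<b} \<longrightarrow> g x - h x = 0"
  proof (intro fundamental_lemma)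
    show "loc_integrable {a<..<b} (\<lambda>x. g x - h x)" using l unfolding loc_integrable_def by (auto intro: set_integral_diff)
    fix \<phi> assume \<phi>: "test_function {a<..<b} \<phi>"
    have "(LINT x:{a<..<b}|lebesgue. g x * \<phi> x) = (LINT x:{a<..<b}|lebesgue. h x * \<phi> x)"
      using assms \<phi> by (auto simp: has_weak_deriv_def dist_deriv_def)
    then show "(LINT x:{a<..<b}|lebesgue. (g x - h x) * \<phi> x) = 0"
      using loc_integrable_mult_test[OF _ \<phi>] l by (simp add: left_diff_distrib set_integral_diff)
  qed
  then show ?thesis by simp
qed

text \<open>The choice operator returns some weak derivative; uniqueness identifies it, up to a null
  set, with any derivative that can be exhibited.\<close>

lemma weak_deriv_AE:
  assumes "has_weak_deriv {a<..<b} k f g"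
  shows "AE x in lebesgue. x \<in> {a<..<b} \<longrightarrow> weak_deriv {a<..<b} k f x = g x"
proof -
  have "has_weak_deriv {a<..<b} k f (weak_deriv {a<..<b} k f)"
    unfolding weak_deriv_def using someI_ex[of "has_weak_deriv {a<..<b} k f"] assms by blast
  then show ?thesis using assms by (rule has_weak_deriv_unique)
qed

section \<open>Integration by parts\<close>

text \<open>Both terms are integrals of f(x) q(y), one over y <= x and one over x <= y. The two
  triangles cover the square and overlap only in the diagonal, so Fubini gives the product of the
  integrals.\<close>

lemma integral_by_parts_Lebesgue:
  fixes f q :: "real \<Rightarrow> real"
  assumes f: "f absolutely_integrable_on {a..b}" and q: "q absolutely_integrable_on {a..b}"
  shows "(LINT x:{a..b}|lebesgue. f x * integral {a..x} q) + (LINT x:{a..b}|lebesgue. q x * integral {a..x} f)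
    = integral {a..b} f * integral {a..b} q"
proof -
  \<comment> \<open>A Borel representative, extended by zero, moves the computation to
    \<open>lborel\<close>, where the product measure and joint measurability are available.\<close>
  have rep: "\<exists>f0. integrable lborel f0 \<and> (AE x in lebesgue. x \<in> {a..b} \<longrightarrow> f x = f0 x) \<and> (\<forall>x. x \<notin> {a..b} \<longrightarrow> f0 x = 0)
     \<and> (\<forall>x\<in>{a..b}. integral {a..x} f = (LINT y|lborel. f0 y * indicator {..x} y))"
    if f: "f absolutely_integrable_on {a..b}" for f :: "real \<Rightarrow> real"
  proof -
    have m: "(\<lambda>x. indicator {a..b} x *\<^sub>R f x) \<in> borel_measurable lebesgue"
      using f by (auto simp: set_integrable_def)
    then obtain f1 where f1: "f1 \<in> borel_measurable lborel" "AE x in lborel. indicator {a..b} x *\<^sub>R f x = f1 x"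
      using completion_ex_borel_measurable_real by blast
    define f0 where "f0 = (\<lambda>x. indicator {a..b} x * f1 x)"
    have f0m: "f0 \<in> borel_measurable lborel" unfolding f0_def using f1(1) by simp
    have ae: "AE x in lebesgue. indicator {a..b} x *\<^sub>R f x = f0 x"
      using AE_completion[OF f1(2)]
    proof eventually_elim
      case (elim x) then show ?case by (cases "x \<in> {a..b}") (auto simp: f0_def)
    qed
    have "integrable lebesgue f0"
      using f integrable_cong_AE[OF m _ ae] f0m by (simp add: set_integrable_def measurable_completion)
    then have i0: "integrable lborel f0" using f0m by (simp add: integrable_completion)
    have "integral {a..x} f = (LINT y|lborel. f0 y * indicator {..x} y)" if "x \<in> {a..b}" for x
    proof -
      have "integral {a..x} f = (LINT y:{a..x}|lebesgue. f y)"
        using that by (intro set_lebesgue_integral_eq_integral(2)[symmetric] set_integrable_subset[OF f]) auto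
      also have "\<dots> = (LINT y:{a..x}|lebesgue. f0 y)"
        by (rule LINT_cong_AE) (use ae that in \<open>auto elim!: eventually_mono simp: indicator_def split: if_splits\<close>)
      also have "\<dots> = (LINT y|lebesgue. f0 y * indicator {..x} y)"
        unfolding set_lebesgue_integral_def
        by (rule Bochner_Integration.integral_cong) (auto simp: f0_def indicator_def)
      also have "\<dots> = (LINT y|lborel. f0 y * indicator {..x} y)"
        using f0m by (intro integral_completion) auto
      finally show ?thesis .
    qed
    moreover have "AE x in lebesgue. x \<in> {a..b} \<longrightarrow> f x = f0 x"
      using ae by eventually_elim auto
    ultimately show ?thesis using i0 by (intro exI[of _ f0]) (auto simp: f0_def)
  qed
  obtain f0 where f0: "integrable lborel f0" "AE x in lebesgue. x \<in> {a..b} \<longrightarrow> f x = f0 x" "\<And>x. x \<notin> {a..b} \<Longrightarrow> f0 x = 0"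
     "\<And>x. x\<in>{a..b} \<Longrightarrow> integral {a..x} f = (LINT y|lborel. f0 y * indicator {..x} y)" using rep[OF f] by blast
  obtain q0 where q0: "integrable lborel q0" "AE x in lebesgue. x \<in> {a..b} \<longrightarrow> q x = q0 x" "\<And>x. x \<notin> {a..b} \<Longrightarrow> q0 x = 0"
     "\<And>x. x\<in>{a..b} \<Longrightarrow> integral {a..x} q = (LINT y|lborel. q0 y * indicator {..x} y)" using rep[OF q] by blast
  have [measurable]: "f0 \<in> borel_measurable borel" "q0 \<in> borel_measurable borel" using f0(1) q0(1) by auto
  \<comment> \<open>Stated for a general pair because it is used twice, with the roles of f and q
    exchanged.\<close>
  have conv: "(LINT x:{a..b}|lebesgue. f x * integral {a..x} q) = (LINT x|lborel. LINT y|lborel. f0 x * q0 y * indicator {..x} y)"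
    if f0: "AE x in lebesgue. x \<in> {a..b} \<longrightarrow> f x = f0 x" "\<And>x. x \<notin> {a..b} \<Longrightarrow> f0 x = 0" "integrable lborel f0"
     and q0: "\<And>x. x\<in>{a..b} \<Longrightarrow> integral {a..x} q = (LINT y|lborel. q0 y * indicator {..x} y)" "integrable lborel q0"
    for f q f0 q0 :: "real \<Rightarrow> real"
  proof -
    have [measurable]: "f0 \<in> borel_measurable borel" "q0 \<in> borel_measurable borel" using f0(3) q0(2) by auto
    have "(LINT x:{a..b}|lebesgue. f x * integral {a..x} q) = (LINT x:{a..b}|lebesgue. f0 x * (LINT y|lborel. q0 y * indicator {..x} y))"
      by (rule LINT_cong_AE) (use f0(1) q0 in \<open>auto elim!: eventually_mono\<close>)
    also have "\<dots> = (LINT x|lebesgue. f0 x * (LINT y|lborel. q0 y * indicator {..x} y))"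
      unfolding set_lebesgue_integral_def
      by (intro Bochner_Integration.integral_cong refl) (simp add: f0(2) split: split_indicator)
    also have "\<dots> = (LINT x|lborel. f0 x * (LINT y|lborel. q0 y * indicator {y. y \<le> x} y))"
      unfolding atMost_def by (intro integral_completion) measurable
    also have "\<dots> = (LINT x|lborel. LINT y|lborel. f0 x * q0 y * indicator {..x} y)"
      by (simp add: mult.assoc atMost_def)
    finally show ?thesis .
  qed
  let ?F = "\<lambda>(x, y). f0 x * q0 y" 
  have iF: "integrable (lborel \<Otimes>\<^sub>M lborel) ?F"
  proof (rule lborel_pair.Fubini_integrable)
    show "?F \<in> borel_measurable (lborel \<Otimes>\<^sub>M lborel)" by measurable
    show "integrable lborel (\<lambda>x. LINT y|lborel. norm (?F (x, y)))"
      using f0(1) by (simp add: abs_mult)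
    show "AE x in lborel. integrable lborel (\<lambda>y. ?F (x, y))" using q0(1) by simp
  qed
  have D: "{p \<in> space (lborel \<Otimes>\<^sub>M lborel). fst p \<le> (snd p :: real)} \<in> sets (lborel \<Otimes>\<^sub>M lborel)"
    "{p \<in> space (lborel \<Otimes>\<^sub>M lborel). snd p \<le> (fst p :: real)} \<in> sets (lborel \<Otimes>\<^sub>M lborel)" by measurable
  have i1: "integrable (lborel \<Otimes>\<^sub>M lborel) (\<lambda>(x, y). f0 x * q0 y * indicator {x..} y)"
    by (rule Bochner_Integration.integrable_cong[THEN iffD1, OF refl _ integrable_real_mult_indicator[OF D(1) iF]])
       (auto simp: indicator_def space_pair_measure)
  have i2: "integrable (lborel \<Otimes>\<^sub>M lborel) (\<lambda>(x, y). f0 x * q0 y * indicator {..x} y)"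
    by (rule Bochner_Integration.integrable_cong[THEN iffD1, OF refl _ integrable_real_mult_indicator[OF D(2) iF]])
       (auto simp: indicator_def space_pair_measure)
  have "(LINT x:{a..b}|lebesgue. q x * integral {a..x} f) = (LINT y|lborel. LINT x|lborel. q0 y * f0 x * indicator {..y} x)"
    by (rule conv) (use f0 q0 in auto)
  also have "\<dots> = (LINT y|lborel. LINT x|lborel. f0 x * q0 y * indicator {x..} y)"
    by (simp add: mult.commute[of "q0 _"] indicator_def)
  also have "\<dots> = (LINT x|lborel. LINT y|lborel. f0 x * q0 y * indicator {x..} y)"
    using lborel_pair.Fubini_integral[of "\<lambda>x y. f0 x * q0 y * indicator {x..} y"] i1 by simp
  finally have 2: "(LINT x:{a..b}|lebesgue. q x * integral {a..x} f) = (LINT x|lborel. LINT y|lborel. f0 x * q0 y * indicator {x..} y)" .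
  have 1: "(LINT x:{a..b}|lebesgue. f x * integral {a..x} q) = (LINT x|lborel. LINT y|lborel. f0 x * q0 y * indicator {..x} y)"
    by (rule conv) (use f0 q0 in auto)
  have I1: "integrable lborel (\<lambda>x. LINT y|lborel. f0 x * q0 y * indicator {..x} y)" using lborel_pair.integrable_fst'[OF i2] by simp
  have I2: "integrable lborel (\<lambda>x. LINT y|lborel. f0 x * q0 y * indicator {x..} y)" using lborel_pair.integrable_fst'[OF i1] by simp
  have "(LINT y|lborel. f0 x * q0 y * indicator {..x} y) + (LINT y|lborel. f0 x * q0 y * indicator {x..} y) = f0 x * (LINT y|lborel. q0 y)" for x
  proof -
    have j: "integrable lborel (\<lambda>y. f0 x * q0 y * indicator {..x} y)" "integrable lborel (\<lambda>y. f0 x * q0 y * indicator {x..} y)"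
      using q0(1) by (auto intro!: integrable_real_mult_indicator)
    have "(LINT y|lborel. f0 x * q0 y * indicator {..x} y) + (LINT y|lborel. f0 x * q0 y * indicator {x..} y) 
       = (LINT y|lborel. f0 x * q0 y * indicator {..x} y + f0 x * q0 y * indicator {x..} y)"
      using j by simp
    also have "\<dots> = (LINT y|lborel. f0 x * q0 y)"
    proof (rule integral_cong_AE)
      \<comment> \<open>The point y = x is counted twice, but it is a null set.\<close>
      show "AE y in lborel. f0 x * q0 y * indicator {..x} y + f0 x * q0 y * indicator {x..} y = f0 x * q0 y"
        using AE_lborel_singleton[of x] by eventually_elim (auto simp: indicator_def)
    qed auto
    finally show ?thesis by simp
  qed
  then have "(LINT x:{a..b}|lebesgue. f x * integral {a..x} q) + (LINT x:{a..b}|lebesgue. q x * integral {a..x} f)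
     = (LINT x|lborel. f0 x) * (LINT y|lborel. q0 y)"
    unfolding 1 2 Bochner_Integration.integral_add[OF I1 I2, symmetric] by simp
  moreover have "integral {a..b} f = (LINT x|lborel. f0 x)" "integral {a..b} q = (LINT x|lborel. q0 x)"
  proof -
    have c: "integral {a..b} f = (LINT x|lborel. f0 x)" if
      "\<And>x. x \<notin> {a..b} \<Longrightarrow> f0 x = 0" 
      "\<And>x. x\<in>{a..b} \<Longrightarrow> integral {a..x} f = (LINT y|lborel. f0 y * indicator {..x} y)" for f f0 :: "real \<Rightarrow> real"
    proof (cases "a \<le> b")
      case True
      have "(\<lambda>y. f0 y * indicator {..b} y) = f0" using that(1) by (auto simp: fun_eq_iff indicator_def)
      then show ?thesis using that(2)[of b] True by simp
    next
      case False
      then have "f0 = (\<lambda>x. 0)" using that(1) by auto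
      then show ?thesis using False by simp
    qed
    show "integral {a..b} f = (LINT x|lborel. f0 x)" "integral {a..b} q = (LINT x|lborel. q0 x)"
      using c[of f0 f] c[of q0 q] f0(3,4) q0(3,4) by auto
  qed
  ultimately show ?thesis by simp
qed

section \<open>Uniqueness of absolutely continuous parts\<close>

lemma LINT_bump_tendsto_measure:
  assumes m: "radon_on {a<..<b} m" and "a < p" "q < b"
  shows "(\<lambda>n. LINT x:{a<..<b}|m. bump n p q x) \<longlonglongrightarrow> measure m {p<..<q}"
proof -
  have sm[simp]: "sets m = sets borel" using m by (simp add: radon_on_def)
  have sp[simp]: "space m = UNIV" using sets_eq_imp_space_eq[OF sm] by simp
  have fin: "emeasure m {p..q} < \<infinity>" using m assms by (auto simp: radon_on_def subset_eq)
  have "bump n p q \<in> borel_measurable borel" for n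
    by (rule borel_measurable_continuous_onI) (rule test_function_continuous[OF test_function_bump[of p q UNIV]], simp)
  then have [measurable]: "bump n p q \<in> borel_measurable m" for n
    by (simp cong: measurable_cong_sets)
  have "(\<lambda>n. LINT x|m. bump n p q x) \<longlonglongrightarrow> (LINT x|m. indicator {p<..<q} x)"
  proof (rule integral_dominated_convergence[where w = "indicator {p..q}"])
    show "integrable m (indicat_real {p..q})" using fin by (simp add: integrable_indicator_iff)
    show "AE x in m. (\<lambda>n. bump n p q x) \<longlonglongrightarrow> indicator {p<..<q} x" by (simp add: bump_tendsto)
    show "AE x in m. norm (bump n p q x) \<le> indicator {p..q} x" for n
      using bump_bounds[of n p q] bump_zero[of _ p q n] by (intro AE_I2) (auto simp: indicator_def)
    show "(indicator {p<..<q} :: real \<Rightarrow> real) \<in> borel_measurable m" by (rule borel_measurable_indicator) simp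
  qed auto
  moreover have "(LINT x:{a<..<b}|m. bump n p q x) = (LINT x|m. bump n p q x)" for n
    unfolding set_lebesgue_integral_def
  proof (rule Bochner_Integration.integral_cong[OF refl])
    show "indicator {a<..<b} x *\<^sub>R bump n p q x = bump n p q x" for x
      using assms bump_zero[of x p q n] by (cases "x \<in> {p<..<q}") auto
  qed
  ultimately show ?thesis by simp
qed

lemma density_zero_of_singular:
  fixes M :: "'i \<Rightarrow> real measure"
  assumes g: "loc_integrable {a<..<b} g" and I: "finite I"
    and M: "\<And>i. i \<in> I \<Longrightarrow> radon_on {a<..<b} (M i)"
    and N: "N \<in> sets borel" "emeasure lborel N = 0"
    and sing: "\<And>i. i \<in> I \<Longrightarrow> emeasure (M i) ({a<..<b} - N) = 0"
    and eq: "\<And>\<phi>. test_function {a<..<b} \<phi> \<Longrightarrow>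
      (LINT x:{a<..<b}|lebesgue. g x * \<phi> x) = (\<Sum>i\<in>I. \<sigma> i * (LINT x:{a<..<b}|M i. \<phi> x))"
  shows "AE x in lebesgue. x \<in> {a<..<b} \<longrightarrow> g x = 0"
proof (rule AE_open_interval_exhaust)
  have s[simp]: "sets (M i) = sets borel" if "i \<in> I" for i using M[OF that] by (simp add: radon_on_def)
  have int: "(LINT x:{p<..<q}|lebesgue. g x) = (\<Sum>i\<in>I. \<sigma> i * measure (M i) {p<..<q})"
    if "a < p" "q < b" for p q
  proof -
    have "(\<lambda>n. LINT x:{a<..<b}|lebesgue. g x * bump n p q x) \<longlonglongrightarrow> (LINT x:{p<..<q}|lebesgue. g x)"
      using LINT_bump_tendsto[OF g that] .
    moreover have "(\<lambda>n. \<Sum>i\<in>I. \<sigma> i * (LINT x:{a<..<b}|M i. bump n p q x)) \<longlonglongrightarrow> (\<Sum>i\<in>I. \<sigma> i * measure (M i) {p<..<q})"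
      by (intro tendsto_intros LINT_bump_tendsto_measure M that)
    moreover have "test_function {a<..<b} (bump n p q)" for n
      by (rule test_function_bump) (use that in auto)
    ultimately show ?thesis using eq LIMSEQ_unique by simp
  qed
  fix c d assume cd: "a < c" "c < d" "d < b"
  have gi: "g absolutely_integrable_on {c..d}" using loc_integrable_Icc g cd by blast
  have gB: "g absolutely_integrable_on B \<inter> {c<..<d}" if "B \<in> sets borel" for B
    by (rule set_integrable_subset[OF gi]) (use that in auto)
  have fin: "emeasure (M i) (B \<inter> {c<..<d}) \<noteq> \<infinity>" if "i \<in> I" "B \<in> sets borel" for i B
  proof -
    have "emeasure (M i) (B \<inter> {c<..<d}) \<le> emeasure (M i) {c..d}" using that by (intro emeasure_mono) auto
    also have "\<dots> < \<infinity>" using M[OF that(1)] cd by (auto simp: radon_on_def subset_eq)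
    finally show ?thesis by auto
  qed
  \<comment> \<open>Everything is cut down to (c,d), whose closure is compact in the domain: the
    complement and union cases need finite measures.\<close>
  have P: "(LINT x:B \<inter> {c<..<d}|lebesgue. g x) = (\<Sum>i\<in>I. \<sigma> i * measure (M i) (B \<inter> {c<..<d}))"
    if B: "B \<in> sets borel" for B
  proof -
    have bs: "sets (borel :: real measure) = sigma_sets UNIV (range (\<lambda>(a, b). {a<..<b::real}))"
      by (simp add: borel_eq_box)
    have stable: "Int_stable (range (\<lambda>(a, b). {a<..<b::real}))"
      by (auto simp: Int_stable_def image_iff)
    have sub: "range (\<lambda>(a, b). {a<..<b::real}) \<subseteq> Pow UNIV" by simp
    have "B \<in> sigma_sets UNIV (range (\<lambda>(a, b). {a<..<b::real}))" using B bs by simp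
    from stable sub this show ?thesis
    proof (induction B rule: sigma_sets_induct_disjoint)
      case (basic A)
      then obtain p q where "A = {p<..<q}" by auto
      then have "A \<inter> {c<..<d} = {max p c<..<min q d}" by auto
      then show ?case using int[of "max p c" "min q d"] cd by (simp add: less_max_iff_disj min_less_iff_disj)
    next
      case empty show ?case by (simp add: set_lebesgue_integral_def)
    next
      case (compl A)
      then have A: "A \<in> sets borel" using bs by simp
      have u: "(LINT x:{c<..<d}|lebesgue. g x) = (LINT x:A \<inter> {c<..<d}|lebesgue. g x) + (LINT x:(UNIV - A) \<inter> {c<..<d}|lebesgue. g x)"
      proof -
        have "{c<..<d} = (A \<inter> {c<..<d}) \<union> ((UNIV - A) \<inter> {c<..<d})" by auto
        moreover have "(LINT x:(A \<inter> {c<..<d}) \<union> ((UNIV - A) \<inter> {c<..<d})|lebesgue. g x) =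
            (LINT x:A \<inter> {c<..<d}|lebesgue. g x) + (LINT x:(UNIV - A) \<inter> {c<..<d}|lebesgue. g x)"
          by (rule set_integral_Un) (use gB[of A] gB[of "UNIV - A"] A in auto)
        ultimately show ?thesis by simp
      qed
      have v: "measure (M i) {c<..<d} = measure (M i) (A \<inter> {c<..<d}) + measure (M i) ((UNIV - A) \<inter> {c<..<d})" if "i \<in> I" for i
      proof -
        have "measure (M i) ((A \<inter> {c<..<d}) \<union> ((UNIV - A) \<inter> {c<..<d})) = measure (M i) (A \<inter> {c<..<d}) + measure (M i) ((UNIV - A) \<inter> {c<..<d})"
          using that A fin[OF that] by (intro measure_Union) auto
        moreover have "(A \<inter> {c<..<d}) \<union> ((UNIV - A) \<inter> {c<..<d}) = {c<..<d}" by auto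
        ultimately show ?thesis by simp
      qed
      have "(LINT x:(UNIV - A) \<inter> {c<..<d}|lebesgue. g x) = (\<Sum>i\<in>I. \<sigma> i * measure (M i) {c<..<d}) - (\<Sum>i\<in>I. \<sigma> i * measure (M i) (A \<inter> {c<..<d}))"
        using u compl.IH int[of c d] cd by simp
      also have "\<dots> = (\<Sum>i\<in>I. \<sigma> i * measure (M i) ((UNIV - A) \<inter> {c<..<d}))"
        unfolding sum_subtractf[symmetric] by (rule sum.cong) (auto simp: v algebra_simps)
      finally show ?case .
    next
      case (union A)
      have A: "A i \<in> sets borel" for i using union.hyps(2) bs by auto
      have eqU: "(\<Union>i. A i) \<inter> {c<..<d} = (\<Union>i. A i \<inter> {c<..<d})" by auto
      have disj: "disjoint_family (\<lambda>i. A i \<inter> {c<..<d})"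
        using union.hyps(1) unfolding disjoint_family_on_def by blast
      have gU: "g absolutely_integrable_on (\<Union>i. A i \<inter> {c<..<d})"
        unfolding eqU[symmetric] by (rule gB) (use A in blast)
      have "(LINT x:(\<Union>i. A i \<inter> {c<..<d})|lebesgue. g x) = (\<Sum>n. LINT x:A n \<inter> {c<..<d}|lebesgue. g x)"
      proof (rule lebesgue_integral_countable_add[OF _ _ gU])
        show "A i \<inter> {c<..<d} \<in> sets lebesgue" for i using A[of i] by auto
        show "A i \<inter> {c<..<d} \<inter> (A j \<inter> {c<..<d}) = {}" if "i \<noteq> j" for i j
          using disj that by (auto simp: disjoint_family_on_def)
      qed
      also have "\<dots> = (\<Sum>n. \<Sum>i\<in>I. \<sigma> i * measure (M i) (A n \<inter> {c<..<d}))" using union.IH by simp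
      also have "\<dots> = (\<Sum>i\<in>I. \<sigma> i * measure (M i) (\<Union>n. A n \<inter> {c<..<d}))"
      proof (intro sums_unique[symmetric] sums_sum sums_mult measure_UNION[OF _ disj])
        fix i assume "i \<in> I"
        then show "range (\<lambda>n. A n \<inter> {c<..<d}) \<subseteq> sets (M i)" using A by auto
        show "emeasure (M i) (\<Union>n. A n \<inter> {c<..<d}) \<noteq> \<infinity>"
          unfolding eqU[symmetric] by (rule fin[OF \<open>i \<in> I\<close>]) (use A in blast)
      qed
      finally show ?case unfolding eqU .
    qed
  qed
  show "AE x in lebesgue. x \<in> {c<..<d} \<longrightarrow> g x = 0"
  proof (rule integrals_zero_imp_AE_zero[OF gi])
    fix p q assume pq: "c < p" "p < q" "q < d"
    \<comment> \<open>Removing \<open>N\<close> annihilates the singular measures but,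
      \<open>N\<close> being a null set, leaves the Lebesgue integral unchanged.\<close>
    have sub: "({p<..<q} - N) \<inter> {c<..<d} = {p<..<q} - N" using pq by auto
    have z: "measure (M i) ({p<..<q} - N) = 0" if "i \<in> I" for i
    proof -
      have "emeasure (M i) ({p<..<q} - N) \<le> emeasure (M i) ({a<..<b} - N)"
        using pq cd N that by (intro emeasure_mono) auto
      then show ?thesis using sing[OF that] by (simp add: measure_def)
    qed
    have "(LINT x:{p<..<q} - N|lebesgue. g x) = 0"
      using P[of "{p<..<q} - N"] N(1) unfolding sub by (simp add: z)
    moreover have "(LINT x:{p<..<q} - N|lebesgue. g x) = (LINT x:{p<..<q}|lebesgue. g x)"
    proof -
      have ng: "g absolutely_integrable_on {p<..<q}" "g absolutely_integrable_on {p<..<q} - N"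
        by (rule set_integrable_subset[OF gi]; use pq N in auto)+
      have "integral ({p<..<q} - N) g = integral {p<..<q} g"
      proof (rule integral_spike_set)
        have nN: "negligible N" using N null_sets_completionI[of N lborel] by (simp add: negligible_iff_null_sets null_setsI)
        show "negligible {x \<in> {p<..<q} - N - {p<..<q}. g x \<noteq> 0}" "negligible {x \<in> {p<..<q} - ({p<..<q} - N). g x \<noteq> 0}"
          by (rule negligible_subset[OF nN]; auto)+
      qed
      then show ?thesis using ng by (simp add: set_lebesgue_integral_eq_integral(2))
    qed
    ultimately show "(LINT x:{p<..<q}|lebesgue. g x) = 0" by simp
  qed
qed

lemma loc_integrable_diff: "loc_integrable \<Omega> f \<Longrightarrow> loc_integrable \<Omega> g \<Longrightarrow> loc_integrable \<Omega> (\<lambda>x. f x - g x)"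
  unfolding loc_integrable_def by (auto intro: set_integral_diff)

lemma has_ac_deriv_unique:
  assumes "has_ac_deriv {a<..<b} f g" "has_ac_deriv {a<..<b} f h"
  shows "AE x in lebesgue. x \<in> {a<..<b} \<longrightarrow> g x = h x"
proof -
  let ?\<Omega> = "{a<..<b}"
  obtain m1 m2 N where 1: "N \<in> sets borel" "emeasure lborel N = 0" "emeasure m1 (?\<Omega> - N) = 0" "emeasure m2 (?\<Omega> - N) = 0"
    "distribution_is_measure ?\<Omega> (\<lambda>\<phi>. dist_deriv ?\<Omega> 1 f \<phi> - dist_deriv ?\<Omega> 0 g \<phi>) m1 m2"
    using assms(1) unfolding has_ac_deriv_def by blast
  obtain m3 m4 N' where 2: "N' \<in> sets borel" "emeasure lborel N' = 0" "emeasure m3 (?\<Omega> - N') = 0" "emeasure m4 (?\<Omega> - N') = 0"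
    "distribution_is_measure ?\<Omega> (\<lambda>\<phi>. dist_deriv ?\<Omega> 1 f \<phi> - dist_deriv ?\<Omega> 0 h \<phi>) m3 m4"
    using assms(2) unfolding has_ac_deriv_def by blast
  have l: "loc_integrable ?\<Omega> g" "loc_integrable ?\<Omega> h" using assms by (auto simp: has_ac_deriv_def)
  let ?M = "\<lambda>i::nat. [m1, m2, m3, m4] ! i"
  have all: "P (?M i)" if "i \<in> {..<4}" "P m1" "P m2" "P m3" "P m4" for P i
    using that by (auto simp: numeral_eq_Suc lessThan_Suc)
  have r: "radon_on ?\<Omega> m1" "radon_on ?\<Omega> m2" "radon_on ?\<Omega> m3" "radon_on ?\<Omega> m4"
    using 1(5) 2(5) by (auto simp: distribution_is_measure_def signed_radon_def)
  then have sets: "sets m1 = sets borel" "sets m2 = sets borel" "sets m3 = sets borel" "sets m4 = sets borel"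
    by (auto simp: radon_on_def)
  have "AE x in lebesgue. x \<in> ?\<Omega> \<longrightarrow> g x - h x = 0"
  \<comment> \<open>Subtracting the two decompositions leaves g - h = -m1 + m2 + m3 - m4 as
    distributions, hence the signs.\<close>
  proof (rule density_zero_of_singular[where I = "{..<4}" and M = ?M and N = "N \<union> N'" and \<sigma> = "\<lambda>i. [-1, 1, 1, -1] ! i"])
    show "loc_integrable ?\<Omega> (\<lambda>x. g x - h x)" using l by (rule loc_integrable_diff)
    show "radon_on ?\<Omega> (?M i)" if "i \<in> {..<4}" for i using all[OF that, of "radon_on ?\<Omega>"] r by blast
    show "emeasure lborel (N \<union> N') = 0" using 1 2 by (simp add: emeasure_Un_null_set null_sets_def)
    have z: "emeasure m (?\<Omega> - (N \<union> N')) = 0" if "emeasure m (?\<Omega> - N) = 0 \<or> emeasure m (?\<Omega> - N') = 0" "sets m = sets borel" for m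
    proof -
      have "emeasure m (?\<Omega> - (N \<union> N')) \<le> emeasure m (?\<Omega> - N)" "emeasure m (?\<Omega> - (N \<union> N')) \<le> emeasure m (?\<Omega> - N')"
        by (rule emeasure_mono, blast, unfold that(2), rule sets.Diff[OF _ 1(1)] sets.Diff[OF _ 2(1)], simp)+
      then show ?thesis using that(1) by (elim disjE) simp_all
    qed
    show "emeasure (?M i) (?\<Omega> - (N \<union> N')) = 0" if "i \<in> {..<4}" for i
      by (rule all[OF that, of "\<lambda>m. emeasure m (?\<Omega> - (N \<union> N')) = 0"]; rule z) (simp_all add: 1 2 sets)
    fix \<phi> assume \<phi>: "test_function ?\<Omega> \<phi>"
    have "dist_deriv ?\<Omega> 1 f \<phi> - (LINT x:?\<Omega>|lebesgue. g x * \<phi> x) = (LINT x:?\<Omega>|m1. \<phi> x) - (LINT x:?\<Omega>|m2. \<phi> x)"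
      using 1(5) \<phi> by (simp add: distribution_is_measure_def signed_set_integral_def dist_deriv_def)
    moreover have "dist_deriv ?\<Omega> 1 f \<phi> - (LINT x:?\<Omega>|lebesgue. h x * \<phi> x) = (LINT x:?\<Omega>|m3. \<phi> x) - (LINT x:?\<Omega>|m4. \<phi> x)"
      using 2(5) \<phi> by (simp add: distribution_is_measure_def signed_set_integral_def dist_deriv_def)
    ultimately have "(LINT x:?\<Omega>|lebesgue. g x * \<phi> x) - (LINT x:?\<Omega>|lebesgue. h x * \<phi> x) = 
       - (LINT x:?\<Omega>|m1. \<phi> x) + (LINT x:?\<Omega>|m2. \<phi> x) + (LINT x:?\<Omega>|m3. \<phi> x) - (LINT x:?\<Omega>|m4. \<phi> x)"
      by linarith
    then show "(LINT x:?\<Omega>|lebesgue. (g x - h x) * \<phi> x) = (\<Sum>i<4. [-1, 1, 1, -1] ! i * (LINT x:?\<Omega>|?M i. \<phi> x))"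
      using loc_integrable_mult_test[OF _ \<phi>] l by (simp add: left_diff_distrib set_integral_diff numeral_eq_Suc)
  qed (use 1 2 in auto)
  then show ?thesis by simp
qed

text \<open>This ties the choices behind \<open>dot\<close>, \<open>ddot\<close> and
  \<open>dddot\<close> to any absolutely continuous part that can be computed.\<close>

lemma ac_deriv_AE:
  assumes "has_ac_deriv {a<..<b} f g"
  shows "AE x in lebesgue. x \<in> {a<..<b} \<longrightarrow> ac_deriv {a<..<b} f x = g x"
proof -
  have "has_ac_deriv {a<..<b} f (ac_deriv {a<..<b} f)"
    unfolding ac_deriv_def using someI_ex[of "has_ac_deriv {a<..<b} f"] assms by blast
  then show ?thesis using assms by (rule has_ac_deriv_unique)
qed

section \<open>Square integrable functions\<close>

lemma L2_iff:
  assumes "\<Omega> \<in> sets lebesgue"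
  shows "L2 \<Omega> f \<longleftrightarrow> (\<lambda>x. indicator \<Omega> x * f x) \<in> borel_measurable lebesgue \<and> (\<lambda>x. (f x)\<^sup>2) absolutely_integrable_on \<Omega>"
  using assms unfolding L2_def set_integrable_def
  by (subst borel_measurable_restrict_space_iff, simp, subst integrable_restrict_space) (auto simp: mult.commute)

lemma L2_mult_integrable:
  assumes "\<Omega> \<in> sets lebesgue" "L2 \<Omega> f" "L2 \<Omega> g"
  shows "(\<lambda>x. f x * g x) absolutely_integrable_on \<Omega>"
proof -
  have f: "(\<lambda>x. indicator \<Omega> x * f x) \<in> borel_measurable lebesgue" "(\<lambda>x. (f x)\<^sup>2) absolutely_integrable_on \<Omega>"
    and g: "(\<lambda>x. indicator \<Omega> x * g x) \<in> borel_measurable lebesgue" "(\<lambda>x. (g x)\<^sup>2) absolutely_integrable_on \<Omega>"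
    using assms by (auto simp: L2_iff)
  have "integrable lebesgue (\<lambda>x. indicator \<Omega> x * (f x)\<^sup>2 + indicator \<Omega> x * (g x)\<^sup>2)"
    using f(2) g(2) by (simp add: set_integrable_def)
  then have "integrable lebesgue (\<lambda>x. (indicator \<Omega> x * f x) * (indicator \<Omega> x * g x))"
  proof (rule Bochner_Integration.integrable_bound)
    show "(\<lambda>x. (indicator \<Omega> x * f x) * (indicator \<Omega> x * g x)) \<in> borel_measurable lebesgue" using f g by simp
    have "\<bar>u * v\<bar> \<le> u\<^sup>2 + v\<^sup>2" for u v :: real
    proof -
      have "\<bar>u * v\<bar> \<le> (u\<^sup>2 + v\<^sup>2) / 2" using sum_squares_bound[of "\<bar>u\<bar>" "\<bar>v\<bar>"] by (simp add: abs_mult)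
      moreover have "(u\<^sup>2 + v\<^sup>2) / 2 \<le> u\<^sup>2 + v\<^sup>2" by simp
      ultimately show ?thesis by (rule order_trans)
    qed
    then show "AE x in lebesgue. norm ((indicator \<Omega> x * f x) * (indicator \<Omega> x * g x)) \<le> norm (indicator \<Omega> x * (f x)\<^sup>2 + indicator \<Omega> x * (g x)\<^sup>2)"
      by (intro AE_I2) (auto simp: indicator_def)
  qed
  moreover have "(indicator \<Omega> x * f x) * (indicator \<Omega> x * g x) = indicator \<Omega> x *\<^sub>R (f x * g x)" for x
    by (simp add: indicator_def)
  ultimately show ?thesis by (simp add: set_integrable_def)
qed

lemma L2_add:
  assumes "\<Omega> \<in> sets lebesgue" "L2 \<Omega> f" "L2 \<Omega> g"
  shows "L2 \<Omega> (\<lambda>x. f x + g x)"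
proof -
  have "(\<lambda>x. f x * f x + 2 * (f x * g x) + g x * g x) absolutely_integrable_on \<Omega>"
    using assms by (intro set_integral_add set_integrable_mult_right L2_mult_integrable) auto
  then show ?thesis using assms by (auto simp: L2_iff distrib_left power2_eq_square algebra_simps)
qed

lemma L2_cmult:
  assumes "\<Omega> \<in> sets lebesgue" "L2 \<Omega> f"
  shows "L2 \<Omega> (\<lambda>x. k * f x)"
proof -
  have "(\<lambda>x. indicator \<Omega> x * (k * f x)) = (\<lambda>x. k * (indicator \<Omega> x * f x))" by (auto simp: fun_eq_iff)
  then show ?thesis using assms set_integrable_mult_right[of "k\<^sup>2" lebesgue \<Omega> "\<lambda>x. (f x)\<^sup>2"] 
    by (auto simp: L2_iff power_mult_distrib)
qed

lemma L2_bounded: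
  assumes "\<Omega> \<in> sets lebesgue" "bounded \<Omega>" "f \<in> borel_measurable borel" "\<And>x. x \<in> \<Omega> \<Longrightarrow> \<bar>f x\<bar> \<le> B"
  shows "L2 \<Omega> f"
proof -
  have "(\<lambda>x. (f x)\<^sup>2) absolutely_integrable_on \<Omega>"
  proof (rule absolutely_integrable_bounded)
    show "\<bar>(f x)\<^sup>2\<bar> \<le> B\<^sup>2" if "x \<in> \<Omega>" for x using assms(4)[OF that] abs_le_square_iff[of "f x" B] by auto
  qed (use assms in auto)
  moreover have "f \<in> borel_measurable lebesgue" using assms(3) by (auto intro: measurable_completion)
  ultimately show ?thesis using assms by (auto simp: L2_iff)
qed

lemma L2_integrable:
  assumes "\<Omega> \<in> sets lebesgue" "bounded \<Omega>" "L2 \<Omega> f"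
  shows "f absolutely_integrable_on \<Omega>"
  using L2_mult_integrable[OF assms(1,3) L2_bounded[OF assms(1,2), of "\<lambda>_. 1" 1]] by simp

lemma L2_subset:
  assumes "\<Omega> \<in> sets lebesgue" "\<Omega>' \<in> sets lebesgue" "\<Omega>' \<subseteq> \<Omega>" "L2 \<Omega> f"
  shows "L2 \<Omega>' f"
proof -
  have "(\<lambda>x. indicator \<Omega>' x * f x) = (\<lambda>x. indicator \<Omega>' x * (indicator \<Omega> x * f x))"
    using assms(3) by (auto simp: fun_eq_iff indicator_def)
  moreover have "(\<lambda>x. (f x)\<^sup>2) absolutely_integrable_on \<Omega>'"
    using assms by (auto simp: L2_iff intro: set_integrable_subset)
  moreover have "(\<lambda>x. indicator \<Omega>' x * (indicator \<Omega> x * f x)) \<in> borel_measurable lebesgue"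
    using assms by (auto simp: L2_iff)
  ultimately show ?thesis using assms by (simp add: L2_iff)
qed

lemma L2_cong_AE:
  assumes "\<Omega> \<in> sets lebesgue" "L2 \<Omega> f" "AE x in lebesgue. x \<in> \<Omega> \<longrightarrow> f x = g x"
  shows "L2 \<Omega> g"
proof -
  have "(\<lambda>x. indicator \<Omega> x * g x) \<in> borel_measurable lebesgue"
  proof (rule borel_measurable_AE)
    show "(\<lambda>x. indicator \<Omega> x * f x) \<in> borel_measurable lebesgue" using assms by (simp add: L2_iff)
    show "AE x in lebesgue. indicator \<Omega> x * f x = indicator \<Omega> x * g x"
      using assms(3) by eventually_elim (auto simp: indicator_def)
  qed
  moreover have "(\<lambda>x. (g x)\<^sup>2) absolutely_integrable_on \<Omega>"
  proof (subst absolutely_integrable_cong_AE)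
    show "AE x in lebesgue. x \<in> \<Omega> \<longrightarrow> (g x)\<^sup>2 = (f x)\<^sup>2"
      using assms(3) by eventually_elim auto
    show "(\<lambda>x. (f x)\<^sup>2) absolutely_integrable_on \<Omega>" using assms by (simp add: L2_iff)
  qed
  ultimately show ?thesis using assms by (simp add: L2_iff)
qed

section \<open>Primitives and jump functions\<close>

text \<open>
  The truncation at \<open>2\<close> makes the primitive continuous and bounded on the whole line, whatever
  \<open>f\<close> is outside \<open>[-2,2]\<close>.
\<close>

definition prim :: "(real \<Rightarrow> real) \<Rightarrow> real \<Rightarrow> real" where
  "prim f x = integral {-2..min x 2} f"

text \<open>Left-continuous normalisation: the jump at s counts only strictly to the right of s, so
  the value at s is the left limit and adding \<open>c s\<close> gives the right limit.\<close>

definition jumps :: "(real \<Rightarrow> real) \<Rightarrow> real \<Rightarrow> real" where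
  "jumps c x = (\<Sum>s | c s \<noteq> 0. c s * indicator {s<..} x)"

abbreviation (input) integrable_22 :: "(real \<Rightarrow> real) \<Rightarrow> bool" where
  "integrable_22 f \<equiv> f absolutely_integrable_on {-2..2}"

lemma integrable_22_imp: "integrable_22 f \<Longrightarrow> f integrable_on {-2..2}"
  by (rule set_lebesgue_integral_eq_integral(1))

lemma integrable_22_sub: "integrable_22 f \<Longrightarrow> -2 \<le> a \<Longrightarrow> b \<le> 2 \<Longrightarrow> f integrable_on {a..b}"
  by (rule integrable_subinterval_real[OF integrable_22_imp]) auto

lemma prim_continuous:
  assumes "integrable_22 f" shows "continuous_on UNIV (prim f)"
proof -
  have c: "continuous_on {-2..2} (\<lambda>x. integral {-2..x} f)"
    by (rule indefinite_integral_continuous_1[OF integrable_22_imp[OF assms]])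
  \<comment> \<open>Left of -2 the interval is empty and the integral 0, so clamping from below
    changes nothing and exhibits a composition of continuous functions.\<close>
  have eq: "prim f = (\<lambda>x. integral {-2..max (-2) (min x 2)} f)"
    by (auto simp: prim_def fun_eq_iff max_def)
  have "continuous_on UNIV (\<lambda>x. integral {-2..max (-2) (min x 2)} f)"
    by (rule continuous_on_compose2[OF c]) (auto intro!: continuous_intros)
  then show ?thesis unfolding eq .
qed

lemma prim_isCont: "integrable_22 f \<Longrightarrow> isCont (prim f) x"
  using prim_continuous continuous_on_eq_continuous_at[of UNIV "prim f"] by auto

lemma prim_measurable: "integrable_22 f \<Longrightarrow> prim f \<in> borel_measurable borel"
  by (rule borel_measurable_continuous_onI[OF prim_continuous])

lemma prim_le: "x \<le> -2 \<Longrightarrow> prim f x = 0"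
  by (cases "x = -2") (auto simp: prim_def)

lemma prim_ge: "x \<ge> 2 \<Longrightarrow> prim f x = prim f 2"
  by (simp add: prim_def min_def)

lemma prim_diff:
  assumes "integrable_22 f" "-2 \<le> x" "x \<le> y" "y \<le> 2"
  shows "prim f y - prim f x = integral {x..y} f"
  using Henstock_Kurzweil_Integration.integral_combine[of "-2" x y f] integrable_22_sub[OF assms(1), of "-2" y] assms
  by (simp add: prim_def)

lemma prim_bounded:
  assumes "integrable_22 f" obtains B where "\<And>x. \<bar>prim f x\<bar> \<le> B"
proof -
  have "compact (prim f ` {-2..2})"
    by (intro compact_continuous_image continuous_on_subset[OF prim_continuous[OF assms]]) auto
  then obtain B where B: "\<And>y. y \<in> prim f ` {-2..2} \<Longrightarrow> \<bar>y\<bar> \<le> B"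
    by (metis bounded_iff compact_imp_bounded real_norm_def)
  have "\<bar>prim f x\<bar> \<le> max 0 B" for x
  proof -
    consider "x \<le> -2" | "-2 \<le> x \<and> x \<le> 2" | "x \<ge> 2" by linarith
    then show ?thesis using B[of "prim f x"] B[of "prim f 2"] prim_le[of x f] prim_ge[of x f] by cases auto
  qed
  then show ?thesis using that by blast
qed

lemma integrable_22_bounded:
  "g \<in> borel_measurable borel \<Longrightarrow> (\<And>x. \<bar>g x\<bar> \<le> B) \<Longrightarrow> integrable_22 g"
  by (rule absolutely_integrable_bounded) auto

lemma integrable_22_continuous:
  "continuous_on {-2..2} g \<Longrightarrow> integrable_22 g"
  by (rule absolutely_integrable_continuous_real)

lemma integrable_22_prim: "integrable_22 f \<Longrightarrow> integrable_22 (prim f)"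
  by (metis prim_bounded prim_measurable integrable_22_bounded)

lemma integrable_22_add: "integrable_22 f \<Longrightarrow> integrable_22 g \<Longrightarrow> integrable_22 (\<lambda>x. f x + g x)"
  by (rule set_integral_add(1))

lemma integrable_22_diff: "integrable_22 f \<Longrightarrow> integrable_22 g \<Longrightarrow> integrable_22 (\<lambda>x. f x - g x)"
  by (rule set_integral_diff(1))

lemma integrable_22_cmult: "integrable_22 f \<Longrightarrow> integrable_22 (\<lambda>x. k * f x)"
  by (rule set_integrable_mult_right) simp

lemma prim_add:
  assumes "integrable_22 f" "integrable_22 g"
  shows "prim (\<lambda>x. f x + g x) x = prim f x + prim g x"
  unfolding prim_def by (intro Henstock_Kurzweil_Integration.integral_add integrable_22_sub assms) auto

lemma prim_diff_fun:
  assumes "integrable_22 f" "integrable_22 g"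
  shows "prim (\<lambda>x. f x - g x) x = prim f x - prim g x"
  unfolding prim_def by (intro Henstock_Kurzweil_Integration.integral_diff integrable_22_sub assms) auto

lemma prim_cmult: "prim (\<lambda>x. k * f x) x = k * prim f x"
  unfolding prim_def by simp

text \<open>The end points join the exceptional set, so that statements on the open interval can be
  used under integrals over the closed one.\<close>

lemma AE_22_negligible:
  fixes P :: "real \<Rightarrow> bool"
  assumes "AE x in lebesgue. x \<in> {-2<..<2} \<longrightarrow> P x"
  obtains N where "negligible N" "-2 \<in> N" "2 \<in> N" "\<And>x. x \<in> {-2..2} \<Longrightarrow> x \<notin> N \<Longrightarrow> P x"
proof -
  obtain N where N: "N \<in> null_sets lebesgue" "{x \<in> space lebesgue. \<not> (x \<in> {-2<..<2} \<longrightarrow> P x)} \<subseteq> N"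
    using assms unfolding eventually_ae_filter by blast
  have "negligible (N \<union> {-2, 2})" using N(1) by (simp add: negligible_iff_null_sets[symmetric])
  moreover have "P x" if "x \<in> {-2..2}" "x \<notin> N \<union> {-2, 2}" for x
    using N(2) that by (auto simp: subset_iff less_le)
  ultimately show ?thesis using that by blast
qed

lemma prim_cong_AE:
  assumes "AE x in lebesgue. x \<in> {-2<..<2} \<longrightarrow> f x = g x"
  shows "prim f = prim g"
proof
  fix x
  obtain N where N: "negligible N" "\<And>x. x \<in> {-2..2} \<Longrightarrow> x \<notin> N \<Longrightarrow> f x = g x"
    using AE_22_negligible[OF assms] by metis
  show "prim f x = prim g x" unfolding prim_def
    by (rule integral_spike[OF N(1)]) (use N(2) in auto)
qed

lemma integrable_22_cong_AE:
  assumes "AE x in lebesgue. x \<in> {-2<..<2} \<longrightarrow> f x = g x" "integrable_22 f"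
  shows "integrable_22 g"
proof -
  obtain N where N: "negligible N" "\<And>x. x \<in> {-2..2} \<Longrightarrow> x \<notin> N \<Longrightarrow> f x = g x"
    using AE_22_negligible[OF assms(1)] by metis
  show ?thesis by (rule absolutely_integrable_spike[OF assms(2) N(1)]) (use N(2) in auto)
qed

lemma prim_DERIV:
  assumes "integrable_22 f" "isCont f x" "-2 < x" "x < 2"
  shows "(prim f has_real_derivative f x) (at x)"
proof -
  have "((\<lambda>u. integral {-2..u} f) has_vector_derivative f x) (at x within {-2..2})"
  proof -
    have "continuous (at x within {-2..2}) f" using assms(2) by (rule continuous_at_imp_continuous_within)
    moreover have "x \<in> {-2..2}" using assms by simp
    ultimately show ?thesis
      using integral_has_vector_derivative_continuous_at[OF integrable_22_imp[OF assms(1)], of x "{}"]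
      by (simp only: Diff_empty finite.emptyI)
  qed
  moreover have "at x within {-2..2} = at x" by (rule at_within_interior) (use assms in simp)
  ultimately have "((\<lambda>u. integral {-2..u} f) has_real_derivative f x) (at x)"
    unfolding has_real_derivative_iff_has_vector_derivative by (simp only:)
  then show ?thesis
  proof (rule has_field_derivative_transform_within_open[of _ _ _ "{-2<..<2}"])
    show "integral {-2..y} f = prim f y" if "y \<in> {-2<..<2}" for y
      using that by (simp add: prim_def min_def)
  qed (use assms in auto)
qed

lemma prim_FTC:
  assumes "\<And>x. (\<phi> has_real_derivative \<phi>' x) (at x)" "-2 \<le> x" "x \<le> 2"
  shows "prim \<phi>' x = \<phi> x - \<phi> (-2)"
proof -
  have "(\<phi>' has_integral \<phi> x - \<phi> (-2)) {-2..x}"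
    by (rule fundamental_theorem_of_calculus)
       (use assms in \<open>auto simp: has_real_derivative_iff_has_vector_derivative[symmetric] intro: has_field_derivative_at_within\<close>)
  then show ?thesis using assms by (simp add: prim_def integral_unique)
qed

lemma prim_by_parts:
  assumes "integrable_22 f" "integrable_22 q"
  shows "(LINT x:{-2..2}|lebesgue. f x * prim q x) + (LINT x:{-2..2}|lebesgue. q x * prim f x) = prim f 2 * prim q 2"
proof -
  have "(LINT x:{-2..2}|lebesgue. g x * prim h x) = (LINT x:{-2..2}|lebesgue. g x * integral {-2..x} h)" for g h
    by (rule set_lebesgue_integral_cong) (auto simp: prim_def)
  then show ?thesis using integral_by_parts_Lebesgue[OF assms] by (simp add: prim_def)
qed

lemma LINT_extend:
  fixes g :: "real \<Rightarrow> real"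
  assumes "A \<subseteq> B" "\<And>x. x \<in> B \<Longrightarrow> x \<notin> A \<Longrightarrow> g x = 0"
  shows "(LINT x:A|M. g x) = (LINT x:B|M. g x)"
  unfolding set_lebesgue_integral_def
  by (rule Bochner_Integration.integral_cong) (use assms in \<open>auto simp: indicator_def\<close>)

lemma test_function_endpoints:
  assumes "test_function \<Omega> \<phi>" "\<Omega> \<subseteq> {-2<..<2}" shows "\<phi> (-2) = 0" "\<phi> 2 = 0"
proof -
  have "-2 \<notin> \<Omega>" "2 \<notin> \<Omega>" using assms(2) by auto
  then show "\<phi> (-2) = 0" "\<phi> 2 = 0" using test_function_zero[OF assms(1)] by blast+
qed

lemma test_function_prim:
  assumes "test_function \<Omega> \<phi>" "\<Omega> \<subseteq> {-2<..<2}"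
  shows "prim (deriv \<phi>) x = (if x \<in> {-2..2} then \<phi> x else 0)"
proof -
  have "prim (deriv \<phi>) x = \<phi> x" if "x \<in> {-2..2}" for x
    using prim_FTC[of \<phi> "deriv \<phi>" x] test_function_DERIV[OF assms(1)] test_function_endpoints[OF assms] that by simp
  from this[of x] this[of 2] show ?thesis
    using prim_le[of x "deriv \<phi>"] prim_ge[of x "deriv \<phi>"] test_function_endpoints[OF assms] by auto
qed

lemma LINT_test_extend:
  assumes "test_function \<Omega> \<phi>" "\<Omega> \<subseteq> {-2<..<2}"
  shows "(LINT x:\<Omega>|lebesgue. f x * \<phi> x) = (LINT x:{-2..2}|lebesgue. f x * \<phi> x)"
  by (rule LINT_extend) (use assms test_function_zero[OF assms(1)] in \<open>auto simp: subset_iff less_le\<close>)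

lemma test_function_integrable_22:
  assumes "test_function \<Omega> \<phi>" shows "integrable_22 \<phi>"
  by (rule integrable_22_continuous[OF test_function_continuous[OF assms]])

lemma integrable_22_mult_test:
  assumes "integrable_22 f" "test_function \<Omega> \<phi>"
  shows "integrable_22 (\<lambda>x. f x * \<phi> x)"
proof -
  obtain B where "\<And>x. \<bar>\<phi> x\<bar> \<le> B" using test_function_bounded[OF assms(2)] by blast
  then show ?thesis
    by (intro absolutely_integrable_mult_bounded[OF assms(1)])
       (auto intro: borel_measurable_continuous_onI test_function_continuous[OF assms(2)])
qed

lemma LINT_prim_test:
  assumes "integrable_22 f" "test_function \<Omega> \<phi>" "\<Omega> \<subseteq> {-2<..<2}"
  shows "(LINT x:\<Omega>|lebesgue. prim f x * deriv \<phi> x) = - (LINT x:\<Omega>|lebesgue. f x * \<phi> x)"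
proof -
  have d: "test_function \<Omega> (deriv \<phi>)" by (rule test_function_deriv[OF assms(2)])
  have "(LINT x:{-2..2}|lebesgue. f x * prim (deriv \<phi>) x) + (LINT x:{-2..2}|lebesgue. deriv \<phi> x * prim f x) = prim f 2 * prim (deriv \<phi>) 2"
    by (rule prim_by_parts[OF assms(1) test_function_integrable_22[OF d]])
  moreover have "(LINT x:{-2..2}|lebesgue. f x * prim (deriv \<phi>) x) = (LINT x:{-2..2}|lebesgue. f x * \<phi> x)"
    by (rule set_lebesgue_integral_cong) (auto simp: test_function_prim[OF assms(2,3)])
  moreover have "prim (deriv \<phi>) 2 = 0" using test_function_prim[OF assms(2,3)] test_function_endpoints[OF assms(2,3)] by simp
  ultimately show ?thesis
    unfolding LINT_test_extend[OF assms(2,3)] LINT_test_extend[OF d assms(3)] by (simp add: mult.commute)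
qed

text \<open>The distributional derivative of a unit step is the point mass at its node.\<close>

lemma LINT_step_test:
  assumes "test_function \<Omega> \<phi>" "\<Omega> \<subseteq> {-2<..<2}"
  shows "(LINT x:\<Omega>|lebesgue. indicator {s<..} x * deriv \<phi> x) = - \<phi> s"
proof -
  have d: "test_function \<Omega> (deriv \<phi>)" by (rule test_function_deriv[OF assms(1)])
  \<comment> \<open>Clamping treats nodes outside [-2,2] uniformly: there the step is constant on
    the interval, and \<phi> vanishes at s as well as at the clamped node.\<close>
  let ?s = "max (-2) (min s 2)"
  have "(LINT x:\<Omega>|lebesgue. indicator {s<..} x * deriv \<phi> x) = (LINT x:{-2..2}|lebesgue. indicator {s<..} x * deriv \<phi> x)"
    by (rule LINT_test_extend[OF d assms(2)])
  also have "\<dots> = (LINT x:{?s..2}|lebesgue. deriv \<phi> x)"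
  proof -
    have "AE x in lebesgue. x \<noteq> s" using AE_lborel_singleton[of s] by (rule AE_completion)
    moreover have "AE x in lebesgue. x \<noteq> (2::real)" using AE_lborel_singleton[of 2] by (rule AE_completion)
    ultimately have "AE x in lebesgue. x \<in> {-2..2} \<longrightarrow> indicator {s<..} x * deriv \<phi> x = indicator {?s..2} x * deriv \<phi> x"
      by eventually_elim (auto simp: indicator_def max_def min_def)
    then have "(LINT x:{-2..2}|lebesgue. indicator {s<..} x * deriv \<phi> x) = (LINT x:{-2..2}|lebesgue. indicator {?s..2} x * deriv \<phi> x)"
      by (rule LINT_cong_AE)
    also have "\<dots> = (LINT x:{?s..2}|lebesgue. indicator {?s..2} x * deriv \<phi> x)"
      by (rule LINT_extend[symmetric]) auto
    also have "\<dots> = (LINT x:{?s..2}|lebesgue. deriv \<phi> x)"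
      by (rule set_lebesgue_integral_cong) auto
    finally show ?thesis .
  qed
  also have "\<dots> = integral {?s..2} (deriv \<phi>)"
    by (rule set_lebesgue_integral_eq_integral(2), rule set_integrable_subset[OF test_function_integrable_22[OF d]]) auto
  also have "\<dots> = prim (deriv \<phi>) 2 - prim (deriv \<phi>) ?s"
    by (rule prim_diff[symmetric, OF test_function_integrable_22[OF d]]) auto
  also have "\<dots> = - \<phi> s"
  proof -
    have "\<phi> s = 0" if "s \<notin> {-2<..<2}" using test_function_zero[OF assms(1)] assms(2) that by blast
    moreover have "?s = s" if "s \<in> {-2<..<2}" using that by auto
    moreover have "?s = -2 \<or> ?s = 2" if "s \<notin> {-2<..<2}" using that by auto
    moreover have "prim (deriv \<phi>) 2 = 0" "prim (deriv \<phi>) ?s = \<phi> ?s"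
      using test_function_prim[OF assms, of 2] test_function_prim[OF assms, of ?s] test_function_endpoints[OF assms] by simp_all
    moreover have "\<phi> ?s = \<phi> s"
    proof (cases "s \<in> {-2<..<2}")
      case False
      then have "?s = -2 \<or> ?s = 2" "\<phi> s = 0" using calculation by blast+
      then show ?thesis using test_function_endpoints[OF assms] by (elim disjE) simp_all
    qed (use calculation in simp)
    ultimately show ?thesis by simp
  qed
  finally show ?thesis .
qed

section \<open>Jump functions\<close>

lemma jumps_superset:
  assumes "finite T" "{s. c s \<noteq> 0} \<subseteq> T"
  shows "jumps c x = (\<Sum>s\<in>T. c s * indicator {s<..} x)"
  unfolding jumps_def by (rule sum.mono_neutral_left) (use assms in auto)

lemma finite_support_add:
  "finite {s. c s \<noteq> 0} \<Longrightarrow> finite {s. d s \<noteq> 0} \<Longrightarrow> finite {s. c s + d s \<noteq> (0::real)}"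
  by (rule finite_subset[of _ "{s. c s \<noteq> 0} \<union> {s. d s \<noteq> 0}"]) auto

lemma finite_support_cmult: "finite {s. c s \<noteq> 0} \<Longrightarrow> finite {s. k * c s \<noteq> (0::real)}"
  by (rule finite_subset[of _ "{s. c s \<noteq> 0}"]) auto

lemma jumps_add:
  assumes "finite {s. c s \<noteq> 0}" "finite {s. d s \<noteq> 0}"
  shows "jumps (\<lambda>s. c s + d s) x = jumps c x + jumps d x"
proof -
  let ?T = "{s. c s \<noteq> 0} \<union> {s. d s \<noteq> 0}"
  have fin: "finite ?T" using assms by simp
  have "jumps c x = (\<Sum>s\<in>?T. c s * indicator {s<..} x)" "jumps d x = (\<Sum>s\<in>?T. d s * indicator {s<..} x)"
    "jumps (\<lambda>s. c s + d s) x = (\<Sum>s\<in>?T. (c s + d s) * indicator {s<..} x)"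
    by (rule jumps_superset[OF fin], force)+
  then show ?thesis by (simp only: sum.distrib distrib_right)
qed

lemma jumps_cmult:
  assumes "finite {s. c s \<noteq> 0}"
  shows "jumps (\<lambda>s. k * c s) x = k * jumps c x"
proof -
  have "jumps (\<lambda>s. k * c s) x = (\<Sum>s | c s \<noteq> 0. (k * c s) * indicator {s<..} x)"
    by (rule jumps_superset[OF assms]) auto
  then show ?thesis by (simp only: jumps_def sum_distrib_left mult.assoc)
qed

lemma jumps_0 [simp]: "jumps (\<lambda>_. 0) x = 0"
  by (simp add: jumps_def)

lemma jumps_measurable: "jumps c \<in> borel_measurable borel"
  unfolding jumps_def[abs_def] by measurable

lemma jumps_bounded: "\<bar>jumps c x\<bar> \<le> (\<Sum>s | c s \<noteq> 0. \<bar>c s\<bar>)"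
  unfolding jumps_def by (rule order_trans[OF sum_abs sum_mono]) (auto simp: indicator_def)

lemma integrable_22_jumps: "integrable_22 (jumps c)"
  by (rule integrable_22_bounded[OF jumps_measurable jumps_bounded])

text \<open>Finitely many nodes leave a punctured neighbourhood of x free of them. The point x
  itself belongs to the left part because jump functions are left-continuous.\<close>

lemma jumps_local:
  assumes "finite {s. c s \<noteq> 0}"
  obtains \<delta> where "\<delta> > 0" "\<And>y. x < y \<Longrightarrow> y < x + \<delta> \<Longrightarrow> jumps c y = jumps c x + c x"
    "\<And>y. x - \<delta> < y \<Longrightarrow> y \<le> x \<Longrightarrow> jumps c y = jumps c x" "\<And>y. 0 < \<bar>y - x\<bar> \<Longrightarrow> \<bar>y - x\<bar> < \<delta> \<Longrightarrow> c y = 0"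
proof -
  let ?S = "{s. c s \<noteq> 0}"
  obtain \<delta> where \<delta>: "\<delta> > 0" "\<And>s. s \<in> ?S \<Longrightarrow> s \<noteq> x \<Longrightarrow> \<delta> \<le> dist x s"
    using finite_set_avoid[OF assms, of x] by blast
  have far: "\<delta> \<le> \<bar>s - x\<bar>" if "c s \<noteq> 0" "s \<noteq> x" for s
    using \<delta>(2)[of s] that by (simp add: dist_real_def abs_minus_commute)
  have "jumps c y = jumps c x + c x" if y: "x < y" "y < x + \<delta>" for y
  proof -
    have "jumps c y = (\<Sum>s\<in>insert x ?S. c s * indicator {s<..} y)" using assms by (intro jumps_superset) auto
    also have "\<dots> = (\<Sum>s\<in>insert x ?S. c s * indicator {s<..} x + (if s = x then c x else 0))"
    proof (rule sum.cong[OF refl])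
      fix s assume "s \<in> insert x ?S"
      then show "c s * indicator {s<..} y = c s * indicator {s<..} x + (if s = x then c x else 0)"
        using far[of s] y by (cases "s = x") (auto simp: indicator_def)
    qed
    also have "\<dots> = (\<Sum>s\<in>insert x ?S. c s * indicator {s<..} x) + c x"
      using assms by (simp add: sum.distrib)
    also have "(\<Sum>s\<in>insert x ?S. c s * indicator {s<..} x) = jumps c x" using assms by (intro jumps_superset[symmetric]) auto
    finally show ?thesis .
  qed
  moreover have "jumps c y = jumps c x" if y: "x - \<delta> < y" "y \<le> x" for y
    unfolding jumps_def
  proof (rule sum.cong[OF refl])
    fix s assume "s \<in> ?S"
    then show "c s * indicator {s<..} y = c s * indicator {s<..} x"
      using far[of s] y by (cases "s = x") (auto simp: indicator_def)
  qed
  moreover have "c y = 0" if "0 < \<bar>y - x\<bar>" "\<bar>y - x\<bar> < \<delta>" for y using far[of y] that by force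
  ultimately show ?thesis using \<delta>(1) that by blast
qed

section \<open>Limits of classes\<close>

lemma has_rlimI:
  assumes "\<delta> > 0" "AE y in lebesgue. y \<in> {x<..<x+\<delta>} \<longrightarrow> f y = g y" "(g \<longlongrightarrow> l) (at_right x)"
  shows "has_rlim f x l"
proof -
  obtain N where N: "N \<in> null_sets lebesgue" "{y \<in> space lebesgue. \<not> (y \<in> {x<..<x+\<delta>} \<longrightarrow> f y = g y)} \<subseteq> N"
    using assms(2) unfolding eventually_ae_filter by blast
  have "(g \<longlongrightarrow> l) (at x within ({x<..} - N))" using assms(3) by (rule tendsto_within_subset) auto
  then have "(f \<longlongrightarrow> l) (at x within ({x<..} - N))"
  proof (rule Lim_transform_eventually)
    show "\<forall>\<^sub>F y in at x within {x<..} - N. g y = f y"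
      unfolding eventually_at using assms(1) N(2) by (intro exI[of _ \<delta>]) (auto simp: dist_real_def subset_iff)
  qed
  then show ?thesis using N(1) unfolding has_rlim_def ess_lim_def negligible_iff_null_sets by blast
qed

lemma has_llimI:
  assumes "\<delta> > 0" "AE y in lebesgue. y \<in> {x-\<delta><..<x} \<longrightarrow> f y = g y" "(g \<longlongrightarrow> l) (at_left x)"
  shows "has_llim f x l"
proof -
  obtain N where N: "N \<in> null_sets lebesgue" "{y \<in> space lebesgue. \<not> (y \<in> {x-\<delta><..<x} \<longrightarrow> f y = g y)} \<subseteq> N"
    using assms(2) unfolding eventually_ae_filter by blast
  have "(g \<longlongrightarrow> l) (at x within ({..<x} - N))" using assms(3) by (rule tendsto_within_subset) auto
  then have "(f \<longlongrightarrow> l) (at x within ({..<x} - N))"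
  proof (rule Lim_transform_eventually)
    show "\<forall>\<^sub>F y in at x within {..<x} - N. g y = f y"
      unfolding eventually_at using assms(1) N(2)
      by (intro exI[of _ \<delta>]) (auto simp: dist_real_def subset_iff diff_less_eq add.commute)
  qed
  then show ?thesis using N(1) unfolding has_llim_def ess_lim_def negligible_iff_null_sets by blast
qed

text \<open>Two representatives are compared off the union of their exceptional sets. This leaves x
  an accumulation point because A contains nondegenerate intervals arbitrarily close to x, and these
  are not negligible.\<close>

lemma ess_lim_unique:
  assumes A: "\<And>e. e > 0 \<Longrightarrow> \<exists>a b. a < b \<and> {a<..<b} \<subseteq> A \<inter> ball x e - {x}"
    and "ess_lim f x A l" "ess_lim f x A l'"
  shows "l = l'"
proof -
  obtain N N' where N: "negligible N" "(f \<longlongrightarrow> l) (at x within (A - N))" "negligible N'" "(f \<longlongrightarrow> l') (at x within (A - N'))"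
    using assms unfolding ess_lim_def by blast
  have *: "(f \<longlongrightarrow> l) (at x within (A - (N \<union> N')))" "(f \<longlongrightarrow> l') (at x within (A - (N \<union> N')))"
    using N by (auto elim!: tendsto_within_subset)
  have "x islimpt (A - (N \<union> N'))"
    unfolding islimpt_approachable
  proof (intro allI impI)
    fix e :: real assume "e > 0"
    then obtain a b where ab: "a < b" "{a<..<b} \<subseteq> A \<inter> ball x e - {x}" using A by blast
    have "negligible (N \<union> N')" using N by simp
    moreover have "\<not> negligible {a<..<b}" using ab(1) negligible_interval(2)[of a b] by simp
    ultimately have "\<not> {a<..<b} \<subseteq> N \<union> N'" using negligible_subset by blast
    then obtain y where "y \<in> {a<..<b}" "y \<notin> N \<union> N'" by blast
    then show "\<exists>x'\<in>A - (N \<union> N'). x' \<noteq> x \<and> dist x' x < e" using ab(2) by (intro bexI[of _ y]) (auto simp: dist_commute)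
  qed
  then have "\<not> trivial_limit (at x within (A - (N \<union> N')))" by (simp add: trivial_limit_within)
  from tendsto_unique[OF this *] show ?thesis .
qed

lemma has_rlim_unique: 
  assumes "has_rlim f x l" "has_rlim f x l'" shows "l = l'"
proof (rule ess_lim_unique)
  show "\<exists>a b. a < b \<and> {a<..<b} \<subseteq> {x<..} \<inter> ball x e - {x}" if "e > 0" for e
    using that by (intro exI[of _ x] exI[of _ "x + e"]) (auto simp: dist_real_def)
qed (use assms in \<open>auto simp: has_rlim_def\<close>)

lemma has_llim_unique: 
  assumes "has_llim f x l" "has_llim f x l'" shows "l = l'"
proof (rule ess_lim_unique)
  show "\<exists>a b. a < b \<and> {a<..<b} \<subseteq> {..<x} \<inter> ball x e - {x}" if "e > 0" for e
    using that by (intro exI[of _ "x - e"] exI[of _ x]) (auto simp: dist_real_def)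
qed (use assms in \<open>auto simp: has_llim_def\<close>)

lemma rlim_eq: "has_rlim f x l \<Longrightarrow> rlim f x = l"
  unfolding rlim_def by (rule the_equality, assumption) (rule has_rlim_unique)

lemma llim_eq: "has_llim f x l \<Longrightarrow> llim f x = l"
  unfolding llim_def by (rule the_equality, assumption) (rule has_llim_unique)

lemma ess_lim_UNIV_iff: "ess_lim f x UNIV l \<longleftrightarrow> has_rlim f x l \<and> has_llim f x l"
proof
  assume "ess_lim f x UNIV l"
  then show "has_rlim f x l \<and> has_llim f x l"
    unfolding has_rlim_def has_llim_def ess_lim_def by (meson Diff_mono subset_UNIV order_refl tendsto_within_subset)
next
  assume "has_rlim f x l \<and> has_llim f x l"
  then obtain N N' where N: "negligible N" "(f \<longlongrightarrow> l) (at x within ({x<..} - N))" "negligible N'" "(f \<longlongrightarrow> l) (at x within ({..<x} - N'))"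
    unfolding has_rlim_def has_llim_def ess_lim_def by blast
  have "(f \<longlongrightarrow> l) (at x within ({x<..} - N) \<union> ({..<x} - N'))"
    using N by (simp add: Lim_within_Un)
  then have "(f \<longlongrightarrow> l) (at x within (UNIV - (N \<union> N' \<union> {x})))"
    by (rule tendsto_within_subset) auto
  moreover have "negligible (N \<union> N' \<union> {x})" using N by simp
  ultimately show "ess_lim f x UNIV l" unfolding ess_lim_def by blast
qed

lemma val_eq:
  assumes "has_rlim f x l" "has_llim f x l" shows "val f x = l"
  unfolding val_def
proof (rule the_equality)
  show "ess_lim f x UNIV l" using assms by (simp add: ess_lim_UNIV_iff)
  fix k assume "ess_lim f x UNIV k"
  then show "k = l" using has_rlim_unique[OF _ assms(1)] by (simp add: ess_lim_UNIV_iff)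
qed

lemma disc_iff:
  assumes "has_rlim f x r" "has_llim f x l" "x \<in> {-2<..<2}"
  shows "x \<in> disc f \<longleftrightarrow> r \<noteq> l"
proof -
  have "(\<exists>k. ess_lim f x UNIV k) \<longleftrightarrow> r = l"
  proof
    assume "\<exists>k. ess_lim f x UNIV k"
    then obtain k where "has_rlim f x k" "has_llim f x k" by (auto simp: ess_lim_UNIV_iff)
    then show "r = l" using has_rlim_unique[OF assms(1)] has_llim_unique[OF assms(2)] by simp
  next
    assume "r = l"
    then show "\<exists>k. ess_lim f x UNIV k" using assms by (intro exI[of _ l]) (simp add: ess_lim_UNIV_iff)
  qed
  then show ?thesis using assms(3) unfolding disc_def by blast
qed

section \<open>Finite sums of point masses\<close>

text \<open>In \<open>point_measure\<close> every subset of T is measurable; the push-forward along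
  the identity turns it into a Borel measure on the line, as \<open>radon_on\<close>
  demands.\<close>

definition atoms :: "real set \<Rightarrow> (real \<Rightarrow> real) \<Rightarrow> real measure" where
  "atoms T c = distr (point_measure T (\<lambda>s. ennreal (c s))) borel (\<lambda>x. x)"

lemma sets_atoms [simp]: "sets (atoms T c) = sets borel"
  by (simp add: atoms_def)

lemma point_measure_measurable_borel: "f \<in> measurable (point_measure T c) borel"
  by (rule measurableI) (simp_all add: sets_point_measure space_point_measure)

lemma emeasure_atoms:
  assumes "finite T" "A \<in> sets borel"
  shows "emeasure (atoms T c) A = (\<Sum>s\<in>A \<inter> T. ennreal (c s))"
  unfolding atoms_def
  by (subst emeasure_distr[OF point_measure_measurable_borel assms(2)])
     (simp add: space_point_measure emeasure_point_measure_finite assms(1))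

lemma LINT_atoms:
  assumes "finite T" "\<And>s. s \<in> T \<Longrightarrow> 0 \<le> c s" "\<Omega> \<in> sets borel" "f \<in> borel_measurable borel"
  shows "(LINT x:\<Omega>|atoms T c. f x) = (\<Sum>s\<in>T. c s * (indicator \<Omega> s * f s))"
  unfolding atoms_def set_lebesgue_integral_def
  by (subst integral_distr[OF point_measure_measurable_borel])
     (use assms in \<open>auto simp: lebesgue_integral_point_measure_finite\<close>)

lemma radon_atoms: "finite T \<Longrightarrow> radon_on \<Omega> (atoms T c)"
  by (auto simp: radon_on_def emeasure_atoms borel_compact)

section \<open>Piecewise absolutely continuous functions\<close>

text \<open>There is no constant of integration: a jump at a node s <= -2 is a constant on (-2,2).
  For this reason, conditions on c are always restricted to points of the open interval.\<close>

definition pwac :: "(real \<Rightarrow> real) \<Rightarrow> (real \<Rightarrow> real) \<Rightarrow> (real \<Rightarrow> real) \<Rightarrow> bool" where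
  "pwac v c q \<longleftrightarrow> finite {s. c s \<noteq> 0} \<and> integrable_22 q \<and>
     (AE x in lebesgue. x \<in> {-2<..<2} \<longrightarrow> v x = jumps c x + prim q x)"

lemma pwac_AE: "pwac v c q \<Longrightarrow> AE x in lebesgue. x \<in> {-2<..<2} \<longrightarrow> v x = jumps c x + prim q x"
  by (simp add: pwac_def)

lemma pwac_has_rlim:
  assumes "pwac v c q" "-2 \<le> x" "x < 2"
  shows "has_rlim v x (jumps c x + c x + prim q x)"
proof -
  have fin: "finite {s. c s \<noteq> 0}" and q: "integrable_22 q" using assms by (auto simp: pwac_def)
  obtain \<delta> where \<delta>: "\<delta> > 0" "\<And>y. x < y \<Longrightarrow> y < x + \<delta> \<Longrightarrow> jumps c y = jumps c x + c x"
    by (rule jumps_local[OF fin, of x]) blast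
  show ?thesis
  proof (rule has_rlimI[of "min \<delta> (2 - x)"])
    show "0 < min \<delta> (2 - x)" using \<delta> assms by simp
    show "AE y in lebesgue. y \<in> {x<..<x + min \<delta> (2 - x)} \<longrightarrow> v y = jumps c x + c x + prim q y"
      using pwac_AE[OF assms(1)] by eventually_elim (use assms \<delta>(2) in auto)
    show "((\<lambda>y. jumps c x + c x + prim q y) \<longlongrightarrow> jumps c x + c x + prim q x) (at_right x)"
      by (intro tendsto_intros filterlim_mono[OF prim_isCont[OF q, unfolded isCont_def]]) (auto simp: at_le)
  qed
qed

lemma pwac_has_llim:
  assumes "pwac v c q" "-2 < x" "x \<le> 2"
  shows "has_llim v x (jumps c x + prim q x)"
proof -
  have fin: "finite {s. c s \<noteq> 0}" and q: "integrable_22 q" using assms by (auto simp: pwac_def)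
  obtain \<delta> where \<delta>: "\<delta> > 0" "\<And>y. x - \<delta> < y \<Longrightarrow> y \<le> x \<Longrightarrow> jumps c y = jumps c x"
    by (rule jumps_local[OF fin, of x]) blast
  show ?thesis
  proof -
    define e where "e = min \<delta> (x + 2)"
    have e: "0 < e" "e \<le> \<delta>" "e \<le> x + 2" using \<delta>(1) assms(2) by (auto simp: e_def)
    show ?thesis
    proof (rule has_llimI[OF e(1)])
      show "AE y in lebesgue. y \<in> {x - e<..<x} \<longrightarrow> v y = jumps c x + prim q y"
        using pwac_AE[OF assms(1)]
      proof eventually_elim
        case (elim y)
        show ?case
        proof
          assume "y \<in> {x - e<..<x}"
          then show "v y = jumps c x + prim q y" using elim \<delta>(2)[of y] e assms(3) by simp
        qed
      qed
      show "((\<lambda>y. jumps c x + prim q y) \<longlongrightarrow> jumps c x + prim q x) (at_left x)"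
        by (intro tendsto_intros filterlim_mono[OF prim_isCont[OF q, unfolded isCont_def]]) (auto simp: at_le)
    qed
  qed
qed

lemma pwac_rlim: "pwac v c q \<Longrightarrow> -2 \<le> x \<Longrightarrow> x < 2 \<Longrightarrow> rlim v x = jumps c x + c x + prim q x"
  using pwac_has_rlim[of v c q x] by (intro rlim_eq) simp

lemma pwac_llim: "pwac v c q \<Longrightarrow> -2 < x \<Longrightarrow> x \<le> 2 \<Longrightarrow> llim v x = jumps c x + prim q x"
  using pwac_has_llim[of v c q x] by (intro llim_eq) simp

lemma pwac_disc:
  assumes "pwac v c q" shows "disc v = {x\<in>{-2<..<2}. c x \<noteq> 0}"
proof -
  have "x \<in> disc v \<longleftrightarrow> c x \<noteq> 0" if "x \<in> {-2<..<2}" for x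
    using disc_iff[OF pwac_has_rlim[OF assms] pwac_has_llim[OF assms], of x] that by auto
  moreover have "disc v \<subseteq> {-2<..<2}" by (auto simp: disc_def)
  ultimately show ?thesis by auto
qed

lemma pwac_val:
  assumes "pwac v c q" "-2 < x" "x < 2" "c x = 0"
  shows "val v x = jumps c x + prim q x"
proof (rule val_eq)
  show "has_rlim v x (jumps c x + prim q x)" using pwac_has_rlim[OF assms(1), of x] assms(2-4) by simp
  show "has_llim v x (jumps c x + prim q x)" using pwac_has_llim[OF assms(1), of x] assms(2-4) by simp
qed

lemma pwac_dist_deriv:
  assumes "pwac v c q" "test_function \<Omega> \<phi>" "\<Omega> \<subseteq> {-2<..<2}"
  shows "dist_deriv \<Omega> 1 v \<phi> = (\<Sum>s | c s \<noteq> 0. c s * \<phi> s) + (LINT x:\<Omega>|lebesgue. q x * \<phi> x)"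
proof -
  have q: "integrable_22 q" and fin: "finite {s. c s \<noteq> 0}" using assms by (auto simp: pwac_def)
  have d: "test_function \<Omega> (deriv \<phi>)" by (rule test_function_deriv[OF assms(2)])
  have i: "integrable_22 (\<lambda>x. f x * deriv \<phi> x)" if "integrable_22 f" for f
    by (rule integrable_22_mult_test[OF that d])
  have st: "integrable_22 (indicator {s<..})" for s :: real
    by (rule integrable_22_bounded[of _ 1]) (auto simp: indicator_def)
  have "(LINT x:\<Omega>|lebesgue. v x * deriv \<phi> x) = (LINT x:\<Omega>|lebesgue. (jumps c x + prim q x) * deriv \<phi> x)"
    by (rule LINT_cong_AE) (use pwac_AE[OF assms(1)] assms(3) in \<open>auto elim!: eventually_mono\<close>)
  also have "\<dots> = (LINT x:{-2..2}|lebesgue. (jumps c x + prim q x) * deriv \<phi> x)"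
    by (rule LINT_test_extend[OF d assms(3)])
  also have "\<dots> = (LINT x:{-2..2}|lebesgue. jumps c x * deriv \<phi> x) + (LINT x:{-2..2}|lebesgue. prim q x * deriv \<phi> x)"
    unfolding distrib_right by (intro set_integral_add i integrable_22_jumps integrable_22_prim q)
  also have "(LINT x:{-2..2}|lebesgue. prim q x * deriv \<phi> x) = - (LINT x:\<Omega>|lebesgue. q x * \<phi> x)"
    unfolding LINT_test_extend[OF d assms(3), symmetric] by (rule LINT_prim_test[OF q assms(2,3)])
  also have "(LINT x:{-2..2}|lebesgue. jumps c x * deriv \<phi> x) = (LINT x:{-2..2}|lebesgue. (\<Sum>s | c s \<noteq> 0. c s * (indicator {s<..} x * deriv \<phi> x)))"
    unfolding jumps_def sum_distrib_right mult.assoc by simp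
  also have "\<dots> = (\<Sum>s | c s \<noteq> 0. LINT x:{-2..2}|lebesgue. c s * (indicator {s<..} x * deriv \<phi> x))"
    unfolding set_lebesgue_integral_def scaleR_sum_right
    by (rule Bochner_Integration.integral_sum)
       (rule integrable_22_cmult[OF i[OF st], unfolded set_integrable_def])
  also have "\<dots> = (\<Sum>s | c s \<noteq> 0. c s * - \<phi> s)"
  proof (rule sum.cong[OF refl])
    fix s
    have "(LINT x:{-2..2}|lebesgue. indicator {s<..} x * deriv \<phi> x) = - \<phi> s"
      using LINT_step_test[OF assms(2,3), of s] LINT_test_extend[OF d assms(3), of "indicator {s<..}"] by (simp only:)
    then show "(LINT x:{-2..2}|lebesgue. c s * (indicator {s<..} x * deriv \<phi> x)) = c s * - \<phi> s"
      by (simp only: set_integral_mult_right)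
  qed
  finally show ?thesis by (simp add: dist_deriv_def sum_negf)
qed

lemma pwac_loc_integrable:
  assumes "pwac v c q" "\<Omega> \<subseteq> {-2<..<2}" shows "loc_integrable \<Omega> v"
  unfolding loc_integrable_def
proof (intro allI impI)
  fix C assume C: "compact C \<and> C \<subseteq> \<Omega>"
  have "integrable_22 (\<lambda>x. jumps c x + prim q x)"
    using assms(1) by (intro integrable_22_add integrable_22_jumps integrable_22_prim) (simp add: pwac_def)
  moreover have "AE x in lebesgue. x \<in> {-2<..<2} \<longrightarrow> jumps c x + prim q x = v x"
    using pwac_AE[OF assms(1)] by eventually_elim simp
  ultimately have "integrable_22 v" by (rule integrable_22_cong_AE[rotated])
  then show "v absolutely_integrable_on C"
    by (rule set_integrable_subset) (use C assms(2) in \<open>force simp: borel_compact\<close>)+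
qed

lemma integrable_22_loc:
  assumes "integrable_22 q" "\<Omega> \<subseteq> {-2<..<2}" shows "loc_integrable \<Omega> q"
  unfolding loc_integrable_def
proof (intro allI impI)
  fix C assume C: "compact C \<and> C \<subseteq> \<Omega>"
  show "q absolutely_integrable_on C"
    by (rule set_integrable_subset[OF assms(1)]) (use C assms(2) in \<open>force simp: borel_compact\<close>)+
qed

text \<open>The singular part is a finite sum of point masses, carried by the null set of jumps; its
  Jordan decomposition separates the upward from the downward jumps.\<close>

lemma pwac_has_ac_deriv:
  assumes v: "pwac v c q" and \<Omega>: "{a<..<b} \<subseteq> {-2<..<2}"
  shows "has_ac_deriv {a<..<b} v q"
proof -
  let ?\<Omega> = "{a<..<b}"
  have q: "integrable_22 q" and fin: "finite {s. c s \<noteq> 0}" using assms by (auto simp: pwac_def)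
  let ?S = "{s. c s \<noteq> 0}" and ?P = "{s. c s > 0}" and ?N = "{s. c s < 0}"
  have fP: "finite ?P" "finite ?N" by (rule finite_subset[OF _ fin]; auto)+
  let ?m1 = "atoms ?P c" and ?m2 = "atoms ?N (\<lambda>s. - c s)"
  have b: "A \<in> sets borel" if "finite A" for A :: "real set" using that by (simp add: finite_imp_closed borel_closed)
  have z: "A \<inter> B = {} \<Longrightarrow> emeasure (atoms B f) A = 0" if "finite B" "A \<in> sets borel" for A B f
    using emeasure_atoms[OF that] by simp
  have "signed_radon ?\<Omega> ?m1 ?m2"
    unfolding signed_radon_def
  proof (intro conjI bexI[of _ ?P] radon_atoms fP)
    show "?P \<in> sets borel" by (rule b[OF fP(1)])
    show "emeasure ?m1 (?\<Omega> - ?P) = 0" by (rule z[OF fP(1)]) (use b[OF fP(1)] in auto)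
    show "emeasure ?m2 (?\<Omega> \<inter> ?P) = 0" by (rule z[OF fP(2)]) (use b[OF fP(1)] in auto)
  qed
  moreover have "dist_deriv ?\<Omega> 1 v \<phi> - dist_deriv ?\<Omega> 0 q \<phi> = signed_set_integral ?\<Omega> ?m1 ?m2 \<phi>"
    if \<phi>: "test_function ?\<Omega> \<phi>" for \<phi>
  proof -
    have m: "\<phi> \<in> borel_measurable borel" by (rule borel_measurable_continuous_onI[OF test_function_continuous[OF \<phi>]])
    have z: "indicator ?\<Omega> s * \<phi> s = \<phi> s" for s using test_function_zero[OF \<phi>, of s] by (cases "s \<in> ?\<Omega>") auto
    have "signed_set_integral ?\<Omega> ?m1 ?m2 \<phi> = (\<Sum>s\<in>?P. c s * \<phi> s) - (\<Sum>s\<in>?N. - c s * \<phi> s)"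
      unfolding signed_set_integral_def
      by (subst (1 2) LINT_atoms) (use fP m in \<open>simp_all add: z\<close>)
    also have "\<dots> = (\<Sum>s\<in>?P \<union> ?N. c s * \<phi> s)"
      by (subst sum.union_disjoint) (use fP in \<open>auto simp: sum_negf\<close>)
    also have "?P \<union> ?N = ?S" by auto
    finally show ?thesis using pwac_dist_deriv[OF v \<phi> \<Omega>] by (simp add: dist_deriv_def)
  qed
  moreover have "?S \<in> sets borel" "emeasure lborel ?S = 0"
    using b[OF fin] finite_imp_null_set_lborel[OF fin] by auto
  moreover have "emeasure ?m1 (?\<Omega> - ?S) = 0" "emeasure ?m2 (?\<Omega> - ?S) = 0"
    by (rule z[OF fP(1)] z[OF fP(2)]; use b[OF fin] in auto)+
  ultimately show ?thesis
    using pwac_loc_integrable[OF v \<Omega>] integrable_22_loc[OF q \<Omega>]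
    unfolding has_ac_deriv_def distribution_is_measure_def by blast
qed

section \<open>The lemma of du Bois-Reymond\<close>

text \<open>The vanishing mean is what makes the primitive return to 0 to the right of the support
  of \<open>\<zeta>\<close>.\<close>

lemma test_function_primitive:
  assumes \<zeta>: "test_function {a<..<b} \<zeta>" "(LINT x:{a<..<b}|lebesgue. \<zeta> x) = 0"
  obtains \<phi> where "test_function {a<..<b} \<phi>" "deriv \<phi> = \<zeta>"
proof (cases rule: test_function_interval[OF \<zeta>(1)])
  case 2
  have "deriv \<zeta> = \<zeta>" using 2 by (auto intro!: DERIV_imp_deriv)
  then show ?thesis using that[OF \<zeta>(1)] by simp
next
  case (1 p q)
  \<comment> \<open>The base point lies strictly left of the support, so that every x >= p,
    including p itself, is an interior point of an interval of integration.\<close>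
  define \<phi> where "\<phi> x = integral {p - 1..x} \<zeta>" for x
  have c: "continuous_on A \<zeta>" for A by (rule test_function_continuous[OF \<zeta>(1)])
  have low: "\<phi> y = 0" if "y < p" for y
  proof -
    have "integral {p - 1..y} \<zeta> = integral {p - 1..y} (\<lambda>_. 0)"
      by (rule Henstock_Kurzweil_Integration.integral_cong) (use 1(4) that in auto)
    then show ?thesis by (simp add: \<phi>_def)
  qed
  have D: "(\<phi> has_real_derivative \<zeta> x) (at x)" for x
  proof (cases "x < p")
    case True
    have "\<phi> y = 0" if "y < p" for y by (rule low[OF that])
    moreover have "((\<lambda>_. 0) has_real_derivative 0) (at x)" by simp
    ultimately have "(\<phi> has_real_derivative 0) (at x)"
      using has_field_derivative_transform_within_open[of "\<lambda>_. 0" 0 x "{..<p}" \<phi>] True by auto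
    then show ?thesis using 1(4)[of x] True by simp
  next
    case False
    have "(\<phi> has_real_derivative \<zeta> x) (at x within {p - 1..x + 1})"
      unfolding \<phi>_def by (rule integral_has_real_derivative[OF c]) (use False in auto)
    moreover have "at x within {p - 1..x + 1} = at x" by (rule at_within_interior) (use False in simp)
    ultimately show ?thesis by (simp only:)
  qed
  then have d: "deriv \<phi> = \<zeta>" by (intro ext DERIV_imp_deriv)
  have "smooth k \<phi>" for k
  proof -
    have "smooth (Suc k) \<phi>" unfolding smooth_Suc d
      using D \<zeta>(1) by (auto simp: test_function_iff_smooth intro: real_differentiable_def[THEN iffD2])
    then show ?thesis by (rule smooth_mono) simp
  qed
  moreover have "\<phi> x = 0" if "x \<notin> {p..q}" for x
  proof (cases "x < p")
    case True
    then show ?thesis by (rule low)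
  next
    case False
    have "(\<zeta> has_integral integral {p..q} \<zeta>) {p..q}"
      by (rule integrable_integral[OF integrable_continuous_real[OF c]])
    then have "(\<zeta> has_integral integral {p..q} \<zeta>) {p - 1..x}"
      by (rule has_integral_on_superset) (use 1(4) False that in auto)
    then have "\<phi> x = integral {p..q} \<zeta>" unfolding \<phi>_def by (rule integral_unique)
    also have "\<dots> = (LINT x:{p..q}|lebesgue. \<zeta> x)"
      by (rule set_lebesgue_integral_eq_integral(2)[symmetric]) (rule absolutely_integrable_continuous_real[OF c])
    also have "\<dots> = (LINT x:{a<..<b}|lebesgue. \<zeta> x)"
      by (rule LINT_extend) (use 1 in auto)
    finally show ?thesis using \<zeta>(2) by simp
  qed
  ultimately have "test_function {a<..<b} \<phi>"
    by (intro test_function_supportI[of \<phi> p q]) (use 1 in auto)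
  then show ?thesis using that d by blast
qed

lemma test_function_lincomb:
  assumes "test_function {a<..<b} \<phi>" "test_function {a<..<b} \<psi>"
  shows "test_function {a<..<b} (\<lambda>x. \<phi> x + k * \<psi> x)"
proof -
  have s: "smooth j (\<lambda>x. \<phi> x + k * \<psi> x)" for j
    using assms by (intro smooth_add smooth_cmult) (auto simp: test_function_iff_smooth)
  show ?thesis
  proof (cases rule: test_function_interval[OF assms(1)])
    case \<phi>: (1 p q)
    show ?thesis
    proof (cases rule: test_function_interval[OF assms(2)])
      case \<psi>: (1 p' q')
      have "\<phi> x = 0" "\<psi> x = 0" if "x \<notin> {min p p'..max q q'}" for x
        by (rule \<phi>(4) \<psi>(4); use that in force)+
      then show ?thesis by (intro test_function_supportI[of _ "min p p'" "max q q'"]) (use \<phi>(1-3) \<psi>(1-3) s in auto)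
    next
      case 2 then show ?thesis using assms by simp
    qed
  next
    case \<phi>: 2
    show ?thesis
    proof (cases rule: test_function_interval[OF assms(2)])
      case \<psi>: (1 p' q')
      show ?thesis by (rule test_function_supportI[of _ p' q']) (use \<phi> \<psi> s in auto)
    next
      case 2 then show ?thesis using assms by simp
    qed
  qed
qed

text \<open>Every test function is a multiple of one fixed bump \<open>\<theta>\<close> plus a test
  function of mean zero, and the latter is a derivative. With k chosen so that V - k is orthogonal
  to \<open>\<theta>\<close>, it is orthogonal to all test functions.\<close>

lemma du_Bois_Reymond:
  assumes V: "loc_integrable {a<..<b} V" and "a < b"
    and z: "\<And>\<phi>. test_function {a<..<b} \<phi> \<Longrightarrow> (LINT x:{a<..<b}|lebesgue. V x * deriv \<phi> x) = 0"
  obtains k where "AE x in lebesgue. x \<in> {a<..<b} \<longrightarrow> V x = k"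
proof -
  let ?I = "\<lambda>f. LINT x:{a<..<b}|lebesgue. f x"
  define p where "p = (2 * a + b) / 3"
  define q where "q = (a + 2 * b) / 3"
  have pq: "a < p" "p < q" "q < b" using \<open>a < b\<close> by (auto simp: p_def q_def)
  define \<theta> where "\<theta> = bump 1 p q"
  have \<theta>: "test_function {a<..<b} \<theta>" unfolding \<theta>_def by (rule test_function_bump) (use pq in auto)
  have one: "loc_integrable {a<..<b} (\<lambda>_. 1)"
    unfolding loc_integrable_def by (auto intro!: absolutely_integrable_on_const lmeasurable_compact)
  have i1: "\<xi> absolutely_integrable_on {a<..<b}" if "test_function {a<..<b} \<xi>" for \<xi>
    using loc_integrable_mult_test[OF one that] by simp
  have "?I \<theta> \<noteq> 0"
  proof
    assume "?I \<theta> = 0"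
    then have "AE x in lebesgue. indicator {a<..<b} x *\<^sub>R \<theta> x = 0"
      using i1[OF \<theta>] unfolding set_lebesgue_integral_def set_integrable_def
      by (subst (asm) integral_nonneg_eq_0_iff_AE) (auto simp: \<theta>_def bump_bounds)
    then have "AE x in lebesgue. x \<notin> {p<..<q}"
      by eventually_elim (use bump_pos[of 1 _ p q] pq in \<open>force simp: \<theta>_def indicator_def split: if_splits\<close>)
    then have "{p<..<q} \<in> null_sets lebesgue"
      by (subst (asm) AE_iff_null_sets[symmetric]) auto
    then show False using pq negligible_interval(2)[of p q] by (simp add: negligible_iff_null_sets)
  qed
  define k where "k = ?I (\<lambda>x. V x * \<theta> x) / ?I \<theta>"
  have lc: "loc_integrable {a<..<b} (\<lambda>x. V x - k)"
    using loc_integrable_diff[OF V, of "\<lambda>_. k"] unfolding loc_integrable_def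
    by (auto intro!: absolutely_integrable_on_const lmeasurable_compact)
  have "AE x in lebesgue. x \<in> {a<..<b} \<longrightarrow> V x - k = 0"
  proof (rule fundamental_lemma[OF lc])
    fix \<xi> assume \<xi>: "test_function {a<..<b} \<xi>"
    define \<zeta> where "\<zeta> x = \<xi> x + (- (?I \<xi> / ?I \<theta>)) * \<theta> x" for x
    have \<zeta>: "test_function {a<..<b} \<zeta>" unfolding \<zeta>_def by (rule test_function_lincomb[OF \<xi> \<theta>])
    have "?I \<zeta> = ?I \<xi> + (- (?I \<xi> / ?I \<theta>)) * ?I \<theta>"
      unfolding \<zeta>_def by (subst set_integral_add(2)[OF i1[OF \<xi>] set_integrable_mult_right[OF i1[OF \<theta>]]]) (simp only: set_integral_mult_right)
    then have "?I \<zeta> = 0" using \<open>?I \<theta> \<noteq> 0\<close> by simp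
    then obtain \<phi> where \<phi>: "test_function {a<..<b} \<phi>" "deriv \<phi> = \<zeta>"
      using test_function_primitive[OF \<zeta>] by metis
    have "0 = ?I (\<lambda>x. V x * \<zeta> x)" using z[OF \<phi>(1)] \<phi>(2) by simp
    also have "\<dots> = ?I (\<lambda>x. V x * \<xi> x + (- (?I \<xi> / ?I \<theta>)) * (V x * \<theta> x))"
      by (rule set_lebesgue_integral_cong) (auto simp: \<zeta>_def algebra_simps)
    also have "\<dots> = ?I (\<lambda>x. V x * \<xi> x) + (- (?I \<xi> / ?I \<theta>)) * ?I (\<lambda>x. V x * \<theta> x)"
      by (subst set_integral_add(2)[OF loc_integrable_mult_test[OF V \<xi>] set_integrable_mult_right[OF loc_integrable_mult_test[OF V \<theta>]]]) (simp only: set_integral_mult_right)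
    finally have e: "?I (\<lambda>x. V x * \<xi> x) = k * ?I \<xi>" by (simp add: k_def)
    have "?I (\<lambda>x. (V x - k) * \<xi> x) = ?I (\<lambda>x. V x * \<xi> x - k * \<xi> x)"
      by (rule set_lebesgue_integral_cong) (auto simp: algebra_simps)
    also have "\<dots> = ?I (\<lambda>x. V x * \<xi> x) - k * ?I \<xi>"
      by (subst set_integral_diff(2)[OF loc_integrable_mult_test[OF V \<xi>] set_integrable_mult_right[OF i1[OF \<xi>]]]) (simp only: set_integral_mult_right)
    finally show "?I (\<lambda>x. (V x - k) * \<xi> x) = 0" using e by simp
  qed
  then show ?thesis using that[of k] by simp
qed

section \<open>Piecewise \<open>H\<^sup>2\<close> functions\<close>

definition pwH2 :: "(real \<Rightarrow> real) \<Rightarrow> (real \<Rightarrow> real) \<Rightarrow> (real \<Rightarrow> real) \<Rightarrow> (real \<Rightarrow> real) \<Rightarrow> bool" where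
  "pwH2 v c d r \<longleftrightarrow> pwac v c (\<lambda>x. jumps d x + prim r x) \<and> finite {s. d s \<noteq> 0} \<and> L2 {-2<..<2} r"

lemma L2_integrable_22: "L2 {-2<..<2} r \<Longrightarrow> integrable_22 r"
  using L2_integrable[of "{-2<..<2}" r] by (simp add: absolutely_integrable_on_Icc_iff_Ioo)

lemma pwH2D:
  assumes "pwH2 v c d r"
  shows "pwac v c (\<lambda>x. jumps d x + prim r x)" "finite {s. c s \<noteq> 0}" "finite {s. d s \<noteq> 0}"
    "L2 {-2<..<2} r" "integrable_22 r"
  using assms by (simp_all add: pwH2_def pwac_def L2_integrable_22)

lemma pwacI:
  assumes "finite {s. c s \<noteq> 0}" "integrable_22 q" "AE x in lebesgue. x \<in> {-2<..<2} \<longrightarrow> v x = jumps c x + prim q x"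
  shows "pwac v c q"
  using assms by (simp add: pwac_def)

lemma pwH2_dot_AE:
  assumes "pwH2 v c d r"
  shows "AE x in lebesgue. x \<in> {-2<..<2} \<longrightarrow> dot v x = jumps d x + prim r x"
  unfolding dot_def by (rule ac_deriv_AE[OF pwac_has_ac_deriv[OF pwH2D(1)[OF assms]]]) simp

lemma pwH2_dot:
  assumes "pwH2 v c d r" shows "pwac (dot v) d r"
  by (rule pwacI[OF pwH2D(3)[OF assms] pwH2D(5)[OF assms] pwH2_dot_AE[OF assms]])

lemma pwH2_ddot_AE:
  assumes "pwH2 v c d r"
  shows "AE x in lebesgue. x \<in> {-2<..<2} \<longrightarrow> ddot v x = r x"
  unfolding ddot_def by (rule ac_deriv_AE[OF pwac_has_ac_deriv[OF pwH2_dot[OF assms]]]) auto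

lemma pwH2_disc: "pwH2 v c d r \<Longrightarrow> disc v = {x\<in>{-2<..<2}. c x \<noteq> 0}"
  by (rule pwac_disc[OF pwH2D(1)])

lemma pwH2_disc_dot: "pwH2 v c d r \<Longrightarrow> disc (dot v) = {x\<in>{-2<..<2}. d x \<noteq> 0}"
  by (rule pwac_disc[OF pwH2_dot])

lemma dist_deriv_Suc: "dist_deriv \<Omega> (Suc k) f \<phi> = - dist_deriv \<Omega> k f (deriv \<phi>)"
  by (simp add: dist_deriv_def funpow_Suc_right del: funpow.simps)

lemma pwac_weak_deriv:
  assumes "pwac v c q" "test_function \<Omega> \<phi>" "\<Omega> \<subseteq> {-2<..<2}" "\<And>x. x \<in> \<Omega> \<Longrightarrow> c x = 0"
  shows "dist_deriv \<Omega> 1 v \<phi> = dist_deriv \<Omega> 0 q \<phi>"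
proof -
  have "c s * \<phi> s = 0" for s using assms(4)[of s] test_function_zero[OF assms(2), of s] by auto
  then have "(\<Sum>s | c s \<noteq> 0. c s * \<phi> s) = 0" by (intro sum.neutral) blast
  then show ?thesis using pwac_dist_deriv[OF assms(1-3)] by (simp add: dist_deriv_def)
qed

lemma pwac_self:
  assumes "finite {s. d s \<noteq> 0}" "integrable_22 r" shows "pwac (\<lambda>x. jumps d x + prim r x) d r"
  using assms by (simp add: pwac_def)

lemma pwH2_weak_deriv_1:
  assumes "pwH2 v c d r" "test_function \<Omega> \<phi>" "\<Omega> \<subseteq> {-2<..<2}" "\<And>x. x \<in> \<Omega> \<Longrightarrow> c x = 0"
  shows "dist_deriv \<Omega> 1 v \<phi> = dist_deriv \<Omega> 0 (\<lambda>x. jumps d x + prim r x) \<phi>"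
  by (rule pwac_weak_deriv[OF pwH2D(1)[OF assms(1)] assms(2-4)])

lemma pwH2_weak_deriv_2:
  assumes "pwH2 v c d r" "test_function \<Omega> \<phi>" "\<Omega> \<subseteq> {-2<..<2}" "\<And>x. x \<in> \<Omega> \<Longrightarrow> c x = 0" "\<And>x. x \<in> \<Omega> \<Longrightarrow> d x = 0"
  shows "dist_deriv \<Omega> 2 v \<phi> = dist_deriv \<Omega> 0 r \<phi>"
proof -
  have "dist_deriv \<Omega> 2 v \<phi> = - dist_deriv \<Omega> 1 v (deriv \<phi>)"
    by (simp only: numeral_2_eq_2 One_nat_def dist_deriv_Suc)
  also have "\<dots> = - dist_deriv \<Omega> 0 (\<lambda>x. jumps d x + prim r x) (deriv \<phi>)"
    by (subst pwH2_weak_deriv_1[OF assms(1) test_function_deriv[OF assms(2)] assms(3,4)]) auto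
  also have "\<dots> = dist_deriv \<Omega> 1 (\<lambda>x. jumps d x + prim r x) \<phi>"
    by (simp only: One_nat_def dist_deriv_Suc)
  also have "\<dots> = dist_deriv \<Omega> 0 r \<phi>"
    by (rule pwac_weak_deriv[OF pwac_self[OF pwH2D(3,5)[OF assms(1)]] assms(2,3,5)])
  finally show ?thesis .
qed

lemma pwac_L2:
  assumes "pwac v c q" "\<Omega> \<in> sets lebesgue" "\<Omega> \<subseteq> {-2<..<2}" shows "L2 \<Omega> v"
proof -
  have q: "integrable_22 q" using assms by (simp add: pwac_def)
  obtain B where B: "\<And>x. \<bar>prim q x\<bar> \<le> B" using prim_bounded[OF q] by blast
  have "L2 {-2<..<2} (\<lambda>x. jumps c x + prim q x)"
  proof (rule L2_bounded)
    show "(\<lambda>x. jumps c x + prim q x) \<in> borel_measurable borel"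
      by (intro borel_measurable_add jumps_measurable prim_measurable q)
    show "\<bar>jumps c x + prim q x\<bar> \<le> (\<Sum>s | c s \<noteq> 0. \<bar>c s\<bar>) + B" for x
      using jumps_bounded[of c x] B[of x] by linarith
  qed auto
  then have "L2 {-2<..<2} v"
  proof (rule L2_cong_AE[rotated])
    show "AE x in lebesgue. x \<in> {-2<..<2} \<longrightarrow> jumps c x + prim q x = v x"
      using pwac_AE[OF assms(1)] by eventually_elim simp
  qed simp
  then show ?thesis using assms by (intro L2_subset[of "{-2<..<2}" \<Omega>]) auto
qed

lemma pwH2_has_weak_deriv_2:
  assumes v: "pwH2 v c d r" and \<Omega>: "\<Omega> \<subseteq> {-2<..<2}" and z: "\<And>x. x \<in> \<Omega> \<Longrightarrow> c x = 0 \<and> d x = 0"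
  shows "has_weak_deriv \<Omega> 2 v r"
  unfolding has_weak_deriv_def
proof (intro conjI allI impI)
  show "loc_integrable \<Omega> v" by (rule pwac_loc_integrable[OF pwH2D(1)[OF v] \<Omega>])
  show "loc_integrable \<Omega> r" by (rule integrable_22_loc[OF pwH2D(5)[OF v] \<Omega>])
  show "dist_deriv \<Omega> 2 v \<phi> = dist_deriv \<Omega> 0 r \<phi>" if "test_function \<Omega> \<phi>" for \<phi>
    by (rule pwH2_weak_deriv_2[OF v that \<Omega>]) (use z in auto)
qed

lemma pwH2_sobolev:
  assumes v: "pwH2 v c d r" and \<Omega>: "\<Omega> \<subseteq> {-2<..<2}" "\<Omega> \<in> sets lebesgue" and z: "\<And>x. x \<in> \<Omega> \<Longrightarrow> c x = 0 \<and> d x = 0"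
  shows "sobolev 2 \<Omega> v"
proof -
  let ?q = "\<lambda>x. jumps d x + prim r x"
  note pv = pwH2D(1)[OF v] and r = pwH2D(4)[OF v] and d = pwH2D(3)[OF v]
  have pq: "pwac ?q d r" by (rule pwac_self[OF d L2_integrable_22[OF r]])
  have "has_weak_deriv \<Omega> 1 v ?q"
    unfolding has_weak_deriv_def
  proof (intro conjI allI impI)
    show "loc_integrable \<Omega> v" by (rule pwac_loc_integrable[OF pv \<Omega>(1)])
    show "loc_integrable \<Omega> ?q" by (rule pwac_loc_integrable[OF pq \<Omega>(1)])
    show "dist_deriv \<Omega> 1 v \<phi> = dist_deriv \<Omega> 0 ?q \<phi>" if "test_function \<Omega> \<phi>" for \<phi>
      by (rule pwH2_weak_deriv_1[OF v that \<Omega>(1)]) (use z in auto)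
  qed
  moreover have "L2 \<Omega> ?q" by (rule pwac_L2[OF pq \<Omega>(2,1)])
  moreover have "L2 \<Omega> v" by (rule pwac_L2[OF pv \<Omega>(2,1)])
  moreover have "L2 \<Omega> r" by (rule L2_subset[OF _ \<Omega>(2,1) r]) simp
  moreover have "has_weak_deriv \<Omega> 2 v r" by (rule pwH2_has_weak_deriv_2[OF v \<Omega>(1) z])
  moreover have "{1..2} = {1, 2::nat}" by auto
  ultimately show ?thesis unfolding sobolev_def by auto
qed

lemma pwH2_piecewise_H2:
  assumes v: "pwH2 v c d r" shows "piecewise_H2 v"
proof -
  \<comment> \<open>Nodes outside (-2,2) are dropped: on the interval they contribute only constants
    to v and to its derivative.\<close>
  define S where "S = ({s. c s \<noteq> 0} \<union> {s. d s \<noteq> 0}) \<inter> {-2<..<2} \<union> {-2, 2}"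
  have fin: "finite S" using pwH2D(2,3)[OF v] by (simp add: S_def)
  define l where "l = sorted_list_of_set S"
  have l: "sorted l" "distinct l" "set l = S" using fin by (auto simp: l_def)
  have Sb: "S \<subseteq> {-2..2}" "-2 \<in> S" "2 \<in> S" by (auto simp: S_def)
  have "card S \<ge> 2" using card_mono[OF fin, of "{-2, 2}"] Sb by simp
  then have len: "length l \<ge> 2" by (simp add: l_def)
  define n where "n = length l - 1"
  have lt: "l ! i < l ! j" if "i < j" "j < length l" for i j
    using that l(1,2) sorted_wrt_nth_less[of "(<)" l i j] strict_sorted_iff by blast
  have mem: "l ! i \<in> S" if "i < length l" for i using that l(3) nth_mem by blast
  have "l ! 0 = -2"
  proof -
    obtain i where i: "i < length l" "l ! i = -2" using Sb(2) l(3) by (metis in_set_conv_nth)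
    have "l ! 0 \<in> {-2..2}" using mem[of 0] Sb(1) len by force
    then show ?thesis using i lt[of 0 i] by (cases "i = 0") auto
  qed
  moreover have "l ! n = 2"
  proof -
    obtain i where i: "i < length l" "l ! i = 2" using Sb(3) l(3) by (metis in_set_conv_nth)
    have "n < length l" using len by (simp add: n_def)
    then have "l ! n \<in> {-2..2}" using mem[of n] Sb(1) by blast
    moreover have "i = n \<or> i < n" using i(1) by (auto simp: n_def)
    ultimately show ?thesis using i lt[of i n] \<open>n < length l\<close> by auto
  qed
  moreover have "l ! i < l ! Suc i \<and> sobolev 2 {l ! i<..<l ! Suc i} v" if "i < n" for i
  proof
    have il: "i < length l" "Suc i < length l" using that by (auto simp: n_def)
    then show "l ! i < l ! Suc i" using lt[of i "Suc i"] by simp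
    have b: "{l ! i<..<l ! Suc i} \<subseteq> {-2<..<2}"
    proof -
      have "l ! i \<in> {-2..2}" "l ! Suc i \<in> {-2..2}" using il mem Sb(1) by blast+
      then show ?thesis by auto
    qed
    have "x \<notin> S" if x: "l ! i < x" "x < l ! Suc i" for x
    proof
      assume "x \<in> S"
      then obtain j where j: "j < length l" "l ! j = x" using l(3) by (metis in_set_conv_nth)
      have "j \<le> i \<or> Suc i \<le> j" by linarith
      then show False
      proof
        assume "j \<le> i" then show False using lt[of j i] j x il by (cases "j = i") auto
      next
        assume "Suc i \<le> j" then show False using lt[of "Suc i" j] j x by (cases "j = Suc i") auto
      qed
    qed
    then have "c x = 0 \<and> d x = 0" if "x \<in> {l ! i<..<l ! Suc i}" for x
    proof -
      have "x \<notin> S" "x \<in> {-2<..<2}" using \<open>\<And>x. l ! i < x \<Longrightarrow> x < l ! Suc i \<Longrightarrow> x \<notin> S\<close>[of x] that b by auto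
      then show ?thesis by (simp add: S_def)
    qed
    then show "sobolev 2 {l ! i<..<l ! Suc i} v" by (intro pwH2_sobolev[OF v b]) auto
  qed
  ultimately show ?thesis unfolding piecewise_H2_def by (intro exI[of _ n] exI[of _ "\<lambda>i. l ! i"] conjI allI impI) auto
qed

section \<open>From weak derivatives to jumps and densities\<close>

text \<open>The difference v - \<open>prim f\<close> has weak derivative 0 and is therefore
  constant. Here f extends g beyond the piece, so that all pieces of a partition can share one
  primitive.\<close>

lemma weak_deriv_1_prim:
  assumes w: "has_weak_deriv {p<..<q} 1 v g" and pq: "p < q" "{p<..<q} \<subseteq> {-2<..<2}"
    and f: "integrable_22 f" "AE x in lebesgue. x \<in> {p<..<q} \<longrightarrow> f x = g x"
  obtains A where "AE x in lebesgue. x \<in> {p<..<q} \<longrightarrow> v x = A + prim f x"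
proof -
  have v: "loc_integrable {p<..<q} v" using w by (simp add: has_weak_deriv_def)
  have P: "loc_integrable {p<..<q} (prim f)" by (rule integrable_22_loc[OF integrable_22_prim[OF f(1)] pq(2)])
  obtain A where "AE x in lebesgue. x \<in> {p<..<q} \<longrightarrow> v x - prim f x = A"
  proof (rule du_Bois_Reymond[OF loc_integrable_diff[OF v P] pq(1)])
    fix \<phi> assume \<phi>: "test_function {p<..<q} \<phi>"
    note d = test_function_deriv[OF \<phi>]
    have "(LINT x:{p<..<q}|lebesgue. (v x - prim f x) * deriv \<phi> x) = (LINT x:{p<..<q}|lebesgue. v x * deriv \<phi> x - prim f x * deriv \<phi> x)"
      by (simp only: left_diff_distrib)
    also have "\<dots> = (LINT x:{p<..<q}|lebesgue. v x * deriv \<phi> x) - (LINT x:{p<..<q}|lebesgue. prim f x * deriv \<phi> x)"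
      by (rule set_integral_diff(2)[OF loc_integrable_mult_test[OF v d] loc_integrable_mult_test[OF P d]])
    also have "(LINT x:{p<..<q}|lebesgue. v x * deriv \<phi> x) = - (LINT x:{p<..<q}|lebesgue. g x * \<phi> x)"
      using w \<phi> by (auto simp: has_weak_deriv_def dist_deriv_def)
    also have "(LINT x:{p<..<q}|lebesgue. prim f x * deriv \<phi> x) = - (LINT x:{p<..<q}|lebesgue. f x * \<phi> x)"
      by (rule LINT_prim_test[OF f(1) \<phi> pq(2)])
    also have "(LINT x:{p<..<q}|lebesgue. f x * \<phi> x) = (LINT x:{p<..<q}|lebesgue. g x * \<phi> x)"
      by (rule LINT_cong_AE) (use f(2) in \<open>auto elim!: eventually_mono\<close>)
    finally show "(LINT x:{p<..<q}|lebesgue. (v x - prim f x) * deriv \<phi> x) = 0" by simp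
  qed
  then have "AE x in lebesgue. x \<in> {p<..<q} \<longrightarrow> v x = A + prim f x" by eventually_elim auto
  then show ?thesis using that by blast
qed

text \<open>\<open>sobolev\<close> provides each weak derivative of v separately; testing against
  \<open>deriv \<phi>\<close> shows that the one of order k + 1 is the weak derivative of the one of
  order k.\<close>

lemma weak_deriv_Suc:
  assumes "has_weak_deriv \<Omega> k v g" "has_weak_deriv \<Omega> (Suc k) v h"
  shows "has_weak_deriv \<Omega> 1 g h"
  unfolding has_weak_deriv_def
proof (intro conjI allI impI)
  fix \<phi> assume \<phi>: "test_function \<Omega> \<phi>"
  have "dist_deriv \<Omega> 1 g \<phi> = - dist_deriv \<Omega> 0 g (deriv \<phi>)" by (simp only: One_nat_def dist_deriv_Suc)
  also have "\<dots> = - dist_deriv \<Omega> k v (deriv \<phi>)"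
    using assms(1) test_function_deriv[OF \<phi>] by (auto simp: has_weak_deriv_def)
  also have "\<dots> = dist_deriv \<Omega> (Suc k) v \<phi>" by (simp only: dist_deriv_Suc)
  also have "\<dots> = dist_deriv \<Omega> 0 h \<phi>" using assms(2) \<phi> by (auto simp: has_weak_deriv_def)
  finally show "dist_deriv \<Omega> 1 g \<phi> = dist_deriv \<Omega> 0 h \<phi>" .
qed (use assms in \<open>auto simp: has_weak_deriv_def\<close>)

lemma L2_zero: "\<Omega> \<in> sets lebesgue \<Longrightarrow> L2 \<Omega> (\<lambda>_. 0)"
  by (simp add: L2_iff)

lemma L2_sum:
  assumes "\<Omega> \<in> sets lebesgue" "\<And>i. i \<in> I \<Longrightarrow> L2 \<Omega> (f i)"
  shows "L2 \<Omega> (\<lambda>x. \<Sum>i\<in>I. f i x)"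
  using assms(2)
proof (induction I rule: infinite_finite_induct)
  case (insert i I)
  then show ?case by (simp add: L2_add[OF assms(1)])
qed (simp_all add: L2_zero assms(1))

lemma L2_indicator_mult:
  assumes "\<Omega> \<in> sets lebesgue" "\<Omega>' \<in> sets lebesgue" "\<Omega>' \<subseteq> \<Omega>" "L2 \<Omega>' f"
  shows "L2 \<Omega> (\<lambda>x. indicator \<Omega>' x * f x)"
proof -
  have "indicator \<Omega> x * (indicator \<Omega>' x * f x) = indicator \<Omega>' x * f x" for x
    using assms(3) by (auto simp: indicator_def)
  moreover have "indicator \<Omega> x *\<^sub>R (indicator \<Omega>' x * f x)\<^sup>2 = indicator \<Omega>' x *\<^sub>R (f x)\<^sup>2" for x
    using assms(3) by (auto simp: indicator_def)
  ultimately have "(\<lambda>x. indicator \<Omega> x * (indicator \<Omega>' x * f x)) = (\<lambda>x. indicator \<Omega>' x * f x)"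
    "(\<lambda>x. indicator \<Omega> x *\<^sub>R (indicator \<Omega>' x * f x)\<^sup>2) = (\<lambda>x. indicator \<Omega>' x *\<^sub>R (f x)\<^sup>2)" by blast+
  then show ?thesis using assms(4) unfolding L2_iff[OF assms(1)] L2_iff[OF assms(2)] set_integrable_def by (simp only:)
qed

text \<open>The jumps are the increments of the prescribed values. The first value is itself a jump
  at \<open>s 0\<close>, so that no additive constant remains.\<close>

lemma jumps_telescope:
  fixes s A :: "nat \<Rightarrow> real"
  assumes mono: "\<And>i j. i < j \<Longrightarrow> j \<le> n \<Longrightarrow> s i < s j"
  obtains c where "{x. c x \<noteq> 0} \<subseteq> s ` {..<n}"
    "\<And>k x. k < n \<Longrightarrow> x \<in> {s k<..<s (Suc k)} \<Longrightarrow> jumps c x = A k"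
proof -
  define C where "C i = (if i = 0 then A 0 else A i - A (i - 1))" for i
  define c where "c x = (\<Sum>i<n. if s i = x then C i else 0)" for x
  have inj: "inj_on s {..<n}"
  proof (rule inj_onI)
    fix i j assume "i \<in> {..<n}" "j \<in> {..<n}" "s i = s j"
    then show "i = j" using mono[of i j] mono[of j i] by (cases i j rule: linorder_cases) auto
  qed
  have cs: "c (s i) = C i" if "i < n" for i
  proof -
    have "c (s i) = (\<Sum>j<n. if j = i then C j else 0)"
      unfolding c_def by (rule sum.cong[OF refl]) (use inj that in \<open>auto simp: inj_on_def\<close>)
    then show ?thesis using that by simp
  qed
  have sub: "{x. c x \<noteq> 0} \<subseteq> s ` {..<n}"
  proof
    fix x assume "x \<in> {x. c x \<noteq> 0}"
    then have "c x \<noteq> 0" by simp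
    then obtain i where "i \<in> {..<n}" "(if s i = x then C i else 0) \<noteq> 0"
      unfolding c_def by (rule sum.not_neutral_contains_not_neutral)
    then show "x \<in> s ` {..<n}" by (auto split: if_splits)
  qed
  have tele: "(\<Sum>i\<le>k. C i) = A k" for k by (induction k) (auto simp: C_def)
  have "jumps c x = A k" if k: "k < n" and x: "x \<in> {s k<..<s (Suc k)}" for k x
  proof -
    have "jumps c x = (\<Sum>t\<in>s ` {..<n}. c t * indicator {t<..} x)" by (rule jumps_superset[OF _ sub]) simp
    also have "\<dots> = (\<Sum>i<n. c (s i) * indicator {s i<..} x)" by (simp only: sum.reindex[OF inj] o_def)
    also have "\<dots> = (\<Sum>i<n. if i \<in> {..k} then C i else 0)"
    proof (rule sum.cong[OF refl])
      fix i assume i: "i \<in> {..<n}"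
      have "s i < x \<longleftrightarrow> i \<le> k"
      proof
        assume "s i < x"
        show "i \<le> k"
        proof (rule ccontr)
          assume "\<not> i \<le> k"
          then have "i = Suc k \<or> Suc k < i" by linarith
          then have "s (Suc k) \<le> s i" using mono[of "Suc k" i] i by auto
          then show False using \<open>s i < x\<close> x by simp
        qed
      next
        assume "i \<le> k" then show "s i < x" using mono[of i k] k x by (cases "i = k") auto
      qed
      then show "c (s i) * indicator {s i<..} x = (if i \<in> {..k} then C i else 0)" using cs i by (auto simp: indicator_def)
    qed
    also have "\<dots> = (\<Sum>i\<in>{..<n} \<inter> {..k}. C i)" by (simp add: sum.inter_restrict)
    also have "{..<n} \<inter> {..k} = {..k}" using k by auto
    finally show ?thesis using tele by simp
  qed
  then show ?thesis using that sub by blast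
qed

lemma AE_pieces:
  fixes s :: "nat \<Rightarrow> real"
  assumes "\<And>i. i < n \<Longrightarrow> AE x in lebesgue. x \<in> {s i<..<s (Suc i)} \<longrightarrow> P x"
  shows "AE x in lebesgue. x \<in> {s 0<..<s n} \<longrightarrow> P x"
  using assms
proof (induction n)
  case (Suc n)
  have "AE x in lebesgue. x \<noteq> s n" using AE_lborel_singleton[of "s n"] by (rule AE_completion)
  moreover have "AE x in lebesgue. x \<in> {s 0<..<s n} \<longrightarrow> P x" using Suc by auto
  moreover have "AE x in lebesgue. x \<in> {s n<..<s (Suc n)} \<longrightarrow> P x" using Suc.prems by simp
  ultimately show ?case
  proof eventually_elim
    case (elim x)
    then show ?case by (cases x "s n" rule: linorder_cases) auto
  qed
qed simp

text \<open>Integrating twice leaves one constant per piece each time. The constants of the first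
  derivatives become the jumps d, which yields a single global density q, and the constants of v
  relative to \<open>prim q\<close> become the jumps c. The last node carries no jump, which matters
  for a single piece.\<close>

lemma piecewise_sobolev_pwH2:
  assumes s: "s 0 = -2" "s n = 2" "\<And>i. i < n \<Longrightarrow> s i < s (Suc i) \<and> sobolev 2 {s i<..<s (Suc i)} v"
  obtains c d r where "pwH2 v c d r" "{x. c x \<noteq> 0} \<union> {x. d x \<noteq> 0} \<subseteq> s ` {..<n}"
proof -
  have mono: "s i < s j" if "i < j" "j \<le> n" for i j
    using that
  proof (induction j)
    case (Suc j)
    then show ?case using s(3)[of j] by (cases "i = j") auto
  qed simp
  have sub: "{s i<..<s (Suc i)} \<subseteq> {-2<..<2}" if "i < n" for i
  proof -
    have "-2 \<le> s i" using mono[of 0 i] s(1) that by (cases "i = 0") auto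
    moreover have "s (Suc i) \<le> 2" using mono[of "Suc i" n] s(2) that by (cases "Suc i = n") auto
    ultimately show ?thesis by auto
  qed
  have "\<exists>g h. L2 {s i<..<s (Suc i)} h \<and> has_weak_deriv {s i<..<s (Suc i)} 1 v g \<and> has_weak_deriv {s i<..<s (Suc i)} 2 v h" if "i < n" for i
    using s(3)[OF that] unfolding sobolev_def by (metis atLeastAtMost_iff one_le_numeral order_refl)
  then obtain g h where gh: "\<And>i. i < n \<Longrightarrow> L2 {s i<..<s (Suc i)} (h i)"
    "\<And>i. i < n \<Longrightarrow> has_weak_deriv {s i<..<s (Suc i)} 1 v (g i)"
    "\<And>i. i < n \<Longrightarrow> has_weak_deriv {s i<..<s (Suc i)} 2 v (h i)" by metis
  define r where "r x = (\<Sum>i<n. indicator {s i<..<s (Suc i)} x * h i x)" for x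
  have r: "L2 {-2<..<2} r"
    unfolding r_def by (intro L2_sum L2_indicator_mult gh sub) auto
  note ri = L2_integrable_22[OF r]
  have rh: "r x = h k x" if "k < n" "x \<in> {s k<..<s (Suc k)}" for k x
  proof -
    have "indicator {s i<..<s (Suc i)} x * h i x = (if i = k then h k x else 0)" if "i < n" for i
    proof (cases i k rule: linorder_cases)
      case less
      then have "s (Suc i) \<le> s k" using mono[of "Suc i" k] \<open>k < n\<close> by (cases "Suc i = k") auto
      then show ?thesis using less \<open>x \<in> _\<close> by auto
    next
      case greater
      then have "s (Suc k) \<le> s i" using mono[of "Suc k" i] \<open>i < n\<close> by (cases "Suc k = i") auto
      then show ?thesis using greater \<open>x \<in> _\<close> by auto
    qed (use that \<open>x \<in> _\<close> in auto)
    then have "r x = (\<Sum>i<n. if i = k then h k x else 0)" unfolding r_def by (intro sum.cong) auto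
    then show ?thesis using that by simp
  qed
  have "\<exists>B. AE x in lebesgue. x \<in> {s i<..<s (Suc i)} \<longrightarrow> g i x = B + prim r x" if i: "i < n" for i
  proof -
    have "has_weak_deriv {s i<..<s (Suc i)} 1 (g i) (h i)"
      by (rule weak_deriv_Suc[of _ 1]) (use gh(2,3)[OF i] in \<open>simp_all add: numeral_2_eq_2\<close>)
    moreover have "s i < s (Suc i)" using s(3)[OF i] by simp
    moreover have "AE x in lebesgue. x \<in> {s i<..<s (Suc i)} \<longrightarrow> r x = h i x" using rh[OF i] by (intro AE_I2) blast
    ultimately obtain B where "AE x in lebesgue. x \<in> {s i<..<s (Suc i)} \<longrightarrow> g i x = B + prim r x"
      using weak_deriv_1_prim[OF _ _ sub[OF i] ri] by blast
    then show ?thesis by blast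
  qed
  then obtain B where B: "\<And>i. i < n \<Longrightarrow> AE x in lebesgue. x \<in> {s i<..<s (Suc i)} \<longrightarrow> g i x = B i + prim r x" by metis
  obtain d where d: "{x. d x \<noteq> 0} \<subseteq> s ` {..<n}" "\<And>k x. k < n \<Longrightarrow> x \<in> {s k<..<s (Suc k)} \<Longrightarrow> jumps d x = B k"
    by (rule jumps_telescope[of n s B]) (use mono in auto)
  define q where "q = (\<lambda>x. jumps d x + prim r x)"
  have q: "integrable_22 q" unfolding q_def by (intro integrable_22_add integrable_22_jumps integrable_22_prim ri)
  have "\<exists>A. AE x in lebesgue. x \<in> {s i<..<s (Suc i)} \<longrightarrow> v x = A + prim q x" if i: "i < n" for i
  proof -
    have "AE x in lebesgue. x \<in> {s i<..<s (Suc i)} \<longrightarrow> q x = g i x"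
      using B[OF i] by eventually_elim (use d(2)[OF i] in \<open>auto simp: q_def\<close>)
    moreover have "s i < s (Suc i)" using s(3)[OF i] by simp
    ultimately obtain A where "AE x in lebesgue. x \<in> {s i<..<s (Suc i)} \<longrightarrow> v x = A + prim q x"
      using weak_deriv_1_prim[OF gh(2)[OF i] _ sub[OF i] q] by blast
    then show ?thesis by blast
  qed
  then obtain A where A: "\<And>i. i < n \<Longrightarrow> AE x in lebesgue. x \<in> {s i<..<s (Suc i)} \<longrightarrow> v x = A i + prim q x" by metis
  obtain c where c: "{x. c x \<noteq> 0} \<subseteq> s ` {..<n}" "\<And>k x. k < n \<Longrightarrow> x \<in> {s k<..<s (Suc k)} \<Longrightarrow> jumps c x = A k"
    by (rule jumps_telescope[of n s A]) (use mono in auto)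
  have "AE x in lebesgue. x \<in> {s 0<..<s n} \<longrightarrow> v x = jumps c x + prim q x"
  proof (rule AE_pieces)
    fix i assume i: "i < n"
    show "AE x in lebesgue. x \<in> {s i<..<s (Suc i)} \<longrightarrow> v x = jumps c x + prim q x"
      using A[OF i] by eventually_elim (use c(2)[OF i] in auto)
  qed
  then have "pwac v c q" using finite_subset[OF c(1)] q s(1,2) by (intro pwacI) auto
  then have "pwH2 v c d r" using finite_subset[OF d(1)] r by (simp add: pwH2_def q_def)
  then show ?thesis using that c(1) d(1) by blast
qed

lemma piecewise_H2_pwH2: "piecewise_H2 v \<Longrightarrow> \<exists>c d r. pwH2 v c d r"
  unfolding piecewise_H2_def by (metis piecewise_sobolev_pwH2)

lemma sobolev_pwH2:
  assumes "sobolev 2 {-2<..<2} v"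
  obtains c d r where "pwH2 v c d r" "\<And>x. x \<in> {-2<..<2} \<Longrightarrow> c x = 0 \<and> d x = 0"
\<comment> \<open>The partition has the single piece (-2,2), so the only possible node is -2,
  outside the open interval.\<close>
proof (rule piecewise_sobolev_pwH2[of "\<lambda>i. if i = 0 then -2 else 2" 1 v])
  fix c d r assume *: "pwH2 v c d r" "{x. c x \<noteq> 0} \<union> {x. d x \<noteq> 0} \<subseteq> (\<lambda>i. if i = 0 then -2 else 2) ` {..<(1::nat)}"
  have "c x = 0 \<and> d x = 0" if "x \<in> {-2<..<2}" for x
  proof -
    have "x \<notin> {x. c x \<noteq> 0} \<union> {x. d x \<noteq> 0}" using *(2) that by (auto simp: subset_iff)
    then show ?thesis by simp
  qed
  then show ?thesis using that *(1) by blast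
qed (use assms in auto)

lemma pwac_add:
  assumes "pwac v c q" "pwac v' c' q'"
  shows "pwac (\<lambda>x. v x + v' x) (\<lambda>s. c s + c' s) (\<lambda>x. q x + q' x)"
proof (rule pwacI)
  have f: "finite {s. c s \<noteq> 0}" "finite {s. c' s \<noteq> 0}" and q: "integrable_22 q" "integrable_22 q'"
    using assms by (auto simp: pwac_def)
  show "finite {s. c s + c' s \<noteq> 0}" using f by (rule finite_support_add)
  show "integrable_22 (\<lambda>x. q x + q' x)" using q by (rule integrable_22_add)
  show "AE x in lebesgue. x \<in> {-2<..<2} \<longrightarrow> v x + v' x = jumps (\<lambda>s. c s + c' s) x + prim (\<lambda>x. q x + q' x) x"
    using pwac_AE[OF assms(1)] pwac_AE[OF assms(2)]
    by eventually_elim (simp add: jumps_add[OF f] prim_add[OF q])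
qed

lemma pwac_cmult:
  assumes "pwac v c q"
  shows "pwac (\<lambda>x. k * v x) (\<lambda>s. k * c s) (\<lambda>x. k * q x)"
proof (rule pwacI)
  have f: "finite {s. c s \<noteq> 0}" and q: "integrable_22 q" using assms by (auto simp: pwac_def)
  show "finite {s. k * c s \<noteq> 0}" using f by (rule finite_support_cmult)
  show "integrable_22 (\<lambda>x. k * q x)" using q by (rule integrable_22_cmult)
  show "AE x in lebesgue. x \<in> {-2<..<2} \<longrightarrow> k * v x = jumps (\<lambda>s. k * c s) x + prim (\<lambda>x. k * q x) x"
    using pwac_AE[OF assms] by eventually_elim (simp add: jumps_cmult[OF f] prim_cmult distrib_left)
qed

lemma pwH2_add:
  assumes "pwH2 v c d r" "pwH2 v' c' d' r'"
  shows "pwH2 (\<lambda>x. v x + v' x) (\<lambda>s. c s + c' s) (\<lambda>s. d s + d' s) (\<lambda>x. r x + r' x)"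
proof -
  have "(\<lambda>x. jumps (\<lambda>s. d s + d' s) x + prim (\<lambda>x. r x + r' x) x) = (\<lambda>x. (jumps d x + prim r x) + (jumps d' x + prim r' x))"
    by (simp add: jumps_add[OF pwH2D(3)[OF assms(1)] pwH2D(3)[OF assms(2)]] prim_add[OF pwH2D(5)[OF assms(1)] pwH2D(5)[OF assms(2)]] fun_eq_iff)
  then show ?thesis
    using pwac_add[OF pwH2D(1)[OF assms(1)] pwH2D(1)[OF assms(2)]]
      finite_support_add[OF pwH2D(3)[OF assms(1)] pwH2D(3)[OF assms(2)]]
      L2_add[OF _ pwH2D(4)[OF assms(1)] pwH2D(4)[OF assms(2)]]
    by (simp add: pwH2_def)
qed

lemma pwH2_cmult:
  assumes "pwH2 v c d r"
  shows "pwH2 (\<lambda>x. k * v x) (\<lambda>s. k * c s) (\<lambda>s. k * d s) (\<lambda>x. k * r x)"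
proof -
  have "(\<lambda>x. jumps (\<lambda>s. k * d s) x + prim (\<lambda>x. k * r x) x) = (\<lambda>x. k * (jumps d x + prim r x))"
    by (simp add: jumps_cmult[OF pwH2D(3)[OF assms]] prim_cmult fun_eq_iff distrib_left)
  then show ?thesis
    using pwac_cmult[OF pwH2D(1)[OF assms], of k] finite_support_cmult[OF pwH2D(3)[OF assms], of k]
      L2_cmult[OF _ pwH2D(4)[OF assms], of k]
    by (simp add: pwH2_def)
qed

section \<open>Quadratic splines\<close>

text \<open>
  An entry \<open>(s, c, d, e)\<close> of the list adds \<open>c\<close>, \<open>d\<close> and \<open>e\<close> to the value, the slope and the second
  derivative on the right of the node \<open>s\<close>.
\<close>

definition spline :: "(real \<times> real \<times> real \<times> real) list \<Rightarrow> real \<Rightarrow> real" where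
  "spline L x = (\<Sum>(s, c, d, e)\<leftarrow>L. if s < x then c + d * (x - s) + e * (x - s)\<^sup>2 / 2 else 0)"

definition spline_c :: "(real \<times> real \<times> real \<times> real) list \<Rightarrow> real \<Rightarrow> real" where
  "spline_c L x = (\<Sum>(s, c, d, e)\<leftarrow>L. if x = s then c else 0)"

definition spline_d :: "(real \<times> real \<times> real \<times> real) list \<Rightarrow> real \<Rightarrow> real" where
  "spline_d L x = (\<Sum>(s, c, d, e)\<leftarrow>L. if x = s then d else 0)"

definition spline_e :: "(real \<times> real \<times> real \<times> real) list \<Rightarrow> real \<Rightarrow> real" where
  "spline_e L x = (\<Sum>(s, c, d, e)\<leftarrow>L. if s < x then e else 0)"

lemmas spline_defs = spline_def spline_c_def spline_d_def spline_e_def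

lemma jumps_single: "jumps (\<lambda>x. if x = s then k else 0) x = (if s < x then k else 0)"
proof -
  have "jumps (\<lambda>x. if x = s then k else 0) x = (\<Sum>t\<in>{s}. (if t = s then k else 0) * indicator {t<..} x)"
    by (rule jumps_superset) auto
  also have "\<dots> = k * indicator {s<..} x" by (subst sum.insert) auto
  finally show ?thesis by (simp add: indicator_def)
qed

lemma max_power_DERIV: "((\<lambda>x. (max 0 (x - s))\<^sup>2 / 2) has_real_derivative max 0 (x - s)) (at x)"
proof -
  consider "x < s" | "s < x" | "x = s" by linarith
  then show ?thesis
  proof cases
    case 1
    have "((\<lambda>_. 0) has_real_derivative max 0 (x - s)) (at x)" using 1 by simp
    then show ?thesis
      by (rule has_field_derivative_transform_within_open[of _ _ _ "{..<s}"]) (use 1 in auto)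
  next
    case 2
    have "((\<lambda>x. (x - s)\<^sup>2 / 2) has_real_derivative max 0 (x - s)) (at x)"
      using 2 by (auto intro!: derivative_eq_intros)
    then show ?thesis
      by (rule has_field_derivative_transform_within_open[of _ _ _ "{s<..}"]) (use 2 in auto)
  next
    case 3
    have "((\<lambda>y. (max 0 (y - s))\<^sup>2 / 2 / (y - s)) \<longlongrightarrow> 0) (at s)"
    proof (rule Lim_null_comparison)
      show "((\<lambda>y. \<bar>y - s\<bar>) \<longlongrightarrow> 0) (at s)" by (auto intro!: tendsto_eq_intros)
      have "\<bar>(max 0 t)\<^sup>2 / 2 / t\<bar> \<le> \<bar>t\<bar>" for t :: real
        by (cases "t > 0") (auto simp: max_def power2_eq_square)
      then show "\<forall>\<^sub>F y in at s. norm ((max 0 (y - s))\<^sup>2 / 2 / (y - s)) \<le> \<bar>y - s\<bar>"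
        unfolding real_norm_def by (intro always_eventually allI)
    qed
    then show ?thesis using 3 by (simp add: has_field_derivative_iff)
  qed
qed

lemma prim_step:
  assumes "-2 \<le> s" "x \<le> 2" 
  shows "prim (indicator {s<..}) x = max 0 (x - s)"
proof -
  have "prim (indicator {s<..}) x = integral {-2..x} (\<lambda>y. if y \<in> {s..} then 1 else 0)"
    unfolding prim_def min_absorb1[OF assms(2)]
    by (rule integral_spike[of "{s}"]) (auto simp: indicator_def)
  also have "\<dots> = integral ({s..} \<inter> {-2..x}) (\<lambda>_. 1)" by (rule integral_restrict_Int)
  also have "{s..} \<inter> {-2..x} = {s..x}" using assms by auto
  finally show ?thesis by simp
qed

lemma pwH2_step: "pwH2 (\<lambda>x. if s < x then k else 0) (\<lambda>x. if x = s then k else 0) (\<lambda>_. 0) (\<lambda>_. 0)"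
  unfolding pwH2_def
  by (auto intro!: pwacI simp: jumps_single L2_zero prim_def set_integrable_def cong: if_cong)

lemma pwH2_ramp:
  assumes "-2 \<le> s"
  shows "pwH2 (\<lambda>x. max 0 (x - s)) (\<lambda>_. 0) (\<lambda>x. if x = s then 1 else 0) (\<lambda>_. 0)"
proof -
  have eq: "(\<lambda>x. jumps (\<lambda>x. if x = s then 1 else 0) x + prim (\<lambda>_. 0) x) = indicator {s<..}"
    by (auto simp: jumps_single prim_def indicator_def)
  have "integrable_22 (indicator {s<..})"
    by (rule integrable_22_bounded[of _ 1]) (auto simp: indicator_def)
  then have "pwac (\<lambda>x. max 0 (x - s)) (\<lambda>_. 0) (indicator {s<..})"
    using prim_step[OF assms] by (intro pwacI) auto
  then show ?thesis unfolding pwH2_def eq by (auto simp: L2_zero cong: if_cong)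
qed

lemma pwH2_parabola:
  assumes "-2 \<le> s"
  shows "pwH2 (\<lambda>x. (max 0 (x - s))\<^sup>2 / 2) (\<lambda>_. 0) (\<lambda>_. 0) (indicator {s<..})"
proof -
  have "prim (\<lambda>y. prim (indicator {s<..}) y) = prim (\<lambda>y. max 0 (y - s))"
    by (rule prim_cong_AE) (use prim_step[OF assms] in auto)
  moreover have "prim (\<lambda>y. max 0 (y - s)) x = (max 0 (x - s))\<^sup>2 / 2" if "x \<in> {-2<..<2}" for x
    using prim_FTC[OF max_power_DERIV, of x s] that assms by simp
  moreover have "integrable_22 (indicator {s<..})"
    by (rule integrable_22_bounded[of _ 1]) (auto simp: indicator_def)
  moreover have "L2 {-2<..<2} (indicator {s<..})"
    by (rule L2_bounded[of _ _ 1]) (auto simp: indicator_def)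
  ultimately show ?thesis
    unfolding pwH2_def by (auto intro!: pwacI integrable_22_prim simp: eta_contract_eq)
qed

text \<open>Nodes left of -2 are excluded because \<open>prim\<close> starts there: a ramp that
  begins earlier would enter the interval with a positive value.\<close>

lemma pwH2_spline:
  assumes "\<And>s c d e. (s, c, d, e) \<in> set L \<Longrightarrow> -2 \<le> s"
  shows "pwH2 (spline L) (spline_c L) (spline_d L) (spline_e L)"
  using assms
proof (induction L)
  case Nil
  then show ?case using pwH2_step[of 0 0] by (simp add: spline_defs[abs_def] cong: if_cong)
next
  case (Cons a L)
  obtain s c d e where a: "a = (s, c, d, e)" by (cases a)
  have s: "-2 \<le> s" using Cons.prems a by auto
  have "pwH2 (\<lambda>x. (if s < x then c else 0) + (d * max 0 (x - s) + (e * ((max 0 (x - s))\<^sup>2 / 2) + spline L x)))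
     (\<lambda>x. (if x = s then c else 0) + (d * 0 + (e * 0 + spline_c L x)))
     (\<lambda>x. 0 + (d * (if x = s then 1 else 0) + (e * 0 + spline_d L x)))
     (\<lambda>x. 0 + (d * 0 + (e * indicator {s<..} x + spline_e L x)))"
    by (intro pwH2_add pwH2_cmult pwH2_step pwH2_ramp pwH2_parabola Cons.IH s) (use Cons.prems in auto)
  moreover have "(if s < x then c else 0) + (d * max 0 (x - s) + (e * ((max 0 (x - s))\<^sup>2 / 2) + spline L x)) = spline (a # L) x" for x
    by (auto simp: spline_def a max_def)
  moreover have "(if x = s then c else 0) + (d * 0 + (e * 0 + spline_c L x)) = spline_c (a # L) x" for x
    by (auto simp: spline_c_def a)
  moreover have "0 + (d * (if x = s then 1 else 0) + (e * 0 + spline_d L x)) = spline_d (a # L) x" for x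
    by (auto simp: spline_d_def a)
  moreover have "0 + (d * 0 + (e * indicator {s<..} x + spline_e L x)) = spline_e (a # L) x" for x
    by (auto simp: spline_e_def a indicator_def)
  ultimately show ?case by (simp only: eta_contract_eq)
qed

section \<open>The admissible set and the functional\<close>

lemma not_trivial_limit_punctured:
  assumes N: "negligible N" and A: "\<And>e. e > 0 \<Longrightarrow> \<exists>a b. a < b \<and> {a<..<b} \<subseteq> A \<inter> ball x e - {x}"
  shows "\<not> trivial_limit (at (x::real) within (A - N))"
proof -
  have "x islimpt (A - N)"
    unfolding islimpt_approachable
  proof (intro allI impI)
    fix e :: real assume "e > 0"
    then obtain a b where ab: "a < b" "{a<..<b} \<subseteq> A \<inter> ball x e - {x}" using A by blast
    have "\<not> negligible {a<..<b}" using ab(1) negligible_interval(2)[of a b] by simp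
    then have "\<not> {a<..<b} \<subseteq> N" using N negligible_subset by blast
    then obtain y where "y \<in> {a<..<b}" "y \<notin> N" by blast
    then show "\<exists>x'\<in>A - N. x' \<noteq> x \<and> dist x' x < e" using ab(2) by (intro bexI[of _ y]) (auto simp: dist_commute)
  qed
  then show ?thesis by (simp add: trivial_limit_within)
qed

lemma ess_lim_le:
  assumes A: "\<And>e. e > 0 \<Longrightarrow> \<exists>a b. a < b \<and> {a<..<b} \<subseteq> A \<inter> ball x e - {x}"
    and f: "ess_lim f x A l" and g: "ess_lim g x A k" and "\<delta> > 0"
    and le: "AE y in lebesgue. y \<in> A \<inter> ball x \<delta> - {x} \<longrightarrow> f y \<le> g y"
  shows "l \<le> k"
proof -
  obtain N1 where N1: "negligible N1" "(f \<longlongrightarrow> l) (at x within (A - N1))" using f unfolding ess_lim_def by blast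
  obtain N2 where N2: "negligible N2" "(g \<longlongrightarrow> k) (at x within (A - N2))" using g unfolding ess_lim_def by blast
  obtain N3 where N3: "N3 \<in> null_sets lebesgue" "{y \<in> space lebesgue. \<not> (y \<in> A \<inter> ball x \<delta> - {x} \<longrightarrow> f y \<le> g y)} \<subseteq> N3"
    using le unfolding eventually_ae_filter by blast
  let ?N = "N1 \<union> N2 \<union> N3"
  have N: "negligible ?N" using N1(1) N2(1) N3(1) by (simp add: negligible_iff_null_sets[symmetric])
  show ?thesis
  proof (rule tendsto_le)
    show "\<not> trivial_limit (at x within (A - ?N))" by (rule not_trivial_limit_punctured[OF N A])
    show "(f \<longlongrightarrow> l) (at x within (A - ?N))" by (rule tendsto_within_subset[OF N1(2)]) auto
    show "(g \<longlongrightarrow> k) (at x within (A - ?N))" by (rule tendsto_within_subset[OF N2(2)]) auto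
    show "\<forall>\<^sub>F y in at x within (A - ?N). f y \<le> g y"
      unfolding eventually_at using \<open>\<delta> > 0\<close> N3(2) by (intro exI[of _ \<delta>]) (auto simp: subset_iff dist_commute)
  qed
qed

lemma has_rlim_le:
  assumes "has_rlim f x l" "has_rlim g x k" "\<delta> > 0" "AE y in lebesgue. y \<in> {x<..<x+\<delta>} \<longrightarrow> f y \<le> g y"
  shows "l \<le> k"
proof (rule ess_lim_le[of "{x<..}" x f l g k \<delta>])
  show "\<exists>a b. a < b \<and> {a<..<b} \<subseteq> {x<..} \<inter> ball x e - {x}" if "e > 0" for e
    using that by (intro exI[of _ x] exI[of _ "x + e"]) (auto simp: dist_real_def)
  show "AE y in lebesgue. y \<in> {x<..} \<inter> ball x \<delta> - {x} \<longrightarrow> f y \<le> g y"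
    using assms(4) by eventually_elim (auto simp: dist_real_def)
qed (use assms in \<open>auto simp: has_rlim_def\<close>)

lemma has_llim_le:
  assumes "has_llim f x l" "has_llim g x k" "\<delta> > 0" "AE y in lebesgue. y \<in> {x-\<delta><..<x} \<longrightarrow> f y \<le> g y"
  shows "l \<le> k"
proof (rule ess_lim_le[of "{..<x}" x f l g k \<delta>])
  show "\<exists>a b. a < b \<and> {a<..<b} \<subseteq> {..<x} \<inter> ball x e - {x}" if "e > 0" for e
    using that by (intro exI[of _ "x - e"] exI[of _ x]) (auto simp: dist_real_def)
  show "AE y in lebesgue. y \<in> {..<x} \<inter> ball x \<delta> - {x} \<longrightarrow> f y \<le> g y"
    using assms(4) by eventually_elim (auto simp: dist_real_def)
qed (use assms in \<open>auto simp: has_llim_def\<close>)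

text \<open>An inequality almost everywhere passes to one-sided limits. Conversely, off the finitely
  many jumps the value of the class is its continuous value, at which \<open>above\<close> compares
  the functions on [-1,1]; outside that interval \<open>out\<close> gives equality.\<close>

lemma above_iff_AE:
  assumes r: "pwac vr c q" and p: "pwac vp cp qp" and cp: "\<And>x. x \<in> {-2<..<2} \<Longrightarrow> cp x = 0"
    and out: "AE x in lebesgue. x \<in> {-2<..<-1} \<union> {1<..<2} \<longrightarrow> vr x = vp x"
  shows "above vr vp \<longleftrightarrow> (AE x in lebesgue. x \<in> {-2<..<2} \<longrightarrow> vp x \<le> vr x)"
proof
  assume ab: "above vr vp"
  have fin: "finite {x. c x \<noteq> 0}" using r by (simp add: pwac_def)
  then have "AE x in lebesgue. c x = 0"
    using negligible_finite[OF fin] by (intro AE_I'[of "{x. c x \<noteq> 0}"]) (auto simp: negligible_iff_null_sets)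
  moreover have "AE x in lebesgue. x \<noteq> (1::real)" "AE x in lebesgue. x \<noteq> (-1::real)"
    using AE_lborel_singleton[of 1] AE_lborel_singleton[of "-1"] by (auto intro: AE_completion)
  ultimately show "AE x in lebesgue. x \<in> {-2<..<2} \<longrightarrow> vp x \<le> vr x"
    using pwac_AE[OF r] pwac_AE[OF p] out
  proof eventually_elim
    case (elim x)
    show ?case
    proof
      assume x: "x \<in> {-2<..<2}"
      show "vp x \<le> vr x"
      proof (cases "x \<in> {-1..1}")
        case True
        have "x \<notin> disc vr" using elim(1) by (simp add: pwac_disc[OF r])
        then have "val vp x \<le> val vr x" using ab True by (simp add: above_def)
        then show ?thesis
          using pwac_val[OF r, of x] pwac_val[OF p, of x] cp[OF x] elim x by simp
      next
        case False
        then show ?thesis using elim x by (auto simp: not_le)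
      qed
    qed
  qed
next
  assume ae: "AE x in lebesgue. x \<in> {-2<..<2} \<longrightarrow> vp x \<le> vr x"
  have R: "val vp x \<le> rlim vr x" if "x \<in> {-2<..<2}" for x
  proof -
    have "jumps cp x + cp x + prim qp x \<le> jumps c x + c x + prim q x"
    proof (rule has_rlim_le[OF pwac_has_rlim[OF p] pwac_has_rlim[OF r], of x "2 - x"])
      show "AE y in lebesgue. y \<in> {x<..<x + (2 - x)} \<longrightarrow> vp y \<le> vr y"
        using ae by eventually_elim (use that in auto)
    qed (use that in auto)
    then show ?thesis using pwac_rlim[OF r, of x] pwac_val[OF p, of x] cp[OF that] that by simp
  qed
  have L: "val vp x \<le> llim vr x" if "x \<in> {-2<..<2}" for x
  proof -
    have "jumps cp x + prim qp x \<le> jumps c x + prim q x"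
    proof (rule has_llim_le[OF pwac_has_llim[OF p] pwac_has_llim[OF r], of x "x + 2"])
      show "AE y in lebesgue. y \<in> {x - (x + 2)<..<x} \<longrightarrow> vp y \<le> vr y"
        using ae by eventually_elim (use that in auto)
    qed (use that in auto)
    then show ?thesis using pwac_llim[OF r, of x] pwac_val[OF p, of x] cp[OF that] that by simp
  qed
  have "val vp x \<le> val vr x" if "x \<in> {-1..1} - disc vr" for x
  proof -
    have x: "x \<in> {-2<..<2}" "c x = 0" using that by (auto simp: pwac_disc[OF r])
    then have "val vr x = llim vr x" using pwac_val[OF r, of x] pwac_llim[OF r, of x] by simp
    then show ?thesis using L[OF x(1)] by simp
  qed
  moreover have "disc vr \<subseteq> {-2<..<2}" by (auto simp: disc_def)
  ultimately show "above vr vp" unfolding above_def using R L by auto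
qed

text \<open>Variations are checked against this form of the constraint: an inequality almost
  everywhere needs no bookkeeping of one-sided values.\<close>

lemma KK_iff:
  "(vr, vp) \<in> KK w \<longleftrightarrow> piecewise_H2 vr \<and> sobolev 2 {-2<..<2} vp \<and>
     (AE x in lebesgue. x \<in> {-2<..<2} \<longrightarrow> vp x \<le> vr x) \<and>
     (AE x in lebesgue. x \<in> {-2<..<-1} \<union> {1<..<2} \<longrightarrow> vr x = w x \<and> vp x = w x)"
proof -
  have "above vr vp \<longleftrightarrow> (AE x in lebesgue. x \<in> {-2<..<2} \<longrightarrow> vp x \<le> vr x)"
    if H: "piecewise_H2 vr" "sobolev 2 {-2<..<2} vp"
     "AE x in lebesgue. x \<in> {-2<..<-1} \<union> {1<..<2} \<longrightarrow> vr x = w x \<and> vp x = w x"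
  proof -
    have "\<exists>c d r. pwH2 vr c d r" by (rule piecewise_H2_pwH2) (rule H(1))
    then obtain c d r where r: "pwH2 vr c d r" by blast
    obtain cp dp rp where p: "pwH2 vp cp dp rp" "\<And>x. x \<in> {-2<..<2} \<Longrightarrow> cp x = 0 \<and> dp x = 0"
      proof (rule sobolev_pwH2[OF H(2)], goal_cases)
      case (1 c d r) show ?thesis by (rule 1(1)[OF 1(2) 1(3)])
    qed
    have "AE x in lebesgue. x \<in> {-2<..<-1} \<union> {1<..<2} \<longrightarrow> vr x = vp x"
      using H(3) by eventually_elim auto
    then show ?thesis using above_iff_AE[OF pwH2D(1)[OF r] pwH2D(1)[OF p(1)]] p(2) by blast
  qed
  then show ?thesis unfolding KK_def by blast
qed

section \<open>The first variation\<close>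

abbreviation I11 :: "(real \<Rightarrow> real) \<Rightarrow> real" where
  "I11 f \<equiv> LINT x:{-1<..<1}|lebesgue. f x"

abbreviation integrable_11 :: "(real \<Rightarrow> real) \<Rightarrow> bool" where
  "integrable_11 f \<equiv> f absolutely_integrable_on {-1<..<1}"

lemma I11_add: "integrable_11 f \<Longrightarrow> integrable_11 g \<Longrightarrow> I11 (\<lambda>x. f x + g x) = I11 f + I11 g"
  by (rule set_integral_add(2))

lemma I11_diff: "integrable_11 f \<Longrightarrow> integrable_11 g \<Longrightarrow> I11 (\<lambda>x. f x - g x) = I11 f - I11 g"
  by (rule set_integral_diff(2))

lemma integrable_11_add: "integrable_11 f \<Longrightarrow> integrable_11 g \<Longrightarrow> integrable_11 (\<lambda>x. f x + g x)"
  by (rule set_integral_add(1))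

lemma integrable_11_diff: "integrable_11 f \<Longrightarrow> integrable_11 g \<Longrightarrow> integrable_11 (\<lambda>x. f x - g x)"
  by (rule set_integral_diff(1))

lemma integrable_11_cmult: "integrable_11 f \<Longrightarrow> integrable_11 (\<lambda>x. k * f x)"
  by (rule set_integrable_mult_right) simp

lemma I11_cmult: "I11 (\<lambda>x. k * f x) = k * I11 f"
  by (rule set_integral_mult_right)

lemma I11_quadratic:
  assumes "integrable_11 a" "integrable_11 b" "integrable_11 c"
    and "\<And>x. f x = a x + \<epsilon> * b x + \<epsilon>\<^sup>2 * c x"
  shows "I11 f = I11 a + \<epsilon> * I11 b + \<epsilon>\<^sup>2 * I11 c"
proof -
  have "I11 f = I11 (\<lambda>x. a x + \<epsilon> * b x + \<epsilon>\<^sup>2 * c x)" using assms(4) by simp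
  also have "\<dots> = I11 a + \<epsilon> * I11 b + \<epsilon>\<^sup>2 * I11 c"
    by (simp only: I11_add I11_cmult integrable_11_add integrable_11_cmult assms(1-3))
  finally show ?thesis .
qed

lemma L2_mult_11: "L2 {-1<..<1} f \<Longrightarrow> L2 {-1<..<1} g \<Longrightarrow> integrable_11 (\<lambda>x. f x * g x)"
  by (rule L2_mult_integrable) auto

lemma L2_diff:
  assumes "\<Omega> \<in> sets lebesgue" "L2 \<Omega> f" "L2 \<Omega> g" shows "L2 \<Omega> (\<lambda>x. f x - g x)"
  using L2_add[OF assms(1,2) L2_cmult[OF assms(1,3), of "-1"]] by simp

lemma pwH2_L2_11:
  assumes "pwH2 v c d r" shows "L2 {-1<..<1} v" "L2 {-1<..<1} r"
  using pwac_L2[OF pwH2D(1)[OF assms], of "{-1<..<1}"] L2_subset[OF _ _ _ pwH2D(4)[OF assms], of "{-1<..<1}"]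
  by (auto simp: subset_iff)

definition jump_cost :: "real \<Rightarrow> real \<Rightarrow> (real \<Rightarrow> real) \<Rightarrow> (real \<Rightarrow> real) \<Rightarrow> real" where
  "jump_cost \<alpha> \<beta> c d = \<alpha> * real (card {x\<in>{-2<..<2}. c x \<noteq> 0}) + \<beta> * real (card {x\<in>{-2<..<2}. d x \<noteq> 0 \<and> c x = 0})"

lemma F1_pwH2:
  assumes v: "pwH2 v c d r" and z: "pwH2 z c' d' r'" "\<And>x. x \<in> {-2<..<2} \<Longrightarrow> c' x = 0 \<and> d' x = 0"
  shows "F1 \<alpha> \<beta> \<eta> \<mu> \<gamma> fr fp (v, z) = jump_cost \<alpha> \<beta> c d + I11 (\<lambda>x. \<eta> * (r x)\<^sup>2 - fr x * v x)
     + \<mu> * I11 (\<lambda>x. (v x - z x)\<^sup>2) + I11 (\<lambda>x. \<gamma> * (r' x)\<^sup>2 - fp x * z x)"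
proof -
  have "I11 (\<lambda>x. \<eta> * \<bar>ddot v x\<bar>\<^sup>2 - fr x * v x) = I11 (\<lambda>x. \<eta> * (r x)\<^sup>2 - fr x * v x)"
    by (rule LINT_cong_AE) (use pwH2_ddot_AE[OF v] in \<open>auto elim!: eventually_mono\<close>)
  moreover have "I11 (\<lambda>x. \<gamma> * \<bar>weak_deriv {-2<..<2} 2 z x\<bar>\<^sup>2 - fp x * z x) = I11 (\<lambda>x. \<gamma> * (r' x)\<^sup>2 - fp x * z x)"
  proof (rule LINT_cong_AE)
    have "has_weak_deriv {-2<..<2} 2 z r'" by (rule pwH2_has_weak_deriv_2[OF z(1) _ z(2)]) auto
    from weak_deriv_AE[OF this]
    show "AE x in lebesgue. x \<in> {-1<..<1} \<longrightarrow> \<gamma> * \<bar>weak_deriv {-2<..<2} 2 z x\<bar>\<^sup>2 - fp x * z x = \<gamma> * (r' x)\<^sup>2 - fp x * z x"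
      by eventually_elim auto
  qed
  moreover have "{x\<in>{-2<..<2}. d x \<noteq> 0} - {x\<in>{-2<..<2}. c x \<noteq> 0} = {x\<in>{-2<..<2}. d x \<noteq> 0 \<and> c x = 0}" by auto
  ultimately show ?thesis
    unfolding F1_def jump_cost_def by (simp add: pwH2_disc[OF v] pwH2_disc_dot[OF v])
qed

text \<open>Within the given jump sets the worst that can happen is that a jump point turns into a
  mere crease, and this replaces \<alpha> by \<beta> <= \<alpha>.\<close>

lemma jump_cost_mono:
  assumes fin: "finite {x. c x \<noteq> 0}" "finite {x. d x \<noteq> 0}" and ab: "0 \<le> \<beta>" "\<beta> \<le> \<alpha>"
    and c: "\<And>x. x \<in> {-2<..<2} \<Longrightarrow> c x = 0 \<Longrightarrow> c' x = 0"
    and d: "\<And>x. x \<in> {-2<..<2} \<Longrightarrow> c x = 0 \<Longrightarrow> d x = 0 \<Longrightarrow> d' x = 0"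
  shows "jump_cost \<alpha> \<beta> c' d' \<le> jump_cost \<alpha> \<beta> c d"
proof -
  let ?C = "{x\<in>{-2<..<2}. c x \<noteq> 0}" and ?C' = "{x\<in>{-2<..<2}. c' x \<noteq> 0}"
  let ?D = "{x\<in>{-2<..<2}. d x \<noteq> 0 \<and> c x = 0}" and ?D' = "{x\<in>{-2<..<2}. d' x \<noteq> 0 \<and> c' x = 0}"
  have f: "finite ?C" "finite ?D" by (rule finite_subset[OF _ fin(1)], blast, rule finite_subset[OF _ fin(2)], blast)
  have sub: "?C' \<subseteq> ?C" using c by blast
  have "?D' \<subseteq> ?D \<union> (?C - ?C')" using d by blast
  then have "card ?D' \<le> card (?D \<union> (?C - ?C'))" using f by (intro card_mono) auto
  also have "\<dots> \<le> card ?D + card (?C - ?C')" by (rule card_Un_le)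
  also have "card (?C - ?C') = card ?C - card ?C'" using sub f by (intro card_Diff_subset) (auto intro: finite_subset)
  finally have D: "real (card ?D') \<le> real (card ?D) + (real (card ?C) - real (card ?C'))"
    using card_mono[OF f(1) sub] by (simp add: of_nat_diff[symmetric] del: of_nat_diff)
  have C: "real (card ?C') \<le> real (card ?C)" using card_mono[OF f(1) sub] by simp
  have "\<alpha> * real (card ?C') + \<beta> * real (card ?D') \<le> \<alpha> * real (card ?C') + \<beta> * (real (card ?D) + (real (card ?C) - real (card ?C')))"
    using D ab(1) by (intro add_left_mono mult_left_mono)
  also have "\<dots> = (\<alpha> - \<beta>) * real (card ?C') + \<beta> * real (card ?D) + \<beta> * real (card ?C)" by (simp add: algebra_simps)
  also have "\<dots> \<le> (\<alpha> - \<beta>) * real (card ?C) + \<beta> * real (card ?D) + \<beta> * real (card ?C)"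
    using C ab by (intro add_right_mono mult_left_mono) auto
  finally show ?thesis by (simp add: jump_cost_def algebra_simps)
qed

section \<open>Minimisers and admissible perturbations\<close>

locale minimizer =
  fixes w fr fp ur up :: "real \<Rightarrow> real" and \<alpha> \<beta> \<eta> \<mu> \<gamma> :: real
    and c d r cp dp rp :: "real \<Rightarrow> real"
  assumes pos: "\<eta> > 0" "\<mu> > 0" "\<gamma> > 0" "0 < \<beta>" "\<beta> \<le> \<alpha>"
    and f: "L2 {-1<..<1} fr" "L2 {-1<..<1} fp"
    and ur: "pwH2 ur c d r"
    and up: "pwH2 up cp dp rp" and upz: "\<And>x. x \<in> {-2<..<2} \<Longrightarrow> cp x = 0 \<and> dp x = 0"
    and K: "(ur, up) \<in> KK w"
    and minimal: "\<And>v z. (v, z) \<in> KK w \<Longrightarrow> F1 \<alpha> \<beta> \<eta> \<mu> \<gamma> fr fp (ur, up) \<le> F1 \<alpha> \<beta> \<eta> \<mu> \<gamma> fr fp (v, z)"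
begin

text \<open>The first variation is divided by 2, which leaves \<eta> r r' and halves the force. All
  terms without derivatives are collected in h, as the right-hand side of the equation \<eta>
  u_r'''' = h.\<close>

definition h :: "real \<Rightarrow> real" where "h x = fr x / 2 - \<mu> * (ur x - up x)"

definition hp :: "real \<Rightarrow> real" where "hp x = fp x / 2 - \<mu> * (up x - ur x)"

lemma above_AE: "AE x in lebesgue. x \<in> {-2<..<2} \<longrightarrow> up x \<le> ur x"
  using K by (simp add: KK_iff)

lemma outside_AE: "AE x in lebesgue. x \<in> {-2<..<-1} \<union> {1<..<2} \<longrightarrow> ur x = w x \<and> up x = w x"
  using K by (simp add: KK_iff)

lemma h_L2: "L2 {-1<..<1} h" "L2 {-1<..<1} hp"
proof -
  have s: "{-1<..<1::real} \<in> sets lebesgue" by simp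
  have "L2 {-1<..<1} (\<lambda>x. 1/2 * fr x - \<mu> * (ur x - up x))" "L2 {-1<..<1} (\<lambda>x. 1/2 * fp x - \<mu> * (up x - ur x))"
    by (intro L2_diff[OF s] L2_cmult[OF s] f pwH2_L2_11[OF ur] pwH2_L2_11[OF up])+
  then show "L2 {-1<..<1} h" "L2 {-1<..<1} hp" by (simp_all add: h_def[abs_def] hp_def[abs_def])
qed

text \<open>For small positive \<epsilon> the jump cost does not increase and the integrals are a
  quadratic polynomial in \<epsilon>. Minimality makes
  \<open>\<epsilon> * B + \<epsilon>\<^sup>2 * C\<close> nonnegative, hence also its linear
  coefficient, which is twice the sum in the conclusion.\<close>

lemma first_variation:
  assumes \<psi>: "pwH2 \<psi> c' d' r'" and \<psi>p: "pwH2 \<psi>p cp' dp' rp'"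
    and zp: "\<And>x. x \<in> {-2<..<2} \<Longrightarrow> cp' x = 0 \<and> dp' x = 0"
    and c': "\<And>x. x \<in> {-2<..<2} \<Longrightarrow> c x = 0 \<Longrightarrow> c' x = 0"
    and d': "\<And>x. x \<in> {-2<..<2} \<Longrightarrow> c x = 0 \<Longrightarrow> d x = 0 \<Longrightarrow> d' x = 0"
    and out: "\<And>x. x \<in> {-2<..<-1} \<union> {1<..<2} \<Longrightarrow> \<psi> x = 0 \<and> \<psi>p x = 0"
    and adm: "\<epsilon>0 > 0" "AE x in lebesgue. x \<in> {-1<..<1} \<longrightarrow> (\<forall>\<epsilon>. 0 < \<epsilon> \<longrightarrow> \<epsilon> < \<epsilon>0 \<longrightarrow> up x + \<epsilon> * \<psi>p x \<le> ur x + \<epsilon> * \<psi> x)"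
  shows "0 \<le> I11 (\<lambda>x. \<eta> * (r x * r' x) - h x * \<psi> x) + I11 (\<lambda>x. \<gamma> * (rp x * rp' x) - hp x * \<psi>p x)"
proof -
  note l = pwH2_L2_11[OF ur] pwH2_L2_11[OF up] pwH2_L2_11[OF \<psi>] pwH2_L2_11[OF \<psi>p] f
  note ii = integrable_11_add integrable_11_diff integrable_11_cmult L2_mult_11 l L2_diff
  have s: "{-1<..<1::real} \<in> sets lebesgue" by simp
  define B where "B = I11 (\<lambda>x. 2 * \<eta> * (r x * r' x) - fr x * \<psi> x) + \<mu> * I11 (\<lambda>x. 2 * ((ur x - up x) * (\<psi> x - \<psi>p x)))
     + I11 (\<lambda>x. 2 * \<gamma> * (rp x * rp' x) - fp x * \<psi>p x)"
  define C where "C = I11 (\<lambda>x. \<eta> * (r' x * r' x)) + \<mu> * I11 (\<lambda>x. (\<psi> x - \<psi>p x) * (\<psi> x - \<psi>p x)) + I11 (\<lambda>x. \<gamma> * (rp' x * rp' x))"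
  have key: "0 \<le> \<epsilon> * B + \<epsilon>\<^sup>2 * C" if \<epsilon>: "0 < \<epsilon>" "\<epsilon> < \<epsilon>0" for \<epsilon>
  proof -
    let ?v = "\<lambda>x. ur x + \<epsilon> * \<psi> x" and ?z = "\<lambda>x. up x + \<epsilon> * \<psi>p x"
    have v: "pwH2 ?v (\<lambda>x. c x + \<epsilon> * c' x) (\<lambda>x. d x + \<epsilon> * d' x) (\<lambda>x. r x + \<epsilon> * r' x)"
      by (rule pwH2_add[OF ur pwH2_cmult[OF \<psi>]])
    have z: "pwH2 ?z (\<lambda>x. cp x + \<epsilon> * cp' x) (\<lambda>x. dp x + \<epsilon> * dp' x) (\<lambda>x. rp x + \<epsilon> * rp' x)"
      by (rule pwH2_add[OF up pwH2_cmult[OF \<psi>p]])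
    have zz: "cp x + \<epsilon> * cp' x = 0 \<and> dp x + \<epsilon> * dp' x = 0" if "x \<in> {-2<..<2}" for x
      using upz[OF that] zp[OF that] by simp
    have "(?v, ?z) \<in> KK w"
      unfolding KK_iff
    proof (intro conjI)
      show "piecewise_H2 ?v" by (rule pwH2_piecewise_H2[OF v])
      show "sobolev 2 {-2<..<2} ?z" by (rule pwH2_sobolev[OF z _ _ zz]) auto
      show o: "AE x in lebesgue. x \<in> {-2<..<-1} \<union> {1<..<2} \<longrightarrow> ?v x = w x \<and> ?z x = w x"
        using outside_AE by eventually_elim (simp add: out)
      have "AE x in lebesgue. x \<noteq> (1::real)" "AE x in lebesgue. x \<noteq> (-1::real)"
        using AE_lborel_singleton[of 1] AE_lborel_singleton[of "-1"] by (auto intro: AE_completion)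
      then show "AE x in lebesgue. x \<in> {-2<..<2} \<longrightarrow> ?z x \<le> ?v x"
        using o adm(2)
      proof eventually_elim
        case (elim x)
        show ?case
        proof
          assume "x \<in> {-2<..<2}"
          then consider "x \<in> {-1<..<1}" | "x \<in> {-2<..<-1} \<union> {1<..<2}" using elim(1,2) by force
          then show "?z x \<le> ?v x"
          proof cases
            case 1 then show ?thesis using elim(4) \<epsilon> by blast
          next
            case 2 then show ?thesis using elim(3) by simp
          qed
        qed
      qed
    qed
    note minimal[OF this]
    moreover have "F1 \<alpha> \<beta> \<eta> \<mu> \<gamma> fr fp (ur, up) = jump_cost \<alpha> \<beta> c d + I11 (\<lambda>x. \<eta> * (r x)\<^sup>2 - fr x * ur x) + \<mu> * I11 (\<lambda>x. (ur x - up x)\<^sup>2) + I11 (\<lambda>x. \<gamma> * (rp x)\<^sup>2 - fp x * up x)"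
      by (rule F1_pwH2[OF ur up upz])
    moreover have "F1 \<alpha> \<beta> \<eta> \<mu> \<gamma> fr fp (?v, ?z) = jump_cost \<alpha> \<beta> (\<lambda>x. c x + \<epsilon> * c' x) (\<lambda>x. d x + \<epsilon> * d' x) + I11 (\<lambda>x. \<eta> * (r x + \<epsilon> * r' x)\<^sup>2 - fr x * ?v x)
        + \<mu> * I11 (\<lambda>x. (?v x - ?z x)\<^sup>2) + I11 (\<lambda>x. \<gamma> * (rp x + \<epsilon> * rp' x)\<^sup>2 - fp x * ?z x)"
      by (rule F1_pwH2[OF v z zz])
    ultimately have "jump_cost \<alpha> \<beta> c d + I11 (\<lambda>x. \<eta> * (r x)\<^sup>2 - fr x * ur x) + \<mu> * I11 (\<lambda>x. (ur x - up x)\<^sup>2) + I11 (\<lambda>x. \<gamma> * (rp x)\<^sup>2 - fp x * up x)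
      \<le> jump_cost \<alpha> \<beta> (\<lambda>x. c x + \<epsilon> * c' x) (\<lambda>x. d x + \<epsilon> * d' x) + I11 (\<lambda>x. \<eta> * (r x + \<epsilon> * r' x)\<^sup>2 - fr x * ?v x)
        + \<mu> * I11 (\<lambda>x. (?v x - ?z x)\<^sup>2) + I11 (\<lambda>x. \<gamma> * (rp x + \<epsilon> * rp' x)\<^sup>2 - fp x * ?z x)"
      by (simp only:)
    moreover have "jump_cost \<alpha> \<beta> (\<lambda>x. c x + \<epsilon> * c' x) (\<lambda>x. d x + \<epsilon> * d' x) \<le> jump_cost \<alpha> \<beta> c d"
      by (rule jump_cost_mono[OF pwH2D(2,3)[OF ur]]) (use pos c' d' in auto)
    moreover have "I11 (\<lambda>x. \<eta> * (r x + \<epsilon> * r' x)\<^sup>2 - fr x * ?v x) = I11 (\<lambda>x. \<eta> * (r x * r x) - fr x * ur x)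
       + \<epsilon> * I11 (\<lambda>x. 2 * \<eta> * (r x * r' x) - fr x * \<psi> x) + \<epsilon>\<^sup>2 * I11 (\<lambda>x. \<eta> * (r' x * r' x))"
      by (rule I11_quadratic) (intro ii, intro ii, intro ii, simp add: power2_eq_square algebra_simps)
    moreover have "I11 (\<lambda>x. \<gamma> * (rp x + \<epsilon> * rp' x)\<^sup>2 - fp x * ?z x) = I11 (\<lambda>x. \<gamma> * (rp x * rp x) - fp x * up x)
       + \<epsilon> * I11 (\<lambda>x. 2 * \<gamma> * (rp x * rp' x) - fp x * \<psi>p x) + \<epsilon>\<^sup>2 * I11 (\<lambda>x. \<gamma> * (rp' x * rp' x))"
      by (rule I11_quadratic) (intro ii, intro ii, intro ii, simp add: power2_eq_square algebra_simps)
    moreover have "I11 (\<lambda>x. (?v x - ?z x)\<^sup>2) = I11 (\<lambda>x. (ur x - up x) * (ur x - up x))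
       + \<epsilon> * I11 (\<lambda>x. 2 * ((ur x - up x) * (\<psi> x - \<psi>p x))) + \<epsilon>\<^sup>2 * I11 (\<lambda>x. (\<psi> x - \<psi>p x) * (\<psi> x - \<psi>p x))"
      by (rule I11_quadratic) (intro ii s, intro ii s, intro ii s, simp add: power2_eq_square algebra_simps)
    ultimately show ?thesis by (simp add: B_def C_def power2_eq_square algebra_simps)
  qed
  have "0 \<le> B"
  proof (rule ccontr)
    assume "\<not> 0 \<le> B"
    \<comment> \<open>Small enough for the quadratic term to use up at most half of the negative B;
      the summand 1 avoids division by zero and leaves strict room.\<close>
    define e where "e = min (\<epsilon>0 / 2) (- B / (2 * (\<bar>C\<bar> + 1)))"
    have e: "0 < e" "e < \<epsilon>0" using adm(1) \<open>\<not> 0 \<le> B\<close> by (auto simp: e_def field_simps)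
    have "e * (\<bar>C\<bar> + 1) \<le> - B / (2 * (\<bar>C\<bar> + 1)) * (\<bar>C\<bar> + 1)"
      by (intro mult_right_mono) (auto simp: e_def)
    also have "\<dots> = - B / 2" by (simp add: nonzero_eq_divide_eq divide_eq_eq) 
    finally have "e * (\<bar>C\<bar> + 1) \<le> - B / 2" .
    then have "B + e * C < 0"
    proof -
      have "e * C \<le> e * \<bar>C\<bar>" using e(1) by (intro mult_left_mono) auto
      moreover have "e * (\<bar>C\<bar> + 1) = e * \<bar>C\<bar> + e" by (simp add: distrib_left)
      ultimately show ?thesis using \<open>e * (\<bar>C\<bar> + 1) \<le> - B / 2\<close> \<open>\<not> 0 \<le> B\<close> e(1) by linarith
    qed
    then have "e * (B + e * C) < 0" using e(1) by (simp add: mult_pos_neg)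
    then show False using key[OF e] by (simp add: power2_eq_square algebra_simps)
  qed
  also have "B = 2 * (I11 (\<lambda>x. \<eta> * (r x * r' x) - h x * \<psi> x) + I11 (\<lambda>x. \<gamma> * (rp x * rp' x) - hp x * \<psi>p x))"
  proof -
    have 1: "I11 (\<lambda>x. 2 * \<eta> * (r x * r' x) - fr x * \<psi> x) + (\<mu> * I11 (\<lambda>x. 2 * ((ur x - up x) * (\<psi> x - \<psi>p x)))
     + I11 (\<lambda>x. 2 * \<gamma> * (rp x * rp' x) - fp x * \<psi>p x)) = I11 (\<lambda>x. (2 * \<eta> * (r x * r' x) - fr x * \<psi> x) + (\<mu> * (2 * ((ur x - up x) * (\<psi> x - \<psi>p x)))
     + (2 * \<gamma> * (rp x * rp' x) - fp x * \<psi>p x)))"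
      unfolding I11_cmult[of \<mu>, symmetric] by (subst I11_add, (intro ii s)+, subst I11_add, (intro ii s)+, rule refl)
    have 2: "I11 (\<lambda>x. \<eta> * (r x * r' x) - h x * \<psi> x) + I11 (\<lambda>x. \<gamma> * (rp x * rp' x) - hp x * \<psi>p x)
      = I11 (\<lambda>x. (\<eta> * (r x * r' x) - h x * \<psi> x) + (\<gamma> * (rp x * rp' x) - hp x * \<psi>p x))"
      by (rule I11_add[symmetric]; intro ii h_L2)
    show ?thesis unfolding B_def add.assoc 1 2 unfolding I11_cmult[symmetric]
      by (rule set_lebesgue_integral_cong) (auto simp: h_def hp_def algebra_simps)
  qed
  finally show ?thesis by simp
qed

end

section \<open>Convexity on a dense set\<close>

text \<open>
  Slopes over pairs of points of \<open>E\<close> are monotone, and their infimum \<open>g x\<close> over the pairs to the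
  right of \<open>x\<close> is the derivative of \<open>f\<close>: over \<open>[a,b]\<close> the increment of \<open>f\<close> and the integral of \<open>g\<close>
  differ by at most \<open>(b - a) (g b - g y)\<close> for any \<open>y < a\<close>, and this error is \<open>O(1/n)\<close> when summed
  over a partition into \<open>n\<close> pieces.
\<close>

lemma convex_on_dense_primitive:
  fixes f :: "real \<Rightarrow> real"
  assumes E: "E \<subseteq> {s<..<t}" and dense: "\<And>p q. s \<le> p \<Longrightarrow> p < q \<Longrightarrow> q \<le> t \<Longrightarrow> \<exists>x\<in>E. p < x \<and> x < q"
    and conv: "\<And>a b c. a \<in> E \<Longrightarrow> b \<in> E \<Longrightarrow> c \<in> E \<Longrightarrow> a < b \<Longrightarrow> b < c \<Longrightarrow> (c - a) * f b \<le> (c - b) * f a + (b - a) * f c"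
  obtains g where "\<And>x y. s < x \<Longrightarrow> x \<le> y \<Longrightarrow> y < t \<Longrightarrow> g x \<le> g y"
    "\<And>a b. a \<in> E \<Longrightarrow> b \<in> E \<Longrightarrow> a < b \<Longrightarrow> (g has_integral (f b - f a)) {a..b}"
proof -
  define S where "S a b = (f b - f a) / (b - a)" for a b
  have S1: "S a b \<le> S b c" if "a \<in> E" "b \<in> E" "c \<in> E" "a < b" "b < c" for a b c
  proof -
    have "(f b - f a) * (c - b) \<le> (f c - f b) * (b - a)" using conv[OF that] by (simp add: algebra_simps)
    then show ?thesis using that by (simp add: S_def frac_le_eq divide_le_eq le_divide_eq)
  qed
  have S2: "S a b \<le> S a' b'" if "a \<in> E" "b \<in> E" "a' \<in> E" "b' \<in> E" "a < b" "b \<le> a'" "a' < b'" for a b a' b'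
  proof (cases "b = a'")
    case True then show ?thesis using S1 that by blast
  next
    case False
    then show ?thesis using S1[of a b a'] S1[of b a' b'] that by fastforce
  qed
  define P where "P x = {S a b |a b. a \<in> E \<and> b \<in> E \<and> x < a \<and> a < b}" for x
  define g where "g x = Inf (P x)" for x
  have pair: "\<exists>a b. a \<in> E \<and> b \<in> E \<and> p < a \<and> a < b \<and> b < q" if pq: "s \<le> p" "p < q" "q \<le> t" for p q
  proof -
    obtain a where a: "a \<in> E" "p < a" "a < q" using dense[OF pq] by blast
    obtain b where b: "b \<in> E" "a < b" "b < q" using dense[of a q] a pq by auto
    show ?thesis using a b by blast
  qed
  have ne: "P x \<noteq> {}" if "s < x" "x < t" for x
    using pair[of x t] that unfolding P_def by fastforce
  have below: "S a b \<le> z" if "a \<in> E" "b \<in> E" "a < b" "b \<le> x" "z \<in> P x" for a b x z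
    using that S2 unfolding P_def by fastforce
  have bdd: "bdd_below (P x)" if x: "s < x" "x < t" for x
  proof -
    obtain a b where "a \<in> E" "b \<in> E" "a < b" "b < x" using pair[of s x] x by auto
    then show ?thesis using below[of a b x] by (intro bdd_belowI[of _ "S a b"]) auto
  qed
  have g1: "S a b \<le> g x" if "a \<in> E" "b \<in> E" "a < b" "b \<le> x" "x < t" for a b x
  proof -
    have "s < x" using E that by force
    then show ?thesis unfolding g_def using below[OF that(1-4)] that(5) by (intro cInf_greatest ne) auto
  qed
  have g2: "g x \<le> S a b" if "a \<in> E" "b \<in> E" "a < b" "x < a" "s < x" for a b x
  proof -
    have "S a b \<in> P x" unfolding P_def using that by blast
    moreover have "x < t" using that E by force
    ultimately show ?thesis unfolding g_def using bdd[of x] that by (intro cInf_lower) auto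
  qed
  have mono: "g x \<le> g y" if "s < x" "x \<le> y" "y < t" for x y
  proof -
    have "P y \<subseteq> P x"
    proof
      fix z assume "z \<in> P y"
      then obtain a b where "z = S a b" "a \<in> E" "b \<in> E" "y < a" "a < b" unfolding P_def by blast
      then show "z \<in> P x" unfolding P_def using that(2) by (intro CollectI exI[of _ a] exI[of _ b]) auto
    qed
    then show ?thesis unfolding g_def using that by (intro cInf_superset_mono ne bdd) auto
  qed
  have gi: "g integrable_on {a..b}" if "s < a" "b < t" for a b
    by (rule integrable_on_mono_on) (use mono that in \<open>auto simp: mono_on_def\<close>)
  define \<Psi> where "\<Psi> a b = f b - f a - integral {a..b} g" for a b
  have step: "\<bar>\<Psi> a b\<bar> \<le> (b - a) * (g b - g y)" if ab: "a \<in> E" "b \<in> E" "a < b" and y: "s < y" "y < a" for a b y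
  proof -
    have st: "s < a" "b < t" using ab E by auto
    have up: "S a b \<le> g b" using g1[OF ab] st by simp
    have lo: "g y \<le> S a b" using g2[OF ab] y by simp
    have e: "f b - f a = S a b * (b - a)" using ab by (simp add: S_def)
    have "integral {a..b} g \<le> integral {a..b} (\<lambda>_. g b)"
      by (rule integral_le[OF gi[OF st]]) (use mono st in auto)
    then have iu: "integral {a..b} g \<le> g b * (b - a)" using ab by (simp add: mult.commute)
    have "integral {a..b} (\<lambda>_. g y) \<le> integral {a..b} g"
      by (rule integral_le[OF _ gi[OF st]]) (use mono[of y] st y in auto)
    then have il: "g y * (b - a) \<le> integral {a..b} g" using ab by (simp add: mult.commute)
    have "S a b * (b - a) \<le> g b * (b - a)" "g y * (b - a) \<le> S a b * (b - a)"
      using up lo ab by (auto intro: mult_right_mono)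
    then show ?thesis using iu il unfolding \<Psi>_def e by (simp add: abs_le_iff algebra_simps)
  qed
  have zero: "\<Psi> a b = 0" if ab: "a \<in> E" "b \<in> E" "a < b" for a b
  proof -
    have st: "s < a" "b < t" using ab E by auto
    obtain y where y: "y \<in> E" "y < a" using dense[of s a] st ab by auto
    then have sy: "s < y" using E by auto
    have bound: "\<bar>\<Psi> a b\<bar> \<le> 4 * (b - a) * (g b - g y) / real n" if n: "n > 0" for n
    proof -
      define \<delta> where "\<delta> = (b - a) / real n"
      have \<delta>: "\<delta> > 0" "real n * \<delta> = b - a" using n ab by (auto simp: \<delta>_def)
      \<comment> \<open>A nearly equidistant partition through points of E: each inner node lies in
        the left half of its cell, so the nodes increase and consecutive ones are at most 2 \<delta>
        apart.\<close>
      have "\<exists>x. \<forall>i. (i = 0 \<longrightarrow> x i = a) \<and> (i = n \<longrightarrow> x i = b) \<and> (0 < i \<and> i < n \<longrightarrow> x i \<in> E \<and> a + real i * \<delta> < x i \<and> x i < a + real i * \<delta> + \<delta> / 2)"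
      proof (intro choice allI)
        fix i
        show "\<exists>x. (i = 0 \<longrightarrow> x = a) \<and> (i = n \<longrightarrow> x = b) \<and> (0 < i \<and> i < n \<longrightarrow> x \<in> E \<and> a + real i * \<delta> < x \<and> x < a + real i * \<delta> + \<delta> / 2)"
        proof (cases "0 < i \<and> i < n")
          case True
          have "real (Suc i) * \<delta> \<le> real n * \<delta>" using True \<delta>(1) by (intro mult_right_mono) auto
          then have "a + real i * \<delta> + \<delta> / 2 \<le> t" using \<delta> st by (simp add: algebra_simps)
          moreover have "s \<le> a + real i * \<delta>" using st \<delta>(1) by (simp add: add_increasing2)
          ultimately obtain x where "x \<in> E" "a + real i * \<delta> < x" "x < a + real i * \<delta> + \<delta> / 2"
            using dense[of "a + real i * \<delta>" "a + real i * \<delta> + \<delta> / 2"] \<delta>(1) by auto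
          then show ?thesis using True by auto
        next
          case False
          then show ?thesis using n by auto
        qed
      qed
      then obtain x where x0: "x 0 = a" "x n = b" and xi: "\<And>i. 0 < i \<Longrightarrow> i < n \<Longrightarrow> x i \<in> E \<and> a + real i * \<delta> < x i \<and> x i < a + real i * \<delta> + \<delta> / 2"
        by blast
      have loc: "x i \<in> E \<and> a + real i * \<delta> \<le> x i \<and> x i < a + real i * \<delta> + \<delta> / 2" if "i \<le> n" for i
      proof -
        have "i = 0 \<or> i = n \<or> 0 < i \<and> i < n" using that by linarith
        then show ?thesis using x0 xi[of i] ab \<delta> by (elim disjE) auto
      qed
      have inc: "x i < x (Suc i)" "x (Suc i) - x i \<le> 2 * \<delta>" if "i < n" for i
        using loc[of i] loc[of "Suc i"] that \<delta>(1) by (auto simp: algebra_simps)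
      have sum: "f (x k) - f a - integral {a..x k} g = (\<Sum>i<k. \<Psi> (x i) (x (Suc i)))" if "k \<le> n" for k
        using that
      proof (induction k)
        case 0 then show ?case using x0 by simp
      next
        case (Suc k)
        have ak: "a \<le> x k" using loc[of k] Suc.prems \<delta>(1) by (smt (verit) Suc_leD of_nat_0_le_iff zero_le_mult_iff)
        have "x (Suc k) < t" using loc[of "Suc k"] Suc.prems E by auto
        then have "integral {a..x k} g + integral {x k..x (Suc k)} g = integral {a..x (Suc k)} g"
          using ak inc(1)[of k] Suc.prems st by (intro Henstock_Kurzweil_Integration.integral_combine gi) auto
        then show ?case using Suc by (simp add: \<Psi>_def)
      qed
      \<comment> \<open>The lower bound for the slope over a piece needs a point strictly to its
        left, since the infimum defining g runs over pairs strictly to the right. The preceding node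
        serves, and y does so for the first piece.\<close>
      define z where "z i = (case i of 0 \<Rightarrow> y | Suc j \<Rightarrow> x j)" for i
      have zx: "s < z i \<and> z i < x i" if "i < n" for i
      proof (cases i)
        case 0 then show ?thesis using sy y x0 by (simp add: z_def)
      next
        case (Suc j) then show ?thesis using inc(1)[of j] loc[of j] that E by (auto simp: z_def)
      qed
      \<comment> \<open>The two arguments of g are two nodes apart, so that two terms survive at
        each end. The conditional summand is always 0.\<close>
      have tele: "(\<Sum>i<k. g (x (Suc i)) - g (z i)) = g (x k) + (if k = 0 then g y - g y else 0) + g (z k) - g (x 0) - g y" for k
        by (induction k) (auto simp: z_def)
      have "\<bar>\<Psi> a b\<bar> = \<bar>\<Sum>i<n. \<Psi> (x i) (x (Suc i))\<bar>" using sum[of n] x0 by (simp add: \<Psi>_def)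
      also have "\<dots> \<le> (\<Sum>i<n. 2 * \<delta> * (g (x (Suc i)) - g (z i)))"
      proof (rule order_trans[OF sum_abs sum_mono])
        fix i assume "i \<in> {..<n}"
        then have i: "i < n" by simp
        have "\<bar>\<Psi> (x i) (x (Suc i))\<bar> \<le> (x (Suc i) - x i) * (g (x (Suc i)) - g (z i))"
          by (rule step) (use loc[of i] loc[of "Suc i"] inc[OF i] zx[OF i] i in auto)
        also have "\<dots> \<le> 2 * \<delta> * (g (x (Suc i)) - g (z i))"
        proof (rule mult_right_mono[OF inc(2)[OF i]])
          have "x (Suc i) < t" using loc[of "Suc i"] i E by auto
          then have "g (z i) \<le> g (x (Suc i))" using zx[OF i] inc(1)[OF i] by (intro mono) auto
          then show "0 \<le> g (x (Suc i)) - g (z i)" by simp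
        qed
        finally show "\<bar>\<Psi> (x i) (x (Suc i))\<bar> \<le> 2 * \<delta> * (g (x (Suc i)) - g (z i))" .
      qed
      also have "\<dots> = 2 * \<delta> * (g b + g (z n) - g a - g y)"
        unfolding sum_distrib_left[symmetric] tele using n x0 by simp
      also have "\<dots> \<le> 2 * \<delta> * (2 * (g b - g y))"
      proof (rule mult_left_mono)
        have "g y \<le> g a" using mono[of y a] sy y ab st by simp
        moreover have "g (z n) \<le> g b"
        proof -
          obtain j where j: "n = Suc j" using n by (cases n) auto
          have "z n < b" "s < z n" using inc(1)[of j] loc[of j] x0 j E by (auto simp: z_def)
          then show ?thesis using mono[of "z n" b] st by simp
        qed
        ultimately show "g b + g (z n) - g a - g y \<le> 2 * (g b - g y)" by simp
      qed (use \<delta> in simp)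
      also have "\<dots> = 4 * (b - a) * (g b - g y) / real n" by (simp add: \<delta>_def algebra_simps)
      finally show ?thesis .
    qed
    have "(\<lambda>n. 4 * (b - a) * (g b - g y) / real n) \<longlonglongrightarrow> 0" by (rule lim_const_over_n)
    then have "\<bar>\<Psi> a b\<bar> \<le> 0"
      by (rule LIMSEQ_le_const) (use bound in \<open>auto intro!: exI[of _ 1]\<close>)
    then show ?thesis by simp
  qed
  have "(g has_integral (f b - f a)) {a..b}" if "a \<in> E" "b \<in> E" "a < b" for a b
  proof -
    have "s < a" "b < t" using that E by auto
    then show ?thesis using zero[OF that] gi[of a b] by (simp add: \<Psi>_def has_integral_iff)
  qed
  then show ?thesis using that mono by blast
qed

text \<open>Quotients from the right match the tents below, whose second derivative is spread over
  blocks of the form (a, a + \<delta>).\<close>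

lemma lebesgue_points:
  assumes "integrable_22 G"
  obtains N where "negligible N"
    "\<And>x. x \<in> {-2<..<2} - N \<Longrightarrow> ((\<lambda>\<delta>. (prim G (x + \<delta>) - prim G x) / \<delta>) \<longlongrightarrow> G x) (at_right 0)"
proof -
  let ?g = "\<lambda>x. if x \<in> {-2..2} then G x else 0"
  have g: "?g absolutely_integrable_on UNIV" using assms by (simp only: absolutely_integrable_restrict_UNIV)
  have int: "?g integrable_on cbox a b" for a b
    by (rule set_lebesgue_integral_eq_integral(1), rule set_integrable_subset[OF g]) auto
  obtain N where N: "negligible N" and lim: "\<And>x e. x \<notin> N \<Longrightarrow> 0 < e \<Longrightarrow>
      \<exists>\<delta>>0. \<forall>h. 0 < h \<and> h < \<delta> \<longrightarrow> norm (integral (cbox x (x + h *\<^sub>R One)) ?g /\<^sub>R h ^ DIM(real) - ?g x) < e"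
  proof (rule integrable_ccontinuous_explicit[OF int], goal_cases)
    case (1 N) then show ?thesis using that[of N] by simp
  qed
  have "((\<lambda>\<delta>. (prim G (x + \<delta>) - prim G x) / \<delta>) \<longlongrightarrow> G x) (at_right 0)" if x: "x \<in> {-2<..<2} - N" for x
  proof (rule tendstoI)
    fix e :: real assume "e > 0"
    then obtain \<delta> where \<delta>: "\<delta> > 0"
      "\<And>h. 0 < h \<Longrightarrow> h < \<delta> \<Longrightarrow> norm (integral (cbox x (x + h *\<^sub>R One)) ?g /\<^sub>R h ^ DIM(real) - ?g x) < e"
      using lim[of x e] x by blast
    have "dist ((prim G (x + h) - prim G x) / h) (G x) < e" if h: "0 < h" "h < min \<delta> (2 - x)" for h
    proof -
      have box: "cbox x (x + h *\<^sub>R One) = {x..x + h}" by simp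
      have "integral {x..x + h} ?g = integral {x..x + h} G"
        using h x by (intro Henstock_Kurzweil_Integration.integral_cong) auto
      also have "\<dots> = prim G (x + h) - prim G x"
        by (rule prim_diff[OF assms, symmetric]) (use h x in auto)
      finally have "integral (cbox x (x + h *\<^sub>R One)) ?g = prim G (x + h) - prim G x" unfolding box .
      then show ?thesis using \<delta>(2)[of h] h x by (simp add: dist_real_def divide_inverse mult.commute)
    qed
    then show "\<forall>\<^sub>F h in at_right 0. dist ((prim G (x + h) - prim G x) / h) (G x) < e"
      unfolding eventually_at_right_field using \<delta>(1) x by (intro exI[of _ "min \<delta> (2 - x)"]) auto
  qed
  then show ?thesis using that N by blast
qed

text \<open>
  The second derivative of this spline approximates the divided second difference
  \<open>(c - b) \<delta>\<^sub>a - (c - a) \<delta>\<^sub>b + (b - a) \<delta>\<^sub>c\<close>, so that testing with it gives convexity at Lebesgue points.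
\<close>

definition tent :: "real \<Rightarrow> real \<Rightarrow> real \<Rightarrow> real \<Rightarrow> (real \<times> real \<times> real \<times> real) list" where
  "tent a b c \<delta> =
     [(a, 0, 0, (c - b) / \<delta>), (a + \<delta>, 0, 0, - ((c - b) / \<delta>)),
      (b, 0, 0, - ((c - a) / \<delta>)), (b + \<delta>, 0, 0, (c - a) / \<delta>),
      (c, 0, 0, (b - a) / \<delta>), (c + \<delta>, 0, 0, - ((b - a) / \<delta>))]"

lemma tent_jumps: "spline_c (tent a b c \<delta>) = (\<lambda>_. 0)" "spline_d (tent a b c \<delta>) = (\<lambda>_. 0)"
  by (auto simp: tent_def spline_c_def spline_d_def)

text \<open>Let Q be the double primitive of the density 1/\<delta> on (0,\<delta>); it is convex.
  The tent is the combination (c - b) Q(x - a) - (c - a) Q(x - b) + (b - a) Q(x - c), and x - b is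
  the convex combination of x - a and x - c with exactly these weights.\<close>

lemma tent_nonneg:
  assumes "a < b" "b < c" "\<delta> > 0"
  shows "0 \<le> spline (tent a b c \<delta>) x"
proof -
  define Q where "Q y = ((max 0 (y - 0))\<^sup>2 / 2 - (max 0 (y - \<delta>))\<^sup>2 / 2) / \<delta>" for y
  have D: "(Q has_real_derivative (max 0 (y - 0) - max 0 (y - \<delta>)) / \<delta>) (at y)" for y
    unfolding Q_def by (intro DERIV_cdivide DERIV_diff max_power_DERIV)
  have cv: "convex_on UNIV Q"
  proof (rule convex_on_realI)
    show "(max 0 (y - 0) - max 0 (y - \<delta>)) / \<delta> \<le> (max 0 (z - 0) - max 0 (z - \<delta>)) / \<delta>" if "y \<le> z" for y z
      using that assms by (intro divide_right_mono) (auto simp: max_def)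
  qed (use D in auto)
  have "x - b = ((c - b) / (c - a)) * (x - a) + ((b - a) / (c - a)) * (x - c)"
  proof -
    have "(x - b) * (c - a) = (c - b) * (x - a) + (b - a) * (x - c)" by (simp add: algebra_simps)
    then have "x - b = ((c - b) * (x - a) + (b - a) * (x - c)) / (c - a)" using assms by (simp add: eq_divide_eq)
    then show ?thesis by (simp add: add_divide_distrib)
  qed
  moreover have "Q (((c - b) / (c - a)) *\<^sub>R (x - a) + ((b - a) / (c - a)) *\<^sub>R (x - c)) \<le> ((c - b) / (c - a)) * Q (x - a) + ((b - a) / (c - a)) * Q (x - c)"
  proof -
    have t: "1 - (b - a) / (c - a) = (c - b) / (c - a)" using assms by (simp add: field_simps)
    have "0 \<le> (b - a) / (c - a)" "(b - a) / (c - a) \<le> 1" using assms by simp_all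
    from convex_onD[OF cv this, of "x - a" "x - c"] show ?thesis unfolding t by simp
  qed
  ultimately have "Q (x - b) \<le> ((c - b) * Q (x - a) + (b - a) * Q (x - c)) / (c - a)"
    by (simp add: add_divide_distrib)
  then have le: "(c - a) * Q (x - b) \<le> (c - b) * Q (x - a) + (b - a) * Q (x - c)"
    using assms by (simp add: le_divide_eq mult.commute)
  have "spline (tent a b c \<delta>) x = (c - b) * Q (x - a) - (c - a) * Q (x - b) + (b - a) * Q (x - c)"
  proof -
    have m: "(if s < x then 0 + 0 * (x - s) + e * (x - s)\<^sup>2 / 2 else 0) = e * ((max 0 (x - s))\<^sup>2 / 2)" for s e
      by (auto simp: max_def)
    have n: "max 0 (x - (s + \<delta>)) = max 0 (x - s - \<delta>)" for s by (simp add: algebra_simps)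
    show ?thesis unfolding spline_def tent_def list.map sum_list.Cons sum_list.Nil prod.case m Q_def n
      by (simp add: diff_divide_distrib algebra_simps)
  qed
  then show ?thesis using le by simp
qed

text \<open>Right of its block each pair of entries has become affine, Q(t) = t - \<delta>/2, and
  the three weights annihilate affine functions. At c + \<delta> itself the last entry has not yet
  set in, which accounts for the exceptional point of the second derivative.\<close>

lemma tent_zero:
  assumes "a < b" "b < c" "\<delta> > 0" "x \<notin> {a<..<c+\<delta>}"
  shows "spline (tent a b c \<delta>) x = 0" "spline_e (tent a b c \<delta>) x = 0 \<or> x = c + \<delta>"
proof -
  consider "x \<le> a" | "c + \<delta> < x" | "x = c + \<delta>" using assms(4) by force
  then have "spline (tent a b c \<delta>) x = 0 \<and> (spline_e (tent a b c \<delta>) x = 0 \<or> x = c + \<delta>)"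
  proof cases
    case 1
    then show ?thesis using assms by (simp add: spline_def spline_e_def tent_def)
  next
    case 2
    then show ?thesis using assms 
      by (simp add: spline_def spline_e_def tent_def) (simp add: field_simps power2_eq_square)
  next
    case 3
    then show ?thesis using assms 
      by (simp add: spline_def spline_e_def tent_def) (simp add: field_simps power2_eq_square)
  qed
  then show "spline (tent a b c \<delta>) x = 0" "spline_e (tent a b c \<delta>) x = 0 \<or> x = c + \<delta>" by blast+
qed

lemma integrable_22_step: "integrable_22 (\<lambda>x. if s < x then e else (0::real))"
  by (rule integrable_22_bounded[of _ "\<bar>e\<bar>"]) auto

lemma prim_step_scaled: "-2 \<le> s \<Longrightarrow> x \<le> 2 \<Longrightarrow> prim (\<lambda>x. if s < x then e else 0) x = e * max 0 (x - s)"
proof -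
  assume "-2 \<le> s" "x \<le> 2"
  moreover have "(\<lambda>x. if s < x then e else 0) = (\<lambda>x. e * indicator {s<..} x)" by (auto simp: indicator_def)
  ultimately show ?thesis by (simp add: prim_cmult prim_step)
qed

lemma integrable_22_spline_e: "integrable_22 (spline_e L)"
proof (induction L)
  case Nil show ?case by (simp add: spline_e_def[abs_def] set_integrable_def)
next
  case (Cons a L)
  obtain s c d e where a: "a = (s, c, d, e)" by (cases a)
  have "spline_e (a # L) = (\<lambda>x. (if s < x then e else 0) + spline_e L x)" by (simp add: spline_e_def a fun_eq_iff)
  then show ?case using integrable_22_add[OF integrable_22_step Cons.IH] by simp
qed

lemma prim_spline_e:
  assumes "\<And>s c d e. (s, c, d, e) \<in> set L \<Longrightarrow> -2 \<le> s" "x \<le> 2"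
  shows "prim (spline_e L) x = (\<Sum>(s, c, d, e)\<leftarrow>L. e * max 0 (x - s))"
  using assms(1)
proof (induction L)
  case Nil show ?case by (simp add: spline_e_def[abs_def] prim_def)
next
  case (Cons a L)
  obtain s c d e where a: "a = (s, c, d, e)" by (cases a)
  have "spline_e (a # L) = (\<lambda>x. (if s < x then e else 0) + spline_e L x)" by (simp add: spline_e_def a fun_eq_iff)
  moreover have "-2 \<le> s" using Cons.prems a by auto
  moreover have "prim (spline_e L) x = (\<Sum>(s, c, d, e)\<leftarrow>L. e * max 0 (x - s))" by (rule Cons.IH) (use Cons.prems in auto)
  ultimately show ?case using assms(2) by (simp add: prim_add[OF integrable_22_step integrable_22_spline_e] prim_step_scaled a)
qed

text \<open>The second derivative of a spline is a step function, so pairing with it merely samples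
  the primitive of G at the nodes.\<close>

lemma LINT_spline_e:
  assumes G: "integrable_22 G" and L: "\<And>s c d e. (s, c, d, e) \<in> set L \<Longrightarrow> -2 \<le> s \<and> s \<le> 2"
  shows "integrable_22 (\<lambda>x. G x * spline_e L x)"
    "(LINT x:{-2..2}|lebesgue. G x * spline_e L x) = (\<Sum>(s, c, d, e)\<leftarrow>L. e * (prim G 2 - prim G s))"
proof -
  have one: "integrable_22 (\<lambda>x. G x * (if s < x then e else 0))" for s e
    by (rule absolutely_integrable_mult_bounded[OF G, of _ "\<bar>e\<bar>"]) auto
  have val: "(LINT x:{-2..2}|lebesgue. G x * (if s < x then e else 0)) = e * (prim G 2 - prim G s)" if "-2 \<le> s" "s \<le> 2" for s e
  proof -
    have "AE x in lebesgue. x \<noteq> s" using AE_lborel_singleton[of s] by (rule AE_completion)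
    then have "(LINT x:{-2..2}|lebesgue. G x * (if s < x then e else 0)) = (LINT x:{-2..2}|lebesgue. e * (indicator {s..2} x * G x))"
      by (intro LINT_cong_AE) (auto elim!: eventually_mono simp: indicator_def)
    also have "\<dots> = e * (LINT x:{-2..2}|lebesgue. indicator {s..2} x * G x)" by (rule set_integral_mult_right)
    also have "(LINT x:{-2..2}|lebesgue. indicator {s..2} x * G x) = (LINT x:{s..2}|lebesgue. indicator {s..2} x * G x)"
      by (rule LINT_extend[symmetric]) (use that in auto)
    also have "\<dots> = (LINT x:{s..2}|lebesgue. G x)" by (rule set_lebesgue_integral_cong) auto
    also have "\<dots> = integral {s..2} G"
      by (rule set_lebesgue_integral_eq_integral(2), rule set_integrable_subset[OF G]) (use that in auto)
    also have "\<dots> = prim G 2 - prim G s" by (rule prim_diff[OF G, symmetric]) (use that in auto)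
    finally show ?thesis .
  qed
  have "integrable_22 (\<lambda>x. G x * spline_e L x) \<and>
    (LINT x:{-2..2}|lebesgue. G x * spline_e L x) = (\<Sum>(s, c, d, e)\<leftarrow>L. e * (prim G 2 - prim G s))"
    using L
  proof (induction L)
    case Nil show ?case by (simp add: spline_e_def set_integrable_def)
  next
    case (Cons a L)
    obtain s c d e where a: "a = (s, c, d, e)" by (cases a)
    have IH: "integrable_22 (\<lambda>x. G x * spline_e L x)"
      "(LINT x:{-2..2}|lebesgue. G x * spline_e L x) = (\<Sum>(s, c, d, e)\<leftarrow>L. e * (prim G 2 - prim G s))"
      using Cons.IH Cons.prems by auto
    have eq: "(\<lambda>x. G x * spline_e (a # L) x) = (\<lambda>x. G x * (if s < x then e else 0) + G x * spline_e L x)"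
      by (simp add: spline_e_def a fun_eq_iff distrib_left)
    have s: "-2 \<le> s" "s \<le> 2" using Cons.prems a by auto
    show ?case unfolding eq using integrable_22_add[OF one IH(1)] set_integral_add(2)[OF one IH(1), of s e] IH(2) val[OF s, of e]
      by (simp add: a)
  qed
  then show "integrable_22 (\<lambda>x. G x * spline_e L x)"
    "(LINT x:{-2..2}|lebesgue. G x * spline_e L x) = (\<Sum>(s, c, d, e)\<leftarrow>L. e * (prim G 2 - prim G s))" by blast+
qed

definition tent_quot :: "real \<Rightarrow> real \<Rightarrow> real \<Rightarrow> real \<Rightarrow> (real \<Rightarrow> real) \<Rightarrow> real" where
  "tent_quot a b c \<delta> P = (c - b) * ((P (a + \<delta>) - P a) / \<delta>) - (c - a) * ((P (b + \<delta>) - P b) / \<delta>) + (b - a) * ((P (c + \<delta>) - P c) / \<delta>)"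

lemma LINT_tent:
  assumes G: "integrable_22 G" and "-2 \<le> a" "a < b" "b < c" "0 < \<delta>" "c + \<delta> \<le> 2"
  shows "(LINT x:{-2..2}|lebesgue. G x * spline_e (tent a b c \<delta>) x) = tent_quot a b c \<delta> (prim G)"
proof -
  have "(LINT x:{-2..2}|lebesgue. G x * spline_e (tent a b c \<delta>) x) = (\<Sum>(s, c, d, e)\<leftarrow>tent a b c \<delta>. e * (prim G 2 - prim G s))"
    by (rule LINT_spline_e(2)[OF G]) (use assms in \<open>auto simp: tent_def\<close>)
  also have "\<dots> = tent_quot a b c \<delta> (prim G)" using assms(5) by (simp add: tent_def tent_quot_def field_simps)
  finally show ?thesis .
qed

text \<open>The spline representation holds almost everywhere, and continuity of both sides makes it
  pointwise. The vanishing of both primitives at 2 removes the boundary terms from the double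
  integration by parts that follows.\<close>

lemma prim_tent:
  assumes "-2 \<le> a" "a < b" "b < c" "0 < \<delta>" "c + \<delta> < 2"
  shows "x \<in> {-2<..<2} \<Longrightarrow> spline (tent a b c \<delta>) x = prim (prim (spline_e (tent a b c \<delta>))) x"
    "prim (spline_e (tent a b c \<delta>)) 2 = 0" "prim (prim (spline_e (tent a b c \<delta>))) 2 = 0"
proof -
  let ?L = "tent a b c \<delta>" and ?P = "prim (prim (spline_e (tent a b c \<delta>)))"
  have nodes: "-2 \<le> s" if "(s, c', d, e) \<in> set ?L" for s c' d e
    using that assms by (auto simp: tent_def)
  have P: "(?P has_real_derivative prim (spline_e ?L) x) (at x)" if "x \<in> {-2<..<2}" for x
    by (rule prim_DERIV[OF integrable_22_prim[OF integrable_22_spline_e] prim_isCont[OF integrable_22_spline_e]]) (use that in auto)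
  have "pwH2 (spline ?L) (\<lambda>_. 0) (\<lambda>_. 0) (spline_e ?L)"
  proof -
    have "pwH2 (spline ?L) (spline_c ?L) (spline_d ?L) (spline_e ?L)" by (rule pwH2_spline) (rule nodes)
    then show ?thesis by (simp only: tent_jumps)
  qed
  then have ae: "AE x in lebesgue. x \<in> {-2<..<2} \<longrightarrow> spline ?L x = ?P x"
    using pwac_AE[OF pwH2D(1)] by fastforce
  have sc: "isCont (spline ?L) x" for x
  proof -
    have "spline ?L = (\<lambda>x. \<Sum>(s, c, d, e)\<leftarrow>?L. e * ((max 0 (x - s))\<^sup>2 / 2))"
    proof -
      have "(if s < x then e * (x - s)\<^sup>2 / 2 else 0) = e * ((max 0 (x - s))\<^sup>2 / 2)" for s x e :: real by (simp add: max_def)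
      then show ?thesis unfolding spline_def tent_def fun_eq_iff
        by (simp only: list.map prod.case sum_list.Cons sum_list.Nil mult_zero_left add_0_left simp_thms)
    qed
    moreover have "isCont (\<lambda>x. \<Sum>(s, c, d, e)\<leftarrow>L. e * ((max 0 (x - s))\<^sup>2 / 2)) x" for L :: "(real \<times> real \<times> real \<times> real) list"
    proof (induction L)
      case (Cons a L)
      then show ?case by (cases a) (auto intro!: continuous_intros)
    qed simp
    ultimately show ?thesis by simp
  qed
  show eq: "spline ?L x = ?P x" if x: "x \<in> {-2<..<2}" for x
  proof -
    have "has_rlim (spline ?L) x (spline ?L x)"
      by (rule has_rlimI[of 1]) (use sc[of x] in \<open>auto simp: isCont_def filterlim_at_split\<close>)
    moreover have "has_rlim (spline ?L) x (?P x)"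
    proof (rule has_rlimI[of "2 - x"])
      show "AE y in lebesgue. y \<in> {x<..<x + (2 - x)} \<longrightarrow> spline ?L y = ?P y"
        using ae by eventually_elim (use x in auto)
      show "(?P \<longlongrightarrow> ?P x) (at_right x)"
        using prim_isCont[OF integrable_22_prim[OF integrable_22_spline_e[of ?L]], of x] by (auto simp: isCont_def filterlim_at_split)
    qed (use x in auto)
    ultimately show ?thesis by (rule has_rlim_unique)
  qed
  show "prim (spline_e ?L) 2 = 0"
  proof -
    have "prim (spline_e ?L) 2 = (\<Sum>(s, c, d, e)\<leftarrow>?L. e * max 0 (2 - s))"
      by (rule prim_spline_e) (use nodes in auto)
    then show ?thesis using assms by (simp add: tent_def field_simps)
  qed
  have "?P 2 = 0"
  proof -
    have "?P x = 0" if "c + \<delta> < x" "x < 2" for x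
      using eq[of x] tent_zero(1)[of a b c \<delta> x] that assms by auto
    then have "\<forall>\<^sub>F x in at_left 2. ?P x = 0"
      unfolding eventually_at_left_field using assms(5) by (intro exI[of _ "c + \<delta>"]) auto
    then have "(?P \<longlongrightarrow> 0) (at_left 2)" by (simp add: tendsto_eventually)
    moreover have "(?P \<longlongrightarrow> ?P 2) (at_left 2)"
      using prim_isCont[OF integrable_22_prim[OF integrable_22_spline_e[of ?L]], of 2] by (auto simp: isCont_def filterlim_at_split)
    ultimately show ?thesis using tendsto_unique[of "at_left (2::real)"] by (metis trivial_limit_at_left_real)
  qed
  then show "?P 2 = 0" .
qed

lemma double_by_parts:
  assumes "integrable_22 f" "integrable_22 e" "prim e 2 = 0" "prim (prim e) 2 = 0"
  shows "(LINT x:{-2..2}|lebesgue. f x * prim (prim e) x) = (LINT x:{-2..2}|lebesgue. prim (prim f) x * e x)"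
  using prim_by_parts[OF assms(1) integrable_22_prim[OF assms(2)]] prim_by_parts[OF integrable_22_prim[OF assms(1)] assms(2)] assms(3,4)
  by (simp add: mult.commute)

section \<open>Tent variations of a minimiser\<close>

context minimizer
begin

text \<open>Square integrability of h is known on (-1,1) only; the extension by zero makes the
  primitives on (-2,2) available.\<close>

definition h1 :: "real \<Rightarrow> real" where "h1 x = (if x \<in> {-1<..<1} then h x else 0)"
definition hp1 :: "real \<Rightarrow> real" where "hp1 x = (if x \<in> {-1<..<1} then hp x else 0)"
definition G :: "real \<Rightarrow> real" where "G x = \<eta> * r x - prim (prim h1) x"
definition Gp :: "real \<Rightarrow> real" where "Gp x = \<gamma> * rp x - prim (prim hp1) x"

lemma integrable_22_h1: "integrable_22 h1" "integrable_22 hp1"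
proof -
  have "L2 {-2<..<2} (\<lambda>x. indicator {-1<..<1} x * h x)" "L2 {-2<..<2} (\<lambda>x. indicator {-1<..<1} x * hp x)"
    using h_L2 by (auto intro!: L2_indicator_mult)
  moreover have "(\<lambda>x. indicator {-1<..<1} x * h x) = h1" "(\<lambda>x. indicator {-1<..<1} x * hp x) = hp1"
    by (auto simp: h1_def hp1_def indicator_def)
  ultimately show "integrable_22 h1" "integrable_22 hp1" by (simp_all add: L2_integrable_22)
qed

lemma integrable_22_G: "integrable_22 G" "integrable_22 Gp"
  unfolding G_def[abs_def] Gp_def[abs_def]
  by (intro integrable_22_diff integrable_22_cmult integrable_22_prim integrable_22_h1 pwH2D(5)[OF ur] pwH2D(5)[OF up])+

text \<open>Two integrations by parts move the force onto the second derivative of the tent, where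
  it merges with the curvature term; this is the origin of the combination \<open>G\<close>. The
  coefficient, density and force are variables because the lemma serves both u_r and u_p.\<close>

lemma tent_LINT_aux:
  assumes abc: "-1 < a" "a < b" "b < c'" "0 < \<delta>" "c' + \<delta> < 1" and r: "integrable_22 r'" and k1: "integrable_22 k1"
    and k: "\<And>x. x \<in> {-1<..<1} \<Longrightarrow> k1 x = k x" "\<And>x. x \<notin> {-1<..<1} \<Longrightarrow> k1 x = 0"
  shows "I11 (\<lambda>x. \<eta>' * (r' x * spline_e (tent a b c' \<delta>) x) - k x * spline (tent a b c' \<delta>) x)
     = tent_quot a b c' \<delta> (prim (\<lambda>x. \<eta>' * r' x - prim (prim k1) x))"
proof -
  let ?e = "spline_e (tent a b c' \<delta>)" and ?s = "spline (tent a b c' \<delta>)"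
  have L2: "-2 \<le> s \<and> s \<le> 2" if "(s, c, d, e) \<in> set (tent a b c' \<delta>)" for s c d e using that abc by (auto simp: tent_def)
  note P = prim_tent[of a b c' \<delta>]
  have ie: "integrable_22 ?e" by (rule integrable_22_spline_e)
  have "I11 (\<lambda>x. \<eta>' * (r' x * ?e x) - k x * ?s x) = I11 (\<lambda>x. \<eta>' * (r' x * ?e x) - k1 x * prim (prim ?e) x)"
    by (rule set_lebesgue_integral_cong) (use k P(1) abc in auto)
  also have "\<dots> = (LINT x:{-2..2}|lebesgue. \<eta>' * (r' x * ?e x) - k1 x * prim (prim ?e) x)"
  proof -
    have "AE x in lebesgue. x \<noteq> c' + \<delta>" using AE_lborel_singleton[of "c' + \<delta>"] by (rule AE_completion)
    then have ae: "AE x in lebesgue. x \<in> {-2..2} \<longrightarrow> \<eta>' * (r' x * ?e x) - k1 x * prim (prim ?e) x = indicator {-1<..<1} x * (\<eta>' * (r' x * ?e x) - k1 x * prim (prim ?e) x)"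
    proof eventually_elim
      case (elim x)
      have "?e x = 0 \<and> k1 x = 0" if "x \<notin> {-1<..<1}"
        using tent_zero(2)[of a b c' \<delta> x] elim abc that k(2) by fastforce
      then show ?case by (cases "x \<in> {-1<..<1}") auto
    qed
    have "I11 (\<lambda>x. \<eta>' * (r' x * ?e x) - k1 x * prim (prim ?e) x) = I11 (\<lambda>x. indicator {-1<..<1} x * (\<eta>' * (r' x * ?e x) - k1 x * prim (prim ?e) x))"
      by (rule set_lebesgue_integral_cong) auto
    also have "\<dots> = (LINT x:{-2..2}|lebesgue. indicator {-1<..<1} x * (\<eta>' * (r' x * ?e x) - k1 x * prim (prim ?e) x))"
      by (rule LINT_extend) auto
    finally show ?thesis using LINT_cong_AE[OF ae] by simp
  qed
  also have "\<dots> = (LINT x:{-2..2}|lebesgue. \<eta>' * (r' x * ?e x)) - (LINT x:{-2..2}|lebesgue. k1 x * prim (prim ?e) x)"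
  proof (rule set_integral_diff(2))
    show "integrable_22 (\<lambda>x. \<eta>' * (r' x * ?e x))"
      by (rule integrable_22_cmult, rule LINT_spline_e(1)[OF r]) (use L2 in blast)
    obtain B where "\<And>x. \<bar>prim (prim ?e) x\<bar> \<le> B" using prim_bounded[OF integrable_22_prim[OF ie]] by blast
    then show "integrable_22 (\<lambda>x. k1 x * prim (prim ?e) x)"
      by (intro absolutely_integrable_mult_bounded[OF k1] prim_measurable integrable_22_prim ie) auto
  qed
  also have "(LINT x:{-2..2}|lebesgue. k1 x * prim (prim ?e) x) = (LINT x:{-2..2}|lebesgue. prim (prim k1) x * ?e x)"
    by (rule double_by_parts[OF k1 ie P(2,3)]) (use abc in auto)
  also have "(LINT x:{-2..2}|lebesgue. \<eta>' * (r' x * ?e x)) - (LINT x:{-2..2}|lebesgue. prim (prim k1) x * ?e x)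
     = (LINT x:{-2..2}|lebesgue. \<eta>' * (r' x * ?e x) - prim (prim k1) x * ?e x)"
    by (rule set_integral_diff(2)[symmetric]; (rule integrable_22_cmult)?; rule LINT_spline_e(1); (intro r integrable_22_prim k1)?; use L2 in blast)
  also have "\<dots> = (LINT x:{-2..2}|lebesgue. (\<eta>' * r' x - prim (prim k1) x) * ?e x)"
    by (rule set_lebesgue_integral_cong) (auto simp: algebra_simps)
  also have "\<dots> = tent_quot a b c' \<delta> (prim (\<lambda>x. \<eta>' * r' x - prim (prim k1) x))"
    by (rule LINT_tent) (use abc r k1 in \<open>auto intro!: integrable_22_diff integrable_22_cmult integrable_22_prim\<close>)
  finally show ?thesis .
qed

text \<open>The two coefficients cover all uses: raising u_r alone, moving u_r and u_p together in
  either direction, and lowering u_r where there is room above u_p.\<close>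

lemma tent_variation:
  assumes abc: "-1 < a" "a < b" "b < c'" "0 < \<delta>" "c' + \<delta> < 1"
    and adm: "\<epsilon>0 > 0" "AE x in lebesgue. x \<in> {-1<..<1} \<longrightarrow> (\<forall>\<epsilon>. 0 < \<epsilon> \<longrightarrow> \<epsilon> < \<epsilon>0 \<longrightarrow>
      up x + \<epsilon> * (kp * spline (tent a b c' \<delta>) x) \<le> ur x + \<epsilon> * (k * spline (tent a b c' \<delta>) x))"
  shows "0 \<le> k * tent_quot a b c' \<delta> (prim G) + kp * tent_quot a b c' \<delta> (prim Gp)"
proof -
  let ?e = "spline_e (tent a b c' \<delta>)" and ?s = "spline (tent a b c' \<delta>)"
  have ps: "pwH2 ?s (\<lambda>_. 0) (\<lambda>_. 0) ?e"
  proof -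
    have "pwH2 ?s (spline_c (tent a b c' \<delta>)) (spline_d (tent a b c' \<delta>)) ?e"
      by (rule pwH2_spline) (use abc in \<open>auto simp: tent_def\<close>)
    then show ?thesis by (simp only: tent_jumps)
  qed
  have p: "pwH2 (\<lambda>x. l * ?s x) (\<lambda>_. l * 0) (\<lambda>_. l * 0) (\<lambda>x. l * ?e x)" for l by (rule pwH2_cmult[OF ps])
  have "0 \<le> I11 (\<lambda>x. \<eta> * (r x * (k * ?e x)) - h x * (k * ?s x)) + I11 (\<lambda>x. \<gamma> * (rp x * (kp * ?e x)) - hp x * (kp * ?s x))"
    by (rule first_variation[OF p p _ _ _ _ adm]) (use tent_zero(1)[of a b c' \<delta>] abc in force)+
  also have "I11 (\<lambda>x. \<eta> * (r x * (k * ?e x)) - h x * (k * ?s x)) = k * I11 (\<lambda>x. \<eta> * (r x * ?e x) - h x * ?s x)"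
    unfolding I11_cmult[symmetric] by (rule set_lebesgue_integral_cong) (auto simp: algebra_simps)
  also have "I11 (\<lambda>x. \<gamma> * (rp x * (kp * ?e x)) - hp x * (kp * ?s x)) = kp * I11 (\<lambda>x. \<gamma> * (rp x * ?e x) - hp x * ?s x)"
    unfolding I11_cmult[symmetric] by (rule set_lebesgue_integral_cong) (auto simp: algebra_simps)
  also have "I11 (\<lambda>x. \<eta> * (r x * ?e x) - h x * ?s x) = tent_quot a b c' \<delta> (prim G)"
    unfolding G_def[abs_def] by (rule tent_LINT_aux[OF abc pwH2D(5)[OF ur] integrable_22_h1(1)]) (auto simp: h1_def)
  also have "I11 (\<lambda>x. \<gamma> * (rp x * ?e x) - hp x * ?s x) = tent_quot a b c' \<delta> (prim Gp)"
    unfolding Gp_def[abs_def] by (rule tent_LINT_aux[OF abc pwH2D(5)[OF up] integrable_22_h1(2)]) (auto simp: hp1_def)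
  finally show ?thesis .
qed

end

section \<open>Auxiliary facts on primitives, integrals and monotone functions\<close>

lemma jumps_const:
  assumes "\<And>s. s \<in> {p<..<q} \<Longrightarrow> c s = 0"
  obtains k where "\<And>x. x \<in> {p<..<q} \<Longrightarrow> jumps c x = k"
proof
  fix x assume x: "x \<in> {p<..<q}"
  show "jumps c x = (\<Sum>s | c s \<noteq> 0. c s * (if s \<le> p then 1 else 0))"
    unfolding jumps_def
  proof (rule sum.cong[OF refl])
    fix s assume "s \<in> {s. c s \<noteq> 0}"
    then have "s \<le> p \<or> q \<le> s" using assms[of s] by force
    then show "c s * indicator {s<..} x = c s * (if s \<le> p then 1 else 0)" using x by (auto simp: indicator_def)
  qed
qed

lemma prim_lipschitz:
  assumes f: "integrable_22 f" "\<And>x. \<bar>f x\<bar> \<le> B" and "-2 \<le> y" "y \<le> z" "z \<le> 2"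
  shows "\<bar>prim f z - prim f y\<bar> \<le> B * (z - y)"
proof -
  have i: "f integrable_on {y..z}" by (rule integrable_22_sub[OF f(1)]) (use assms in auto)
  have "norm (integral {y..z} f) \<le> integral {y..z} (\<lambda>_. B)"
    by (rule integral_norm_bound_integral[OF i]) (use f(2) in auto)
  then show ?thesis using assms(4) by (simp add: prim_diff[OF f(1) assms(3-5)] mult.commute)
qed

text \<open>A function that is positive almost everywhere on a nondegenerate interval has a positive
  integral. Avoiding \<open>N\<close> allows the point to be taken where the densities are
  controlled pointwise.\<close>

lemma exists_nonpos_of_integral_zero:
  fixes F :: "real \<Rightarrow> real"
  assumes F: "F absolutely_integrable_on {a..b}" and "a < b" "integral {a..b} F = 0" and N: "negligible N"
  obtains y where "y \<in> {a<..<b} - N" "F y \<le> 0"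
proof (rule ccontr)
  assume "\<not> thesis"
  then have pos: "F y > 0" if "y \<in> {a<..<b} - N" for y using that \<open>\<And>y. _ \<Longrightarrow> _ \<Longrightarrow> thesis\<close> by force
  have Fo: "F absolutely_integrable_on {a<..<b}" by (rule set_integrable_subset[OF F]) auto
  have aeN: "AE y in lebesgue. y \<notin> N" using N by (simp add: negligible_iff_null_sets AE_not_in)
  have "(LINT y:{a<..<b}|lebesgue. F y) = integral {a<..<b} F" by (rule set_lebesgue_integral_eq_integral(2)[OF Fo])
  also have "\<dots> = 0" using assms(3) by (simp add: integral_open_interval_real)
  finally have "(LINT y|lebesgue. indicator {a<..<b} y *\<^sub>R F y) = 0" by (simp add: set_lebesgue_integral_def)
  moreover have "AE y in lebesgue. 0 \<le> indicator {a<..<b} y *\<^sub>R F y"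
    using aeN by eventually_elim (use pos in \<open>auto simp: indicator_def less_imp_le\<close>)
  ultimately have "AE y in lebesgue. indicator {a<..<b} y *\<^sub>R F y = 0"
    using Fo integral_nonneg_eq_0_iff_AE unfolding set_integrable_def by blast
  with aeN have "AE y in lebesgue. y \<notin> {a<..<b}"
  proof eventually_elim
    case (elim y) then show ?case using pos[of y] by (cases "y \<in> {a<..<b}") auto
  qed
  then have "{a<..<b} \<in> null_sets lebesgue" by (subst (asm) AE_iff_null_sets[symmetric]) auto
  then show False using negligible_interval(2)[of a b] \<open>a < b\<close> by (simp add: negligible_iff_null_sets)
qed

lemma tent_quot_tendsto:
  assumes "\<And>x. x \<in> {a, b, c} \<Longrightarrow> ((\<lambda>\<delta>. (prim G (x + \<delta>) - prim G x) / \<delta>) \<longlongrightarrow> G x) (at_right 0)"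
  shows "((\<lambda>\<delta>. tent_quot a b c \<delta> (prim G)) \<longlongrightarrow> (c - b) * G a - (c - a) * G b + (b - a) * G c) (at_right 0)"
  unfolding tent_quot_def by (intro tendsto_intros assms) auto

text \<open>The right limit, written as an infimum over the points to the right, differs from g only
  at discontinuities. A monotone function has countably many of these, so integrals do not notice
  the change.\<close>

lemma mono_right_continuous_version:
  fixes g :: "real \<Rightarrow> real"
  assumes mono: "mono g" and B: "\<And>x. \<bar>g x\<bar> \<le> M"
  obtains gg where "mono gg" "\<And>x. continuous (at_right x) gg" "\<And>x. \<bar>gg x\<bar> \<le> M"
    "\<And>x y. x < y \<Longrightarrow> gg x \<le> g y" "\<And>x. g x \<le> gg x" "countable {x. gg x \<noteq> g x}"
proof -
  define gg where "gg x = Inf (g ` {x<..})" for x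
  have bdd: "bdd_below (g ` {x<..})" for x
  proof (rule bdd_belowI)
    fix z assume "z \<in> g ` {x<..}"
    then obtain y where "z = g y" by blast
    then show "- M \<le> z" using B[of y] by linarith
  qed
  have le: "gg x \<le> g y" if "x < y" for x y unfolding gg_def using that by (intro cInf_lower bdd) auto
  have ge: "g x \<le> gg x" for x unfolding gg_def using mono by (intro cInf_greatest) (auto simp: mono_def)
  have m: "gg x \<le> gg y" if "x \<le> y" for x y
    unfolding gg_def using that by (intro cInf_superset_mono bdd) auto
  have rc: "continuous (at_right x) gg" for x
    unfolding continuous_within
  proof (rule order_tendstoI)
    fix l assume "l < gg x"
    then show "\<forall>\<^sub>F y in at_right x. l < gg y"
      using m by (auto simp: eventually_at_filter intro!: always_eventually intro: less_le_trans)
  next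
    fix u assume "gg x < u"
    then obtain y where y: "x < y" "g y < u" unfolding gg_def using cInf_lessD[of "g ` {x<..}" u] by auto
    have "gg z < u" if "x < z" "z < y" for z using le[OF that(2)] y by simp
    then show "\<forall>\<^sub>F z in at_right x. gg z < u" unfolding eventually_at_right_field using y(1) by blast
  qed
  have "\<bar>gg x\<bar> \<le> M" for x using le[of x "x + 1"] ge[of x] B[of x] B[of "x + 1"] by (simp add: abs_le_iff)
  moreover have "{x. gg x \<noteq> g x} \<subseteq> {x. \<not> isCont g x}"
  proof
    fix x assume "x \<in> {x. gg x \<noteq> g x}"
    then have lt: "g x < gg x" using ge[of x] by auto
    show "x \<in> {x. \<not> isCont g x}"
    proof (rule CollectI, rule notI)
      assume "isCont g x"
      then have "(g \<longlongrightarrow> g x) (at_right x)" by (auto simp: isCont_def filterlim_at_split)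
      then have "\<forall>\<^sub>F y in at_right x. g y < gg x" using lt by (rule order_tendstoD)
      then obtain b where "x < b" "\<And>y. x < y \<Longrightarrow> y < b \<Longrightarrow> g y < gg x" unfolding eventually_at_right_field by blast
      moreover have "x < (x + b) / 2" "(x + b) / 2 < b" using \<open>x < b\<close> by simp_all
      ultimately show False using le[of x "(x + b) / 2"] by fastforce
    qed
  qed
  then have "countable {x. gg x \<noteq> g x}" using mono_ctble_discont[OF mono] countable_subset by blast
  ultimately show ?thesis using that[of gg] m rc le ge by (auto simp: mono_def)
qed

lemma spline_bounded:
  obtains B where "B > 0" "\<And>x. x \<in> {-1<..<1} \<Longrightarrow> \<bar>spline L x\<bar> \<le> B"
proof -
  have "\<exists>B. \<forall>x\<in>{-1<..<1}. \<bar>spline L x\<bar> \<le> B"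
  proof (induction L)
    case Nil show ?case by (auto simp: spline_def)
  next
    case (Cons a L)
    obtain s c d e where a: "a = (s, c, d, e)" by (cases a)
    obtain B where B: "\<And>x. x \<in> {-1<..<1} \<Longrightarrow> \<bar>spline L x\<bar> \<le> B" using Cons by blast
    have "compact ((\<lambda>x. c + d * (x - s) + e * (x - s)\<^sup>2 / 2) ` {-1..1})"
      by (intro compact_continuous_image continuous_intros) auto
    then obtain B' where B': "\<And>x. x \<in> {-1..1} \<Longrightarrow> \<bar>c + d * (x - s) + e * (x - s)\<^sup>2 / 2\<bar> \<le> B'"
      unfolding real_norm_def[symmetric] by (meson bounded_iff compact_imp_bounded imageI)
    have "\<bar>spline (a # L) x\<bar> \<le> \<bar>B'\<bar> + B" if "x \<in> {-1<..<1}" for x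
      using B[OF that] B'[of x] that by (auto simp: spline_def a)
    then show ?case by blast
  qed
  then obtain B where "\<And>x. x \<in> {-1<..<1} \<Longrightarrow> \<bar>spline L x\<bar> \<le> B" by blast
  then have "\<And>x. x \<in> {-1<..<1} \<Longrightarrow> \<bar>spline L x\<bar> \<le> max 1 B" by fastforce
  then show ?thesis using that[of "max 1 B"] by simp
qed

section \<open>The gap u_r - u_p and its contact points\<close>

context minimizer
begin

definition q :: "real \<Rightarrow> real" where "q x = jumps d x + prim r x"
definition qp :: "real \<Rightarrow> real" where "qp x = jumps dp x + prim rp x"

text \<open>The left-continuous representative of u_r - u_p. Inside (-2,2) the function u_p has no
  jumps, so D is the left limit of the difference and D + c its right limit.\<close>

definition D :: "real \<Rightarrow> real" where "D x = (jumps c x + prim q x) - (jumps cp x + prim qp x)"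

text \<open>A uniform positive distance lets bounded perturbations of either sign stay admissible
  for one range of \<epsilon>. The interval is open, so that an end may be a jump point at which
  only the inner limit is positive.\<close>

definition gap :: "real \<Rightarrow> real \<Rightarrow> bool" where "gap a b \<longleftrightarrow> (\<exists>\<rho>>0. \<forall>y\<in>{a<..<b}. \<rho> \<le> D y)"

lemma pwac_ur: "pwac ur c q" and pwac_up: "pwac up cp qp"
  using pwH2D(1)[OF ur] pwH2D(1)[OF up] by (simp_all add: q_def[abs_def] qp_def[abs_def])

lemma integrable_22_q: "integrable_22 q" "integrable_22 qp"
  using pwac_ur pwac_up by (simp_all add: pwac_def)

lemma finite_cd: "finite {s. c s \<noteq> 0}" "finite {s. d s \<noteq> 0}"
  using pwH2D(2,3)[OF ur] .

lemma D_AE: "AE x in lebesgue. x \<in> {-2<..<2} \<longrightarrow> ur x - up x = D x"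
  using pwac_AE[OF pwac_ur] pwac_AE[OF pwac_up] by eventually_elim (simp add: D_def)

lemma D_nonneg:
  assumes "x \<in> {-2<..<2}" shows "0 \<le> D x" "0 \<le> D x + c x"
proof -
  have "jumps cp x + prim qp x \<le> jumps c x + prim q x"
  proof (rule has_llim_le[OF pwac_has_llim[OF pwac_up] pwac_has_llim[OF pwac_ur], of x "x + 2"])
    show "AE y in lebesgue. y \<in> {x - (x + 2)<..<x} \<longrightarrow> up y \<le> ur y"
      using above_AE by eventually_elim (use assms in auto)
  qed (use assms in auto)
  then show "0 \<le> D x" by (simp add: D_def)
  have "jumps cp x + cp x + prim qp x \<le> jumps c x + c x + prim q x"
  proof (rule has_rlim_le[OF pwac_has_rlim[OF pwac_up] pwac_has_rlim[OF pwac_ur], of x "2 - x"])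
    show "AE y in lebesgue. y \<in> {x<..<x + (2 - x)} \<longrightarrow> up y \<le> ur y"
      using above_AE by eventually_elim (use assms in auto)
  qed (use assms in auto)
  then show "0 \<le> D x + c x" using upz[OF assms] by (simp add: D_def)
qed

lemma D_right:
  assumes "x \<in> {-2<..<2}" shows "(D \<longlongrightarrow> D x + c x) (at_right x)"
proof -
  obtain k where k: "\<And>y. y \<in> {-2<..<2} \<Longrightarrow> jumps cp y = k" using jumps_const[of "-2" 2 cp] upz by blast
  obtain \<delta> where \<delta>: "\<delta> > 0" "\<And>y. x < y \<Longrightarrow> y < x + \<delta> \<Longrightarrow> jumps c y = jumps c x + c x"
    by (rule jumps_local[OF finite_cd(1), of x]) blast
  have t: "((\<lambda>y. (jumps c x + c x + prim q y) - (k + prim qp y)) \<longlongrightarrow> (jumps c x + c x + prim q x) - (k + prim qp x)) (at_right x)"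
    using prim_isCont[OF integrable_22_q(1), of x] prim_isCont[OF integrable_22_q(2), of x]
    by (auto intro!: tendsto_intros simp: isCont_def filterlim_at_split)
  have "\<forall>\<^sub>F y in at_right x. (jumps c x + c x + prim q y) - (k + prim qp y) = D y"
    unfolding eventually_at_right_field D_def using \<delta> k assms
    by (intro exI[of _ "min (x + \<delta>) 2"]) auto
  from Lim_transform_eventually[OF t this] show ?thesis using k[OF assms] by (simp add: D_def[abs_def] algebra_simps)
qed

lemma D_left:
  assumes "x \<in> {-2<..<2}" shows "(D \<longlongrightarrow> D x) (at_left x)"
proof -
  obtain k where k: "\<And>y. y \<in> {-2<..<2} \<Longrightarrow> jumps cp y = k" using jumps_const[of "-2" 2 cp] upz by blast
  obtain \<delta> where \<delta>: "\<delta> > 0" "\<And>y. x - \<delta> < y \<Longrightarrow> y \<le> x \<Longrightarrow> jumps c y = jumps c x"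
    by (rule jumps_local[OF finite_cd(1), of x]) blast
  have t: "((\<lambda>y. (jumps c x + prim q y) - (k + prim qp y)) \<longlongrightarrow> (jumps c x + prim q x) - (k + prim qp x)) (at_left x)"
    using prim_isCont[OF integrable_22_q(1), of x] prim_isCont[OF integrable_22_q(2), of x]
    by (auto intro!: tendsto_intros simp: isCont_def filterlim_at_split)
  have "\<forall>\<^sub>F y in at_left x. (jumps c x + prim q y) - (k + prim qp y) = D y"
    unfolding eventually_at_left_field D_def
  proof (intro exI[of _ "max (x - \<delta>) (-2)"] conjI allI impI)
    fix y assume y: "max (x - \<delta>) (- 2) < y" "y < x"
    have "jumps c y = jumps c x" using \<delta>(2)[of y] y by simp
    moreover have "jumps cp y = k" using k[of y] y assms by simp
    ultimately show "jumps c x + prim q y - (k + prim qp y) = jumps c y + prim q y - (jumps cp y + prim qp y)" by simp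
  qed (use \<delta> assms in auto)
  from Lim_transform_eventually[OF t this] show ?thesis using k[OF assms] by (simp add: D_def[abs_def])
qed

lemma gap_right:
  assumes "x \<in> {-1..<1}" "D x + c x > 0"
  obtains b where "x < b" "b \<le> 1" "gap x b"
proof -
  have "\<forall>\<^sub>F y in at_right x. (D x + c x) / 2 < D y"
    by (rule order_tendstoD(1)[OF D_right[of x]]) (use assms in auto)
  then obtain b where "x < b" "\<And>y. x < y \<Longrightarrow> y < b \<Longrightarrow> (D x + c x) / 2 < D y" unfolding eventually_at_right_field by blast
  then have "gap x (min b 1)" unfolding gap_def using assms by (intro exI[of _ "(D x + c x) / 2"]) (auto intro!: less_imp_le)
  then show ?thesis using that[of "min b 1"] \<open>x < b\<close> assms by auto
qed

lemma gap_left: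
  assumes "x \<in> {-1<..1}" "D x > 0"
  obtains a where "a < x" "-1 \<le> a" "gap a x"
proof -
  have "\<forall>\<^sub>F y in at_left x. D x / 2 < D y"
    by (rule order_tendstoD(1)[OF D_left[of x]]) (use assms in auto)
  then obtain a where "a < x" "\<And>y. a < y \<Longrightarrow> y < x \<Longrightarrow> D x / 2 < D y" unfolding eventually_at_left_field by blast
  then have "gap (max a (-1)) x" unfolding gap_def using assms by (intro exI[of _ "D x / 2"]) (auto intro!: less_imp_le)
  then show ?thesis using that[of "max a (-1)"] \<open>a < x\<close> assms by auto
qed

lemma gap_at:
  assumes x: "x \<in> {-1<..<1}" and pos: "D x > 0" "D x + c x > 0"
  obtains a b where "-1 \<le> a" "a < x" "x < b" "b \<le> 1" "gap a b"
proof -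
  obtain b where b: "x < b" "b \<le> 1" "gap x b" using gap_right[of x] x pos by auto
  obtain a where a: "a < x" "-1 \<le> a" "gap a x" using gap_left[of x] x pos by auto
  obtain \<rho> \<rho>' where "\<rho> > 0" "\<rho>' > 0" "\<And>y. y \<in> {x<..<b} \<Longrightarrow> \<rho> \<le> D y" "\<And>y. y \<in> {a<..<x} \<Longrightarrow> \<rho>' \<le> D y"
    using a(3) b(3) unfolding gap_def by blast
  then have "\<forall>y\<in>{a<..<b}. min (min \<rho> \<rho>') (D x) \<le> D y"
  proof (intro ballI)
    fix y assume "y \<in> {a<..<b}"
    then consider "y \<in> {a<..<x}" | "y = x" | "y \<in> {x<..<b}" by force
    then show "min (min \<rho> \<rho>') (D x) \<le> D y"
      using \<open>\<And>y. y \<in> {x<..<b} \<Longrightarrow> \<rho> \<le> D y\<close>[of y] \<open>\<And>y. y \<in> {a<..<x} \<Longrightarrow> \<rho>' \<le> D y\<close>[of y] by cases auto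
  qed
  then have "gap a b" unfolding gap_def using \<open>\<rho> > 0\<close> \<open>\<rho>' > 0\<close> pos by (intro exI[of _ "min (min \<rho> \<rho>') (D x)"]) auto
  then show ?thesis using that a b by blast
qed

lemma tent_convex:
  assumes abc: "-1 < a" "a < b" "b < c'" "0 < \<delta>" "c' + \<delta> < 1"
  shows "0 \<le> tent_quot a b c' \<delta> (prim G)"
proof -
  have "0 \<le> 1 * tent_quot a b c' \<delta> (prim G) + 0 * tent_quot a b c' \<delta> (prim Gp)"
    by (rule tent_variation[OF abc, of 1])
       (use above_AE tent_nonneg[OF abc(2,3,4)] in \<open>auto elim!: eventually_mono intro!: add_increasing2\<close>)
  then show ?thesis by simp
qed

text \<open>The difference u_r - u_p is untouched, so both signs are admissible and the inequality
  becomes an equation.\<close>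

lemma tent_joint:
  assumes abc: "-1 < a" "a < b" "b < c'" "0 < \<delta>" "c' + \<delta> < 1"
  shows "tent_quot a b c' \<delta> (prim G) + tent_quot a b c' \<delta> (prim Gp) = 0"
proof -
  have "0 \<le> k * tent_quot a b c' \<delta> (prim G) + k * tent_quot a b c' \<delta> (prim Gp)" for k
    by (rule tent_variation[OF abc, of 1]) (use above_AE in \<open>auto elim!: eventually_mono\<close>)
  from this[of 1] this[of "-1"] show ?thesis by simp
qed

text \<open>Where D is at least \<open>\<rho>\<close>, the function u_r may also be lowered by
  \<epsilon> times a tent bounded by \<open>B\<close>, as long as \<epsilon> <
  \<open>\<rho> / B\<close>; this supplies the inequality opposite to convexity.\<close>

lemma tent_gap:
  assumes abc: "-1 < a" "a < b" "b < c'" "0 < \<delta>" "c' + \<delta> < 1" and g: "gap a (c' + \<delta>)"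
  shows "tent_quot a b c' \<delta> (prim G) = 0"
proof -
  let ?s = "spline (tent a b c' \<delta>)"
  obtain B where B: "B > 0" "\<And>x. x \<in> {-1<..<1} \<Longrightarrow> \<bar>?s x\<bar> \<le> B" using spline_bounded by blast
  obtain \<rho> where \<rho>: "\<rho> > 0" "\<And>y. y \<in> {a<..<c' + \<delta>} \<Longrightarrow> \<rho> \<le> D y" using g unfolding gap_def by blast
  have "0 \<le> -1 * tent_quot a b c' \<delta> (prim G) + 0 * tent_quot a b c' \<delta> (prim Gp)"
  proof (rule tent_variation[OF abc, of "\<rho> / B"])
    show "AE x in lebesgue. x \<in> {-1<..<1} \<longrightarrow> (\<forall>\<epsilon>. 0 < \<epsilon> \<longrightarrow> \<epsilon> < \<rho> / B \<longrightarrow> up x + \<epsilon> * (0 * ?s x) \<le> ur x + \<epsilon> * (-1 * ?s x))"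
      using above_AE D_AE
    proof eventually_elim
      case (elim x)
      show ?case
      proof (intro impI allI)
        fix \<epsilon> assume x: "x \<in> {-1<..<1}" and \<epsilon>: "0 < \<epsilon>" "\<epsilon> < \<rho> / B"
        show "up x + \<epsilon> * (0 * ?s x) \<le> ur x + \<epsilon> * (-1 * ?s x)"
        proof (cases "x \<in> {a<..<c' + \<delta>}")
          case True
          have "\<epsilon> * ?s x \<le> \<epsilon> * B" using B(2)[OF x] \<epsilon> by (intro mult_left_mono) auto
          also have "\<dots> \<le> \<rho>" using \<epsilon> B(1) by (simp add: less_divide_eq)
          also have "\<dots> \<le> ur x - up x" using \<rho>(2)[OF True] elim(2) x by simp
          finally show ?thesis by simp
        next
          case False
          then show ?thesis using tent_zero(1)[OF abc(2,3,4) False] elim(1) x by simp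
        qed
      qed
    qed
  qed (use \<rho> B in simp)
  then show ?thesis using tent_convex[OF abc] by simp
qed

end

lemma affine_on_dense:
  fixes f :: "real \<Rightarrow> real"
  assumes "\<And>a b c. a \<in> E \<Longrightarrow> b \<in> E \<Longrightarrow> c \<in> E \<Longrightarrow> a < b \<Longrightarrow> b < c \<Longrightarrow> (c - b) * f a - (c - a) * f b + (b - a) * f c = 0"
    and "u \<in> E" "v \<in> E" "u < v"
  obtains A B where "\<And>x. x \<in> E \<Longrightarrow> f x = A + B * x"
proof
  fix x assume x: "x \<in> E"
  have *: "(f v - f u) * (x - u) = (f x - f u) * (v - u)"
  proof -
    consider "x < u" | "x = u" | "u < x \<and> x < v" | "x = v" | "v < x" by linarith
    then show ?thesis
    proof cases
      case 1 then show ?thesis using assms(1)[of x u v] assms(2-4) x by (simp add: algebra_simps)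
    next
      case 3 then show ?thesis using assms(1)[of u x v] assms(2-4) x by (simp add: algebra_simps)
    next
      case 5 then show ?thesis using assms(1)[of u v x] assms(2-4) x by (simp add: algebra_simps)
    qed auto
  qed
  then have "f x - f u = (f v - f u) / (v - u) * (x - u)" using assms(4) by (simp add: field_simps)
  then show "f x = (f u - (f v - f u) / (v - u) * u) + (f v - f u) / (v - u) * x" by (simp add: right_diff_distrib)
qed

lemma dense_complement:
  assumes "negligible N" "p < (t::real)"
  obtains x where "x \<notin> N" "p < x" "x < t"
proof -
  have "\<not> negligible {p<..<t}" using negligible_interval(2)[of p t] assms(2) by simp
  then have "\<not> {p<..<t} \<subseteq> N" using negligible_subset[OF assms(1)] by blast
  then obtain x where "x \<in> {p<..<t}" "x \<notin> N" by blast
  then show ?thesis using that[of x] by auto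
qed

section \<open>Construction of the monotone third derivative\<close>

context minimizer
begin

text \<open>As \<delta> tends to 0, the tents with fixed nodes turn into divided second differences
  of G and G_p. One null set collects the points at which either of the two difference quotients
  fails to converge.\<close>

lemma lebesgue_set:
  obtains N where "negligible N"
    "\<And>a b c. a \<in> {-1<..<1} - N \<Longrightarrow> b \<in> {-1<..<1} - N \<Longrightarrow> c \<in> {-1<..<1} - N \<Longrightarrow> a < b \<Longrightarrow> b < c \<Longrightarrow>
       (c - a) * G b \<le> (c - b) * G a + (b - a) * G c"
    "\<And>a b c. a \<in> {-1<..<1} - N \<Longrightarrow> b \<in> {-1<..<1} - N \<Longrightarrow> c \<in> {-1<..<1} - N \<Longrightarrow> a < b \<Longrightarrow> b < c \<Longrightarrow>
       (c - b) * (G a + Gp a) - (c - a) * (G b + Gp b) + (b - a) * (G c + Gp c) = 0"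
    "\<And>p t a b c. gap p t \<Longrightarrow> a \<in> {-1<..<1} - N \<Longrightarrow> b \<in> {-1<..<1} - N \<Longrightarrow> c \<in> {-1<..<1} - N \<Longrightarrow> p < a \<Longrightarrow> a < b \<Longrightarrow> b < c \<Longrightarrow> c < t \<Longrightarrow>
       (c - b) * G a - (c - a) * G b + (b - a) * G c = 0"
proof -
  obtain N1 where N1: "negligible N1" "\<And>x. x \<in> {-2<..<2} - N1 \<Longrightarrow> ((\<lambda>\<delta>. (prim G (x + \<delta>) - prim G x) / \<delta>) \<longlongrightarrow> G x) (at_right 0)"
    using lebesgue_points[OF integrable_22_G(1)] by blast
  obtain N2 where N2: "negligible N2" "\<And>x. x \<in> {-2<..<2} - N2 \<Longrightarrow> ((\<lambda>\<delta>. (prim Gp (x + \<delta>) - prim Gp x) / \<delta>) \<longlongrightarrow> Gp x) (at_right 0)"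
    using lebesgue_points[OF integrable_22_G(2)] by blast
  let ?N = "N1 \<union> N2"
  have lim: "((\<lambda>\<delta>. tent_quot a b c \<delta> (prim G)) \<longlongrightarrow> (c - b) * G a - (c - a) * G b + (b - a) * G c) (at_right 0)"
    "((\<lambda>\<delta>. tent_quot a b c \<delta> (prim Gp)) \<longlongrightarrow> (c - b) * Gp a - (c - a) * Gp b + (b - a) * Gp c) (at_right 0)"
    if "a \<in> {-1<..<1} - ?N" "b \<in> {-1<..<1} - ?N" "c \<in> {-1<..<1} - ?N" for a b c
  proof -
    have "x \<in> {-2<..<2} - N1" "x \<in> {-2<..<2} - N2" if "x \<in> {a, b, c}" for x
      using that \<open>a \<in> _\<close> \<open>b \<in> _\<close> \<open>c \<in> _\<close> by auto
    then show "((\<lambda>\<delta>. tent_quot a b c \<delta> (prim G)) \<longlongrightarrow> (c - b) * G a - (c - a) * G b + (b - a) * G c) (at_right 0)"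
      "((\<lambda>\<delta>. tent_quot a b c \<delta> (prim Gp)) \<longlongrightarrow> (c - b) * Gp a - (c - a) * Gp b + (b - a) * Gp c) (at_right 0)"
      using N1(2) N2(2) by (intro tent_quot_tendsto; blast)+
  qed
  have ev: "\<forall>\<^sub>F \<delta> in at_right 0. P \<delta>" if "\<And>\<delta>. 0 < \<delta> \<Longrightarrow> c + \<delta> < u \<Longrightarrow> P \<delta>" "c < u" for P c and u :: real
    unfolding eventually_at_right_field using that by (intro exI[of _ "u - c"]) auto
  show ?thesis
  proof (rule that)
    show "negligible ?N" using N1 N2 by simp
    fix a b c assume E: "a \<in> {-1<..<1} - ?N" "b \<in> {-1<..<1} - ?N" "c \<in> {-1<..<1} - ?N" and abc: "a < b" "b < c"
    have "0 \<le> (c - b) * G a - (c - a) * G b + (b - a) * G c"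
    proof (rule tendsto_lowerbound[OF lim(1)[OF E]])
      show "\<forall>\<^sub>F \<delta> in at_right 0. 0 \<le> tent_quot a b c \<delta> (prim G)"
        by (rule ev[of c 1]) (use E abc in \<open>auto intro!: tent_convex\<close>)
    qed simp
    then show "(c - a) * G b \<le> (c - b) * G a + (b - a) * G c" by simp
    have "(c - b) * G a - (c - a) * G b + (b - a) * G c + ((c - b) * Gp a - (c - a) * Gp b + (b - a) * Gp c) = 0"
    proof (rule tendsto_unique[OF _ tendsto_add[OF lim[OF E]]])
      show "((\<lambda>\<delta>. tent_quot a b c \<delta> (prim G) + tent_quot a b c \<delta> (prim Gp)) \<longlongrightarrow> 0) (at_right 0)"
        by (rule tendsto_eventually, rule ev[of c 1]) (use E abc in \<open>auto intro!: tent_joint\<close>)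
    qed simp
    then show "(c - b) * (G a + Gp a) - (c - a) * (G b + Gp b) + (b - a) * (G c + Gp c) = 0" by (simp add: algebra_simps)
    fix p t assume "gap p t" "p < a" "c < t"
    then have g: "gap a (c + \<delta>)" if "c + \<delta> < t" for \<delta> using that unfolding gap_def by force
    show "(c - b) * G a - (c - a) * G b + (b - a) * G c = 0"
    proof (rule tendsto_unique[OF _ lim(1)[OF E]])
      show "((\<lambda>\<delta>. tent_quot a b c \<delta> (prim G)) \<longlongrightarrow> 0) (at_right 0)"
        by (rule tendsto_eventually, rule ev[of c "min 1 t"]) (use E abc g \<open>c < t\<close> in \<open>auto intro!: tent_gap\<close>)
    qed simp
  qed
qed

text \<open>The slope \<open>D1\<close> of the gap vanishes at x1 and x2 and, by Rolle, at some
  \<xi> between them. So r - r_p has integral 0 over [x1,\<xi>] and over [\<xi>,x2] and takes both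
  signs, weakly, on each of them. The pair y1, z1 shows a change from nonpositive to nonnegative,
  the pair y2, z2 the opposite change.\<close>

lemma contact_slopes:
  assumes pt: "-1 \<le> p" "p < t" "t \<le> 1" and z: "\<And>s. s \<in> {p<..<t} \<Longrightarrow> c s = 0 \<and> d s = 0"
    and x: "p < x1" "x1 < x2" "x2 < t" "D x1 = 0" "D x2 = 0" and N: "negligible N"
  obtains y1 z1 y2 z2 where "x1 < y1" "y1 < z1" "z1 < x2" "y1 \<notin> N" "z1 \<notin> N" "r y1 - rp y1 \<le> 0" "0 \<le> r z1 - rp z1"
    "x1 < y2" "y2 < z2" "z2 < x2" "y2 \<notin> N" "z2 \<notin> N" "0 \<le> r y2 - rp y2" "r z2 - rp z2 \<le> 0"
proof -
  obtain k1 where k1: "\<And>y. y \<in> {p<..<t} \<Longrightarrow> jumps c y = k1" using jumps_const[of p t c] z by blast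
  obtain k2 where k2: "\<And>y. y \<in> {p<..<t} \<Longrightarrow> jumps d y = k2" using jumps_const[of p t d] z by blast
  obtain k3 where k3: "\<And>y. y \<in> {-2<..<2} \<Longrightarrow> jumps cp y = k3" using jumps_const[of "-2" 2 cp] upz by blast
  obtain k4 where k4: "\<And>y. y \<in> {-2<..<2} \<Longrightarrow> jumps dp y = k4" using jumps_const[of "-2" 2 dp] upz by blast
  let ?F = "\<lambda>y. r y - rp y"
  have rr: "integrable_22 r" "integrable_22 rp" using pwH2D(5)[OF ur] pwH2D(5)[OF up] .
  define D1 where "D1 y = (k2 + prim r y) - (k4 + prim rp y)" for y
  have qc: "isCont q y" "q y = k2 + prim r y" "isCont qp y" "qp y = k4 + prim rp y" if y: "y \<in> {p<..<t}" for y
  proof -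
    have y2: "y \<in> {-2<..<2}" using y pt by auto
    have "isCont (\<lambda>y. k2 + prim r y) y" using prim_isCont[OF rr(1)] by (intro continuous_intros)
    moreover have "\<forall>\<^sub>F w in nhds y. q w = k2 + prim r w"
      using eventually_nhds_in_open[of "{p<..<t}" y] y by (auto elim!: eventually_mono simp: q_def k2)
    ultimately show "isCont q y" using isCont_cong[of q "\<lambda>y. k2 + prim r y" y] by simp
    have "isCont (\<lambda>y. k4 + prim rp y) y" using prim_isCont[OF rr(2)] by (intro continuous_intros)
    moreover have "\<forall>\<^sub>F w in nhds y. qp w = k4 + prim rp w"
      using eventually_nhds_in_open[of "{-2<..<2}" y] y2 by (auto elim!: eventually_mono simp: qp_def k4)
    ultimately show "isCont qp y" using isCont_cong[of qp "\<lambda>y. k4 + prim rp y" y] by simp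
    show "q y = k2 + prim r y" "qp y = k4 + prim rp y" using k2[OF y] k4[OF y2] by (simp_all add: q_def qp_def)
  qed
  have DD: "(D has_real_derivative D1 y) (at y)" if y: "y \<in> {p<..<t}" for y
  proof -
    have y2: "-2 < y" "y < 2" using y pt by auto
    have "((\<lambda>y. (k1 + prim q y) - (k3 + prim qp y)) has_real_derivative (0 + q y) - (0 + qp y)) (at y)"
      by (intro DERIV_diff DERIV_add DERIV_const prim_DERIV integrable_22_q qc[OF y] y2)
    then have "((\<lambda>y. (k1 + prim q y) - (k3 + prim qp y)) has_real_derivative D1 y) (at y)"
      using qc(2,4)[OF y] by (simp add: D1_def)
    then show ?thesis
      by (rule has_field_derivative_transform_within_open[of _ _ _ "{p<..<t}"])
         (use y pt k1 k3 in \<open>auto simp: D_def\<close>)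
  qed
  \<comment> \<open>A contact point is an interior minimum of the nonnegative, here differentiable,
    function D.\<close>
  have D1z: "D1 y = 0" if "y \<in> {p<..<t}" "D y = 0" for y
  proof (rule DERIV_local_min[OF DD[OF that(1)]])
    show "0 < min (y - p) (t - y)" using that by simp
    show "\<forall>w. \<bar>y - w\<bar> < min (y - p) (t - y) \<longrightarrow> D y \<le> D w"
    proof (intro allI impI)
      fix w assume "\<bar>y - w\<bar> < min (y - p) (t - y)"
      then have "w \<in> {-2<..<2}" using that pt by (auto simp: abs_less_iff)
      then show "D y \<le> D w" using D_nonneg(1) that(2) by simp
    qed
  qed
  have "\<exists>\<xi>>x1. \<xi> < x2 \<and> DERIV D \<xi> :> 0"
  proof (rule Rolle[OF x(2)])
    show "D x1 = D x2" using x by simp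
    show "continuous_on {x1..x2} D" by (rule DERIV_continuous_on, rule has_field_derivative_at_within, rule DD) (use x in auto)
    show "D differentiable at y" if "x1 < y" "y < x2" for y
      using DD[of y] that x real_differentiable_def by auto
  qed
  then obtain \<xi> where \<xi>: "x1 < \<xi>" "\<xi> < x2" "DERIV D \<xi> :> 0" by blast
  have "D1 \<xi> = 0" using DERIV_unique[OF DD \<xi>(3)] \<xi> x by auto
  have "D1 x1 = 0" "D1 x2 = 0" using D1z x by auto
  have i: "integral {a..b} ?F = D1 b - D1 a" if "-1 \<le> a" "a \<le> b" "b \<le> 1" for a b
  proof -
    have "integral {a..b} ?F = integral {a..b} r - integral {a..b} rp"
      by (rule Henstock_Kurzweil_Integration.integral_diff; rule integrable_22_sub) (use rr that in auto)
    also have "\<dots> = (prim r b - prim r a) - (prim rp b - prim rp a)"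
      using prim_diff[OF rr(1), of a b] prim_diff[OF rr(2), of a b] that by simp
    finally show ?thesis by (simp add: D1_def)
  qed
  have Fi: "?F absolutely_integrable_on {a..b}" "(\<lambda>y. rp y - r y) absolutely_integrable_on {a..b}" if "-1 \<le> a" "b \<le> 1" for a b
    by (rule set_integrable_subset[of _ "{-2..2}"], rule integrable_22_diff; use rr that in auto)+
  have neg: "integral {a..b} (\<lambda>y. rp y - r y) = 0" if "integral {a..b} ?F = 0" for a b
    using that Henstock_Kurzweil_Integration.integral_neg[of "{a..b}" ?F] by simp
  have z12: "integral {x1..\<xi>} ?F = 0" "integral {\<xi>..x2} ?F = 0"
    using i[of x1 \<xi>] i[of \<xi> x2] \<open>D1 \<xi> = 0\<close> \<open>D1 x1 = 0\<close> \<open>D1 x2 = 0\<close> x \<xi> pt by auto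
  obtain y1 where "y1 \<in> {x1<..<\<xi>} - N" "?F y1 \<le> 0"
    by (rule exists_nonpos_of_integral_zero[OF Fi(1) \<xi>(1) z12(1) N]) (use x \<xi> pt in auto)
  moreover obtain z2 where "z2 \<in> {\<xi><..<x2} - N" "?F z2 \<le> 0"
    by (rule exists_nonpos_of_integral_zero[OF Fi(1) \<xi>(2) z12(2) N]) (use x \<xi> pt in auto)
  moreover obtain y2 where "y2 \<in> {x1<..<\<xi>} - N" "rp y2 - r y2 \<le> 0"
    by (rule exists_nonpos_of_integral_zero[OF Fi(2) \<xi>(1) neg[OF z12(1)] N]) (use x \<xi> pt in auto)
  moreover obtain z1 where "z1 \<in> {\<xi><..<x2} - N" "rp z1 - r z1 \<le> 0"
    by (rule exists_nonpos_of_integral_zero[OF Fi(2) \<xi>(2) neg[OF z12(2)] N]) (use x \<xi> pt in auto)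
  ultimately show ?thesis using that[of y1 z1 y2 z2] by auto
qed

lemma jump_free_end:
  obtains \<delta> where "0 < \<delta>" "\<delta> < 1" "\<And>s. s \<in> {-1<..<-1+\<delta>} \<union> {1-\<delta><..<1} \<Longrightarrow> c s = 0 \<and> d s = 0"
proof -
  obtain \<delta>1 where 1: "\<delta>1 > 0" "\<And>y. 0 < \<bar>y - (-1)\<bar> \<Longrightarrow> \<bar>y - (-1)\<bar> < \<delta>1 \<Longrightarrow> c y = 0" by (rule jumps_local[OF finite_cd(1), of "-1"]) blast
  obtain \<delta>2 where 2: "\<delta>2 > 0" "\<And>y. 0 < \<bar>y - (-1)\<bar> \<Longrightarrow> \<bar>y - (-1)\<bar> < \<delta>2 \<Longrightarrow> d y = 0" by (rule jumps_local[OF finite_cd(2), of "-1"]) blast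
  obtain \<delta>3 where 3: "\<delta>3 > 0" "\<And>y. 0 < \<bar>y - 1\<bar> \<Longrightarrow> \<bar>y - 1\<bar> < \<delta>3 \<Longrightarrow> c y = 0" by (rule jumps_local[OF finite_cd(1), of "1"]) blast
  obtain \<delta>4 where 4: "\<delta>4 > 0" "\<And>y. 0 < \<bar>y - 1\<bar> \<Longrightarrow> \<bar>y - 1\<bar> < \<delta>4 \<Longrightarrow> d y = 0" by (rule jumps_local[OF finite_cd(2), of "1"]) blast
  define \<delta> where "\<delta> = min (min \<delta>1 \<delta>2) (min (min \<delta>3 \<delta>4) (1/2))"
  have \<delta>: "0 < \<delta>" "\<delta> < 1" "\<delta> \<le> \<delta>1" "\<delta> \<le> \<delta>2" "\<delta> \<le> \<delta>3" "\<delta> \<le> \<delta>4" using 1(1) 2(1) 3(1) 4(1) by (auto simp: \<delta>_def)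
  show ?thesis
  proof (rule that[OF \<delta>(1,2)])
    fix s assume "s \<in> {-1<..<-1+\<delta>} \<union> {1-\<delta><..<1}"
    then consider "0 < \<bar>s - (-1)\<bar> \<and> \<bar>s - (-1)\<bar> < \<delta>" | "0 < \<bar>s - 1\<bar> \<and> \<bar>s - 1\<bar> < \<delta>" by force
    then show "c s = 0 \<and> d s = 0" using 1(2)[of s] 2(2)[of s] 3(2)[of s] 4(2)[of s] \<delta> by cases auto
  qed
qed

lemma D_isCont:
  assumes "x \<in> {-2<..<2}" "c x = 0" shows "isCont D x"
  using D_right[OF assms(1)] D_left[OF assms(1)] assms(2) by (simp add: isCont_def filterlim_at_split)

text \<open>Without jumps D is continuous, so on a compact interval it attains a minimum, which is
  positive.\<close>

lemma gap_compact:
  assumes "-1 < a" "a \<le> b" "b < 1" "\<And>x. x \<in> {a..b} \<Longrightarrow> c x = 0 \<and> D x > 0"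
  shows "gap a b"
proof -
  have "continuous_on {a..b} D"
    by (intro continuous_at_imp_continuous_on ballI D_isCont) (use assms in auto)
  then obtain m where "m \<in> {a..b}" "\<And>y. y \<in> {a..b} \<Longrightarrow> D m \<le> D y"
    using continuous_attains_inf[of "{a..b}" D] assms(2) by auto
  then show ?thesis unfolding gap_def using assms(4) by (intro exI[of _ "D m"]) auto
qed

text \<open>Convexity on a dense set gives an increasing function \<open>g0\<close> on the open
  interval whose primitive is G. It must still be bounded at both ends, where it could diverge, and
  be replaced by a right-continuous version, from which a Stieltjes measure can be formed.\<close>

lemma third_derivative:
  obtains g M A0 A B where "mono g" "\<And>x. continuous (at_right x) g" "\<And>x. \<bar>g x\<bar> \<le> M"
    "AE x in lebesgue. x \<in> {-1<..<1} \<longrightarrow> G x = A0 + prim g x"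
    "AE x in lebesgue. x \<in> {-1<..<1} \<longrightarrow> G x + Gp x = A + B * x"
    "\<And>p t x y. gap p t \<Longrightarrow> -1 \<le> p \<Longrightarrow> t \<le> 1 \<Longrightarrow> p < x \<Longrightarrow> x \<le> y \<Longrightarrow> y < t \<Longrightarrow> g x = g y"
proof -
  obtain N where N: "negligible N"
    and convex: "\<And>a b c. a \<in> {-1<..<1} - N \<Longrightarrow> b \<in> {-1<..<1} - N \<Longrightarrow> c \<in> {-1<..<1} - N \<Longrightarrow> a < b \<Longrightarrow> b < c \<Longrightarrow>
       (c - a) * G b \<le> (c - b) * G a + (b - a) * G c"
    and joint: "\<And>a b c. a \<in> {-1<..<1} - N \<Longrightarrow> b \<in> {-1<..<1} - N \<Longrightarrow> c \<in> {-1<..<1} - N \<Longrightarrow> a < b \<Longrightarrow> b < c \<Longrightarrow>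
       (c - b) * (G a + Gp a) - (c - a) * (G b + Gp b) + (b - a) * (G c + Gp c) = 0"
    and gapeq: "\<And>p t a b c. gap p t \<Longrightarrow> a \<in> {-1<..<1} - N \<Longrightarrow> b \<in> {-1<..<1} - N \<Longrightarrow> c \<in> {-1<..<1} - N \<Longrightarrow> p < a \<Longrightarrow> a < b \<Longrightarrow> b < c \<Longrightarrow> c < t \<Longrightarrow>
       (c - b) * G a - (c - a) * G b + (b - a) * G c = 0"
    by (rule lebesgue_set) blast
  let ?E = "{-1<..<1} - N"
  have dense: "\<exists>x\<in>?E. p < x \<and> x < t" if pt: "-1 \<le> p" "p < t" "t \<le> 1" for p t
  proof -
    obtain x where "x \<notin> N" "p < x" "x < t" by (rule dense_complement[OF N pt(2)])
    then show ?thesis using pt by (intro bexI[of _ x]) auto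
  qed
  have "\<exists>g0. (\<forall>x y. -1 < x \<longrightarrow> x \<le> y \<longrightarrow> y < 1 \<longrightarrow> g0 x \<le> g0 y) \<and>
    (\<forall>a b. a \<in> ?E \<longrightarrow> b \<in> ?E \<longrightarrow> a < b \<longrightarrow> (g0 has_integral (G b - G a)) {a..b})"
  proof (rule convex_on_dense_primitive[of ?E "-1" 1 G], goal_cases)
    case 1 show ?case by blast
  next
    case (2 p t) then show ?case by (rule dense)
  next
    case (3 a b c) then show ?case by (rule convex)
  next
    case (4 g) then show ?case by blast
  qed
  then obtain g0 where g0: "\<And>x y. -1 < x \<Longrightarrow> x \<le> y \<Longrightarrow> y < 1 \<Longrightarrow> g0 x \<le> g0 y"
    "\<And>a b. a \<in> ?E \<Longrightarrow> b \<in> ?E \<Longrightarrow> a < b \<Longrightarrow> (g0 has_integral (G b - G a)) {a..b}"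
    by blast
  have inc: "(b - a) * g0 a \<le> G b - G a" "G b - G a \<le> (b - a) * g0 b" if ab: "a \<in> ?E" "b \<in> ?E" "a < b" for a b
  proof -
    have "((\<lambda>_. g0 a) has_integral (b - a) * g0 a) {a..b}" "((\<lambda>_. g0 b) has_integral (b - a) * g0 b) {a..b}"
      using has_integral_const_real[of "g0 a" a b] has_integral_const_real[of "g0 b" a b] ab(3) by auto
    then show "(b - a) * g0 a \<le> G b - G a" "G b - G a \<le> (b - a) * g0 b"
      using has_integral_le[OF _ g0(2)[OF ab]] has_integral_le[OF g0(2)[OF ab]] g0(1) ab by auto
  qed
  obtain u v where uv: "u \<in> ?E" "v \<in> ?E" "u < v"
  proof -
    obtain u where u: "u \<in> ?E" "-1 < u" "u < 0" using dense[of "-1" 0] by auto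
    obtain v where v: "v \<in> ?E" "0 < v" "v < 1" using dense[of 0 1] by auto
    show ?thesis by (rule that[of u v]) (use u v in auto)
  qed
  obtain A B where AB: "\<And>x. x \<in> ?E \<Longrightarrow> G x + Gp x = A + B * x"
    by (rule affine_on_dense[of ?E "\<lambda>x. G x + Gp x" u v]) (use joint uv in auto)
  \<comment> \<open>Inside a gap G is affine with some slope \<open>\<sigma>\<close>. The slope over
    [a,a'] bounds g0 a' from below and the slope over [b,b'] bounds g0 b from above, so monotonicity
    squeezes g0 to \<open>\<sigma>\<close> on [x,y].\<close>
  have gconst: "g0 x = g0 y" if g: "gap p t" and pt: "-1 \<le> p" "t \<le> 1" "p < x" "x \<le> y" "y < t" for p t x y
  proof -
    obtain a where a: "a \<in> ?E" "p < a" "a < x" using dense[of p x] pt by auto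
    obtain a' where a': "a' \<in> ?E" "a < a'" "a' < x" using dense[of a x] a pt by auto
    obtain b where b: "b \<in> ?E" "y < b" "b < t" using dense[of y t] pt by auto
    obtain b' where b': "b' \<in> ?E" "b < b'" "b' < t" using dense[of b t] b pt by auto
    have ab: "a < b" "a' < b" using a a' b pt by auto
    have "(b - a') * G a - (b - a) * G a' + (a' - a) * G b = 0" by (rule gapeq[OF g a(1) a'(1) b(1)]) (use a a' b ab in auto)
    moreover have "(b' - b) * G a' - (b' - a') * G b + (b - a') * G b' = 0" by (rule gapeq[OF g a'(1) b(1) b'(1)]) (use a a' b b' ab in auto)
    ultimately have e1: "(G a' - G a) * (b - a') = (G b - G a') * (a' - a)" and e2: "(G b - G a') * (b' - b) = (G b' - G b) * (b - a')"
      by (simp_all add: algebra_simps)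
    define \<sigma> where "\<sigma> = (G b - G a') / (b - a')"
    have s: "G b - G a' = \<sigma> * (b - a')" using ab by (simp add: \<sigma>_def)
    have "G a' - G a = \<sigma> * (a' - a)" using e1 ab unfolding s by (simp add: mult.assoc mult.left_commute)
    then have "(a' - a) * \<sigma> \<le> (a' - a) * g0 a'" using inc(2)[OF a(1) a'(1,2)] by (simp add: mult.commute)
    then have lo: "\<sigma> \<le> g0 a'" using a' by simp
    have "G b' - G b = \<sigma> * (b' - b)" using e2 ab unfolding s by (simp add: mult.assoc mult.left_commute)
    then have "(b' - b) * g0 b \<le> (b' - b) * \<sigma>" using inc(1)[OF b(1) b'(1,2)] by (simp add: mult.commute)
    then have hi: "g0 b \<le> \<sigma>" using b' by simp
    have "g0 a' \<le> g0 x" "g0 x \<le> g0 y" "g0 y \<le> g0 b" using g0(1) a a' b b' pt by auto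
    then show ?thesis using lo hi by simp
  qed
  obtain B1 where B1: "\<And>x. \<bar>prim h1 x\<bar> \<le> B1" using prim_bounded[OF integrable_22_h1(1)] by blast
  obtain B2 where B2: "\<And>x. \<bar>prim hp1 x\<bar> \<le> B2" using prim_bounded[OF integrable_22_h1(2)] by blast
  \<comment> \<open>Inserting G_p = A + B x - G into the two definitions solves for r - r_p, which
    becomes \<open>\<kappa> * G\<close> plus \<open>W\<close>. The remainder consists of double
    primitives and an affine term and is Lipschitz with constant \<open>L\<close>.\<close>
  define \<kappa> where "\<kappa> = 1 / \<eta> + 1 / \<gamma>"
  have \<kappa>: "\<kappa> > 0" using pos by (simp add: \<kappa>_def add_pos_pos)
  define W where "W x = prim (prim h1) x / \<eta> - prim (prim hp1) x / \<gamma> - (A + B * x) / \<gamma>" for x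
  define L where "L = B1 / \<eta> + B2 / \<gamma> + \<bar>B\<bar> / \<gamma>"
  have F: "r x - rp x = \<kappa> * G x + W x" if "x \<in> ?E" for x
  proof -
    have 1: "r x = (G x + prim (prim h1) x) / \<eta>" using pos by (simp add: G_def)
    have "Gp x = A + B * x - G x" using AB[OF that] by simp
    then have 2: "rp x = (A + B * x - G x + prim (prim hp1) x) / \<gamma>" using pos by (simp add: Gp_def field_simps)
    show ?thesis unfolding 1 2 W_def \<kappa>_def by (simp add: add_divide_distrib diff_divide_distrib algebra_simps)
  qed
  have W: "\<bar>W z - W y\<bar> \<le> L * (z - y)" if "-1 \<le> y" "y \<le> z" "z \<le> 1" for y z
  proof -
    have "\<bar>prim (prim h1) z - prim (prim h1) y\<bar> \<le> B1 * (z - y)" "\<bar>prim (prim hp1) z - prim (prim hp1) y\<bar> \<le> B2 * (z - y)"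
      using prim_lipschitz[OF integrable_22_prim[OF integrable_22_h1(1)] B1] prim_lipschitz[OF integrable_22_prim[OF integrable_22_h1(2)] B2] that by auto
    then have "\<bar>prim (prim h1) z - prim (prim h1) y\<bar> / \<eta> \<le> B1 * (z - y) / \<eta>" "\<bar>prim (prim hp1) z - prim (prim hp1) y\<bar> / \<gamma> \<le> B2 * (z - y) / \<gamma>"
      using pos by (auto intro: divide_right_mono)
    then have a: "\<bar>(prim (prim h1) z - prim (prim h1) y) / \<eta>\<bar> \<le> B1 * (z - y) / \<eta>" "\<bar>(prim (prim hp1) z - prim (prim hp1) y) / \<gamma>\<bar> \<le> B2 * (z - y) / \<gamma>"
      using pos by simp_all
    have b: "\<bar>B * (z - y) / \<gamma>\<bar> = \<bar>B\<bar> * (z - y) / \<gamma>" using that pos by (simp add: abs_mult)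
    have "W z - W y = (prim (prim h1) z - prim (prim h1) y) / \<eta> - (prim (prim hp1) z - prim (prim hp1) y) / \<gamma> - B * (z - y) / \<gamma>"
      by (simp add: W_def add_divide_distrib diff_divide_distrib algebra_simps)
    moreover have "L * (z - y) = B1 * (z - y) / \<eta> + B2 * (z - y) / \<gamma> + \<bar>B\<bar> * (z - y) / \<gamma>"
      by (simp add: L_def algebra_simps)
    ultimately show ?thesis using a b by linarith
  qed
  obtain \<delta> where \<delta>: "0 < \<delta>" "\<delta> < 1" "\<And>s. s \<in> {-1<..<-1+\<delta>} \<union> {1-\<delta><..<1} \<Longrightarrow> c s = 0 \<and> d s = 0"
    using jump_free_end by blast
  \<comment> \<open>If r - r_p passes from nonpositive at y to nonnegative at z, the slope of
    \<kappa> G over [y,z] is at least -L. That slope is at most \<kappa> g0 z, and monotonicity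
    carries the bound to all x right of the contact points.\<close>
  have slope1: "- L \<le> \<kappa> * g0 x" if x: "-1 < x" "x < 1" "-1 < x1" "x1 < x2" "x2 < -1 + \<delta>" "x2 \<le> x" "D x1 = 0" "D x2 = 0" for x x1 x2
  proof -
    obtain y z where yz: "x1 < y" "y < z" "z < x2" "y \<notin> N" "z \<notin> N" "r y - rp y \<le> 0" "0 \<le> r z - rp z"
      by (rule contact_slopes[of "-1" "-1 + \<delta>" x1 x2 N]) (use \<delta> x N in auto)
    have E: "y \<in> ?E" "z \<in> ?E" using yz x \<delta> by auto
    have "\<kappa> * (G z - G y) \<ge> W y - W z" using F[OF E(1)] F[OF E(2)] yz by (simp add: algebra_simps)
    then have "- (L * (z - y)) \<le> \<kappa> * (G z - G y)" using W[of y z] E yz by auto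
    also have "\<dots> \<le> \<kappa> * ((z - y) * g0 z)" using inc(2)[OF E yz(2)] \<kappa> by (intro mult_left_mono) auto
    finally have "(z - y) * (- L) \<le> (z - y) * (\<kappa> * g0 z)" by (simp add: algebra_simps)
    then have "- L \<le> \<kappa> * g0 z" using yz(2) by (simp only: mult_le_cancel_left_pos diff_gt_0_iff_gt)
    also have "\<dots> \<le> \<kappa> * g0 x" using g0(1)[of z x] yz x E \<kappa> by (intro mult_left_mono) auto
    finally show ?thesis .
  qed
  \<comment> \<open>The mirror image at the other end uses the opposite change of sign and bounds g0
    from above at all x left of the contact points.\<close>
  have slope2: "\<kappa> * g0 x \<le> L" if x: "-1 < x" "x < 1" "x2 < 1" "x1 < x2" "1 - \<delta> < x1" "x \<le> x1" "D x1 = 0" "D x2 = 0" for x x1 x2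
  proof -
    obtain y z where yz: "x1 < y" "y < z" "z < x2" "y \<notin> N" "z \<notin> N" "0 \<le> r y - rp y" "r z - rp z \<le> 0"
      by (rule contact_slopes[of "1 - \<delta>" 1 x1 x2 N]) (use \<delta> x N in auto)
    have E: "y \<in> ?E" "z \<in> ?E" using yz x \<delta> by auto
    have "\<kappa> * g0 x \<le> \<kappa> * g0 y" using g0(1)[of x y] yz x E \<kappa> by (intro mult_left_mono) auto
    have "\<kappa> * (G z - G y) \<le> W y - W z" using F[OF E(1)] F[OF E(2)] yz by (simp add: algebra_simps)
    then have *: "\<kappa> * (G z - G y) \<le> L * (z - y)" using W[of y z] E yz by auto
    have "\<kappa> * ((z - y) * g0 y) \<le> \<kappa> * (G z - G y)" using inc(1)[OF E yz(2)] \<kappa> by (intro mult_left_mono) auto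
    then have "(z - y) * (\<kappa> * g0 y) \<le> (z - y) * L" using * by (simp add: algebra_simps)
    then have "\<kappa> * g0 y \<le> L" using yz(2) by (simp only: mult_le_cancel_left_pos diff_gt_0_iff_gt)
    then show ?thesis using \<open>\<kappa> * g0 x \<le> \<kappa> * g0 y\<close> by simp
  qed
  have const: "g0 x = g0 y" if "-1 \<le> p" "t \<le> 1" "p < x" "x \<le> y" "y < t" and cD: "\<And>w. w \<in> {p<..<t} \<Longrightarrow> c w = 0 \<and> D w > 0" for p t x y
  proof -
    have "gap ((p + x) / 2) ((y + t) / 2)" by (rule gap_compact) (use that in auto)
    then show ?thesis by (rule gconst) (use that in auto)
  qed
  \<comment> \<open>If contact accumulates at -1, two contact points can be found between -1 and the
    given x. Otherwise a neighbourhood of -1 is free of contact and of jumps, so g0 is constant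
    there.\<close>
  have "\<exists>m. \<forall>x. -1 < x \<and> x < 1 \<longrightarrow> m \<le> g0 x"
  proof (cases "\<forall>e>0. \<exists>x. -1 < x \<and> x < -1 + e \<and> D x = 0")
    case True
    have "- L / \<kappa> \<le> g0 x" if x: "-1 < x" "x < 1" for x
    proof -
      obtain x2 where x2: "-1 < x2" "x2 < -1 + min \<delta> (x + 1)" "D x2 = 0" using True[rule_format, of "min \<delta> (x + 1)"] \<delta> x by auto
      obtain x1 where x1: "-1 < x1" "x1 < -1 + (x2 + 1)" "D x1 = 0" using True[rule_format, of "x2 + 1"] x2 by auto
      have "- L \<le> \<kappa> * g0 x" by (rule slope1[of x x1 x2]) (use x x1 x2 in auto)
      then show ?thesis using \<kappa> by (subst pos_divide_le_eq) (auto simp: mult.commute)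
    qed
    then show ?thesis by blast
  next
    case False
    then obtain e where e: "e > 0" "\<And>x. -1 < x \<Longrightarrow> x < -1 + e \<Longrightarrow> D x \<noteq> 0" by blast
    define t where "t = -1 + min e \<delta>"
    have t: "-1 < t" "t \<le> -1 + e" "t \<le> -1 + \<delta>" using e \<delta> by (auto simp: t_def)
    have cD: "c w = 0 \<and> D w > 0" if "w \<in> {-1<..<t}" for w
      using that t e(2)[of w] \<delta> D_nonneg(1)[of w] by auto
    have "g0 ((t - 1) / 2) \<le> g0 x" if x: "-1 < x" "x < 1" for x
    proof (cases "x \<le> (t - 1) / 2")
      case True
      have "g0 x = g0 ((t - 1) / 2)" by (rule const[of "-1" t]) (use x t True cD \<delta> in auto)
      then show ?thesis by simp
    next
      case False
      then show ?thesis using g0(1) x t by auto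
    qed
    then show ?thesis by blast
  qed
  moreover have "\<exists>m. \<forall>x. -1 < x \<and> x < 1 \<longrightarrow> g0 x \<le> m"
  proof (cases "\<forall>e>0. \<exists>x. 1 - e < x \<and> x < 1 \<and> D x = 0")
    case True
    have "g0 x \<le> L / \<kappa>" if x: "-1 < x" "x < 1" for x
    proof -
      obtain x1 where x1: "1 - min \<delta> (1 - x) < x1" "x1 < 1" "D x1 = 0" using True[rule_format, of "min \<delta> (1 - x)"] \<delta> x by auto
      obtain x2 where x2: "1 - (1 - x1) < x2" "x2 < 1" "D x2 = 0" using True[rule_format, of "1 - x1"] x1 by auto
      have "\<kappa> * g0 x \<le> L" by (rule slope2[of x x2 x1]) (use x x1 x2 in auto)
      then show ?thesis using \<kappa> by (subst pos_le_divide_eq) (auto simp: mult.commute)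
    qed
    then show ?thesis by blast
  next
    case False
    then obtain e where e: "e > 0" "\<And>x. 1 - e < x \<Longrightarrow> x < 1 \<Longrightarrow> D x \<noteq> 0" by blast
    define t where "t = 1 - min e \<delta>"
    have t: "t < 1" "1 - e \<le> t" "1 - \<delta> \<le> t" using e \<delta> by (auto simp: t_def)
    have cD: "c w = 0 \<and> D w > 0" if "w \<in> {t<..<1}" for w
      using that t e(2)[of w] \<delta> D_nonneg(1)[of w] by auto
    have "g0 x \<le> g0 ((t + 1) / 2)" if x: "-1 < x" "x < 1" for x
    proof (cases "(t + 1) / 2 \<le> x")
      case True
      have "g0 ((t + 1) / 2) = g0 x" by (rule const[of t 1]) (use x t True cD \<delta> in auto)
      then show ?thesis by simp
    next
      case False
      then show ?thesis using g0(1) x t by auto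
    qed
    then show ?thesis by blast
  qed
  ultimately obtain m1 m2 where m: "\<And>x. -1 < x \<Longrightarrow> x < 1 \<Longrightarrow> m1 \<le> g0 x \<and> g0 x \<le> m2" by blast
  define M where "M = max \<bar>m1\<bar> \<bar>m2\<bar>"
  \<comment> \<open>Continuing by the bounds themselves keeps the function bounded and increasing on
    the whole line.\<close>
  define ge where "ge x = (if x \<le> -1 then - M else if x < 1 then g0 x else M)" for x
  have M: "- M \<le> g0 x" "g0 x \<le> M" if "-1 < x" "x < 1" for x using m[OF that] by (auto simp: M_def max_def)
  have "M \<ge> 0" by (simp add: M_def)
  have mge: "mono ge" unfolding mono_def ge_def using g0(1) M \<open>M \<ge> 0\<close> by auto
  have bge: "\<bar>ge x\<bar> \<le> M" for x
  proof (cases "-1 < x \<and> x < 1")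
    case True then show ?thesis using M[of x] by (simp add: ge_def abs_le_iff)
  next
    case False then show ?thesis using \<open>M \<ge> 0\<close> by (auto simp: ge_def)
  qed
  obtain g where g: "mono g" "\<And>x. continuous (at_right x) g" "\<And>x. \<bar>g x\<bar> \<le> M"
    "\<And>x y. x < y \<Longrightarrow> g x \<le> ge y" "\<And>x. ge x \<le> g x" "countable {x. g x \<noteq> ge x}"
    by (rule mono_right_continuous_version[OF mge bge]) blast
  have gm: "g \<in> borel_measurable borel" by (rule borel_measurable_mono[OF g(1)])
  have gi: "integrable_22 g" by (rule integrable_22_bounded[OF gm g(3)])
  have Gg: "G x = (G u - prim g u) + prim g x" if x: "x \<in> ?E" for x
  proof -
    have key: "G b - G a = prim g b - prim g a" if ab: "a \<in> ?E" "b \<in> ?E" "a < b" for a b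
    proof -
      have "(g has_integral (G b - G a)) {a..b}"
      proof (rule has_integral_spike[OF _ _ g0(2)[OF ab]])
        show "negligible {x. g x \<noteq> ge x}" by (rule countable_imp_null_set_lborel[THEN null_sets_completionI, unfolded negligible_iff_null_sets[symmetric], OF g(6)])
        show "g y = g0 y" if "y \<in> {a..b} - {x. g x \<noteq> ge x}" for y using that ab by (auto simp: ge_def)
      qed
      then show ?thesis using prim_diff[OF gi, of a b] ab by (auto simp: integral_unique)
    qed
    show ?thesis using key[of u x] key[of x u] uv x by (cases x u rule: linorder_cases) auto
  qed
  have aeN: "AE x in lebesgue. x \<notin> N" using N by (simp add: negligible_iff_null_sets AE_not_in)
  show ?thesis
  proof (rule that[OF g(1-3)])
    show "AE x in lebesgue. x \<in> {-1<..<1} \<longrightarrow> G x = (G u - prim g u) + prim g x"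
      using aeN by eventually_elim (use Gg in blast)
    show "AE x in lebesgue. x \<in> {-1<..<1} \<longrightarrow> G x + Gp x = A + B * x"
      using aeN by eventually_elim (use AB in blast)
    fix p t x y assume H: "gap p t" "-1 \<le> p" "t \<le> 1" "p < x" "x \<le> y" "y < t"
    have "g x \<le> g y" using g(1) H(5) by (simp add: mono_def)
    \<comment> \<open>The right-continuous version at y is dominated only by values at later points,
      so a point between y and the end of the gap is inserted.\<close>
    moreover have "g y \<le> ge ((y + t) / 2)" using g(4) H by simp
    moreover have "ge ((y + t) / 2) = g0 ((y + t) / 2)" "ge x = g0 x" using H by (auto simp: ge_def)
    moreover have "g0 x = g0 ((y + t) / 2)" by (rule gconst[OF H(1)]) (use H in auto)
    moreover have "ge x \<le> g x" by (rule g(5))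
    ultimately show "g x = g y" by simp
  qed
qed

end

section \<open>Conditions at the jump and crease points\<close>

lemma prim_right_derivative:
  assumes f: "integrable_22 f" "(f \<longlongrightarrow> \<rho>) (at_right x)" and x: "-2 \<le> x" "x < 2"
  shows "((\<lambda>t. (prim f (x + t) - prim f x) / t) \<longlongrightarrow> \<rho>) (at_right 0)"
proof (rule tendstoI)
  fix e :: real assume "e > 0"
  then have "\<forall>\<^sub>F y in at_right x. dist (f y) \<rho> < e / 2" using f(2) by (intro tendstoD) auto
  then obtain b where b: "x < b" "\<And>y. x < y \<Longrightarrow> y < b \<Longrightarrow> dist (f y) \<rho> < e / 2" unfolding eventually_at_right_field by blast
  have "dist ((prim f (x + t) - prim f x) / t) \<rho> < e" if t: "0 < t" "t < min (b - x) (2 - x)" for t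
  proof -
    have i: "f integrable_on {x..x+t}" by (rule integrable_22_sub[OF f(1)]) (use x t in auto)
    have i': "(\<lambda>y. f y - \<rho>) integrable_on {x..x+t}" using i by (intro integrable_diff) auto
    have "prim f (x + t) - prim f x - \<rho> * t = integral {x..x+t} (\<lambda>y. f y - \<rho>)"
      using prim_diff[OF f(1), of x "x + t"] x t by (simp add: Henstock_Kurzweil_Integration.integral_diff[OF i integrable_const_ivl] mult.commute)
    also have "integral {x..x+t} (\<lambda>y. f y - \<rho>) = integral {x<..<x+t} (\<lambda>y. f y - \<rho>)" by (simp add: integral_open_interval_real)
    finally have eq: "prim f (x + t) - prim f x - \<rho> * t = integral {x<..<x+t} (\<lambda>y. f y - \<rho>)" .
    have "norm (integral {x<..<x+t} (\<lambda>y. f y - \<rho>)) \<le> integral {x<..<x+t} (\<lambda>y. e / 2)"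
    proof (rule integral_norm_bound_integral)
      show "(\<lambda>y. f y - \<rho>) integrable_on {x<..<x+t}" using i' by (simp add: integrable_on_Icc_iff_Ioo)
      show "(\<lambda>y. e / 2) integrable_on {x<..<x+t}" by (simp add: integrable_on_Icc_iff_Ioo[symmetric] integrable_const_ivl)
      show "norm (f y - \<rho>) \<le> e / 2" if "y \<in> {x<..<x+t}" for y using b(2)[of y] that t by (auto simp: dist_real_def)
    qed
    also have "\<dots> = e / 2 * t" using t by (simp add: integral_open_interval_real[symmetric])
    finally have "\<bar>prim f (x + t) - prim f x - \<rho> * t\<bar> \<le> e / 2 * t" using eq by simp
    then have "\<bar>(prim f (x + t) - prim f x - \<rho> * t) / t\<bar> \<le> e / 2" using t by (simp add: divide_le_eq)
    moreover have "(prim f (x + t) - prim f x - \<rho> * t) / t = (prim f (x + t) - prim f x) / t - \<rho>" using t by (simp add: diff_divide_distrib)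
    ultimately show ?thesis using \<open>e > 0\<close> by (simp add: dist_real_def)
  qed
  then show "\<forall>\<^sub>F t in at_right 0. dist ((prim f (x + t) - prim f x) / t) \<rho> < e"
    unfolding eventually_at_right_field using b(1) x by (intro exI[of _ "min (b - x) (2 - x)"]) auto
qed

lemma prim_left_derivative:
  assumes f: "integrable_22 f" "(f \<longlongrightarrow> \<rho>) (at_left x)" and x: "-2 < x" "x \<le> 2"
  shows "((\<lambda>t. (prim f x - prim f (x - t)) / t) \<longlongrightarrow> \<rho>) (at_right 0)"
proof (rule tendstoI)
  fix e :: real assume "e > 0"
  then have "\<forall>\<^sub>F y in at_left x. dist (f y) \<rho> < e / 2" using f(2) by (intro tendstoD) auto
  then obtain b where b: "b < x" "\<And>y. b < y \<Longrightarrow> y < x \<Longrightarrow> dist (f y) \<rho> < e / 2" unfolding eventually_at_left_field by blast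
  have "dist ((prim f x - prim f (x - t)) / t) \<rho> < e" if t: "0 < t" "t < min (x - b) (x + 2)" for t
  proof -
    have i: "f integrable_on {x-t..x}" by (rule integrable_22_sub[OF f(1)]) (use x t in auto)
    have i': "(\<lambda>y. f y - \<rho>) integrable_on {x-t..x}" using i by (intro integrable_diff) auto
    have "prim f x - prim f (x - t) - \<rho> * t = integral {x-t..x} (\<lambda>y. f y - \<rho>)"
      using prim_diff[OF f(1), of "x - t" x] x t by (simp add: Henstock_Kurzweil_Integration.integral_diff[OF i integrable_const_ivl] mult.commute)
    also have "integral {x-t..x} (\<lambda>y. f y - \<rho>) = integral {x-t<..<x} (\<lambda>y. f y - \<rho>)" by (simp add: integral_open_interval_real)
    finally have eq: "prim f x - prim f (x - t) - \<rho> * t = integral {x-t<..<x} (\<lambda>y. f y - \<rho>)" .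
    have "norm (integral {x-t<..<x} (\<lambda>y. f y - \<rho>)) \<le> integral {x-t<..<x} (\<lambda>y. e / 2)"
    proof (rule integral_norm_bound_integral)
      show "(\<lambda>y. f y - \<rho>) integrable_on {x-t<..<x}" using i' by (simp add: integrable_on_Icc_iff_Ioo)
      show "(\<lambda>y. e / 2) integrable_on {x-t<..<x}" by (simp add: integrable_on_Icc_iff_Ioo[symmetric] integrable_const_ivl)
      show "norm (f y - \<rho>) \<le> e / 2" if "y \<in> {x-t<..<x}" for y using b(2)[of y] that t by (auto simp: dist_real_def)
    qed
    also have "\<dots> = e / 2 * t" using t by (simp add: integral_open_interval_real[symmetric])
    finally have "\<bar>prim f x - prim f (x - t) - \<rho> * t\<bar> \<le> e / 2 * t" using eq by simp
    then have "\<bar>(prim f x - prim f (x - t) - \<rho> * t) / t\<bar> \<le> e / 2" using t by (simp add: divide_le_eq)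
    moreover have "(prim f x - prim f (x - t) - \<rho> * t) / t = (prim f x - prim f (x - t)) / t - \<rho>" using t by (simp add: diff_divide_distrib)
    ultimately show ?thesis using \<open>e > 0\<close> by (simp add: dist_real_def)
  qed
  then show "\<forall>\<^sub>F t in at_right 0. dist ((prim f x - prim f (x - t)) / t) \<rho> < e"
    unfolding eventually_at_right_field using b(1) x by (intro exI[of _ "min (x - b) (x + 2)"]) auto
qed

text \<open>A one-sided Taylor expansion of order two. It asks only for a one-sided limit of f,
  since the third derivative of u_r, to which it is applied, need not be continuous at a jump
  point.\<close>

lemma prim_prim_right_expansion:
  assumes f: "integrable_22 f" "(f \<longlongrightarrow> \<rho>) (at_right x)" and x: "-2 < x" "x < 2"
  shows "((\<lambda>t. (prim (prim f) (x + t) - prim (prim f) x - prim f x * t) / t\<^sup>2) \<longlongrightarrow> \<rho> / 2) (at_right 0)"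
proof (rule lhopital_right_0)
  note i = integrable_22_prim[OF f(1)]
  have "((\<lambda>t. prim (prim f) (x + t) - prim (prim f) x - prim f x * t) \<longlongrightarrow> prim (prim f) (x + 0) - prim (prim f) x - prim f x * 0) (at_right 0)"
    by (intro tendsto_intros isCont_tendsto_compose[OF prim_isCont[OF i]])
  then show "((\<lambda>t. prim (prim f) (x + t) - prim (prim f) x - prim f x * t) \<longlongrightarrow> 0) (at_right 0)" by simp
  show "((\<lambda>t::real. t\<^sup>2) \<longlongrightarrow> 0) (at_right 0)" by (auto intro!: tendsto_eq_intros)
  show "\<forall>\<^sub>F t::real in at_right 0. t\<^sup>2 \<noteq> 0" "\<forall>\<^sub>F t::real in at_right 0. 2 * t \<noteq> 0"
    by (auto simp: eventually_at_filter intro!: always_eventually)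
  show "\<forall>\<^sub>F t in at_right 0. DERIV (\<lambda>t. prim (prim f) (x + t) - prim (prim f) x - prim f x * t) t :> prim f (x + t) - prim f x"
    unfolding eventually_at_right_field
  proof (intro exI[of _ "2 - x"] conjI allI impI)
    fix t assume t: "0 < t" "t < 2 - x"
    have "DERIV (prim (prim f)) (x + t) :> prim f (x + t)"
      by (rule prim_DERIV[OF i prim_isCont[OF f(1)]]) (use t x in auto)
    then have "DERIV (\<lambda>t. prim (prim f) (x + t)) t :> prim f (x + t)" by (simp add: DERIV_shift add.commute)
    then show "DERIV (\<lambda>t. prim (prim f) (x + t) - prim (prim f) x - prim f x * t) t :> prim f (x + t) - prim f x"
      by (auto intro!: derivative_eq_intros)
  qed (use x in simp)
  show "\<forall>\<^sub>F t::real in at_right 0. DERIV (\<lambda>t. t\<^sup>2) t :> 2 * t"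
    by (auto intro!: always_eventually derivative_eq_intros)
  have "((\<lambda>t. (prim f (x + t) - prim f x) / t / 2) \<longlongrightarrow> \<rho> / 2) (at_right 0)"
    by (intro tendsto_intros prim_right_derivative[OF f]) (use x in auto)
  then show "((\<lambda>t. (prim f (x + t) - prim f x) / (2 * t)) \<longlongrightarrow> \<rho> / 2) (at_right 0)" by (simp add: field_simps)
qed

lemma prim_prim_left_expansion:
  assumes f: "integrable_22 f" "(f \<longlongrightarrow> \<rho>) (at_left x)" and x: "-2 < x" "x < 2"
  shows "((\<lambda>t. (prim (prim f) (x - t) - prim (prim f) x + prim f x * t) / t\<^sup>2) \<longlongrightarrow> \<rho> / 2) (at_right 0)"
proof (rule lhopital_right_0)
  note i = integrable_22_prim[OF f(1)]
  have "((\<lambda>t. prim (prim f) (x - t) - prim (prim f) x + prim f x * t) \<longlongrightarrow> prim (prim f) (x - 0) - prim (prim f) x + prim f x * 0) (at_right 0)"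
    by (intro tendsto_intros isCont_tendsto_compose[OF prim_isCont[OF i]])
  then show "((\<lambda>t. prim (prim f) (x - t) - prim (prim f) x + prim f x * t) \<longlongrightarrow> 0) (at_right 0)" by simp
  show "((\<lambda>t::real. t\<^sup>2) \<longlongrightarrow> 0) (at_right 0)" by (auto intro!: tendsto_eq_intros)
  show "\<forall>\<^sub>F t::real in at_right 0. t\<^sup>2 \<noteq> 0" "\<forall>\<^sub>F t::real in at_right 0. 2 * t \<noteq> 0"
    by (auto simp: eventually_at_filter intro!: always_eventually)
  show "\<forall>\<^sub>F t in at_right 0. DERIV (\<lambda>t. prim (prim f) (x - t) - prim (prim f) x + prim f x * t) t :> prim f x - prim f (x - t)"
    unfolding eventually_at_right_field
  proof (intro exI[of _ "x + 2"] conjI allI impI)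
    fix t assume t: "0 < t" "t < x + 2"
    have "DERIV (prim (prim f)) (x - t) :> prim f (x - t)"
      by (rule prim_DERIV[OF i prim_isCont[OF f(1)]]) (use t x in auto)
    moreover have "DERIV (\<lambda>t. x - t) t :> -1" by (auto intro!: derivative_eq_intros)
    ultimately have "DERIV (\<lambda>t. prim (prim f) (x - t)) t :> prim f (x - t) * (-1)" by (rule DERIV_chain2)
    then show "DERIV (\<lambda>t. prim (prim f) (x - t) - prim (prim f) x + prim f x * t) t :> prim f x - prim f (x - t)"
      by (auto intro!: derivative_eq_intros)
  qed (use x in simp)
  show "\<forall>\<^sub>F t::real in at_right 0. DERIV (\<lambda>t. t\<^sup>2) t :> 2 * t"
    by (auto intro!: always_eventually derivative_eq_intros)
  have "((\<lambda>t. (prim f x - prim f (x - t)) / t / 2) \<longlongrightarrow> \<rho> / 2) (at_right 0)"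
    by (intro tendsto_intros prim_left_derivative[OF f]) (use x in auto)
  then show "((\<lambda>t. (prim f x - prim f (x - t)) / (2 * t)) \<longlongrightarrow> \<rho> / 2) (at_right 0)" by (simp add: field_simps)
qed

lemma at_right_0_scale:
  assumes "((F :: real \<Rightarrow> real) \<longlongrightarrow> l) (at_right 0)" "k > 0"
  shows "((\<lambda>t. F (t * k)) \<longlongrightarrow> l) (at_right 0)"
proof -
  have "filterlim (\<lambda>t::real. t * k) (at_right 0) (at_right 0)"
    unfolding filterlim_at using assms(2)
    by (auto intro!: tendsto_eq_intros simp: eventually_at_filter always_eventually)
  from filterlim_compose[OF assms(1) this] show ?thesis .
qed

lemma spline_measurable: "spline L \<in> borel_measurable borel"
proof (induction L)
  case Nil show ?case by (simp add: spline_def[abs_def])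
next
  case (Cons a L)
  obtain s c d e where a: "a = (s, c, d, e)" by (cases a)
  have "spline (a # L) = (\<lambda>x. (if s < x then c + d * (x - s) + e * (x - s)\<^sup>2 / 2 else 0) + spline L x)"
    by (simp add: spline_def a fun_eq_iff)
  then show ?case using Cons by simp
qed

section \<open>The continuous representative of u_r'' and general spline variations\<close>

locale minimizer_structure = minimizer +
  fixes g :: "real \<Rightarrow> real" and M A0 A B :: real
  assumes g_mono: "mono g" and g_right: "\<And>x. continuous (at_right x) g" and g_bound: "\<And>x. \<bar>g x\<bar> \<le> M"
    and G_AE: "AE x in lebesgue. x \<in> {-1<..<1} \<longrightarrow> G x = A0 + prim g x"
    and Gp_AE: "AE x in lebesgue. x \<in> {-1<..<1} \<longrightarrow> G x + Gp x = A + B * x"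
    and g_gap: "\<And>a b x y. gap a b \<Longrightarrow> -1 \<le> a \<Longrightarrow> b \<le> 1 \<Longrightarrow> a < x \<Longrightarrow> x \<le> y \<Longrightarrow> y < b \<Longrightarrow> g x = g y"
begin

definition R1 :: "real \<Rightarrow> real" where "R1 x = (g x + prim h1 x) / \<eta>"
definition R :: "real \<Rightarrow> real" where "R x = A0 / \<eta> + prim R1 x"

lemma g_measurable: "g \<in> borel_measurable borel" by (rule borel_measurable_mono[OF g_mono])

lemma integrable_22_g: "integrable_22 g"
  by (rule integrable_22_bounded[OF g_measurable g_bound])

lemma integrable_22_R1: "integrable_22 R1"
proof -
  have "integrable_22 (\<lambda>x. 1 / \<eta> * (g x + prim h1 x))"
    by (intro integrable_22_cmult integrable_22_add integrable_22_g integrable_22_prim integrable_22_h1)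
  then show ?thesis by (simp add: R1_def[abs_def])
qed

lemma R1_measurable: "R1 \<in> borel_measurable borel"
  unfolding R1_def[abs_def] using g_measurable prim_measurable[OF integrable_22_h1(1)] by measurable

lemma R1_bounded: obtains C where "\<And>x. \<bar>R1 x\<bar> \<le> C"
proof -
  obtain B1 where B1: "\<And>x. \<bar>prim h1 x\<bar> \<le> B1" using prim_bounded[OF integrable_22_h1(1)] by blast
  have "\<bar>R1 x\<bar> \<le> (M + B1) / \<eta>" for x
    using g_bound[of x] B1[of x] pos(1) by (simp add: R1_def abs_divide divide_right_mono abs_triangle_ineq[THEN order_trans])
  then show ?thesis using that by blast
qed

lemma R_isCont: "isCont R x"
  unfolding R_def[abs_def] by (intro continuous_intros prim_isCont[OF integrable_22_R1])

lemma integrable_22_R: "integrable_22 R"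
  by (rule integrable_22_continuous) (meson R_isCont continuous_at_imp_continuous_on)

lemma r_AE: "AE x in lebesgue. x \<in> {-1<..<1} \<longrightarrow> r x = R x"
  using G_AE
proof eventually_elim
  case (elim x)
  have "prim R1 x = (prim g x + prim (prim h1) x) / \<eta>"
  proof -
    have "prim R1 x = prim (\<lambda>x. 1 / \<eta> * (g x + prim h1 x)) x" by (simp add: R1_def[abs_def])
    also have "\<dots> = 1 / \<eta> * (prim g x + prim (prim h1) x)"
      by (simp only: prim_cmult prim_add[OF integrable_22_g integrable_22_prim[OF integrable_22_h1(1)]])
    finally show ?thesis by simp
  qed
  moreover have "r x = (G x + prim (prim h1) x) / \<eta>" using pos by (simp add: G_def)
  ultimately show ?case using elim by (simp add: R_def add_divide_distrib)
qed

text \<open>Increments of P bound the force term on an interval. Continuity sends them to 0 on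
  shrinking intervals, however singular the square integrable h may be.\<close>

definition P :: "real \<Rightarrow> real" where "P = prim (\<lambda>x. \<bar>h1 x\<bar>)"

lemma integrable_22_abs_h1: "integrable_22 (\<lambda>x. \<bar>h1 x\<bar>)"
  using absolutely_integrable_abs[OF integrable_22_h1(1)] by simp

lemma P_isCont: "isCont P x" unfolding P_def by (rule prim_isCont[OF integrable_22_abs_h1])

lemma h_pairing_bound:
  assumes ab: "-1 \<le> a" "a \<le> b" "b \<le> 1" and s: "s \<in> borel_measurable borel"
    and C: "\<And>x. x \<in> {a<..<b} \<Longrightarrow> \<bar>s x\<bar> \<le> C" and z: "\<And>x. x \<in> {-1<..<1} \<Longrightarrow> x \<notin> {a<..<b} \<Longrightarrow> s x = 0" and "0 \<le> C"
  shows "\<bar>I11 (\<lambda>x. h x * s x)\<bar> \<le> C * (P b - P a)"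
proof -
  have hi: "h1 absolutely_integrable_on {a<..<b}" by (rule set_integrable_subset[OF integrable_22_h1(1)]) (use ab in auto)
  have "I11 (\<lambda>x. h x * s x) = (LINT x:{a<..<b}|lebesgue. h x * s x)"
    by (rule LINT_extend[symmetric]) (use ab z in auto)
  also have "\<dots> = (LINT x:{a<..<b}|lebesgue. h1 x * s x)"
    by (rule set_lebesgue_integral_cong) (use ab in \<open>auto simp: h1_def\<close>)
  finally have eq: "I11 (\<lambda>x. h x * s x) = (LINT x:{a<..<b}|lebesgue. h1 x * s x)" .
  have i1: "(\<lambda>x. h1 x * s x) absolutely_integrable_on {a<..<b}"
    by (rule absolutely_integrable_mult_bounded[OF hi _ s C]) auto
  have i2: "(\<lambda>x. C * \<bar>h1 x\<bar>) absolutely_integrable_on {a<..<b}"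
    by (rule set_integrable_subset[OF integrable_22_cmult[OF integrable_22_abs_h1]]) (use ab in auto)
  have "norm (integral {a<..<b} (\<lambda>x. h1 x * s x)) \<le> integral {a<..<b} (\<lambda>x. C * \<bar>h1 x\<bar>)"
  proof (rule integral_norm_bound_integral)
    show "(\<lambda>x. h1 x * s x) integrable_on {a<..<b}" "(\<lambda>x. C * \<bar>h1 x\<bar>) integrable_on {a<..<b}"
      using set_lebesgue_integral_eq_integral(1)[OF i1] set_lebesgue_integral_eq_integral(1)[OF i2] by blast+
    show "norm (h1 x * s x) \<le> C * \<bar>h1 x\<bar>" if "x \<in> {a<..<b}" for x
      using mult_right_mono[OF C[OF that], of "\<bar>h1 x\<bar>"] by (simp add: abs_mult mult.commute)
  qed
  also have "\<dots> = C * integral {a..b} (\<lambda>x. \<bar>h1 x\<bar>)" by (simp add: integral_open_interval_real)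
  also have "integral {a..b} (\<lambda>x. \<bar>h1 x\<bar>) = P b - P a"
    unfolding P_def by (rule prim_diff[OF integrable_22_abs_h1, symmetric]) (use ab in auto)
  finally show ?thesis unfolding eq set_lebesgue_integral_eq_integral(2)[OF i1] by simp
qed

text \<open>With the continuous R in place of r, pairing with the piecewise constant curvature is a
  finite combination of values of \<open>prim R\<close>; \<open>sum0\<close> cancels the
  contribution of the right end. The force is absorbed into an error bounded by C times the mass of
  |h| on the support.\<close>

lemma spline_variation:
  assumes ab: "-1 \<le> a" "a < b" "b \<le> 1"
    and L: "\<And>s c d e. (s, c, d, e) \<in> set L \<Longrightarrow> a \<le> s \<and> s \<le> b"
    and sum0: "(\<Sum>(s, c, d, e)\<leftarrow>L. e) = 0"
    and right0: "\<And>x. b < x \<Longrightarrow> spline L x = 0"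
    and C: "\<And>x. x \<in> {a<..<b} \<Longrightarrow> \<bar>spline L x\<bar> \<le> C" "0 \<le> C"
    and cc: "\<And>x. spline_c L x \<noteq> 0 \<Longrightarrow> c x \<noteq> 0" and dd: "\<And>x. spline_d L x \<noteq> 0 \<Longrightarrow> c x \<noteq> 0 \<or> d x \<noteq> 0"
    and k: "\<bar>k\<bar> \<le> 1"
    and adm: "e0 > 0" "\<And>y \<epsilon>. y \<in> {a<..<b} \<Longrightarrow> 0 < \<epsilon> \<Longrightarrow> \<epsilon> < e0 \<Longrightarrow> 0 \<le> D y + \<epsilon> * (k * spline L y)"
  shows "0 \<le> k * (- \<eta> * (\<Sum>(s, c, d, e)\<leftarrow>L. e * prim R s)) + C * (P b - P a)"
proof -
  have L2: "-2 \<le> s \<and> s \<le> 2" if "(s, c, d, e) \<in> set L" for s c d e using L[OF that] ab by auto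
  have low: "spline L x = 0" "spline_e L x = 0" if "x \<le> a" for x
  proof -
    have "(case t of (s, c, d, e) \<Rightarrow> if s < x then c + d * (x - s) + e * (x - s)\<^sup>2 / 2 else 0) = 0"
      "(case t of (s, c, d, e) \<Rightarrow> if s < x then e else 0) = 0" if "t \<in> set L" for t
      using L that \<open>x \<le> a\<close> by (cases t; force)+
    then show "spline L x = 0" "spline_e L x = 0"
      unfolding spline_def spline_e_def by (simp_all add: sum_list_eq_0_iff[symmetric] cong: map_cong)
  qed
  \<comment> \<open>Past the last node all curvature increments have been added, and their sum is
    0.\<close>
  have high: "spline_e L x = 0" if "b < x" for x
  proof -
    have "map (\<lambda>(s, c, d, e). if s < x then e else 0) L = map (\<lambda>(s, c, d, e). e) L"
      using L that by (intro map_cong) force+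
    then have "spline_e L x = (\<Sum>(s, c, d, e)\<leftarrow>L. e)" unfolding spline_e_def by (rule arg_cong[where f = sum_list])
    then show ?thesis using sum0 by simp
  qed
  have ps: "pwH2 (spline L) (spline_c L) (spline_d L) (spline_e L)" by (rule pwH2_spline) (use L2 in blast)
  have pk: "pwH2 (\<lambda>x. k * spline L x) (\<lambda>x. k * spline_c L x) (\<lambda>x. k * spline_d L x) (\<lambda>x. k * spline_e L x)"
    by (rule pwH2_cmult[OF ps])
  have p0: "pwH2 (\<lambda>x. 0 * spline L x) (\<lambda>x. 0 * spline_c L x) (\<lambda>x. 0 * spline_d L x) (\<lambda>x. 0 * spline_e L x)"
    by (rule pwH2_cmult[OF ps])
  have "0 \<le> I11 (\<lambda>x. \<eta> * (r x * (k * spline_e L x)) - h x * (k * spline L x)) + I11 (\<lambda>x. \<gamma> * (rp x * (0 * spline_e L x)) - hp x * (0 * spline L x))"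
  proof (rule first_variation[OF pk p0, where ?\<epsilon>0.0 = e0])
    show "k * spline_c L x = 0" if "c x = 0" for x using cc[of x] that by auto
    show "k * spline_d L x = 0" if "c x = 0" "d x = 0" for x using dd[of x] that by auto
    show "k * spline L x = 0 \<and> 0 * spline L x = 0" if "x \<in> {-2<..<-1} \<union> {1<..<2}" for x
      using that low(1)[of x] right0[of x] ab by auto
    have "AE x in lebesgue. x \<noteq> b" using AE_lborel_singleton[of b] by (rule AE_completion)
    then show "AE x in lebesgue. x \<in> {-1<..<1} \<longrightarrow> (\<forall>\<epsilon>>0. \<epsilon> < e0 \<longrightarrow> up x + \<epsilon> * (0 * spline L x) \<le> ur x + \<epsilon> * (k * spline L x))"
      using above_AE D_AE
    proof eventually_elim
      case (elim x)
      show ?case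
      proof (intro impI allI)
        fix \<epsilon> assume x: "x \<in> {-1<..<1}" and \<epsilon>: "0 < \<epsilon>" "\<epsilon> < e0"
        consider "x \<le> a" | "x \<in> {a<..<b}" | "b < x" using elim(1) by force
        then show "up x + \<epsilon> * (0 * spline L x) \<le> ur x + \<epsilon> * (k * spline L x)"
        proof cases
          case 1 then show ?thesis using low(1)[of x] elim(2) x by simp
        next
          case 2 then show ?thesis using adm(2)[OF 2 \<epsilon>] elim(3) x by simp
        next
          case 3 then show ?thesis using right0[of x] elim(2) x by simp
        qed
      qed
    qed
  qed (use adm in auto)
  also have "I11 (\<lambda>x. \<gamma> * (rp x * (0 * spline_e L x)) - hp x * (0 * spline L x)) = 0" by simp
  also have "I11 (\<lambda>x. \<eta> * (r x * (k * spline_e L x)) - h x * (k * spline L x)) = k * (\<eta> * I11 (\<lambda>x. r x * spline_e L x) - I11 (\<lambda>x. h x * spline L x))"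
  proof -
    have "L2 {-1<..<1} r" "L2 {-1<..<1} (spline L)" "L2 {-1<..<1} (spline_e L)" using pwH2_L2_11[OF ur] pwH2_L2_11[OF ps] by blast+
    then have i: "integrable_11 (\<lambda>x. r x * spline_e L x)" "integrable_11 (\<lambda>x. h x * spline L x)" using h_L2 by (auto intro!: L2_mult_11)
    have "I11 (\<lambda>x. \<eta> * (r x * (k * spline_e L x)) - h x * (k * spline L x)) = I11 (\<lambda>x. k * (\<eta> * (r x * spline_e L x) - h x * spline L x))"
      by (rule set_lebesgue_integral_cong) (auto simp: algebra_simps)
    also have "\<dots> = k * (\<eta> * I11 (\<lambda>x. r x * spline_e L x) - I11 (\<lambda>x. h x * spline L x))"
      by (simp only: I11_cmult I11_diff[OF integrable_11_cmult[OF i(1)] i(2)])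
    finally show ?thesis .
  qed
  also have "I11 (\<lambda>x. r x * spline_e L x) = I11 (\<lambda>x. R x * spline_e L x)"
    by (rule LINT_cong_AE) (use r_AE in \<open>auto elim!: eventually_mono\<close>)
  also have "\<dots> = - (\<Sum>(s, c, d, e)\<leftarrow>L. e * prim R s)"
  proof -
    have "AE x in lebesgue. x \<noteq> (1::real)" using AE_lborel_singleton[of "1::real"] by (rule AE_completion)
    then have ae: "AE x in lebesgue. x \<in> {-2..2} \<longrightarrow> R x * spline_e L x = indicator {-1<..<1} x * (R x * spline_e L x)"
    proof eventually_elim
      case (elim x)
      have "spline_e L x = 0" if "x \<notin> {-1<..<1}" using low(2)[of x] high[of x] elim ab that by force
      then show ?case by (cases "x \<in> {-1<..<1}") auto
    qed
    have "I11 (\<lambda>x. R x * spline_e L x) = I11 (\<lambda>x. indicator {-1<..<1} x * (R x * spline_e L x))"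
      by (rule set_lebesgue_integral_cong) auto
    also have "\<dots> = (LINT x:{-2..2}|lebesgue. indicator {-1<..<1} x * (R x * spline_e L x))" by (rule LINT_extend) auto
    also have "\<dots> = (LINT x:{-2..2}|lebesgue. R x * spline_e L x)" using LINT_cong_AE[OF ae] by simp
    also have "\<dots> = (\<Sum>(s, c, d, e)\<leftarrow>L. e * (prim R 2 - prim R s))" by (rule LINT_spline_e(2)[OF integrable_22_R]) (use L2 in blast)
    also have "\<dots> = (\<Sum>(s, c, d, e)\<leftarrow>L. e) * prim R 2 - (\<Sum>(s, c, d, e)\<leftarrow>L. e * prim R s)"
      by (induction L) (auto simp: algebra_simps)
    finally show ?thesis using sum0 by simp
  qed
  finally have "0 \<le> k * (- \<eta> * (\<Sum>(s, c, d, e)\<leftarrow>L. e * prim R s)) - k * I11 (\<lambda>x. h x * spline L x)" by (simp add: algebra_simps)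
  moreover have "\<bar>I11 (\<lambda>x. h x * spline L x)\<bar> \<le> C * (P b - P a)"
  proof (cases "\<forall>x. x \<in> {-1<..<1} \<longrightarrow> x \<notin> {a<..<b} \<longrightarrow> spline L x = 0")
    case True then show ?thesis using ab C by (intro h_pairing_bound spline_measurable) auto
  next
    case False
    \<comment> \<open>A spline with a jump at its last node is left-continuous and need not vanish
      at b. Changing this single value makes the bound applicable.\<close>
    define s where "s x = (if x = b then 0 else spline L x)" for x
    have "AE x in lebesgue. x \<noteq> b" using AE_lborel_singleton[of b] by (rule AE_completion)
    then have ae: "AE x in lebesgue. x \<in> {-1<..<1} \<longrightarrow> h x * spline L x = h x * s x" by eventually_elim (simp add: s_def)
    have "\<bar>I11 (\<lambda>x. h x * spline L x)\<bar> = \<bar>I11 (\<lambda>x. h x * s x)\<bar>" using LINT_cong_AE[OF ae] by simp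
    also have "\<bar>I11 (\<lambda>x. h x * s x)\<bar> \<le> C * (P b - P a)"
    proof (rule h_pairing_bound)
      show "s \<in> borel_measurable borel" unfolding s_def[abs_def] using spline_measurable by measurable
      show "s x = 0" if "x \<in> {-1<..<1}" "x \<notin> {a<..<b}" for x
        using that low(1)[of x] right0[of x] by (cases "x \<le> a"; cases "x = b") (auto simp: s_def)
    qed (use ab C in \<open>auto simp: s_def\<close>)
    finally show ?thesis .
  qed
  moreover have "\<bar>k * I11 (\<lambda>x. h x * spline L x)\<bar> \<le> \<bar>I11 (\<lambda>x. h x * spline L x)\<bar>"
    using k by (simp add: abs_mult mult_left_le_one_le)
  ultimately show ?thesis by linarith
qed

end

section \<open>Splines concentrating at a point\<close>

text \<open>Slope 1 at x, bent back so that value and slope are 0 at x + \<delta>. The curvatures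
  -3/\<delta> and 1/\<delta> on the two halves are the solution of these two conditions.\<close>

definition half_V_right :: "real \<Rightarrow> real \<Rightarrow> (real \<times> real \<times> real \<times> real) list" where
  "half_V_right x \<delta> = [(x, 0, 1, - 3 / \<delta>), (x + \<delta> / 2, 0, 0, 4 / \<delta>), (x + \<delta>, 0, 0, - 1 / \<delta>)]"

definition half_V_left :: "real \<Rightarrow> real \<Rightarrow> (real \<times> real \<times> real \<times> real) list" where
  "half_V_left x \<delta> = [(x - \<delta>, 0, 0, 1 / \<delta>), (x - \<delta> / 2, 0, 0, - 4 / \<delta>), (x, 0, 1, 3 / \<delta>)]"

text \<open>A peak of height \<delta>/2 with slopes 1 and -1 at x. The slope jump -2 is compensated
  by constant positive curvature 1/\<delta> on both sides, which exposes the sign of R at x.\<close>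

definition hat :: "real \<Rightarrow> real \<Rightarrow> (real \<times> real \<times> real \<times> real) list" where
  "hat x \<delta> = [(x - \<delta>, 0, 0, 1 / \<delta>), (x, 0, - 2, 0), (x + \<delta>, 0, 0, - 1 / \<delta>)]"

text \<open>A unit jump at x followed by a descent to 0 with slope 0 at both ends, which forces the
  curvatures -4/\<delta>^2 and 4/\<delta>^2. Their pairing with R is a second difference and detects
  its right derivative.\<close>

definition step_right :: "real \<Rightarrow> real \<Rightarrow> (real \<times> real \<times> real \<times> real) list" where
  "step_right x \<delta> = [(x, 1, 0, - 4 / \<delta>\<^sup>2), (x + \<delta> / 2, 0, 0, 8 / \<delta>\<^sup>2), (x + \<delta>, 0, 0, - 4 / \<delta>\<^sup>2)]"

definition step_left :: "real \<Rightarrow> real \<Rightarrow> (real \<times> real \<times> real \<times> real) list" where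
  "step_left x \<delta> = [(x - \<delta>, 0, 0, 4 / \<delta>\<^sup>2), (x - \<delta> / 2, 0, 0, - 8 / \<delta>\<^sup>2), (x, - 1, 0, 4 / \<delta>\<^sup>2)]"

lemma spline_half_V_right:
  assumes "\<delta> > 0"
  shows "spline (half_V_right x \<delta>) y =
    (if y \<le> x then 0 else if y \<le> x + \<delta> / 2 then (y - x) * (1 - 3 * (y - x) / (2 * \<delta>))
     else if y \<le> x + \<delta> then (x + \<delta> - y)\<^sup>2 / (2 * \<delta>) else 0)"
  using assms by (auto simp: half_V_right_def spline_def field_simps power2_eq_square)

lemma spline_half_V_left:
  assumes "\<delta> > 0"
  shows "spline (half_V_left x \<delta>) y =
    (if y \<le> x - \<delta> then 0 else if y \<le> x - \<delta> / 2 then (y - x + \<delta>)\<^sup>2 / (2 * \<delta>)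
     else if y \<le> x then (x - y) * (1 - 3 * (x - y) / (2 * \<delta>)) else 0)"
  using assms by (auto simp: half_V_left_def spline_def field_simps power2_eq_square)

lemma spline_hat:
  assumes "\<delta> > 0"
  shows "spline (hat x \<delta>) y =
    (if y \<le> x - \<delta> then 0 else if y \<le> x then (y - x + \<delta>)\<^sup>2 / (2 * \<delta>)
     else if y \<le> x + \<delta> then (x + \<delta> - y)\<^sup>2 / (2 * \<delta>) else 0)"
  using assms by (auto simp: hat_def spline_def field_simps power2_eq_square)

lemma spline_step_right:
  assumes "\<delta> > 0"
  shows "spline (step_right x \<delta>) y =
    (if y \<le> x then 0 else if y \<le> x + \<delta> / 2 then 1 - 2 * ((y - x) / \<delta>)\<^sup>2
     else if y \<le> x + \<delta> then 2 * ((x + \<delta> - y) / \<delta>)\<^sup>2 else 0)"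
  using assms by (auto simp: step_right_def spline_def field_simps power2_eq_square)

lemma spline_step_left:
  assumes "\<delta> > 0"
  shows "spline (step_left x \<delta>) y =
    (if y \<le> x - \<delta> then 0 else if y \<le> x - \<delta> / 2 then 2 * ((y - x + \<delta>) / \<delta>)\<^sup>2
     else if y \<le> x then 1 - 2 * ((x - y) / \<delta>)\<^sup>2 else 0)"
  using assms by (auto simp: step_left_def spline_def field_simps power2_eq_square)

text \<open>The bound by y - x, sharper than one by a constant, permits the half V to be subtracted
  at an end point where D itself only grows linearly.\<close>

lemma half_V_right_bounds:
  assumes "\<delta> > 0" "x < y" shows "0 \<le> spline (half_V_right x \<delta>) y" "spline (half_V_right x \<delta>) y \<le> y - x"
proof -
  have "0 \<le> spline (half_V_right x \<delta>) y \<and> spline (half_V_right x \<delta>) y \<le> y - x"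
  proof -
    consider "y \<le> x + \<delta> / 2" | "x + \<delta> / 2 < y" "y \<le> x + \<delta>" | "x + \<delta> < y" by linarith
    then show ?thesis
    proof cases
      case 1
      then have "0 \<le> 1 - 3 * (y - x) / (2 * \<delta>)" "1 - 3 * (y - x) / (2 * \<delta>) \<le> 1" using assms by (auto simp: field_simps)
      then show ?thesis using 1 assms by (auto simp: spline_half_V_right mult_left_le)
    next
      case 2
      have "(x + \<delta> - y)\<^sup>2 \<le> \<delta> * (y - x)" 
      proof -
        have "(x + \<delta> - y) * (x + \<delta> - y) \<le> \<delta> * (y - x)" using 2 assms by (intro mult_mono) auto
        then show ?thesis by (simp add: power2_eq_square)
      qed
      also have "\<dots> \<le> 2 * \<delta> * (y - x)" using assms by simp
      finally show ?thesis using 2 assms by (auto simp: spline_half_V_right divide_le_eq mult.commute mult.left_commute)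
    qed (use assms in \<open>auto simp: spline_half_V_right\<close>)
  qed
  then show "0 \<le> spline (half_V_right x \<delta>) y" "spline (half_V_right x \<delta>) y \<le> y - x" by auto
qed

lemma half_V_reflect: "\<delta> > 0 \<Longrightarrow> y \<noteq> x - \<delta> / 2 \<Longrightarrow> spline (half_V_left x \<delta>) y = spline (half_V_right (- x) \<delta>) (- y)"
  by (auto simp: spline_half_V_left spline_half_V_right)

lemma half_V_left_bounds:
  assumes "\<delta> > 0" "y < x" shows "0 \<le> spline (half_V_left x \<delta>) y" "spline (half_V_left x \<delta>) y \<le> x - y"
proof -
  have "0 \<le> spline (half_V_left x \<delta>) y \<and> spline (half_V_left x \<delta>) y \<le> x - y"
  proof (cases "y = x - \<delta> / 2")
    case True
    define u where "u = x - y"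
    have u: "y = x - u" "\<delta> = 2 * u" "u > 0" using True assms by (auto simp: u_def)
    then have "spline (half_V_left x \<delta>) y = u / 4"
      by (simp add: spline_half_V_left power2_eq_square)
    then show ?thesis using u by simp
  next
    case False
    then show ?thesis using half_V_right_bounds[of \<delta> "- x" "- y"] half_V_reflect[of \<delta> y x] assms by auto
  qed
  then show "0 \<le> spline (half_V_left x \<delta>) y" "spline (half_V_left x \<delta>) y \<le> x - y" by auto
qed

lemma hat_bounds:
  assumes "\<delta> > 0" shows "0 \<le> spline (hat x \<delta>) y" "spline (hat x \<delta>) y \<le> \<delta>"
proof -
  have "t\<^sup>2 \<le> 2 * \<delta> * \<delta>" if "0 \<le> t" "t \<le> \<delta>" for t
  proof -
    have "t\<^sup>2 \<le> \<delta>\<^sup>2" using that by (intro power_mono) auto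
    moreover have "0 \<le> \<delta>\<^sup>2" by simp
    ultimately show ?thesis unfolding power2_eq_square mult.assoc by linarith
  qed
  then show "0 \<le> spline (hat x \<delta>) y" "spline (hat x \<delta>) y \<le> \<delta>"
    using assms by (auto simp: spline_hat divide_le_eq mult.commute mult.left_commute)
qed

lemma square_quotient_le:
  assumes "0 \<le> t" "t \<le> \<delta> / 2" "(\<delta>::real) > 0" shows "(t / \<delta>)\<^sup>2 \<le> 1 / 4"
proof -
  have "(t / \<delta>)\<^sup>2 \<le> (1 / 2)\<^sup>2" using assms by (intro power_mono) (auto simp: field_simps)
  then show ?thesis by (simp add: power2_eq_square)
qed

lemma step_right_bounds:
  assumes "\<delta> > 0" shows "\<bar>spline (step_right x \<delta>) y\<bar> \<le> 1"
proof -
  define a b where "a = ((y - x) / \<delta>)\<^sup>2" and "b = ((x + \<delta> - y) / \<delta>)\<^sup>2"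
  have "0 \<le> a" "0 \<le> b" by (simp_all add: a_def b_def)
  moreover have "0 \<le> y - x \<Longrightarrow> y - x \<le> \<delta> / 2 \<Longrightarrow> a \<le> 1 / 4" "0 \<le> x + \<delta> - y \<Longrightarrow> x + \<delta> - y \<le> \<delta> / 2 \<Longrightarrow> b \<le> 1 / 4"
    unfolding a_def b_def using assms by (intro square_quotient_le; simp)+
  ultimately show ?thesis
    unfolding spline_step_right[OF assms] a_def[symmetric] b_def[symmetric] by (auto simp: abs_le_iff)
qed

lemma step_left_bounds:
  assumes "\<delta> > 0" shows "\<bar>spline (step_left x \<delta>) y\<bar> \<le> 1"
proof -
  define a b where "a = ((x - y) / \<delta>)\<^sup>2" and "b = ((y - x + \<delta>) / \<delta>)\<^sup>2"
  have "0 \<le> a" "0 \<le> b" by (simp_all add: a_def b_def)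
  moreover have "0 \<le> x - y \<Longrightarrow> x - y \<le> \<delta> / 2 \<Longrightarrow> a \<le> 1 / 4" "0 \<le> y - x + \<delta> \<Longrightarrow> y - x + \<delta> \<le> \<delta> / 2 \<Longrightarrow> b \<le> 1 / 4"
    unfolding a_def b_def using assms by (intro square_quotient_le; simp)+
  ultimately show ?thesis
    unfolding spline_step_left[OF assms] a_def[symmetric] b_def[symmetric] by (auto simp: abs_le_iff)
qed

section \<open>The gap at and beyond the end points\<close>

context minimizer
begin

text \<open>The limits from outside vanish because u_r and u_p agree there. At -1 this is the left
  limit D, at 1 it is the right limit D + c; the limits from inside remain free.\<close>

lemma D_outside:
  shows "-2 < x \<Longrightarrow> x \<le> -1 \<Longrightarrow> D x = 0" "1 \<le> x \<Longrightarrow> x < 2 \<Longrightarrow> D x + c x = 0" "1 < x \<Longrightarrow> x < 2 \<Longrightarrow> D x = 0"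
proof -
  have left: "D x \<le> 0" if "x \<in> {-2<..<2}" "e > 0" "{x-e<..<x} \<subseteq> {-2<..<-1} \<union> {1<..<2}" for x e
  proof -
    have "jumps c x + prim q x \<le> jumps cp x + prim qp x"
    proof (rule has_llim_le[OF pwac_has_llim[OF pwac_ur] pwac_has_llim[OF pwac_up] that(2)])
      show "AE y in lebesgue. y \<in> {x - e<..<x} \<longrightarrow> ur y \<le> up y"
        using outside_AE by eventually_elim (use that(3) in auto)
    qed (use that in auto)
    then show ?thesis by (simp add: D_def)
  qed
  have right: "D x + c x \<le> 0" if "x \<in> {-2<..<2}" "e > 0" "{x<..<x+e} \<subseteq> {-2<..<-1} \<union> {1<..<2}" for x e
  proof -
    have "jumps c x + c x + prim q x \<le> jumps cp x + cp x + prim qp x"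
    proof (rule has_rlim_le[OF pwac_has_rlim[OF pwac_ur] pwac_has_rlim[OF pwac_up] that(2)])
      show "AE y in lebesgue. y \<in> {x<..<x+e} \<longrightarrow> ur y \<le> up y"
        using outside_AE by eventually_elim (use that(3) in auto)
    qed (use that in auto)
    then show ?thesis using upz[OF that(1)] by (simp add: D_def)
  qed
  show "D x = 0" if "-2 < x" "x \<le> -1"
    using left[of x "x + 2"] D_nonneg(1)[of x] that by force
  show "D x + c x = 0" if "1 \<le> x" "x < 2"
    using right[of x "2 - x"] D_nonneg(2)[of x] that by force
  show "D x = 0" if "1 < x" "x < 2"
    using left[of x "x - 1"] D_nonneg(1)[of x] that by force
qed

lemma c_outside: "x \<in> {-2<..<-1} \<union> {1<..<2} \<Longrightarrow> c x = 0"
proof (elim UnE)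
  assume "x \<in> {1<..<2}" then show ?thesis using D_outside(2,3)[of x] by simp
next
  assume x: "x \<in> {-2<..<-1}"
  have "(D \<longlongrightarrow> 0) (at_right x)"
  proof (rule Lim_transform_eventually[of "\<lambda>_. 0"])
    show "\<forall>\<^sub>F y in at_right x. 0 = D y" unfolding eventually_at_right_field
      using x D_outside(1) by (intro exI[of _ "-1"]) auto
  qed simp
  then show ?thesis using tendsto_unique[OF _ D_right[of x]] D_outside(1)[of x] x by auto
qed

lemma D_right_derivative:
  assumes x: "x \<in> {-2<..<2}"
  shows "((\<lambda>t. (D (x + t) - (D x + c x)) / t) \<longlongrightarrow> q x - qp x + d x) (at_right 0)"
proof -
  obtain k where k: "\<And>y. y \<in> {-2<..<2} \<Longrightarrow> jumps cp y = k" using jumps_const[of "-2" 2 cp] upz by blast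
  obtain k' where k': "\<And>y. y \<in> {-2<..<2} \<Longrightarrow> jumps dp y = k'" using jumps_const[of "-2" 2 dp] upz by blast
  obtain \<delta> where \<delta>: "\<delta> > 0" "\<And>y. x < y \<Longrightarrow> y < x + \<delta> \<Longrightarrow> jumps c y = jumps c x + c x"
    by (rule jumps_local[OF finite_cd(1), of x]) blast
  obtain \<delta>' where \<delta>': "\<delta>' > 0" "\<And>y. x < y \<Longrightarrow> y < x + \<delta>' \<Longrightarrow> jumps d y = jumps d x + d x"
    by (rule jumps_local[OF finite_cd(2), of x]) blast
  have ir: "integrable_22 r" "integrable_22 rp" using pwH2D(4)[OF ur] pwH2D(4)[OF up] L2_integrable_22 by blast+
  have "((\<lambda>y. (jumps d x + d x + prim r y) - (k' + prim rp y)) \<longlongrightarrow> (jumps d x + d x + prim r x) - (k' + prim rp x)) (at_right x)"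
    using prim_isCont[OF ir(1), of x] prim_isCont[OF ir(2), of x]
    by (auto intro!: tendsto_intros simp: isCont_def filterlim_at_split)
  moreover have "\<forall>\<^sub>F y in at_right x. (jumps d x + d x + prim r y) - (k' + prim rp y) = q y - qp y"
    unfolding eventually_at_right_field q_def qp_def using \<delta>' k' x
    by (intro exI[of _ "min (x + \<delta>') 2"]) auto
  ultimately have "((\<lambda>y. q y - qp y) \<longlongrightarrow> (jumps d x + d x + prim r x) - (k' + prim rp x)) (at_right x)"
    by (rule Lim_transform_eventually)
  moreover have "(jumps d x + d x + prim r x) - (k' + prim rp x) = q x - qp x + d x" using k'[OF x] by (simp add: q_def qp_def)
  ultimately have "((\<lambda>y. q y - qp y) \<longlongrightarrow> q x - qp x + d x) (at_right x)" by simp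
  from prim_right_derivative[OF integrable_22_diff[OF integrable_22_q] this]
  have t: "((\<lambda>t. (prim (\<lambda>y. q y - qp y) (x + t) - prim (\<lambda>y. q y - qp y) x) / t) \<longlongrightarrow> q x - qp x + d x) (at_right 0)" using x by auto
  have "\<forall>\<^sub>F t in at_right 0. (prim (\<lambda>y. q y - qp y) (x + t) - prim (\<lambda>y. q y - qp y) x) / t = (D (x + t) - (D x + c x)) / t"
    unfolding eventually_at_right_field
  proof (intro exI[of _ "min \<delta> (2 - x)"] conjI allI impI)
    fix t assume t: "0 < t" "t < min \<delta> (2 - x)"
    have "jumps cp (x + t) = jumps cp x" using k[of "x + t"] k[OF x] t x by simp
    then show "(prim (\<lambda>y. q y - qp y) (x + t) - prim (\<lambda>y. q y - qp y) x) / t = (D (x + t) - (D x + c x)) / t"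
      using \<delta>(2)[of "x + t"] t by (simp add: D_def prim_diff_fun[OF integrable_22_q] algebra_simps)
  qed (use \<delta> x in auto)
  from Lim_transform_eventually[OF t this] show ?thesis .
qed

lemma D_left_derivative:
  assumes x: "x \<in> {-2<..<2}"
  shows "((\<lambda>t. (D x - D (x - t)) / t) \<longlongrightarrow> q x - qp x) (at_right 0)"
proof -
  obtain k where k: "\<And>y. y \<in> {-2<..<2} \<Longrightarrow> jumps cp y = k" using jumps_const[of "-2" 2 cp] upz by blast
  obtain k' where k': "\<And>y. y \<in> {-2<..<2} \<Longrightarrow> jumps dp y = k'" using jumps_const[of "-2" 2 dp] upz by blast
  obtain \<delta> where \<delta>: "\<delta> > 0" "\<And>y. x - \<delta> < y \<Longrightarrow> y \<le> x \<Longrightarrow> jumps c y = jumps c x"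
    by (rule jumps_local[OF finite_cd(1), of x]) blast
  obtain \<delta>' where \<delta>': "\<delta>' > 0" "\<And>y. x - \<delta>' < y \<Longrightarrow> y \<le> x \<Longrightarrow> jumps d y = jumps d x"
    by (rule jumps_local[OF finite_cd(2), of x]) blast
  have ir: "integrable_22 r" "integrable_22 rp" using pwH2D(4)[OF ur] pwH2D(4)[OF up] L2_integrable_22 by blast+
  have "((\<lambda>y. (jumps d x + prim r y) - (k' + prim rp y)) \<longlongrightarrow> (jumps d x + prim r x) - (k' + prim rp x)) (at_left x)"
    using prim_isCont[OF ir(1), of x] prim_isCont[OF ir(2), of x]
    by (auto intro!: tendsto_intros simp: isCont_def filterlim_at_split)
  moreover have "\<forall>\<^sub>F y in at_left x. (jumps d x + prim r y) - (k' + prim rp y) = q y - qp y"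
    unfolding eventually_at_left_field q_def qp_def
  proof (intro exI[of _ "max (x - \<delta>') (-2)"] conjI allI impI)
    fix y assume y: "max (x - \<delta>') (- 2) < y" "y < x"
    then show "jumps d x + prim r y - (k' + prim rp y) = jumps d y + prim r y - (jumps dp y + prim rp y)"
      using \<delta>'(2)[of y] k'[of y] x by simp
  qed (use \<delta>' x in auto)
  ultimately have "((\<lambda>y. q y - qp y) \<longlongrightarrow> (jumps d x + prim r x) - (k' + prim rp x)) (at_left x)"
    by (rule Lim_transform_eventually)
  moreover have "(jumps d x + prim r x) - (k' + prim rp x) = q x - qp x" using k'[OF x] by (simp add: q_def qp_def)
  ultimately have "((\<lambda>y. q y - qp y) \<longlongrightarrow> q x - qp x) (at_left x)" by simp
  from prim_left_derivative[OF integrable_22_diff[OF integrable_22_q] this]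
  have t: "((\<lambda>t. (prim (\<lambda>y. q y - qp y) x - prim (\<lambda>y. q y - qp y) (x - t)) / t) \<longlongrightarrow> q x - qp x) (at_right 0)" using x by auto
  have "\<forall>\<^sub>F t in at_right 0. (prim (\<lambda>y. q y - qp y) x - prim (\<lambda>y. q y - qp y) (x - t)) / t = (D x - D (x - t)) / t"
    unfolding eventually_at_right_field
  proof (intro exI[of _ "min \<delta> (x + 2)"] conjI allI impI)
    fix t assume t: "0 < t" "t < min \<delta> (x + 2)"
    have "jumps cp (x - t) = jumps cp x" using k[of "x - t"] k[OF x] t x by simp
    then show "(prim (\<lambda>y. q y - qp y) x - prim (\<lambda>y. q y - qp y) (x - t)) / t = (D x - D (x - t)) / t"
      using \<delta>(2)[of "x - t"] t by (simp add: D_def prim_diff_fun[OF integrable_22_q] algebra_simps)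
  qed (use \<delta> x in auto)
  from Lim_transform_eventually[OF t this] show ?thesis .
qed

text \<open>Outside the gap is 0, so without a jump at 1 its slope from inside is determined by the
  crease d alone. As D is nonnegative this slope is not merely nonzero but of the good sign, and D
  grows at least linearly away from the end.\<close>

lemma D_slope_right_end:
  assumes "c 1 = 0" "d 1 \<noteq> 0"
  obtains \<kappa> b where "\<kappa> > 0" "-1 < b" "b < 1" "\<And>y. b < y \<Longrightarrow> y < 1 \<Longrightarrow> \<kappa> * (1 - y) \<le> D y"
proof -
  have D1: "D 1 = 0" using D_outside(2)[of 1] assms by simp
  have "((\<lambda>t. (D (1 + t) - (D 1 + c 1)) / t) \<longlongrightarrow> 0) (at_right 0)"
  proof (rule Lim_transform_eventually[of "\<lambda>_. 0"])
    show "\<forall>\<^sub>F t in at_right 0. 0 = (D (1 + t) - (D 1 + c 1)) / t" unfolding eventually_at_right_field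
      using D_outside(3) D1 assms by (intro exI[of _ 1]) auto
  qed simp
  then have q: "q 1 - qp 1 + d 1 = 0" using tendsto_unique[OF _ D_right_derivative[of 1]] by fastforce
  have t: "((\<lambda>t. D (1 - t) / t) \<longlongrightarrow> d 1) (at_right 0)"
  proof -
    have "d 1 = - (q 1 - qp 1)" using q by simp
    then show ?thesis using tendsto_minus[OF D_left_derivative[of 1]] D1 by simp
  qed
  have "0 \<le> d 1"
  proof (rule tendsto_lowerbound[OF t])
    show "\<forall>\<^sub>F t in at_right 0. 0 \<le> D (1 - t) / t" unfolding eventually_at_right_field
      using D_nonneg(1) by (intro exI[of _ 1]) (auto intro!: divide_nonneg_pos)
  qed simp
  then have dpos: "d 1 / 2 < d 1" "d 1 > 0" using assms by auto
  from order_tendstoD(1)[OF t dpos(1)] obtain \<delta> where \<delta>: "\<delta> > 0" "\<And>t. 0 < t \<Longrightarrow> t < \<delta> \<Longrightarrow> d 1 / 2 < D (1 - t) / t"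
    unfolding eventually_at_right_field by blast
  show ?thesis
  proof (rule that[of "d 1 / 2" "1 - min \<delta> 1"])
    fix y :: real assume y: "1 - min \<delta> 1 < y" "y < 1"
    then have "d 1 / 2 < D (1 - (1 - y)) / (1 - y)" using \<delta> by (intro \<delta>(2)) auto
    then show "d 1 / 2 * (1 - y) \<le> D y" using y by (simp add: less_divide_eq)
  qed (use dpos \<delta> in auto)
qed

lemma D_slope_left_end:
  assumes "c (-1) = 0" "d (-1) \<noteq> 0"
  obtains \<kappa> b where "\<kappa> > 0" "-1 < b" "b < 1" "\<And>y. -1 < y \<Longrightarrow> y < b \<Longrightarrow> \<kappa> * (y + 1) \<le> D y"
proof -
  have D1: "D (-1) = 0" using D_outside(1)[of "-1"] by simp
  have "((\<lambda>t. (D (-1) - D (-1 - t)) / t) \<longlongrightarrow> 0) (at_right 0)"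
  proof (rule Lim_transform_eventually[of "\<lambda>_. 0"])
    show "\<forall>\<^sub>F t in at_right 0. 0 = (D (-1) - D (-1 - t)) / t" unfolding eventually_at_right_field
      using D_outside(1) D1 by (intro exI[of _ 1]) auto
  qed simp
  then have q: "q (-1) - qp (-1) = 0" using tendsto_unique[OF _ D_left_derivative[of "-1"]] by fastforce
  have t: "((\<lambda>t. D (-1 + t) / t) \<longlongrightarrow> d (-1)) (at_right 0)"
    using D_right_derivative[of "-1"] D1 q assms by simp
  have "0 \<le> d (-1)"
  proof (rule tendsto_lowerbound[OF t])
    show "\<forall>\<^sub>F t in at_right 0. 0 \<le> D (-1 + t) / t" unfolding eventually_at_right_field
      using D_nonneg(1) by (intro exI[of _ 1]) (auto intro!: divide_nonneg_pos)
  qed simp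
  then have dpos: "d (-1) / 2 < d (-1)" "d (-1) > 0" using assms by auto
  from order_tendstoD(1)[OF t dpos(1)] obtain \<delta> where \<delta>: "\<delta> > 0" "\<And>t. 0 < t \<Longrightarrow> t < \<delta> \<Longrightarrow> d (-1) / 2 < D (-1 + t) / t"
    unfolding eventually_at_right_field by blast
  show ?thesis
  proof (rule that[of "d (-1) / 2" "-1 + min \<delta> 1"])
    fix y :: real assume y: "-1 < y" "y < -1 + min \<delta> 1"
    then have "d (-1) / 2 < D (-1 + (y + 1)) / (y + 1)" using \<delta> by (intro \<delta>(2)) auto
    then show "d (-1) / 2 * (y + 1) \<le> D y" using y by (simp add: less_divide_eq)
  qed (use dpos \<delta> in auto)
qed

end

section \<open>Second and third derivatives at jumps and creases\<close>

context minimizer_structure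
begin

lemma P_right: "((\<lambda>\<delta>. P (x + \<delta>) - P x) \<longlongrightarrow> 0) (at_right 0)"
proof -
  have "((\<lambda>\<delta>. P (x + \<delta>) - P x) \<longlongrightarrow> P (x + 0) - P x) (at_right 0)"
    by (intro tendsto_intros isCont_tendsto_compose[OF P_isCont])
  then show ?thesis by simp
qed

lemma P_left: "((\<lambda>\<delta>. P x - P (x - \<delta>)) \<longlongrightarrow> 0) (at_right 0)"
proof -
  have "((\<lambda>\<delta>. P x - P (x - \<delta>)) \<longlongrightarrow> P x - P (x - 0)) (at_right 0)"
    by (intro tendsto_intros isCont_tendsto_compose[OF P_isCont])
  then show ?thesis by simp
qed

lemma prim_R_right: "-2 \<le> x \<Longrightarrow> x < 2 \<Longrightarrow> ((\<lambda>t. (prim R (x + t) - prim R x) / t) \<longlongrightarrow> R x) (at_right 0)"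
  using R_isCont[of x] by (intro prim_right_derivative[OF integrable_22_R]) (auto simp: isCont_def filterlim_at_split)

lemma prim_R_left: "-2 < x \<Longrightarrow> x \<le> 2 \<Longrightarrow> ((\<lambda>t. (prim R x - prim R (x - t)) / t) \<longlongrightarrow> R x) (at_right 0)"
  using R_isCont[of x] by (intro prim_left_derivative[OF integrable_22_R]) (auto simp: isCont_def filterlim_at_split)

text \<open>The curvature of the half V has integral -1 for every \<delta>, since it must undo the
  initial slope 1, so its pairing with R tends to -R x. Admissibility is required only for
  increments t between 0 and y - x, which covers both a gap and linear growth of D.\<close>

lemma half_V_right_variation:
  assumes x: "-1 \<le> x" "x < b" "b \<le> 1" and cd: "c x \<noteq> 0 \<or> d x \<noteq> 0" and k: "\<bar>k\<bar> \<le> 1"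
    and adm: "e0 > 0" "\<And>y t \<epsilon>. x < y \<Longrightarrow> y < b \<Longrightarrow> 0 \<le> t \<Longrightarrow> t \<le> y - x \<Longrightarrow> 0 < \<epsilon> \<Longrightarrow> \<epsilon> < e0 \<Longrightarrow> 0 \<le> D y + \<epsilon> * (k * t)"
  shows "k * R x \<le> 0"
proof -
  \<comment> \<open>The three node values of \<open>prim R\<close>, regrouped into quotients at
    scales \<delta> and \<delta>/2. Each tends to R x, so the whole tends to R x - 2 R x.\<close>
  let ?N = "\<lambda>\<delta>. (prim R (x + \<delta>) - prim R x) / \<delta> - 2 * ((prim R (x + \<delta> * (1 / 2)) - prim R x) / (\<delta> * (1 / 2)))"
  have "((\<lambda>\<delta>. k * (\<eta> * ?N \<delta>) + 1 * (P (x + \<delta>) - P x)) \<longlongrightarrow> k * (\<eta> * (R x - 2 * R x)) + 1 * 0) (at_right 0)"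
    by (intro tendsto_intros P_right prim_R_right at_right_0_scale[where F = "\<lambda>t. (prim R (x + t) - prim R x) / t"]) (use x in auto)
  moreover have "\<forall>\<^sub>F \<delta> in at_right 0. 0 \<le> k * (\<eta> * ?N \<delta>) + 1 * (P (x + \<delta>) - P x)"
    unfolding eventually_at_right_field
  proof (intro exI[of _ "min 1 (b - x)"] conjI allI impI)
    fix \<delta> assume \<delta>: "0 < \<delta>" "\<delta> < min 1 (b - x)"
    let ?L = "half_V_right x \<delta>"
    have "0 \<le> k * (- \<eta> * (\<Sum>(s, c, d, e)\<leftarrow>?L. e * prim R s)) + 1 * (P (x + \<delta>) - P x)"
    proof (rule spline_variation[OF x(1), where L = ?L and k = k and ?e0.0 = e0])
      show "x \<le> s \<and> s \<le> x + \<delta>" if "(s, c, d, e) \<in> set ?L" for s c d e using that \<delta> by (auto simp: half_V_right_def)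
      show "(\<Sum>(s, c, d, e)\<leftarrow>?L. e) = 0" by (simp add: half_V_right_def diff_divide_distrib[symmetric] add_divide_distrib[symmetric])
      show "spline ?L y = 0" if "x + \<delta> < y" for y using that \<delta> by (simp add: spline_half_V_right)
      show "\<bar>spline ?L y\<bar> \<le> 1" if "y \<in> {x<..<x + \<delta>}" for y
        using half_V_right_bounds[of \<delta> x y] that \<delta> by auto
      show "c y \<noteq> 0" if "spline_c ?L y \<noteq> 0" for y using that by (simp add: spline_c_def half_V_right_def)
      show "c y \<noteq> 0 \<or> d y \<noteq> 0" if "spline_d ?L y \<noteq> 0" for y
        using that cd by (auto simp: spline_d_def half_V_right_def split: if_splits)
      show "0 \<le> D y + \<epsilon> * (k * spline ?L y)" if "y \<in> {x<..<x + \<delta>}" "0 < \<epsilon>" "\<epsilon> < e0" for y \<epsilon>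
        using half_V_right_bounds[of \<delta> x y] that \<delta> by (intro adm(2)) auto
    qed (use \<delta> x k adm in auto)
    also have "- \<eta> * (\<Sum>(s, c, d, e)\<leftarrow>?L. e * prim R s) = \<eta> * ?N \<delta>"
      using \<delta> by (simp add: half_V_right_def field_simps)
    finally show "0 \<le> k * (\<eta> * ?N \<delta>) + 1 * (P (x + \<delta>) - P x)" .
  qed (use x in simp)
  ultimately have "0 \<le> k * (\<eta> * (R x - 2 * R x)) + 1 * 0" by (rule tendsto_lowerbound) simp
  then have "\<eta> * (k * R x) \<le> 0" by (simp add: algebra_simps)
  then show ?thesis using pos(1) by (simp add: mult_le_0_iff)
qed

lemma half_V_left_variation:
  assumes x: "-1 \<le> a" "a < x" "x \<le> 1" and cd: "c x \<noteq> 0 \<or> d x \<noteq> 0" and k: "\<bar>k\<bar> \<le> 1"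
    and adm: "e0 > 0" "\<And>y t \<epsilon>. a < y \<Longrightarrow> y < x \<Longrightarrow> 0 \<le> t \<Longrightarrow> t \<le> x - y \<Longrightarrow> 0 < \<epsilon> \<Longrightarrow> \<epsilon> < e0 \<Longrightarrow> 0 \<le> D y + \<epsilon> * (k * t)"
  shows "k * R x \<le> 0"
proof -
  let ?N = "\<lambda>\<delta>. (prim R x - prim R (x - \<delta>)) / \<delta> - 2 * ((prim R x - prim R (x - \<delta> * (1 / 2))) / (\<delta> * (1 / 2)))"
  have "((\<lambda>\<delta>. k * (\<eta> * ?N \<delta>) + 1 * (P x - P (x - \<delta>))) \<longlongrightarrow> k * (\<eta> * (R x - 2 * R x)) + 1 * 0) (at_right 0)"
    by (intro tendsto_intros P_left prim_R_left at_right_0_scale[where F = "\<lambda>t. (prim R x - prim R (x - t)) / t"]) (use x in auto)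
  moreover have "\<forall>\<^sub>F \<delta> in at_right 0. 0 \<le> k * (\<eta> * ?N \<delta>) + 1 * (P x - P (x - \<delta>))"
    unfolding eventually_at_right_field
  proof (intro exI[of _ "min 1 (x - a)"] conjI allI impI)
    fix \<delta> assume \<delta>: "0 < \<delta>" "\<delta> < min 1 (x - a)"
    let ?L = "half_V_left x \<delta>"
    have "0 \<le> k * (- \<eta> * (\<Sum>(s, c, d, e)\<leftarrow>?L. e * prim R s)) + 1 * (P x - P (x - \<delta>))"
    proof (rule spline_variation[where L = ?L and k = k and ?e0.0 = e0])
      show "x - \<delta> \<le> s \<and> s \<le> x" if "(s, c, d, e) \<in> set ?L" for s c d e using that \<delta> by (auto simp: half_V_left_def)
      show "(\<Sum>(s, c, d, e)\<leftarrow>?L. e) = 0" by (simp add: half_V_left_def diff_divide_distrib[symmetric] add_divide_distrib[symmetric])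
      show "spline ?L y = 0" if "x < y" for y using that \<delta> by (simp add: spline_half_V_left)
      show "\<bar>spline ?L y\<bar> \<le> 1" if "y \<in> {x - \<delta><..<x}" for y
        using half_V_left_bounds[of \<delta> y x] that \<delta> by auto
      show "c y \<noteq> 0" if "spline_c ?L y \<noteq> 0" for y using that by (simp add: spline_c_def half_V_left_def)
      show "c y \<noteq> 0 \<or> d y \<noteq> 0" if "spline_d ?L y \<noteq> 0" for y
        using that cd by (auto simp: spline_d_def half_V_left_def split: if_splits)
      show "0 \<le> D y + \<epsilon> * (k * spline ?L y)" if "y \<in> {x - \<delta><..<x}" "0 < \<epsilon>" "\<epsilon> < e0" for y \<epsilon>
        using half_V_left_bounds[of \<delta> y x] that \<delta> by (intro adm(2)) auto
    qed (use \<delta> x k adm in auto)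
    also have "- \<eta> * (\<Sum>(s, c, d, e)\<leftarrow>?L. e * prim R s) = \<eta> * ?N \<delta>"
      using \<delta> by (simp add: half_V_left_def field_simps)
    finally show "0 \<le> k * (\<eta> * ?N \<delta>) + 1 * (P x - P (x - \<delta>))" .
  qed (use x in simp)
  ultimately have "0 \<le> k * (\<eta> * (R x - 2 * R x)) + 1 * 0" by (rule tendsto_lowerbound) simp
  then have "\<eta> * (k * R x) \<le> 0" by (simp add: algebra_simps)
  then show ?thesis using pos(1) by (simp add: mult_le_0_iff)
qed

lemma gap_admissible:
  assumes "gap a b" "-1 \<le> a" "b \<le> 1"
  obtains e0 where "e0 > 0" "\<And>y t \<epsilon> k. a < y \<Longrightarrow> y < b \<Longrightarrow> \<bar>t\<bar> \<le> 2 \<Longrightarrow> \<bar>k\<bar> \<le> 1 \<Longrightarrow> 0 < \<epsilon> \<Longrightarrow> \<epsilon> < e0 \<Longrightarrow> 0 \<le> D y + \<epsilon> * (k * t)"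
proof -
  obtain \<rho> where \<rho>: "\<rho> > 0" "\<And>y. y \<in> {a<..<b} \<Longrightarrow> \<rho> \<le> D y" using assms(1) unfolding gap_def by blast
  show ?thesis
  \<comment> \<open>The product \<open>k * t\<close> has absolute value at most 2.\<close>
  proof (rule that[of "\<rho> / 2"])
    fix y t \<epsilon> k :: real assume H: "a < y" "y < b" "\<bar>t\<bar> \<le> 2" "\<bar>k\<bar> \<le> 1" "0 < \<epsilon>" "\<epsilon> < \<rho> / 2"
    have "\<bar>k * t\<bar> \<le> 1 * 2" unfolding abs_mult using H by (intro mult_mono) auto
    then have "\<epsilon> * \<bar>k * t\<bar> \<le> \<rho> / 2 * 2" using H by (intro mult_mono) auto
    then have "\<bar>\<epsilon> * (k * t)\<bar> \<le> \<rho>" using H by (simp add: abs_mult)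
    then show "0 \<le> D y + \<epsilon> * (k * t)" using \<rho>(2)[of y] H by auto
  qed (use \<rho> in simp)
qed

text \<open>Next to a gap the half V may be added and subtracted, so both signs of k are
  available.\<close>

lemma R_zero_right:
  assumes "-1 \<le> x" "x < b" "b \<le> 1" "gap x b" "c x \<noteq> 0 \<or> d x \<noteq> 0"
  shows "R x = 0"
proof -
  obtain e0 where e0: "e0 > 0" "\<And>y t \<epsilon> k. x < y \<Longrightarrow> y < b \<Longrightarrow> \<bar>t\<bar> \<le> 2 \<Longrightarrow> \<bar>k\<bar> \<le> 1 \<Longrightarrow> 0 < \<epsilon> \<Longrightarrow> \<epsilon> < e0 \<Longrightarrow> 0 \<le> D y + \<epsilon> * (k * t)"
    by (rule gap_admissible[OF assms(4,1,3)]) blast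
  have "k * R x \<le> 0" if "\<bar>k\<bar> \<le> 1" for k
    by (rule half_V_right_variation[OF assms(1-3,5) that e0(1)]) (rule e0(2); use assms that in auto)
  from this[of 1] this[of "-1"] show ?thesis by simp
qed

lemma R_zero_left:
  assumes "-1 \<le> a" "a < x" "x \<le> 1" "gap a x" "c x \<noteq> 0 \<or> d x \<noteq> 0"
  shows "R x = 0"
proof -
  obtain e0 where e0: "e0 > 0" "\<And>y t \<epsilon> k. a < y \<Longrightarrow> y < x \<Longrightarrow> \<bar>t\<bar> \<le> 2 \<Longrightarrow> \<bar>k\<bar> \<le> 1 \<Longrightarrow> 0 < \<epsilon> \<Longrightarrow> \<epsilon> < e0 \<Longrightarrow> 0 \<le> D y + \<epsilon> * (k * t)"
    by (rule gap_admissible[OF assms(4,1,3)]) blast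
  have "k * R x \<le> 0" if "\<bar>k\<bar> \<le> 1" for k
    by (rule half_V_left_variation[OF assms(1-3,5) that e0(1)]) (rule e0(2); use assms that in auto)
  from this[of 1] this[of "-1"] show ?thesis by simp
qed

text \<open>Subtraction is possible in spite of contact at -1: the half V is at most y + 1, whereas
  D is at least \<kappa> (y + 1).\<close>

lemma R_nonneg_left_end:
  assumes "c (-1) = 0" "d (-1) \<noteq> 0" shows "0 \<le> R (-1)"
proof -
  obtain \<kappa> b where \<kappa>: "\<kappa> > 0" "-1 < b" "b < 1" "\<And>y. -1 < y \<Longrightarrow> y < b \<Longrightarrow> \<kappa> * (y + 1) \<le> D y"
    using D_slope_left_end[OF assms] by blast
  have "-1 * R (-1) \<le> 0"
  proof (rule half_V_right_variation[OF _ \<kappa>(2) _ _ _ \<kappa>(1)])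
    fix y t \<epsilon> assume H: "-1 < y" "y < b" "0 \<le> t" "t \<le> y - -1" "0 < \<epsilon>" "\<epsilon> < \<kappa>"
    have "\<epsilon> * t \<le> \<kappa> * (y + 1)" using H by (intro mult_mono) auto
    then show "0 \<le> D y + \<epsilon> * (-1 * t)" using \<kappa>(4)[of y] H by simp
  qed (use \<kappa> assms in auto)
  then show ?thesis by simp
qed

lemma R_nonneg_right_end:
  assumes "c 1 = 0" "d 1 \<noteq> 0" shows "0 \<le> R 1"
proof -
  obtain \<kappa> b where \<kappa>: "\<kappa> > 0" "-1 < b" "b < 1" "\<And>y. b < y \<Longrightarrow> y < 1 \<Longrightarrow> \<kappa> * (1 - y) \<le> D y"
    using D_slope_right_end[OF assms] by blast
  have "-1 * R 1 \<le> 0"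
  proof (rule half_V_left_variation[OF _ \<kappa>(3) _ _ _ \<kappa>(1)])
    fix y t \<epsilon> assume H: "b < y" "y < 1" "0 \<le> t" "t \<le> 1 - y" "0 < \<epsilon>" "\<epsilon> < \<kappa>"
    have "\<epsilon> * t \<le> \<kappa> * (1 - y)" using H by (intro mult_mono) auto
    then show "0 \<le> D y + \<epsilon> * (-1 * t)" using \<kappa>(4)[of y] H by simp
  qed (use \<kappa> assms in auto)
  then show ?thesis by simp
qed

text \<open>A nonnegative hat may always be added, whether or not there is contact. Its curvature is
  nonnegative with integral 2 and concentrates at x, so the limit is 0 <= 2 \<eta> R x.\<close>

lemma R_nonneg:
  assumes x: "-1 < x" "x < 1" and cd: "c x \<noteq> 0 \<or> d x \<noteq> 0"
  shows "0 \<le> R x"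
proof -
  let ?N = "\<lambda>\<delta>. (prim R (x + \<delta>) - prim R x) / \<delta> + (prim R x - prim R (x - \<delta>)) / \<delta>"
  have "((\<lambda>\<delta>. 1 * (\<eta> * ?N \<delta>) + 1 * ((P (x + \<delta>) - P x) + (P x - P (x - \<delta>)))) \<longlongrightarrow> 1 * (\<eta> * (R x + R x)) + 1 * (0 + 0)) (at_right 0)"
    by (intro tendsto_intros P_left P_right prim_R_left prim_R_right) (use x in auto)
  moreover have "\<forall>\<^sub>F \<delta> in at_right 0. 0 \<le> 1 * (\<eta> * ?N \<delta>) + 1 * ((P (x + \<delta>) - P x) + (P x - P (x - \<delta>)))"
    unfolding eventually_at_right_field
  proof (intro exI[of _ "min 1 (min (1 - x) (x + 1))"] conjI allI impI)
    fix \<delta> assume \<delta>: "0 < \<delta>" "\<delta> < min 1 (min (1 - x) (x + 1))"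
    let ?L = "hat x \<delta>"
    have "0 \<le> 1 * (- \<eta> * (\<Sum>(s, c, d, e)\<leftarrow>?L. e * prim R s)) + 1 * (P (x + \<delta>) - P (x - \<delta>))"
    proof (rule spline_variation[where L = ?L and k = 1 and ?e0.0 = 1])
      show "x - \<delta> \<le> s \<and> s \<le> x + \<delta>" if "(s, c, d, e) \<in> set ?L" for s c d e using that \<delta> by (auto simp: hat_def)
      show "(\<Sum>(s, c, d, e)\<leftarrow>?L. e) = 0" by (simp add: hat_def)
      show "spline ?L y = 0" if "x + \<delta> < y" for y using that \<delta> by (simp add: spline_hat)
      show "\<bar>spline ?L y\<bar> \<le> 1" if "y \<in> {x - \<delta><..<x + \<delta>}" for y
        using hat_bounds[of \<delta> x y] that \<delta> by auto
      show "c y \<noteq> 0" if "spline_c ?L y \<noteq> 0" for y using that by (simp add: spline_c_def hat_def)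
      show "c y \<noteq> 0 \<or> d y \<noteq> 0" if "spline_d ?L y \<noteq> 0" for y
        using that cd by (auto simp: spline_d_def hat_def split: if_splits)
      show "0 \<le> D y + \<epsilon> * (1 * spline ?L y)" if "y \<in> {x - \<delta><..<x + \<delta>}" "0 < \<epsilon>" "\<epsilon> < 1" for y \<epsilon>
        using hat_bounds(1)[of \<delta> x y] D_nonneg(1)[of y] that \<delta> x by (intro add_nonneg_nonneg) auto
    qed (use \<delta> x in auto)
    also have "- \<eta> * (\<Sum>(s, c, d, e)\<leftarrow>?L. e * prim R s) = \<eta> * ?N \<delta>"
      using \<delta> by (simp add: hat_def field_simps)
    finally show "0 \<le> 1 * (\<eta> * ?N \<delta>) + 1 * ((P (x + \<delta>) - P x) + (P x - P (x - \<delta>)))" by simp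
  qed (use x in simp)
  ultimately have "0 \<le> 1 * (\<eta> * (R x + R x)) + 1 * (0 + 0)" by (rule tendsto_lowerbound) simp
  then show ?thesis using pos(1) by (simp add: zero_le_mult_iff)
qed

text \<open>Splits off the affine part of \<open>prim R\<close>, which second differences
  annihilate.\<close>

lemma prim_R_eq: "x \<in> {-2..2} \<Longrightarrow> prim R x = A0 / \<eta> * (x + 2) + prim (prim R1) x"
proof -
  assume x: "x \<in> {-2..2}"
  have c: "integrable_22 (\<lambda>x. A0 / \<eta>)" by (rule integrable_22_continuous) auto
  have "prim R x = prim (\<lambda>x. A0 / \<eta>) x + prim (prim R1) x"
    unfolding R_def[abs_def] by (rule prim_add[OF c integrable_22_prim[OF integrable_22_R1]])
  also have "prim (\<lambda>x. A0 / \<eta>) x = A0 / \<eta> * (x + 2)" using x by (simp add: prim_def algebra_simps add_divide_distrib)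
  finally show ?thesis .
qed

lemma R1_right_limit: "(R1 \<longlongrightarrow> R1 x) (at_right x)"
proof -
  have "(g \<longlongrightarrow> g x) (at_right x)" using g_right[of x] by (simp add: continuous_within)
  moreover have "(prim h1 \<longlongrightarrow> prim h1 x) (at_right x)"
    using prim_isCont[OF integrable_22_h1(1), of x] by (simp add: isCont_def filterlim_at_split)
  ultimately show ?thesis unfolding R1_def[abs_def] using pos(1) by (intro tendsto_intros) auto
qed

text \<open>A unit step is admissible with both signs at a jump point bordering on a gap. Its
  curvature has integral 0 and first moment 1 about x, so the pairing with R tends to the right
  derivative of R.\<close>

lemma R1_zero_right:
  assumes x: "-1 \<le> x" "x < b" "b \<le> 1" and gp: "gap x b" and cx: "c x \<noteq> 0"
  shows "R1 x = 0"
proof -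
  obtain e0 where e0: "e0 > 0" "\<And>y t \<epsilon> k. x < y \<Longrightarrow> y < b \<Longrightarrow> \<bar>t\<bar> \<le> 2 \<Longrightarrow> \<bar>k\<bar> \<le> 1 \<Longrightarrow> 0 < \<epsilon> \<Longrightarrow> \<epsilon> < e0 \<Longrightarrow> 0 \<le> D y + \<epsilon> * (k * t)"
    by (rule gap_admissible[OF gp x(1,3)]) blast
  have "0 \<le> k * R1 x" if k: "\<bar>k\<bar> \<le> 1" for k
  proof -
    let ?Q = "prim (prim R1)"
    let ?E = "\<lambda>t. (?Q (x + t) - ?Q x - prim R1 x * t) / t\<^sup>2"
    \<comment> \<open>The second difference of \<open>?Q\<close> with step \<delta>/2, times
      4/\<delta>^2, in terms of Taylor remainders: the constant and linear terms cancel. The limit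
      is 2 R1 x - R1 x.\<close>
    let ?N = "\<lambda>\<delta>. 4 * ?E \<delta> - 2 * ?E (\<delta> * (1 / 2))"
    have E: "(?E \<longlongrightarrow> R1 x / 2) (at_right 0)" by (rule prim_prim_right_expansion[OF integrable_22_R1 R1_right_limit]) (use x in auto)
    have "((\<lambda>\<delta>. k * (\<eta> * ?N \<delta>) + 1 * (P (x + \<delta>) - P x)) \<longlongrightarrow> k * (\<eta> * (4 * (R1 x / 2) - 2 * (R1 x / 2))) + 1 * 0) (at_right 0)"
      by (intro tendsto_intros P_right E at_right_0_scale[where F = ?E]) auto
    moreover have "\<forall>\<^sub>F \<delta> in at_right 0. 0 \<le> k * (\<eta> * ?N \<delta>) + 1 * (P (x + \<delta>) - P x)"
      unfolding eventually_at_right_field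
    proof (intro exI[of _ "min 1 (b - x)"] conjI allI impI)
      fix \<delta> assume \<delta>: "0 < \<delta>" "\<delta> < min 1 (b - x)"
      let ?L = "step_right x \<delta>"
      have "0 \<le> k * (- \<eta> * (\<Sum>(s, c, d, e)\<leftarrow>?L. e * prim R s)) + 1 * (P (x + \<delta>) - P x)"
      proof (rule spline_variation[where L = ?L and k = k and ?e0.0 = e0])
        show "x \<le> s \<and> s \<le> x + \<delta>" if "(s, c, d, e) \<in> set ?L" for s c d e using that \<delta> by (auto simp: step_right_def)
        show "(\<Sum>(s, c, d, e)\<leftarrow>?L. e) = 0" by (simp add: step_right_def diff_divide_distrib[symmetric] add_divide_distrib[symmetric])
        show "spline ?L y = 0" if "x + \<delta> < y" for y using that \<delta> by (simp add: spline_step_right)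
        show "\<bar>spline ?L y\<bar> \<le> 1" for y using step_right_bounds[of \<delta> x y] \<delta> by auto
        show "c y \<noteq> 0" if "spline_c ?L y \<noteq> 0" for y using that cx by (auto simp: spline_c_def step_right_def split: if_splits)
        show "c y \<noteq> 0 \<or> d y \<noteq> 0" if "spline_d ?L y \<noteq> 0" for y using that by (simp add: spline_d_def step_right_def)
        show "0 \<le> D y + \<epsilon> * (k * spline ?L y)" if "y \<in> {x<..<x + \<delta>}" "0 < \<epsilon>" "\<epsilon> < e0" for y \<epsilon>
          using step_right_bounds[of \<delta> x y] that \<delta> k by (intro e0(2)) auto
      qed (use \<delta> x k e0 in auto)
      also have "- \<eta> * (\<Sum>(s, c, d, e)\<leftarrow>?L. e * prim R s) = \<eta> * ?N \<delta>"
      proof -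
        have "- \<eta> * (\<Sum>(s, c, d, e)\<leftarrow>?L. e * prim R s) = \<eta> * (4 / \<delta>\<^sup>2 * (prim R x - 2 * prim R (x + \<delta> / 2) + prim R (x + \<delta>)))"
          using \<delta> by (simp add: step_right_def field_simps)
        also have "prim R x - 2 * prim R (x + \<delta> / 2) + prim R (x + \<delta>) = ?Q x - 2 * ?Q (x + \<delta> / 2) + ?Q (x + \<delta>)"
          using x \<delta> by (simp add: prim_R_eq algebra_simps)
        also have "4 / \<delta>\<^sup>2 * (?Q x - 2 * ?Q (x + \<delta> / 2) + ?Q (x + \<delta>)) = ?N \<delta>"
          using \<delta> by (simp add: field_simps power2_eq_square)
        finally show ?thesis .
      qed
      finally show "0 \<le> k * (\<eta> * ?N \<delta>) + 1 * (P (x + \<delta>) - P x)" .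
    qed (use x in simp)
    ultimately have "0 \<le> k * (\<eta> * (4 * (R1 x / 2) - 2 * (R1 x / 2))) + 1 * 0" by (rule tendsto_lowerbound) simp
    then have "0 \<le> \<eta> * (k * R1 x)" by (simp add: algebra_simps)
    then show ?thesis using pos(1) by (simp add: zero_le_mult_iff)
  qed
  from this[of 1] this[of "-1"] show ?thesis by simp
qed

text \<open>In a gap g is constant, so R1 differs there by a constant from a continuous function and
  has a left limit. If the gap continues beyond x, the same constant is g x and R1 is continuous at
  x.\<close>

lemma R1_left_limit_gap:
  assumes "-1 \<le> a" "a < x" "x \<le> 1" "gap a x"
  obtains l where "(R1 \<longlongrightarrow> l) (at_left x)" "x < 1 \<Longrightarrow> (\<exists>b>x. b \<le> 1 \<and> gap a b) \<Longrightarrow> l = R1 x"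
proof -
  let ?m = "(a + x) / 2"
  have "((\<lambda>y. (g ?m + prim h1 y) / \<eta>) \<longlongrightarrow> (g ?m + prim h1 x) / \<eta>) (at_left x)"
    using prim_isCont[OF integrable_22_h1(1), of x] pos(1) by (intro tendsto_intros) (auto simp: isCont_def filterlim_at_split)
  moreover have "\<forall>\<^sub>F y in at_left x. (g ?m + prim h1 y) / \<eta> = R1 y" unfolding eventually_at_left_field
  proof (intro exI[of _ ?m] conjI allI impI)
    fix y assume "?m < y" "y < x"
    then have "g ?m = g y" by (intro g_gap[OF assms(4,1,3)]) (use assms in auto)
    then show "(g ?m + prim h1 y) / \<eta> = R1 y" by (simp add: R1_def)
  qed (use assms in auto)
  ultimately have "(R1 \<longlongrightarrow> (g ?m + prim h1 x) / \<eta>) (at_left x)" by (rule Lim_transform_eventually)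
  moreover have "(g ?m + prim h1 x) / \<eta> = R1 x" if b: "x < 1" "\<exists>b>x. b \<le> 1 \<and> gap a b"
  proof -
    obtain b where "b > x" "b \<le> 1" "gap a b" using b by blast
    then have "g ?m = g x" using assms by (intro g_gap) auto
    then show ?thesis by (simp add: R1_def)
  qed
  ultimately show ?thesis using that by blast
qed

lemma R1_zero_left:
  assumes x: "-1 \<le> a" "a < x" "x \<le> 1" and gp: "gap a x" and cx: "c x \<noteq> 0"
  shows "(R1 \<longlongrightarrow> 0) (at_left x)"
proof -
  obtain l where l: "(R1 \<longlongrightarrow> l) (at_left x)" by (rule R1_left_limit_gap[OF x gp])
  obtain e0 where e0: "e0 > 0" "\<And>y t \<epsilon> k. a < y \<Longrightarrow> y < x \<Longrightarrow> \<bar>t\<bar> \<le> 2 \<Longrightarrow> \<bar>k\<bar> \<le> 1 \<Longrightarrow> 0 < \<epsilon> \<Longrightarrow> \<epsilon> < e0 \<Longrightarrow> 0 \<le> D y + \<epsilon> * (k * t)"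
    by (rule gap_admissible[OF gp x(1,3)]) blast
  have "0 \<le> - k * l" if k: "\<bar>k\<bar> \<le> 1" for k
  proof -
    let ?Q = "prim (prim R1)"
    let ?E = "\<lambda>t. (?Q (x - t) - ?Q x + prim R1 x * t) / t\<^sup>2"
    let ?N = "\<lambda>\<delta>. - (4 * ?E \<delta> - 2 * ?E (\<delta> * (1 / 2)))"
    have E: "(?E \<longlongrightarrow> l / 2) (at_right 0)" by (rule prim_prim_left_expansion[OF integrable_22_R1 l]) (use x in auto)
    have "((\<lambda>\<delta>. k * (\<eta> * ?N \<delta>) + 1 * (P x - P (x - \<delta>))) \<longlongrightarrow> k * (\<eta> * - (4 * (l / 2) - 2 * (l / 2))) + 1 * 0) (at_right 0)"
      by (intro tendsto_intros P_left E at_right_0_scale[where F = ?E]) auto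
    moreover have "\<forall>\<^sub>F \<delta> in at_right 0. 0 \<le> k * (\<eta> * ?N \<delta>) + 1 * (P x - P (x - \<delta>))"
      unfolding eventually_at_right_field
    proof (intro exI[of _ "min 1 (x - a)"] conjI allI impI)
      fix \<delta> assume \<delta>: "0 < \<delta>" "\<delta> < min 1 (x - a)"
      let ?L = "step_left x \<delta>"
      have "0 \<le> k * (- \<eta> * (\<Sum>(s, c, d, e)\<leftarrow>?L. e * prim R s)) + 1 * (P x - P (x - \<delta>))"
      proof (rule spline_variation[where L = ?L and k = k and ?e0.0 = e0])
        show "x - \<delta> \<le> s \<and> s \<le> x" if "(s, c, d, e) \<in> set ?L" for s c d e using that \<delta> by (auto simp: step_left_def)
        show "(\<Sum>(s, c, d, e)\<leftarrow>?L. e) = 0" by (simp add: step_left_def diff_divide_distrib[symmetric] add_divide_distrib[symmetric])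
        show "spline ?L y = 0" if "x < y" for y using that \<delta> by (simp add: spline_step_left)
        show "\<bar>spline ?L y\<bar> \<le> 1" for y using step_left_bounds[of \<delta> x y] \<delta> by auto
        show "c y \<noteq> 0" if "spline_c ?L y \<noteq> 0" for y using that cx by (auto simp: spline_c_def step_left_def split: if_splits)
        show "c y \<noteq> 0 \<or> d y \<noteq> 0" if "spline_d ?L y \<noteq> 0" for y using that by (simp add: spline_d_def step_left_def)
        show "0 \<le> D y + \<epsilon> * (k * spline ?L y)" if "y \<in> {x - \<delta><..<x}" "0 < \<epsilon>" "\<epsilon> < e0" for y \<epsilon>
          using step_left_bounds[of \<delta> x y] that \<delta> k by (intro e0(2)) auto
      qed (use \<delta> x k e0 in auto)
      also have "- \<eta> * (\<Sum>(s, c, d, e)\<leftarrow>?L. e * prim R s) = \<eta> * ?N \<delta>"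
      proof -
        have "- \<eta> * (\<Sum>(s, c, d, e)\<leftarrow>?L. e * prim R s) = \<eta> * - (4 / \<delta>\<^sup>2 * (prim R x - 2 * prim R (x - \<delta> / 2) + prim R (x - \<delta>)))"
          using \<delta> by (simp add: step_left_def field_simps)
        also have "prim R x - 2 * prim R (x - \<delta> / 2) + prim R (x - \<delta>) = ?Q x - 2 * ?Q (x - \<delta> / 2) + ?Q (x - \<delta>)"
          using x \<delta> by (simp add: prim_R_eq algebra_simps)
        also have "- (4 / \<delta>\<^sup>2 * (?Q x - 2 * ?Q (x - \<delta> / 2) + ?Q (x - \<delta>))) = ?N \<delta>"
          using \<delta> by (simp add: field_simps power2_eq_square)
        finally show ?thesis .
      qed
      finally show "0 \<le> k * (\<eta> * ?N \<delta>) + 1 * (P x - P (x - \<delta>))" .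
    qed (use x in simp)
    ultimately have "0 \<le> k * (\<eta> * - (4 * (l / 2) - 2 * (l / 2))) + 1 * 0" by (rule tendsto_lowerbound) simp
    then have "0 \<le> \<eta> * (- k * l)" by (simp add: algebra_simps)
    from zero_le_mult_iff[THEN iffD1, OF this] pos(1) show ?thesis by linarith
  qed
  from this[of 1] this[of "-1"] have "l = 0" by simp
  then show ?thesis using l by simp
qed

end

section \<open>The Stieltjes measure and the final conditions\<close>

lemma has_ac_deriv_cong_AE:
  assumes "has_ac_deriv \<Omega> f g" "AE x in lebesgue. x \<in> \<Omega> \<longrightarrow> f x = f' x"
  shows "has_ac_deriv \<Omega> f' g"
proof -
  have "loc_integrable \<Omega> f'"
    unfolding loc_integrable_def
  proof (intro allI impI)
    fix C assume C: "compact C \<and> C \<subseteq> \<Omega>"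
    then have "f absolutely_integrable_on C" using assms(1) by (simp add: has_ac_deriv_def loc_integrable_def)
    moreover have "AE x in lebesgue. x \<in> C \<longrightarrow> f x = f' x" using assms(2) by eventually_elim (use C in auto)
    ultimately show "f' absolutely_integrable_on C" using absolutely_integrable_cong_AE by blast
  qed
  moreover have "dist_deriv \<Omega> 1 f = dist_deriv \<Omega> 1 f'"
  proof
    fix \<phi>
    have "(LINT x:\<Omega>|lebesgue. f x * (deriv ^^ 1) \<phi> x) = (LINT x:\<Omega>|lebesgue. f' x * (deriv ^^ 1) \<phi> x)"
      by (rule LINT_cong_AE) (use assms(2) in \<open>auto elim!: eventually_mono\<close>)
    then show "dist_deriv \<Omega> 1 f \<phi> = dist_deriv \<Omega> 1 f' \<phi>" by (simp add: dist_deriv_def)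
  qed
  ultimately show ?thesis using assms(1) unfolding has_ac_deriv_def by simp
qed

lemma stieltjes_emeasure:
  fixes g :: "real \<Rightarrow> real"
  assumes "mono g" "\<And>x. continuous (at_right x) g" "a \<le> b"
  shows "emeasure (interval_measure g) {a<..b} = g b - g a"
  by (rule emeasure_interval_measure_Ioc) (use assms in \<open>auto simp: mono_def\<close>)

text \<open>Fubini for \<phi>'(x) on the set s <= x: integrating over s first gives (g x - g (-1))
  \<phi>'(x), over x first -\<phi> s. The constant g (-1) drops out because \<phi>' has integral
  0.\<close>

lemma stieltjes_test:
  assumes g: "mono g" "\<And>x. continuous (at_right x) g"
    and \<phi>: "test_function \<Omega> \<phi>" "\<Omega> \<subseteq> {-1<..<1}"
  shows "(LINT s:\<Omega>|interval_measure g. \<phi> s) = - (LINT x:\<Omega>|lebesgue. g x * deriv \<phi> x)"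
proof -
  \<comment> \<open>The half-open interval has mass g 1 - g (-1), straight from the construction of
    the measure, and this mass is finite.\<close>
  let ?m = "interval_measure g" and ?I = "{-1<..1::real}"
  have \<phi>0: "\<phi> s = 0" "deriv \<phi> s = 0" if "s \<notin> \<Omega>" for s
    using test_function_zero[OF \<phi>(1) that] test_function_zero[OF test_function_deriv[OF \<phi>(1)] that] .
  have \<phi>22: "\<Omega> \<subseteq> {-2<..<2}" "\<Omega> \<subseteq> ?I" using \<phi>(2) by auto
  have [measurable]: "deriv \<phi> \<in> borel_measurable borel" "\<phi> \<in> borel_measurable borel" "g \<in> borel_measurable borel"
    using borel_measurable_continuous_onI[OF test_function_continuous[OF test_function_deriv[OF \<phi>(1)]]]
      borel_measurable_continuous_onI[OF test_function_continuous[OF \<phi>(1)]] borel_measurable_mono[OF g(1)] by auto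
  obtain B where B: "\<And>x. \<bar>deriv \<phi> x\<bar> \<le> B" using test_function_bounded[OF test_function_deriv[OF \<phi>(1)]] by blast
  have B0: "0 \<le> B" using B[of 0] by linarith
  interpret S1: sigma_finite_measure ?m
    by (rule sigma_finite_interval_measure) (use g in \<open>auto simp: mono_def\<close>)
  interpret P: pair_sigma_finite ?m lborel ..
  define f where "f s x = indicator ?I s * (indicator ?I x * ((if s \<le> x then 1 else 0) * deriv \<phi> x))" for s x :: real
  have eI: "emeasure ?m ?I = g 1 - g (-1)" by (rule stieltjes_emeasure[OF g]) simp
  have int: "integrable (?m \<Otimes>\<^sub>M lborel) (case_prod f)"
  proof (rule integrableI_bounded_set[where A = "?I \<times> ?I" and B = B])
    show "?I \<times> ?I \<in> sets (?m \<Otimes>\<^sub>M lborel)" by (intro pair_measureI) auto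
    show "case_prod f \<in> borel_measurable (?m \<Otimes>\<^sub>M lborel)" unfolding f_def[abs_def] by measurable
    have "emeasure (?m \<Otimes>\<^sub>M lborel) (?I \<times> ?I) = emeasure ?m ?I * emeasure lborel ?I"
      by (rule lborel.emeasure_pair_measure_Times) auto
    also have "\<dots> < \<infinity>" unfolding eI by (simp add: ennreal_mult_less_top)
    finally show "emeasure (?m \<Otimes>\<^sub>M lborel) (?I \<times> ?I) < \<infinity>" .
    show "AE p in ?m \<Otimes>\<^sub>M lborel. p \<in> ?I \<times> ?I \<longrightarrow> norm (case_prod f p) \<le> B"
      using B B0 by (intro AE_I2) (auto simp: f_def)
    show "AE p in ?m \<Otimes>\<^sub>M lborel. p \<notin> ?I \<times> ?I \<longrightarrow> case_prod f p = 0"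
      by (intro AE_I2) (auto simp: f_def indicator_def split: if_splits)
  qed
  have lb: "(LINT x:?I|lebesgue. G x) = (\<integral>x. indicator ?I x * G x \<partial>lborel)" if "G \<in> borel_measurable borel" for G :: "real \<Rightarrow> real"
    using that unfolding set_lebesgue_integral_def by (subst integral_completion) auto
  have step: "(LINT x:?I|lebesgue. (if s \<le> x then 1 else 0) * deriv \<phi> x) = - \<phi> s" for s
  proof -
    have "AE x in lebesgue. x \<noteq> s" using AE_lborel_singleton[of s] by (rule AE_completion)
    then have ae: "AE x in lebesgue. x \<in> \<Omega> \<longrightarrow> (if s \<le> x then 1 else 0) * deriv \<phi> x = indicator {s<..} x * deriv \<phi> x"
      by eventually_elim auto
    have "(LINT x:?I|lebesgue. (if s \<le> x then 1 else 0) * deriv \<phi> x) = (LINT x:\<Omega>|lebesgue. (if s \<le> x then 1 else 0) * deriv \<phi> x)"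
      by (rule LINT_extend[symmetric]) (use \<phi>0 \<phi>22 in auto)
    also have "\<dots> = - \<phi> s" unfolding LINT_cong_AE[OF ae] by (rule LINT_step_test[OF \<phi>(1) \<phi>22(1)])
    finally show ?thesis .
  qed
  have "(\<integral>x. (\<integral>s. f s x \<partial>?m) \<partial>lborel) = (\<integral>s. (\<integral>x. f s x \<partial>lborel) \<partial>?m)" by (rule P.Fubini_integral[OF int])
  also have "(\<lambda>s. \<integral>x. f s x \<partial>lborel) = (\<lambda>s. indicator ?I s * - \<phi> s)"
  proof
    fix s
    have "(\<integral>x. f s x \<partial>lborel) = indicator ?I s * (\<integral>x. indicator ?I x * ((if s \<le> x then 1 else 0) * deriv \<phi> x) \<partial>lborel)"
      unfolding f_def by (rule integral_mult_right_zero)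
    also have "(\<integral>x. indicator ?I x * ((if s \<le> x then 1 else 0) * deriv \<phi> x) \<partial>lborel) = - \<phi> s"
      unfolding step[symmetric] by (rule lb[symmetric]) measurable
    finally show "(\<integral>x. f s x \<partial>lborel) = indicator ?I s * - \<phi> s" .
  qed
  also have "(\<integral>s. indicator ?I s * - \<phi> s \<partial>?m) = - (LINT s:?I|?m. \<phi> s)"
    by (simp add: set_lebesgue_integral_def)
  also have "(LINT s:?I|?m. \<phi> s) = (LINT s:\<Omega>|?m. \<phi> s)"
    by (rule LINT_extend[symmetric]) (use \<phi>0 \<phi>22 in auto)
  also have "(\<lambda>x. \<integral>s. f s x \<partial>?m) = (\<lambda>x. indicator ?I x * ((g x - g (-1)) * deriv \<phi> x))"
  proof
    fix x
    show "(\<integral>s. f s x \<partial>?m) = indicator ?I x * ((g x - g (-1)) * deriv \<phi> x)"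
    proof (cases "x \<in> ?I")
      case True
      have "(\<integral>s. f s x \<partial>?m) = (\<integral>s. indicator {-1<..x} s * deriv \<phi> x \<partial>?m)"
        by (rule Bochner_Integration.integral_cong) (use True in \<open>auto simp: f_def indicator_def\<close>)
      also have "\<dots> = measure ?m {-1<..x} * deriv \<phi> x" by simp
      also have "measure ?m {-1<..x} = g x - g (-1)"
        using stieltjes_emeasure[OF g, of "-1" x] True g(1) by (simp add: measure_def mono_def)
      finally show ?thesis using True by simp
    qed (simp add: f_def)
  qed
  also have "(\<integral>x. indicator ?I x * ((g x - g (-1)) * deriv \<phi> x) \<partial>lborel) = (LINT x:?I|lebesgue. (g x - g (-1)) * deriv \<phi> x)"
    by (rule lb[symmetric]) measurable
  also have "\<dots> = (LINT x:?I|lebesgue. g x * deriv \<phi> x) - g (-1) * (LINT x:?I|lebesgue. deriv \<phi> x)"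
  proof -
    have i: "(\<lambda>x. G x * deriv \<phi> x) absolutely_integrable_on ?I" if "integrable_22 G" for G
      by (rule set_integrable_subset[OF integrable_22_mult_test[OF that test_function_deriv[OF \<phi>(1)]]]) auto
    \<comment> \<open>Monotonicity alone gives no global bound; with the argument clamped to [-2,2]
      g is bounded and unchanged where it is integrated.\<close>
    have "\<bar>y\<bar> \<le> max \<bar>a\<bar> \<bar>b\<bar>" if "a \<le> y" "y \<le> b" for a y b :: real using that by (auto simp: max_def abs_if)
    then have bd: "\<bar>g (max (-2) (min 2 x))\<bar> \<le> max \<bar>g (-2)\<bar> \<bar>g 2\<bar>" for x
      using g(1) by (simp add: mono_def)
    have "integrable_22 (\<lambda>x. g (max (-2) (min 2 x)))" by (rule integrable_22_bounded[OF _ bd]) measurable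
    then have "integrable_22 g" by (rule integrable_22_cong_AE[rotated]) (auto intro!: always_eventually)
    moreover have "integrable_22 (\<lambda>x. g (-1))" by (rule integrable_22_continuous) auto
    ultimately have "(LINT x:?I|lebesgue. g x * deriv \<phi> x - g (-1) * deriv \<phi> x) = (LINT x:?I|lebesgue. g x * deriv \<phi> x) - (LINT x:?I|lebesgue. g (-1) * deriv \<phi> x)"
      by (intro set_integral_diff i)
    then show ?thesis by (simp add: left_diff_distrib)
  qed
  also have "(LINT x:?I|lebesgue. deriv \<phi> x) = 0"
  proof -
    have "(LINT x:?I|lebesgue. deriv \<phi> x) = (LINT x:?I|lebesgue. (if -1 \<le> x then 1 else 0) * deriv \<phi> x)"
      by (rule set_lebesgue_integral_cong) auto
    also have "\<dots> = - \<phi> (-1)" by (rule step)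
    also have "\<phi> (-1) = 0" by (rule \<phi>0(1)) (use \<phi>(2) in auto)
    finally show ?thesis by simp
  qed
  also have "(LINT x:?I|lebesgue. g x * deriv \<phi> x) = (LINT x:\<Omega>|lebesgue. g x * deriv \<phi> x)"
    by (rule LINT_extend[symmetric]) (use \<phi>0 \<phi>22 in auto)
  finally show ?thesis by simp
qed

text \<open>A competitor may take either one-sided value at each of its jumps, and such points may
  carry mass. As they are finitely many, they spoil neither measurability nor boundedness.\<close>

lemma set_integrable_finite_exception:
  assumes N: "sets N = sets borel" "emeasure N {-1<..1} < \<infinity>" and \<Omega>: "\<Omega> \<in> sets borel" "\<Omega> \<subseteq> {-1<..<1::real}"
    and F: "F \<in> borel_measurable borel" "\<And>x. \<bar>F x\<bar> \<le> (C::real)" and S: "finite S" "\<And>x. x \<in> \<Omega> - S \<Longrightarrow> f x = F x"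
  shows "set_integrable N \<Omega> f"
proof -
  have sp: "space N = UNIV" using sets_eq_imp_space_eq[OF N(1)] by simp
  have m: "(\<lambda>x. indicator \<Omega> x * f x) \<in> borel_measurable N"
  proof (rule measurable_discrete_difference[where X = S])
    show "(\<lambda>x. indicator \<Omega> x * F x) \<in> borel_measurable N"
      unfolding measurable_cong_sets[OF N(1) refl] using F(1) \<Omega>(1) by measurable
    show "indicator \<Omega> x * F x = indicator \<Omega> x * f x" if "x \<in> space N" "x \<notin> S" for x
      using S(2)[of x] that by (cases "x \<in> \<Omega>") auto
  qed (use S(1) in \<open>auto simp: N(1) countable_finite\<close>)
  show ?thesis unfolding set_integrable_def real_scaleR_def
  proof (rule integrableI_bounded_set[OF _ m N(2)])
    show "{-1<..1} \<in> sets N" by (simp add: N(1))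
    have "\<bar>indicator \<Omega> x * f x\<bar> \<le> C + (\<Sum>s\<in>S. \<bar>f s\<bar>)" for x
    proof (cases "x \<in> S")
      case True
      then have "\<bar>f x\<bar> \<le> (\<Sum>s\<in>S. \<bar>f s\<bar>)" using S(1) by (intro member_le_sum) auto
      then show ?thesis using F(2)[of x] by (auto simp: indicator_def)
    next
      case False
      have "0 \<le> (\<Sum>s\<in>S. \<bar>f s\<bar>)" by (rule sum_nonneg) simp
      then have "C \<le> C + (\<Sum>s\<in>S. \<bar>f s\<bar>)" by simp
      moreover have "\<bar>indicator \<Omega> x * f x\<bar> \<le> C" using False S(2)[of x] F(2)[of x] order_trans[OF abs_ge_zero F(2)[of x]] by (cases "x \<in> \<Omega>") auto
      ultimately show ?thesis by linarith
    qed
    then show "AE x in N. x \<in> {-1<..1} \<longrightarrow> norm (indicator \<Omega> x * f x) \<le> C + (\<Sum>s\<in>S. \<bar>f s\<bar>)" by simp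
    show "AE x in N. x \<notin> {-1<..1} \<longrightarrow> indicator \<Omega> x * f x = 0"
      using \<Omega>(2) by (intro AE_I2) (auto simp: indicator_def)
  qed
qed

section \<open>The Stieltjes measure of g\<close>

context minimizer_structure
begin

abbreviation m where "m \<equiv> interval_measure g"

lemma emeasure_m: "a \<le> b \<Longrightarrow> emeasure m {a<..b} = g b - g a"
  by (rule stieltjes_emeasure[OF g_mono g_right])

text \<open>In the second distributional derivative the affine part disappears, the double primitive
  of f1 cancels f1, and \<open>prim g\<close> leaves \<sigma> times the Stieltjes measure. The sign
  \<sigma> and the slope B' let one statement serve u_r and u_p.\<close>

lemma stieltjes_pairing:
  assumes \<phi>: "test_function \<Omega> \<phi>" "\<Omega> \<subseteq> {-1<..<1}" and f1: "integrable_22 f1"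
    and a: "AE x in lebesgue. x \<in> {-1<..<1} \<longrightarrow> a x = k + B' * x + \<sigma> * prim g x + prim (prim f1) x"
  shows "(LINT x:\<Omega>|lebesgue. a x * deriv (deriv \<phi>) x) - (LINT x:\<Omega>|lebesgue. f1 x * \<phi> x) = \<sigma> * (LINT x:\<Omega>|m. \<phi> x)"
proof -
  have \<Omega>: "\<Omega> \<subseteq> {-2<..<2}" using \<phi>(2) by auto
  note d = test_function_deriv[OF \<phi>(1)] note dd = test_function_deriv[OF d]
  have c: "integrable_22 (\<lambda>_. B')" "integrable_22 (\<lambda>_. 1)" "integrable_22 (\<lambda>_. k - 2 * B')" by (rule integrable_22_continuous; simp)+
  \<comment> \<open>As \<open>prim\<close> starts at -2, the term B' x is this primitive minus 2 B',
    which explains the constant k - 2 B' below.\<close>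
  have lin: "prim (\<lambda>_. B') x = B' * (x + 2)" if "x \<in> {-2..2}" for x using that by (simp add: prim_def)
  let ?J = "\<lambda>f. LINT x:{-2..2}|lebesgue. f x * deriv (deriv \<phi>) x"
  have J: "?J (prim f) = - (LINT x:\<Omega>|lebesgue. f x * deriv \<phi> x)" if "integrable_22 f" for f
    using LINT_prim_test[OF that d \<Omega>] LINT_test_extend[OF dd \<Omega>, of "prim f"] by simp
  have const: "(LINT x:\<Omega>|lebesgue. K * deriv \<xi> x) = 0" if "test_function \<Omega> \<xi>" for K \<xi>
  proof -
    have "(LINT x:\<Omega>|lebesgue. K * deriv \<xi> x) = K * (LINT x:\<Omega>|lebesgue. indicator {-2<..} x * deriv \<xi> x)"
      unfolding set_integral_mult_right[symmetric]
      by (rule LINT_cong_AE) (use \<Omega> in \<open>auto intro!: always_eventually\<close>)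
    also have "\<dots> = 0" using LINT_step_test[OF that \<Omega>, of "-2"] test_function_endpoints[OF that \<Omega>] by simp
    finally show ?thesis .
  qed
  have i: "integrable_22 (\<lambda>x. f x * deriv (deriv \<phi>) x)" if "integrable_22 f" for f
    by (rule integrable_22_mult_test[OF that dd])
  note p = integrable_22_prim
  have "(LINT x:\<Omega>|lebesgue. a x * deriv (deriv \<phi>) x) =
    (LINT x:\<Omega>|lebesgue. ((k - 2 * B') + prim (\<lambda>_. B') x + \<sigma> * prim g x + prim (prim f1) x) * deriv (deriv \<phi>) x)"
  proof (rule LINT_cong_AE)
    show "AE x in lebesgue. x \<in> \<Omega> \<longrightarrow> a x * deriv (deriv \<phi>) x = ((k - 2 * B') + prim (\<lambda>_. B') x + \<sigma> * prim g x + prim (prim f1) x) * deriv (deriv \<phi>) x"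
      using a
    proof eventually_elim
      case (elim x)
      show ?case
      proof
        assume x: "x \<in> \<Omega>"
        then have "a x = (k - 2 * B') + prim (\<lambda>_. B') x + \<sigma> * prim g x + prim (prim f1) x"
          using elim \<phi>(2) lin[of x] \<Omega> by (force simp: algebra_simps)
        then show "a x * deriv (deriv \<phi>) x = ((k - 2 * B') + prim (\<lambda>_. B') x + \<sigma> * prim g x + prim (prim f1) x) * deriv (deriv \<phi>) x" by simp
      qed
    qed
  qed
  also have "\<dots> = ?J (\<lambda>x. (k - 2 * B') + prim (\<lambda>_. B') x + \<sigma> * prim g x + prim (prim f1) x)"
    by (rule LINT_test_extend[OF dd \<Omega>])
  also have "\<dots> = ?J (\<lambda>x. k - 2 * B') + ?J (prim (\<lambda>_. B')) + ?J (\<lambda>x. \<sigma> * prim g x) + ?J (prim (prim f1))"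
    unfolding distrib_right
    by (subst set_integral_add(2) | intro i integrable_22_add c p f1 integrable_22_cmult integrable_22_g set_integral_add(1) refl)+
  also have "?J (\<lambda>x. k - 2 * B') = 0"
    using const[OF d, of "k - 2 * B'"] LINT_test_extend[OF dd \<Omega>, of "\<lambda>_. k - 2 * B'"] by (simp only:)
  also have "?J (prim (\<lambda>_. B')) = 0" using J[OF c(1)] const[OF \<phi>(1), of B'] by simp
  also have "?J (\<lambda>x. \<sigma> * prim g x) = \<sigma> * (LINT x:\<Omega>|m. \<phi> x)"
    using J[OF integrable_22_g] stieltjes_test[OF g_mono g_right \<phi>] by (simp add: mult.assoc)
  also have "?J (prim (prim f1)) = (LINT x:\<Omega>|lebesgue. f1 x * \<phi> x)"
    using J[OF p[OF f1]] LINT_prim_test[OF f1 \<phi>(1) \<Omega>] by simp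
  finally show ?thesis by simp
qed

text \<open>Around a point without contact g is constant on an interval, hence on a half-open one
  with rational end points that contains the point. Countably many such intervals of mass 0 cover
  all these points.\<close>

lemma m_gap_null: "AE x in m. \<not> (x \<in> {-1<..<1} \<and> 0 < D x \<and> 0 < D x + c x)"
proof -
  define N where "N = (\<Union>(a, b)\<in>{(a, b) \<in> \<rat> \<times> \<rat>. a < b \<and> g a = g b}. {a<..b})"
  have "N \<in> null_sets m" unfolding N_def
  proof (rule null_sets_UN')
    show "countable {(a, b) \<in> \<rat> \<times> \<rat>. a < b \<and> g a = g b}"
      by (rule countable_subset[OF _ countable_SIGMA[OF countable_rat, of "\<lambda>_. \<rat>"]]) (auto simp: countable_rat)
    show "(case p of (a, b) \<Rightarrow> {a<..b}) \<in> null_sets m" if "p \<in> {(a, b) \<in> \<rat> \<times> \<rat>. a < b \<and> g a = g b}" for p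
      using that emeasure_m by (auto simp: null_sets_def)
  qed
  then have "AE x in m. x \<notin> N" by (rule AE_not_in)
  then show ?thesis
  proof eventually_elim
    case (elim x)
    show ?case
    proof
      assume x: "x \<in> {-1<..<1} \<and> 0 < D x \<and> 0 < D x + c x"
      obtain a b where ab: "-1 \<le> a" "a < x" "x < b" "b \<le> 1" "gap a b" by (rule gap_at[of x]) (use x in auto)
      obtain a' b' where q: "a' \<in> \<rat>" "b' \<in> \<rat>" "a < a'" "a' < x" "x < b'" "b' < b"
        using Rats_dense_in_real[OF ab(2)] Rats_dense_in_real[OF ab(3)] by blast
      have "g a' = g b'" by (rule g_gap[OF ab(5,1,4)]) (use q in auto)
      then have "x \<in> N" unfolding N_def using q by force
      then show False using elim by simp
    qed
  qed
qed

end

lemma L2_loc_integrable: "L2 {-1<..<1} f \<Longrightarrow> \<Omega> \<subseteq> {-1<..<1} \<Longrightarrow> loc_integrable \<Omega> f"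
  unfolding loc_integrable_def
proof (intro allI impI)
  fix C assume "L2 {-1<..<1} f" "\<Omega> \<subseteq> {-1<..<1}" "compact C \<and> C \<subseteq> \<Omega>"
  then show "f absolutely_integrable_on C"
    by (intro set_integrable_subset[OF L2_integrable[of "{-1<..<1}" f]]) (auto simp: borel_compact)
qed

lemma L2_mult_test:
  assumes "L2 {-1<..<1} f" "test_function \<Omega> \<phi>" "\<Omega> \<in> sets borel" "\<Omega> \<subseteq> {-1<..<1}"
  shows "(\<lambda>x. f x * \<phi> x) absolutely_integrable_on \<Omega>"
proof -
  obtain B where B: "\<And>x. \<bar>\<phi> x\<bar> \<le> B" using test_function_bounded[OF assms(2)] by blast
  have "\<phi> \<in> borel_measurable borel" by (rule borel_measurable_continuous_onI[OF test_function_continuous[OF assms(2)]])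
  then have "L2 {-1<..<1} \<phi>" using B by (intro L2_bounded) auto
  then have "(\<lambda>x. f x * \<phi> x) absolutely_integrable_on {-1<..<1}" using assms(1) by (intro L2_mult_integrable) auto
  then show ?thesis by (rule set_integrable_subset) (use assms in auto)
qed

lemma pwac_rep_bounded:
  assumes "pwac v c' q'"
  obtains C where "(\<lambda>x. jumps c' x + prim q' x) \<in> borel_measurable borel" "\<And>x. \<bar>jumps c' x + prim q' x\<bar> \<le> C"
proof -
  have q: "integrable_22 q'" using assms by (simp add: pwac_def)
  obtain B where B: "\<And>x. \<bar>prim q' x\<bar> \<le> B" using prim_bounded[OF q] by blast
  show ?thesis
  proof (rule that)
    show "(\<lambda>x. jumps c' x + prim q' x) \<in> borel_measurable borel"
      by (intro borel_measurable_add jumps_measurable prim_measurable q)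
    show "\<bar>jumps c' x + prim q' x\<bar> \<le> (\<Sum>s | c' s \<noteq> 0. \<bar>c' s\<bar>) + B" for x
      using jumps_bounded[of c' x] B[of x] by linarith
  qed
qed

section \<open>Limits at jumps, creases and end points\<close>

context minimizer_structure
begin

text \<open>Beyond the ends D vanishes identically, so its two one-sided slopes are 0, and the
  crease is their difference.\<close>

lemma d_outside: "x \<in> {-2<..<-1} \<union> {1<..<2} \<Longrightarrow> d x = 0"
proof -
  assume x: "x \<in> {-2<..<-1} \<union> {1<..<2}"
  then have x2: "x \<in> {-2<..<2}" by auto
  obtain e where e: "e > 0" "\<And>y. \<bar>y - x\<bar> < e \<Longrightarrow> D y = 0"
  proof
    show "0 < min (\<bar>x\<bar> - 1) (2 - \<bar>x\<bar>)" using x by auto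
    show "D y = 0" if "\<bar>y - x\<bar> < min (\<bar>x\<bar> - 1) (2 - \<bar>x\<bar>)" for y
    proof (cases "x < 0")
      case True
      then show ?thesis using that x by (intro D_outside(1)) auto
    next
      case False
      then show ?thesis using that x by (intro D_outside(3)) auto
    qed
  qed
  have "((\<lambda>t. (D (x + t) - (D x + c x)) / t) \<longlongrightarrow> 0) (at_right 0)"
  proof (rule Lim_transform_eventually[of "\<lambda>_. 0"])
    show "\<forall>\<^sub>F t in at_right 0. 0 = (D (x + t) - (D x + c x)) / t" unfolding eventually_at_right_field
      using e c_outside[OF x] by (intro exI[of _ e]) auto
  qed simp
  from tendsto_unique[OF _ this D_right_derivative[OF x2]] have "q x - qp x + d x = 0" by simp
  moreover have "((\<lambda>t. (D x - D (x - t)) / t) \<longlongrightarrow> 0) (at_right 0)"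
  proof (rule Lim_transform_eventually[of "\<lambda>_. 0"])
    show "\<forall>\<^sub>F t in at_right 0. 0 = (D x - D (x - t)) / t" unfolding eventually_at_right_field
      using e by (intro exI[of _ e]) auto
  qed simp
  from tendsto_unique[OF _ this D_left_derivative[OF x2]] have "q x - qp x = 0" by simp
  ultimately show "d x = 0" by simp
qed

lemma contact_iff:
  assumes "x \<in> {-2<..<2}"
  shows "rlim ur x = val up x + (D x + c x)" "llim ur x = val up x + D x"
  using pwac_rlim[OF pwac_ur, of x] pwac_llim[OF pwac_ur, of x] pwac_val[OF pwac_up, of x] upz[OF assms] assms
  by (auto simp: D_def)

lemma ddot_AE: "AE x in lebesgue. x \<in> {-1<..<1} \<longrightarrow> ddot ur x = R x"
  using r_AE pwH2_ddot_AE[OF ur] by eventually_elim auto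

lemma dddot_AE: "AE x in lebesgue. x \<in> {-1<..<1} \<longrightarrow> dddot ur x = R1 x"
proof -
  \<comment> \<open>The additive constant of R is encoded as a jump at -3, which is invisible on
    (-2,2).\<close>
  have "pwac R (\<lambda>s. if s = -3 then A0 / \<eta> else 0) R1"
  proof (rule pwacI)
    have "finite {s. (if s = -3 then A0 / \<eta> else 0) \<noteq> 0}" by (rule finite_subset[of _ "{-3}"]) auto
    then show "finite {s. (if s = -3 then A0 / \<eta> else 0) \<noteq> 0}" .
    show "AE x in lebesgue. x \<in> {-2<..<2} \<longrightarrow> R x = jumps (\<lambda>s. if s = -3 then A0 / \<eta> else 0) x + prim R1 x"
      by (rule always_eventually, subst jumps_superset[of "{-3}"]) (auto simp: R_def)
  qed (rule integrable_22_R1)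
  then have "has_ac_deriv {-1<..<1} R R1" by (rule pwac_has_ac_deriv) auto
  then have "has_ac_deriv {-1<..<1} (ddot ur) R1"
    by (rule has_ac_deriv_cong_AE) (use ddot_AE in \<open>auto elim!: eventually_mono\<close>)
  then show ?thesis unfolding dddot_def by (rule ac_deriv_AE)
qed

lemma ddot_has_rlim: "x \<in> {-1..<1} \<Longrightarrow> has_rlim (ddot ur) x (R x)"
proof (rule has_rlimI[of "1 - x"])
  assume x: "x \<in> {-1..<1}"
  show "AE y in lebesgue. y \<in> {x<..<x + (1 - x)} \<longrightarrow> ddot ur y = R y"
    using ddot_AE by eventually_elim (use x in auto)
  show "(R \<longlongrightarrow> R x) (at_right x)" using R_isCont[of x] by (simp add: isCont_def filterlim_at_split)
qed simp

lemma ddot_has_llim: "x \<in> {-1<..1} \<Longrightarrow> has_llim (ddot ur) x (R x)"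
proof (rule has_llimI[of "x + 1"])
  assume x: "x \<in> {-1<..1}"
  show "AE y in lebesgue. y \<in> {x - (x + 1)<..<x} \<longrightarrow> ddot ur y = R y"
    using ddot_AE by eventually_elim (use x in auto)
  show "(R \<longlongrightarrow> R x) (at_left x)" using R_isCont[of x] by (simp add: isCont_def filterlim_at_split)
qed simp

lemma dddot_has_rlim: "x \<in> {-1..<1} \<Longrightarrow> has_rlim (dddot ur) x (R1 x)"
proof (rule has_rlimI[of "1 - x"])
  assume x: "x \<in> {-1..<1}"
  show "AE y in lebesgue. y \<in> {x<..<x + (1 - x)} \<longrightarrow> dddot ur y = R1 y"
    using dddot_AE by eventually_elim (use x in auto)
qed (simp_all add: R1_right_limit)

lemma dddot_has_llim: "x \<in> {-1<..1} \<Longrightarrow> (R1 \<longlongrightarrow> l) (at_left x) \<Longrightarrow> has_llim (dddot ur) x l"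
proof (rule has_llimI[of "x + 1"])
  assume x: "x \<in> {-1<..1}"
  show "AE y in lebesgue. y \<in> {x - (x + 1)<..<x} \<longrightarrow> dddot ur y = R1 y"
    using dddot_AE by eventually_elim (use x in auto)
qed simp_all

lemma smooth_right:
  assumes x: "x \<in> {-1..<1}" and "c x \<noteq> 0 \<or> d x \<noteq> 0" "D x + c x > 0"
  shows "has_rlim (ddot ur) x 0" "c x \<noteq> 0 \<Longrightarrow> has_rlim (dddot ur) x 0"
proof -
  obtain b where b: "x < b" "b \<le> 1" "gap x b" by (rule gap_right[OF x assms(3)])
  show "has_rlim (ddot ur) x 0"
    using ddot_has_rlim[OF x] R_zero_right[of x b] b x assms(2) by simp
  show "has_rlim (dddot ur) x 0" if "c x \<noteq> 0"
    using dddot_has_rlim[OF x] R1_zero_right[of x b] b x that by simp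
qed

lemma smooth_left:
  assumes x: "x \<in> {-1<..1}" and "c x \<noteq> 0 \<or> d x \<noteq> 0" "D x > 0"
  shows "has_llim (ddot ur) x 0" "c x \<noteq> 0 \<Longrightarrow> has_llim (dddot ur) x 0"
proof -
  obtain a where a: "a < x" "-1 \<le> a" "gap a x" by (rule gap_left[OF x assms(3)])
  show "has_llim (ddot ur) x 0"
    using ddot_has_llim[OF x] R_zero_left[of a x] a x assms(2) by simp
  show "has_llim (dddot ur) x 0" if "c x \<noteq> 0"
    by (rule dddot_has_llim[OF x R1_zero_left[of a]]) (use a x that in auto)
qed

lemma jump_conditions:
  assumes x: "x \<in> disc ur - {-1, 1}" and gt: "rlim ur x > val up x \<and> llim ur x > val up x"
  shows "has_rlim (ddot ur) x 0 \<and> has_llim (ddot ur) x 0 \<and> has_rlim (dddot ur) x 0 \<and> has_llim (dddot ur) x 0"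
proof -
  have x2: "x \<in> {-2<..<2}" "c x \<noteq> 0" using x pwH2_disc[OF ur] by auto
  then have "x \<in> {-1<..<1}" using c_outside[of x] x by force
  moreover have "D x > 0" "D x + c x > 0" using contact_iff[OF x2(1)] gt by simp_all
  ultimately show ?thesis using smooth_right[of x] smooth_left[of x] x2(2) by simp
qed

text \<open>At a crease half V functions are admissible but steps are not, so the third derivative
  is not forced to vanish. It has no jump, because the gap extends to both sides of x and g is
  constant across it.\<close>

lemma crease_conditions:
  assumes x: "x \<in> disc (dot ur) - (disc ur \<union> {-1, 1})" and gt: "rlim ur x > val up x \<and> llim ur x > val up x"
  shows "has_rlim (ddot ur) x 0 \<and> has_llim (ddot ur) x 0 \<and> (\<exists>l. has_rlim (dddot ur) x l \<and> has_llim (dddot ur) x l)"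
proof -
  have x2: "x \<in> {-2<..<2}" "d x \<noteq> 0" using x pwH2_disc_dot[OF ur] by auto
  then have x1: "x \<in> {-1<..<1}" using d_outside[of x] x by force
  have D: "D x > 0" "D x + c x > 0" using contact_iff[OF x2(1)] gt by simp_all
  obtain a b where ab: "-1 \<le> a" "a < x" "x < b" "b \<le> 1" "gap a b" by (rule gap_at[OF x1 D])
  have "gap a x" using ab(3,5) unfolding gap_def by (meson greaterThanLessThan_iff order.strict_trans)
  then obtain l where "(R1 \<longlongrightarrow> l) (at_left x)" "x < 1 \<Longrightarrow> (\<exists>b>x. b \<le> 1 \<and> gap a b) \<Longrightarrow> l = R1 x"
    using R1_left_limit_gap[of a x] ab x1 by auto
  then have "(R1 \<longlongrightarrow> R1 x) (at_left x)" using ab x1 by auto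
  then show ?thesis using smooth_right[of x] smooth_left[of x] dddot_has_rlim[of x] dddot_has_llim[of x "R1 x"] x1 x2 D by auto
qed

text \<open>From outside the gap is 0 at -1, so a positive limit from inside means that u_r jumps
  there. This puts the end point in the situation of an interior jump, seen from the right.\<close>

lemma left_end_conditions:
  assumes "rlim ur (-1) > val up (-1)"
  shows "has_rlim (ddot ur) (-1) 0" "has_rlim (dddot ur) (-1) 0"
proof -
  have "D (-1) + c (-1) > 0" using contact_iff[of "-1"] assms by simp
  moreover have "c (-1) \<noteq> 0" using calculation D_outside(1)[of "-1"] by simp
  ultimately show "has_rlim (ddot ur) (-1) 0" "has_rlim (dddot ur) (-1) 0" using smooth_right[of "-1"] by simp_all
qed

lemma right_end_conditions:
  assumes "llim ur 1 > val up 1"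
  shows "has_llim (ddot ur) 1 0" "has_llim (dddot ur) 1 0"
proof -
  have "D 1 > 0" using contact_iff[of 1] assms by simp
  moreover have "c 1 \<noteq> 0" using calculation D_outside(2)[of 1] by simp
  ultimately show "has_llim (ddot ur) 1 0" "has_llim (dddot ur) 1 0" using smooth_left[of 1] by simp_all
qed

lemma disc_union: "x \<in> disc ur \<union> disc (dot ur) \<Longrightarrow> x \<in> {-1..1} \<and> (c x \<noteq> 0 \<or> d x \<noteq> 0)"
  using c_outside[of x] d_outside[of x] pwH2_disc[OF ur] pwH2_disc_dot[OF ur] by force

text \<open>At interior points the hat gives the sign. At -1 the hat would leave [-1,1]; there
  contact excludes a jump, so the point is a crease at which D grows linearly, and the half V takes
  over.\<close>

lemma contact_right:
  assumes "x \<in> (disc ur \<union> disc (dot ur)) - {1}" "rlim ur x = val up x"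
  shows "\<exists>l\<ge>0. has_rlim (ddot ur) x l"
proof -
  have x: "x \<in> {-1..<1}" "c x \<noteq> 0 \<or> d x \<noteq> 0" using disc_union[of x] assms(1) by auto
  have "0 \<le> R x"
  proof (cases "x = -1")
    case True
    have "D (-1) + c (-1) = 0" using contact_iff[of "-1"] assms(2) True by simp
    then have "c (-1) = 0" using D_outside(1)[of "-1"] by simp
    then show ?thesis using R_nonneg_left_end x(2) True by simp
  qed (use R_nonneg x in auto)
  then show ?thesis using ddot_has_rlim[OF x(1)] by blast
qed

lemma contact_left:
  assumes "x \<in> (disc ur \<union> disc (dot ur)) - {-1}" "llim ur x = val up x"
  shows "\<exists>l\<ge>0. has_llim (ddot ur) x l"
proof -
  have x: "x \<in> {-1<..1}" "c x \<noteq> 0 \<or> d x \<noteq> 0" using disc_union[of x] assms(1) by auto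
  have "0 \<le> R x"
  proof (cases "x = 1")
    case True
    have "D 1 = 0" using contact_iff[of 1] assms(2) True by simp
    then have "c 1 = 0" using D_outside(2)[of 1] by simp
    then show ?thesis using R_nonneg_right_end x(2) True by simp
  qed (use R_nonneg x in auto)
  then show ?thesis using ddot_has_llim[OF x(1)] by blast
qed

lemma ur_pairing:
  assumes \<phi>: "test_function \<Omega> \<phi>" "\<Omega> \<subseteq> {-1<..<1}"
  shows "\<eta> * (LINT x:\<Omega>|lebesgue. r x * deriv (deriv \<phi>) x) - (LINT x:\<Omega>|lebesgue. h x * \<phi> x) = (LINT x:\<Omega>|m. \<phi> x)"
proof -
  have "(LINT x:\<Omega>|lebesgue. \<eta> * r x * deriv (deriv \<phi>) x) - (LINT x:\<Omega>|lebesgue. h1 x * \<phi> x) = 1 * (LINT x:\<Omega>|m. \<phi> x)"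
    by (rule stieltjes_pairing[OF \<phi> integrable_22_h1(1), of _ A0 0])
       (use G_AE in \<open>auto simp: G_def elim!: eventually_mono\<close>)
  moreover have "(LINT x:\<Omega>|lebesgue. h1 x * \<phi> x) = (LINT x:\<Omega>|lebesgue. h x * \<phi> x)"
    by (rule LINT_cong_AE) (use \<phi>(2) in \<open>auto simp: h1_def intro!: always_eventually\<close>)
  ultimately show ?thesis by (simp add: mult.assoc)
qed

lemma up_pairing:
  assumes \<phi>: "test_function \<Omega> \<phi>" "\<Omega> \<subseteq> {-1<..<1}"
  shows "\<gamma> * (LINT x:\<Omega>|lebesgue. rp x * deriv (deriv \<phi>) x) - (LINT x:\<Omega>|lebesgue. hp x * \<phi> x) = - (LINT x:\<Omega>|m. \<phi> x)"
proof -
  have "(LINT x:\<Omega>|lebesgue. \<gamma> * rp x * deriv (deriv \<phi>) x) - (LINT x:\<Omega>|lebesgue. hp1 x * \<phi> x) = - 1 * (LINT x:\<Omega>|m. \<phi> x)"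
  proof (rule stieltjes_pairing[OF \<phi> integrable_22_h1(2), of _ "A - A0" B])
    show "AE x in lebesgue. x \<in> {-1<..<1} \<longrightarrow> \<gamma> * rp x = A - A0 + B * x + - 1 * prim g x + prim (prim hp1) x"
      using G_AE Gp_AE by eventually_elim (auto simp: Gp_def)
  qed
  moreover have "(LINT x:\<Omega>|lebesgue. hp1 x * \<phi> x) = (LINT x:\<Omega>|lebesgue. hp x * \<phi> x)"
    by (rule LINT_cong_AE) (use \<phi>(2) in \<open>auto simp: hp1_def intro!: always_eventually\<close>)
  ultimately show ?thesis by (simp add: mult.assoc)
qed

lemma LINT_h_split:
  assumes "test_function \<Omega> \<phi>" "\<Omega> \<in> sets borel" "\<Omega> \<subseteq> {-1<..<1}"
  shows "(LINT x:\<Omega>|lebesgue. h x * \<phi> x) = (LINT x:\<Omega>|lebesgue. fr x / 2 * \<phi> x) - (LINT x:\<Omega>|lebesgue. \<mu> * (ur x - up x) * \<phi> x)"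
proof -
  have "L2 {-1<..<1} (\<lambda>x. 1 / 2 * fr x)" "L2 {-1<..<1} (\<lambda>x. \<mu> * (ur x - up x))"
    by (intro L2_cmult L2_diff f pwH2_L2_11[OF ur] pwH2_L2_11[OF up]; simp)+
  then have "L2 {-1<..<1} (\<lambda>x. fr x / 2)" "L2 {-1<..<1} (\<lambda>x. \<mu> * (ur x - up x))" by simp_all
  note l = this[THEN L2_mult_test[OF _ assms]]
  from set_integral_diff(2)[OF l] show ?thesis by (simp add: h_def left_diff_distrib)
qed

section \<open>The equation on the non-contact set\<close>

definition free :: "real set" where "free = {x\<in>{-1<..<1}. 0 < D x \<and> 0 < D x + c x}"

lemma free_eq: "{-1<..<1} - {x. rlim ur x = val up x \<or> llim ur x = val up x} = free"
proof -
  have "rlim ur x \<noteq> val up x \<and> llim ur x \<noteq> val up x \<longleftrightarrow> 0 < D x \<and> 0 < D x + c x" if "x \<in> {-1<..<1}" for x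
    using contact_iff[of x] D_nonneg[of x] that by auto
  then show ?thesis unfolding free_def by blast
qed

lemma D_measurable: "D \<in> borel_measurable borel"
  unfolding D_def[abs_def]
  by (intro borel_measurable_diff borel_measurable_add jumps_measurable prim_measurable integrable_22_q)

lemma free_borel: "free \<in> sets borel"
proof -
  have "c \<in> borel_measurable borel"
    by (rule measurable_discrete_difference[of "\<lambda>_. 0" _ _ "{s. c s \<noteq> 0}"]) (use finite_cd(1) in \<open>auto simp: countable_finite\<close>)
  then show ?thesis unfolding free_def using D_measurable by measurable
qed

text \<open>The weak derivative of R is R1 throughout (-1,1); the second one is h / \<eta> plus a
  multiple of the Stieltjes measure, whose contribution vanishes on \<open>free\<close>. Square
  integrability of h then gives the Sobolev regularity.\<close>

lemma free_conditions:
  shows "sobolev 2 free (ddot ur)"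
    and "test_function free \<phi> \<Longrightarrow> \<eta> * dist_deriv free 2 (ddot ur) \<phi> + dist_deriv free 0 (\<lambda>x. \<mu> * (ur x - up x)) \<phi> = dist_deriv free 0 (\<lambda>x. fr x / 2) \<phi>"
proof -
  have sub: "free \<subseteq> {-1<..<1}" "free \<subseteq> {-2<..<2}" by (auto simp: free_def)
  have fl: "free \<in> sets lebesgue" using free_borel by simp
  have L2f: "L2 free f" if "L2 {-1<..<1} f" for f by (rule L2_subset[OF _ fl sub(1) that]) simp
  have L2dd: "L2 {-1<..<1} (ddot ur)"
    by (rule L2_cong_AE[OF _ pwH2_L2_11(2)[OF ur]])
       (use pwH2_ddot_AE[OF ur] in \<open>auto elim!: eventually_mono\<close>)
  obtain C where C: "\<And>x. \<bar>R1 x\<bar> \<le> C" using R1_bounded by blast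
  have L2R1: "L2 {-1<..<1} R1" by (rule L2_bounded[OF _ _ R1_measurable C]) auto
  have L2h: "L2 {-1<..<1} (\<lambda>x. 1 / \<eta> * h x)" by (rule L2_cmult[OF _ h_L2(1)]) simp
  \<comment> \<open>The integrand vanishes almost everywhere for the Stieltjes measure, whatever
    \<phi> is.\<close>
  have m0: "(LINT x:free|m. \<phi> x) = 0" for \<phi> :: "real \<Rightarrow> real"
    unfolding set_lebesgue_integral_def
    by (rule integral_eq_zero_AE) (use m_gap_null in \<open>auto simp: free_def elim!: eventually_mono\<close>)
  have eq: "\<eta> * (LINT x:free|lebesgue. ddot ur x * deriv (deriv \<phi>) x) = (LINT x:free|lebesgue. h x * \<phi> x)"
    if \<phi>: "test_function free \<phi>" for \<phi>
  proof -
    have ae: "AE x in lebesgue. x \<in> free \<longrightarrow> ddot ur x * deriv (deriv \<phi>) x = r x * deriv (deriv \<phi>) x"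
      using pwH2_ddot_AE[OF ur] by eventually_elim (use sub in auto)
    show ?thesis unfolding LINT_cong_AE[OF ae] using ur_pairing[OF \<phi> sub(1)] m0 by simp
  qed
  have 1: "has_weak_deriv free 1 (ddot ur) R1" unfolding has_weak_deriv_def
  proof (intro conjI allI impI L2_loc_integrable L2dd L2R1 sub)
    fix \<phi> assume \<phi>: "test_function free \<phi>"
    note d = test_function_deriv[OF \<phi>]
    have ae: "AE x in lebesgue. x \<in> free \<longrightarrow> ddot ur x * deriv \<phi> x = (A0 / \<eta> * indicator {-2<..} x + prim R1 x) * deriv \<phi> x"
      using ddot_AE by eventually_elim (use sub in \<open>auto simp: R_def\<close>)
    have i: "integrable_22 (indicator {-2<..})" by (rule integrable_22_bounded[of _ 1]) (auto simp: indicator_def)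
    have "(LINT x:free|lebesgue. ddot ur x * deriv \<phi> x) = (LINT x:{-2..2}|lebesgue. (A0 / \<eta> * indicator {-2<..} x + prim R1 x) * deriv \<phi> x)"
      unfolding LINT_cong_AE[OF ae] by (rule LINT_test_extend[OF d sub(2)])
    also have "\<dots> = (LINT x:{-2..2}|lebesgue. A0 / \<eta> * indicator {-2<..} x * deriv \<phi> x) + (LINT x:{-2..2}|lebesgue. prim R1 x * deriv \<phi> x)"
      unfolding distrib_right
      by (intro set_integral_add(2) integrable_22_mult_test[OF _ d] integrable_22_cmult i integrable_22_prim integrable_22_R1)
    also have "(LINT x:{-2..2}|lebesgue. A0 / \<eta> * indicator {-2<..} x * deriv \<phi> x) = A0 / \<eta> * (LINT x:free|lebesgue. indicator {-2<..} x * deriv \<phi> x)"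
      unfolding mult.assoc set_integral_mult_right by (simp only: LINT_test_extend[OF d sub(2)])
    also have "(LINT x:free|lebesgue. indicator {-2<..} x * deriv \<phi> x) = 0"
      using LINT_step_test[OF \<phi> sub(2)] test_function_endpoints[OF \<phi> sub(2)] by simp
    also have "(LINT x:{-2..2}|lebesgue. prim R1 x * deriv \<phi> x) = - (LINT x:free|lebesgue. R1 x * \<phi> x)"
      unfolding LINT_test_extend[OF d sub(2), symmetric] by (rule LINT_prim_test[OF integrable_22_R1 \<phi> sub(2)])
    finally show "dist_deriv free 1 (ddot ur) \<phi> = dist_deriv free 0 R1 \<phi>" by (simp add: dist_deriv_def)
  qed
  have 2: "has_weak_deriv free 2 (ddot ur) (\<lambda>x. 1 / \<eta> * h x)" unfolding has_weak_deriv_def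
  proof (intro conjI allI impI L2_loc_integrable L2dd L2h sub)
    fix \<phi> assume \<phi>: "test_function free \<phi>"
    have "(LINT x:free|lebesgue. 1 / \<eta> * h x * \<phi> x) = 1 / \<eta> * (LINT x:free|lebesgue. h x * \<phi> x)"
      unfolding mult.assoc by (rule set_integral_mult_right)
    then show "dist_deriv free 2 (ddot ur) \<phi> = dist_deriv free 0 (\<lambda>x. 1 / \<eta> * h x) \<phi>"
      using eq[OF \<phi>] pos(1) by (simp add: dist_deriv_def numeral_2_eq_2 field_simps)
  qed
  have "{1..2::nat} = {1, 2}" by auto
  moreover have "\<exists>g. L2 free g \<and> has_weak_deriv free 1 (ddot ur) g" using 1 L2f[OF L2R1] by blast
  moreover have "\<exists>g. L2 free g \<and> has_weak_deriv free 2 (ddot ur) g" using 2 L2f[OF L2h] by blast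
  ultimately show "sobolev 2 free (ddot ur)" using L2f[OF L2dd] by (simp add: sobolev_def)
  assume \<phi>: "test_function free \<phi>"
  show "\<eta> * dist_deriv free 2 (ddot ur) \<phi> + dist_deriv free 0 (\<lambda>x. \<mu> * (ur x - up x)) \<phi> = dist_deriv free 0 (\<lambda>x. fr x / 2) \<phi>"
    using eq[OF \<phi>] LINT_h_split[OF \<phi> free_borel sub(1)] by (simp add: dist_deriv_def numeral_2_eq_2)
qed

section \<open>The variational inequalities\<close>

definition smooth_set :: "real set" where "smooth_set = {-1<..<1} - (disc ur \<union> disc (dot ur))"

lemma smooth_set:
  shows "smooth_set \<in> sets borel" "smooth_set \<subseteq> {-1<..<1}" "x \<in> smooth_set \<Longrightarrow> c x = 0 \<and> d x = 0"
proof -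
  have "finite (disc ur \<union> disc (dot ur))"
    unfolding pwH2_disc[OF ur] pwH2_disc_dot[OF ur] using finite_cd by (simp add: Collect_conj_eq)
  then show "smooth_set \<in> sets borel" unfolding smooth_set_def by (intro sets.Diff) (auto intro: finite_imp_closed borel_closed)
  show "smooth_set \<subseteq> {-1<..<1}" by (auto simp: smooth_set_def)
  show "x \<in> smooth_set \<Longrightarrow> c x = 0 \<and> d x = 0"
    by (auto simp: smooth_set_def pwH2_disc[OF ur] pwH2_disc_dot[OF ur])
qed

lemma dist_deriv_4: "dist_deriv \<Omega> 4 v \<phi> = dist_deriv \<Omega> 2 v (deriv (deriv \<phi>))"
  by (simp add: numeral_eq_Suc dist_deriv_Suc)

lemma radon_m: "\<Omega> \<subseteq> {-1<..<1} \<Longrightarrow> radon_on \<Omega> m"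
  unfolding radon_on_def
proof (intro conjI allI impI)
  fix C assume "\<Omega> \<subseteq> {-1<..<1}" "compact C \<and> C \<subseteq> \<Omega>"
  then have "emeasure m C \<le> emeasure m {-1<..1}" by (intro emeasure_mono) auto
  also have "\<dots> < \<infinity>" by (simp add: emeasure_m)
  finally show "emeasure m C < \<infinity>" .
qed simp

text \<open>The measure is positive, so its Jordan decomposition has no negative part; for u_p the
  two parts change places.\<close>

lemma ur_measure:
  "distribution_is_measure smooth_set
    (\<lambda>\<phi>. \<eta> * dist_deriv smooth_set 4 ur \<phi> + dist_deriv smooth_set 0 (\<lambda>x. \<mu> * (ur x - up x) - fr x / 2) \<phi>) m (null_measure borel)"
  unfolding distribution_is_measure_def
proof (intro conjI allI impI)
  note S = smooth_set
  have S2: "smooth_set \<subseteq> {-2<..<2}" using S(2) by auto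
  show "signed_radon smooth_set m (null_measure borel)"
    unfolding signed_radon_def using radon_m[OF S(2)] by (auto simp: radon_on_def intro!: bexI[of _ UNIV])
  fix \<phi> assume \<phi>: "test_function smooth_set \<phi>"
  note dd = test_function_deriv[OF test_function_deriv[OF \<phi>]]
  have "dist_deriv smooth_set 4 ur \<phi> = (LINT x:smooth_set|lebesgue. r x * deriv (deriv \<phi>) x)"
    unfolding dist_deriv_4 using pwH2_weak_deriv_2[OF ur dd S2] S(3) by (simp add: dist_deriv_def)
  moreover have "dist_deriv smooth_set 0 (\<lambda>x. \<mu> * (ur x - up x) - fr x / 2) \<phi> = - (LINT x:smooth_set|lebesgue. h x * \<phi> x)"
  proof -
    have "dist_deriv smooth_set 0 (\<lambda>x. \<mu> * (ur x - up x) - fr x / 2) \<phi> = (LINT x:smooth_set|lebesgue. - (h x * \<phi> x))"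
      unfolding dist_deriv_def h_def by (simp add: left_diff_distrib)
    then show ?thesis by (simp add: set_lebesgue_integral_def)
  qed
  ultimately show "\<eta> * dist_deriv smooth_set 4 ur \<phi> + dist_deriv smooth_set 0 (\<lambda>x. \<mu> * (ur x - up x) - fr x / 2) \<phi>
      = signed_set_integral smooth_set m (null_measure borel) \<phi>"
    using ur_pairing[OF \<phi> S(2)] by (simp add: signed_set_integral_def set_lebesgue_integral_def)
qed

lemma up_measure:
  "distribution_is_measure smooth_set
    (\<lambda>\<phi>. \<gamma> * dist_deriv smooth_set 4 up \<phi> + dist_deriv smooth_set 0 (\<lambda>x. \<mu> * (up x - ur x) - fp x / 2) \<phi>) (null_measure borel) m"
  unfolding distribution_is_measure_def
proof (intro conjI allI impI)
  note S = smooth_set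
  have S2: "smooth_set \<subseteq> {-2<..<2}" using S(2) by auto
  show "signed_radon smooth_set (null_measure borel) m"
    unfolding signed_radon_def using radon_m[OF S(2)] by (auto simp: radon_on_def intro!: bexI[of _ "{}"])
  fix \<phi> assume \<phi>: "test_function smooth_set \<phi>"
  note dd = test_function_deriv[OF test_function_deriv[OF \<phi>]]
  have "dist_deriv smooth_set 4 up \<phi> = (LINT x:smooth_set|lebesgue. rp x * deriv (deriv \<phi>) x)"
    unfolding dist_deriv_4 using pwH2_weak_deriv_2[OF up dd S2] upz S2 by (simp add: dist_deriv_def subset_iff)
  moreover have "dist_deriv smooth_set 0 (\<lambda>x. \<mu> * (up x - ur x) - fp x / 2) \<phi> = - (LINT x:smooth_set|lebesgue. hp x * \<phi> x)"
  proof -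
    have "dist_deriv smooth_set 0 (\<lambda>x. \<mu> * (up x - ur x) - fp x / 2) \<phi> = (LINT x:smooth_set|lebesgue. - (hp x * \<phi> x))"
      unfolding dist_deriv_def hp_def by (simp add: left_diff_distrib)
    then show ?thesis by (simp add: set_lebesgue_integral_def)
  qed
  ultimately show "\<gamma> * dist_deriv smooth_set 4 up \<phi> + dist_deriv smooth_set 0 (\<lambda>x. \<mu> * (up x - ur x) - fp x / 2) \<phi>
      = signed_set_integral smooth_set (null_measure borel) m \<phi>"
    using up_pairing[OF \<phi> S(2)] by (simp add: signed_set_integral_def set_lebesgue_integral_def)
qed

lemma smooth_set_integrable:
  assumes u: "pwac u c1 q1" and v: "pwac v c2 q2"
    and f: "\<And>x. x \<in> smooth_set \<Longrightarrow> c1 x = 0 \<Longrightarrow> c2 x = 0 \<Longrightarrow> f x = (jumps c1 x + prim q1 x) - (jumps c2 x + prim q2 x)"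
  shows "set_integrable m smooth_set f" "set_integrable (null_measure borel) smooth_set f"
proof -
  obtain C1 where C1: "(\<lambda>x. jumps c1 x + prim q1 x) \<in> borel_measurable borel" "\<And>x. \<bar>jumps c1 x + prim q1 x\<bar> \<le> C1"
    using pwac_rep_bounded[OF u] by blast
  obtain C2 where C2: "(\<lambda>x. jumps c2 x + prim q2 x) \<in> borel_measurable borel" "\<And>x. \<bar>jumps c2 x + prim q2 x\<bar> \<le> C2"
    using pwac_rep_bounded[OF v] by blast
  let ?S = "{x. c1 x \<noteq> 0} \<union> {x. c2 x \<noteq> 0}"
  have S: "finite ?S" using u v by (simp add: pwac_def)
  have b: "\<bar>(jumps c1 x + prim q1 x) - (jumps c2 x + prim q2 x)\<bar> \<le> C1 + C2" for x using C1(2)[of x] C2(2)[of x] by linarith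
  note F = set_integrable_finite_exception[OF _ _ smooth_set(1,2) borel_measurable_diff[OF C1(1) C2(1)] b S]
  show "set_integrable m smooth_set f" by (rule F) (use f in \<open>auto simp: emeasure_m\<close>)
  show "set_integrable (null_measure borel) smooth_set f" by (rule F) (use f in auto)
qed

text \<open>The integrals in both inequalities thus see only contact points, where the sign of the
  integrand can be read off from the constraint.\<close>

lemma contact_m: "AE x in m. x \<in> smooth_set \<longrightarrow> val ur x = val up x"
  using m_gap_null
proof eventually_elim
  case (elim x)
  show ?case
  proof
    assume x: "x \<in> smooth_set"
    then have x2: "x \<in> {-1<..<1}" "x \<in> {-2<..<2}" "c x = 0" using smooth_set(2,3) by auto
    then have "D x = 0" using elim D_nonneg(1)[of x] by force
    then show "val ur x = val up x"
      using pwac_val[OF pwac_ur, of x] pwac_val[OF pwac_up, of x] upz x2 by (simp add: D_def)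
  qed
qed

text \<open>At contact points u_r equals u_p, and u_p lies below both one-sided limits of the
  competitor v. So u_r - v' is nonpositive for any choice between these limits, and it is integrated
  against a positive measure.\<close>

lemma ur_inequality:
  assumes v: "(v, up) \<in> KK w" and v': "\<And>x. x \<in> smooth_set \<Longrightarrow> v' x = rlim v x \<or> v' x = llim v x"
  shows "signed_set_integrable smooth_set m (null_measure borel) (\<lambda>x. val ur x - v' x)"
    and "signed_set_integral smooth_set m (null_measure borel) (\<lambda>x. val ur x - v' x) \<le> 0"
proof -
  obtain c2 d2 r2 where p: "pwH2 v c2 d2 r2" using v unfolding KK_iff using piecewise_H2_pwH2 by blast
  note v2 = pwH2D(1)[OF p]
  have ge: "AE x in lebesgue. x \<in> {-2<..<2} \<longrightarrow> up x \<le> v x" using v by (simp add: KK_iff)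
  have v'eq: "v' x = jumps c2 x + c2 x + prim (\<lambda>x. jumps d2 x + prim r2 x) x \<or> v' x = jumps c2 x + prim (\<lambda>x. jumps d2 x + prim r2 x) x"
    if "x \<in> smooth_set" for x
    using v'[OF that] pwac_rlim[OF v2, of x] pwac_llim[OF v2, of x] that smooth_set(2) by auto
  have vu: "val ur x = jumps c x + prim q x" if "x \<in> smooth_set" for x
    using pwac_val[OF pwac_ur, of x] smooth_set(2) smooth_set(3)[OF that] that by auto
  have f: "val ur x - v' x = (jumps c x + prim q x) - (jumps c2 x + prim (\<lambda>x. jumps d2 x + prim r2 x) x)"
    if "x \<in> smooth_set" "c2 x = 0" for x
    using v'eq[OF that(1)] vu[OF that(1)] that(2) by auto
  have i: "set_integrable m smooth_set (\<lambda>x. val ur x - v' x)" "set_integrable (null_measure borel) smooth_set (\<lambda>x. val ur x - v' x)"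
    by (rule smooth_set_integrable[OF pwac_ur v2]; use f in blast)+
  then show "signed_set_integrable smooth_set m (null_measure borel) (\<lambda>x. val ur x - v' x)"
    by (simp add: signed_set_integrable_def)
  have le: "val up x \<le> v' x" if x: "x \<in> smooth_set" for x
  proof -
    have x2: "x \<in> {-1<..<1}" using x smooth_set(2) by blast
    have up': "val up x = jumps cp x + prim qp x" "cp x = 0" using pwac_val[OF pwac_up, of x] upz[of x] x2 by auto
    have "jumps cp x + cp x + prim qp x \<le> jumps c2 x + c2 x + prim (\<lambda>x. jumps d2 x + prim r2 x) x"
    proof (rule has_rlim_le[OF pwac_has_rlim[OF pwac_up] pwac_has_rlim[OF v2], of x 1])
      show "AE y in lebesgue. y \<in> {x<..<x + 1} \<longrightarrow> up y \<le> v y" using ge by eventually_elim (use x2 in auto)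
    qed (use x2 in auto)
    moreover have "jumps cp x + prim qp x \<le> jumps c2 x + prim (\<lambda>x. jumps d2 x + prim r2 x) x"
    proof (rule has_llim_le[OF pwac_has_llim[OF pwac_up] pwac_has_llim[OF v2], of x 1])
      show "AE y in lebesgue. y \<in> {x - 1<..<x} \<longrightarrow> up y \<le> v y" using ge by eventually_elim (use x2 in auto)
    qed (use x2 in auto)
    ultimately show ?thesis using v'eq[OF x] up' by auto
  qed
  have "AE x in m. 0 \<le> - (indicator smooth_set x *\<^sub>R (val ur x - v' x))"
    using contact_m
  proof eventually_elim
    case (elim x)
    then show ?case using le[of x] by (cases "x \<in> smooth_set") auto
  qed
  then have "0 \<le> (\<integral>x. - (indicator smooth_set x *\<^sub>R (val ur x - v' x)) \<partial>m)" by (rule integral_nonneg_AE)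
  then show "signed_set_integral smooth_set m (null_measure borel) (\<lambda>x. val ur x - v' x) \<le> 0"
    by (simp add: signed_set_integral_def set_lebesgue_integral_def)
qed

text \<open>At contact points u_p equals u_r, which lies above z, so u_p - z is nonnegative there.
  The measure now sits in the negative part, which turns the integral nonpositive.\<close>

lemma up_inequality:
  assumes z: "(ur, z) \<in> KK w"
  shows "signed_set_integrable smooth_set (null_measure borel) m (\<lambda>x. val up x - val z x)"
    and "signed_set_integral smooth_set (null_measure borel) m (\<lambda>x. val up x - val z x) \<le> 0"
proof -
  have s: "sobolev 2 {-2<..<2} z" using z by (simp add: KK_iff)
  obtain c2 d2 r2 where p: "pwH2 z c2 d2 r2" and c2: "\<And>x. x \<in> {-2<..<2} \<Longrightarrow> c2 x = 0 \<and> d2 x = 0"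
    by (rule sobolev_pwH2[OF s]) blast
  note z2 = pwH2D(1)[OF p]
  have ge: "AE x in lebesgue. x \<in> {-2<..<2} \<longrightarrow> z x \<le> ur x" using z by (simp add: KK_iff)
  have vz: "val z x = jumps c2 x + prim (\<lambda>x. jumps d2 x + prim r2 x) x" "val up x = jumps cp x + prim qp x" "val ur x = jumps c x + prim q x"
    if "x \<in> smooth_set" for x
    using pwac_val[OF pwac_ur, of x] pwac_val[OF z2, of x] pwac_val[OF pwac_up, of x] smooth_set(2) smooth_set(3)[OF that] that c2[of x] upz[of x] by auto
  have i: "set_integrable m smooth_set (\<lambda>x. val up x - val z x)" "set_integrable (null_measure borel) smooth_set (\<lambda>x. val up x - val z x)"
    by (rule smooth_set_integrable[OF pwac_up z2]; use vz in simp)+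
  then show "signed_set_integrable smooth_set (null_measure borel) m (\<lambda>x. val up x - val z x)"
    by (simp add: signed_set_integrable_def)
  have le: "val z x \<le> val ur x" if x: "x \<in> smooth_set" for x
  proof -
    have x2: "x \<in> {-1<..<1}" using x smooth_set(2) by blast
    have "jumps c2 x + prim (\<lambda>x. jumps d2 x + prim r2 x) x \<le> jumps c x + prim q x"
    proof (rule has_llim_le[OF pwac_has_llim[OF z2] pwac_has_llim[OF pwac_ur], of x 1])
      show "AE y in lebesgue. y \<in> {x - 1<..<x} \<longrightarrow> z y \<le> ur y" using ge by eventually_elim (use x2 in auto)
    qed (use x2 in auto)
    then show ?thesis using vz[OF x] by simp
  qed
  have "AE x in m. 0 \<le> indicator smooth_set x *\<^sub>R (val up x - val z x)"
    using contact_m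
  proof eventually_elim
    case (elim x)
    then show ?case using le[of x] by (cases "x \<in> smooth_set") auto
  qed
  then have "0 \<le> (LINT x:smooth_set|m. val up x - val z x)"
    unfolding set_lebesgue_integral_def by (rule integral_nonneg_AE)
  then show "signed_set_integral smooth_set (null_measure borel) m (\<lambda>x. val up x - val z x) \<le> 0"
    by (simp add: signed_set_integral_def set_lebesgue_integral_def)
qed

end

theorem proposition3p12:
  fixes w fr fp ur up :: "real \<Rightarrow> real" and \<alpha> \<beta> \<eta> \<mu> \<gamma> :: real
  assumes "C2_on (-2) 2 w" and "\<eta> > 0" and "\<mu> > 0" and "\<gamma> > 0"
    and "L2 {-1<..<1} fr" and "L2 {-1<..<1} fp"
    and "0 < \<beta>" and "\<beta> \<le> \<alpha>" and "\<alpha> \<le> 2 * \<beta>"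
    and "is_arg_min (F1 \<alpha> \<beta> \<eta> \<mu> \<gamma> fr fp) (\<lambda>p. p \<in> KK w) (ur, up)"
  shows
    "(ur, up) \<in> KK w \<and>
     (let \<Omega> = {-1<..<1} - (disc ur \<union> disc (dot ur)) in
       (\<exists>m1 m2.
          distribution_is_measure \<Omega>
            (\<lambda>\<phi>. \<eta> * dist_deriv \<Omega> 4 ur \<phi>
                 + dist_deriv \<Omega> 0 (\<lambda>x. \<mu> * (ur x - up x) - fr x / 2) \<phi>) m1 m2 \<and>
          (\<forall>v v'. (v, up) \<in> KK w \<and> (\<forall>x\<in>\<Omega>. v' x = rlim v x \<or> v' x = llim v x) \<longrightarrow>
             signed_set_integrable \<Omega> m1 m2 (\<lambda>x. val ur x - v' x) \<and>
             signed_set_integral \<Omega> m1 m2 (\<lambda>x. val ur x - v' x) \<le> 0)) \<and>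
       (\<exists>m1 m2.
          distribution_is_measure \<Omega>
            (\<lambda>\<phi>. \<gamma> * dist_deriv \<Omega> 4 up \<phi>
                 + dist_deriv \<Omega> 0 (\<lambda>x. \<mu> * (up x - ur x) - fp x / 2) \<phi>) m1 m2 \<and>
          (\<forall>z. (ur, z) \<in> KK w \<longrightarrow>
             signed_set_integrable \<Omega> m1 m2 (\<lambda>x. val up x - val z x) \<and>
             signed_set_integral \<Omega> m1 m2 (\<lambda>x. val up x - val z x) \<le> 0))) \<and>

     (\<forall>x \<in> disc ur - {-1, 1}. rlim ur x > val up x \<and> llim ur x > val up x \<longrightarrow>
        has_rlim (ddot ur) x 0 \<and> has_llim (ddot ur) x 0 \<and>
        has_rlim (dddot ur) x 0 \<and> has_llim (dddot ur) x 0) \<and>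
     (\<forall>x \<in> disc (dot ur) - (disc ur \<union> {-1, 1}). rlim ur x > val up x \<and> llim ur x > val up x \<longrightarrow>
        has_rlim (ddot ur) x 0 \<and> has_llim (ddot ur) x 0 \<and>
        (\<exists>l. has_rlim (dddot ur) x l \<and> has_llim (dddot ur) x l)) \<and>
     (let \<Omega> = {-1<..<1} - {x. rlim ur x = val up x \<or> llim ur x = val up x} in
        sobolev 2 \<Omega> (ddot ur) \<and>
        (\<forall>\<phi>. test_function \<Omega> \<phi> \<longrightarrow>
           \<eta> * dist_deriv \<Omega> 2 (ddot ur) \<phi> + dist_deriv \<Omega> 0 (\<lambda>x. \<mu> * (ur x - up x)) \<phi>
             = dist_deriv \<Omega> 0 (\<lambda>x. fr x / 2) \<phi>)) \<and>
     (-1 \<notin> disc (dot ur) - disc ur \<and> rlim ur (-1) > val up (-1) \<longrightarrow>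
        has_rlim (ddot ur) (-1) 0 \<and> has_rlim (dddot ur) (-1) 0) \<and>
     (1 \<notin> disc (dot ur) - disc ur \<and> llim ur 1 > val up 1 \<longrightarrow>
        has_llim (ddot ur) 1 0 \<and> has_llim (dddot ur) 1 0) \<and>
     (-1 \<in> disc (dot ur) - disc ur \<and> rlim ur (-1) > val up (-1) \<longrightarrow> has_rlim (ddot ur) (-1) 0) \<and>
     (1 \<in> disc (dot ur) - disc ur \<and> llim ur 1 > val up 1 \<longrightarrow> has_llim (ddot ur) 1 0) \<and>

     (\<forall>x \<in> (disc ur \<union> disc (dot ur)) - {1}. rlim ur x = val up x \<longrightarrow>
        (\<exists>l\<ge>0. has_rlim (ddot ur) x l)) \<and>
     (\<forall>x \<in> (disc ur \<union> disc (dot ur)) - {-1}. llim ur x = val up x \<longrightarrow>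
        (\<exists>l\<ge>0. has_llim (ddot ur) x l))"
proof -
  note K = \<open>is_arg_min _ _ _\<close>
  have KK: "(ur, up) \<in> KK w" and min: "\<And>v z. (v, z) \<in> KK w \<Longrightarrow> F1 \<alpha> \<beta> \<eta> \<mu> \<gamma> fr fp (ur, up) \<le> F1 \<alpha> \<beta> \<eta> \<mu> \<gamma> fr fp (v, z)"
    using K unfolding is_arg_min_def by (auto simp: not_less)
  obtain c d r where "pwH2 ur c d r" using KK unfolding KK_iff using piecewise_H2_pwH2 by blast
  moreover have "sobolev 2 {-2<..<2} up" using KK by (simp add: KK_iff)
  then obtain cp dp rp where "pwH2 up cp dp rp" "\<And>x. x \<in> {-2<..<2} \<Longrightarrow> cp x = 0 \<and> dp x = 0"
    by (rule sobolev_pwH2) blast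
  ultimately interpret minimizer w fr fp ur up \<alpha> \<beta> \<eta> \<mu> \<gamma> c d r cp dp rp
    by unfold_locales (use assms KK min in auto)
  obtain g M A0 A B where "minimizer_structure w fr fp ur up \<alpha> \<beta> \<eta> \<mu> \<gamma> c d r cp dp rp g M A0 A B"
  proof (rule third_derivative)
    fix g M A0 A B
    assume "mono g" "\<And>x. continuous (at_right x) g" "\<And>x. \<bar>g x\<bar> \<le> M"
      "AE x in lebesgue. x \<in> {-1<..<1} \<longrightarrow> G x = A0 + prim g x" "AE x in lebesgue. x \<in> {-1<..<1} \<longrightarrow> G x + Gp x = A + B * x"
      "\<And>p t x y. gap p t \<Longrightarrow> -1 \<le> p \<Longrightarrow> t \<le> 1 \<Longrightarrow> p < x \<Longrightarrow> x \<le> y \<Longrightarrow> y < t \<Longrightarrow> g x = g y"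
    then have "minimizer_structure w fr fp ur up \<alpha> \<beta> \<eta> \<mu> \<gamma> c d r cp dp rp g M A0 A B"
      by unfold_locales blast+
    then show ?thesis by (rule that)
  qed
  then interpret minimizer_structure w fr fp ur up \<alpha> \<beta> \<eta> \<mu> \<gamma> c d r cp dp rp g M A0 A B .
  show ?thesis
    unfolding Let_def free_eq smooth_set_def[symmetric]
  proof (intro conjI)
    show "(ur, up) \<in> KK w" by (rule KK)
    show "\<exists>m1 m2. distribution_is_measure smooth_set
            (\<lambda>\<phi>. \<eta> * dist_deriv smooth_set 4 ur \<phi> + dist_deriv smooth_set 0 (\<lambda>x. \<mu> * (ur x - up x) - fr x / 2) \<phi>) m1 m2 \<and>
          (\<forall>v v'. (v, up) \<in> KK w \<and> (\<forall>x\<in>smooth_set. v' x = rlim v x \<or> v' x = llim v x) \<longrightarrow>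
             signed_set_integrable smooth_set m1 m2 (\<lambda>x. val ur x - v' x) \<and>
             signed_set_integral smooth_set m1 m2 (\<lambda>x. val ur x - v' x) \<le> 0)"
      using ur_measure ur_inequality by blast
    show "\<exists>m1 m2. distribution_is_measure smooth_set
            (\<lambda>\<phi>. \<gamma> * dist_deriv smooth_set 4 up \<phi> + dist_deriv smooth_set 0 (\<lambda>x. \<mu> * (up x - ur x) - fp x / 2) \<phi>) m1 m2 \<and>
          (\<forall>z. (ur, z) \<in> KK w \<longrightarrow>
             signed_set_integrable smooth_set m1 m2 (\<lambda>x. val up x - val z x) \<and>
             signed_set_integral smooth_set m1 m2 (\<lambda>x. val up x - val z x) \<le> 0)"
      using up_measure up_inequality by blast
    show "sobolev 2 free (ddot ur)" by (rule free_conditions)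
    show "\<forall>\<phi>. test_function free \<phi> \<longrightarrow> \<eta> * dist_deriv free 2 (ddot ur) \<phi> + dist_deriv free 0 (\<lambda>x. \<mu> * (ur x - up x)) \<phi>
        = dist_deriv free 0 (\<lambda>x. fr x / 2) \<phi>"
      using free_conditions(2) by blast
  qed ((intro ballI impI, (rule jump_conditions crease_conditions contact_right contact_left; assumption))
    | (use left_end_conditions right_end_conditions in simp))+
qed

end
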